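(* Let $f_\bullet : X_\bullet \to Y_\bullet$ be a map of semi-simplicial spaces and let $k$ be an integer. If $f_p : X_p \to Y_p$ is $(k-p)$-connected for all $p \geq 0$, then $\|f_\bullet\| : \|X_\bullet\| \to \|Y_\bullet\|$ is $k$-connected.
   Context: All spaces are compactly generated (no Hausdorff condition), and products are formed in that category. A semi-simplicial space $X_\bullet$ is a functor $\Delta_{\mathrm{inj}}^{op} \to \mathrm{Top}$, where $\Delta_{\mathrm{inj}}$ has objects $[p]=\{0<1<\cdots<p\}$, $p\ge 0$, and morphisms the injective monotone maps; equivalently, spaces $X_p$ with face maps $d_i : X_p \to X_{p-1}$, $0\le i\le p$, satisfying $d_i d_j = d_{j-1} d_i$ for $i<j$. Maps of semi-simplicial spaces are natural transformations. The geometric realisation is $\|X_\bullet\| = \left(\coprod_p X_p \times \Delta^p\right)/\sim$ where $(x, d^i t) \sim (d_i x, t)$ and $d^i : \Delta^{p-1} \to \Delta^p$ is the $i$-th coface inclusion. A map is $k$-connected if, for all basepoints in the source, it induces bijections on $\pi_i$ for $i<k$ and a surjection on $\pi_k$ (for $k=0$: a surjection on $\pi_0$; for $k<0$: no condition). *)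

theory Defs
  imports "HOL-Analysis.Analysis" "HOL-Homology.Simplices"
begin

section \<open>Compactly generated spaces\<close>

text \<open>
  Compact generation without a separation axiom is tested against all continuous maps
  \<open>u : K \<rightarrow> X\<close> from compact Hausdorff spaces \<open>K\<close>.  (For non-Hausdorff \<open>X\<close> this differs from
  \<^const>\<open>k_space\<close> and \<^const>\<open>kification\<close>, which are tested against the compact subspaces of \<open>X\<close>.)
  A HOL formula cannot quantify over the type of \<open>K\<close>; in \<open>k_open\<close> the points of \<open>K\<close> are
  elements of \<open>(nat \<times> 'a) set set\<close>.  Theorem \<open>k_open_test\<close> below shows that
  this is no restriction: a set that passes these tests passes the test against
  every compact Hausdorff space over every type.
\<close>

definition k_open :: "'a topology \<Rightarrow> 'a set \<Rightarrow> bool" where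
  "k_open X U \<longleftrightarrow> U \<subseteq> topspace X \<and>
     (\<forall>(K :: (nat \<times> 'a) set set topology) u.
        compact_space K \<and> Hausdorff_space K \<and> continuous_map K X u
        \<longrightarrow> openin K {z \<in> topspace K. u z \<in> U})"

definition k_ification :: "'a topology \<Rightarrow> 'a topology" where
  "k_ification X = topology (k_open X)"

definition compactly_generated :: "'a topology \<Rightarrow> bool" where
  "compactly_generated X \<longleftrightarrow> (\<forall>U. k_open X U \<longrightarrow> openin X U)"

definition k_prod_topology :: "'a topology \<Rightarrow> 'b topology \<Rightarrow> ('a \<times> 'b) topology" where
  "k_prod_topology X Y = k_ification (prod_topology X Y)"

lemma istopology_k_open: "istopology (k_open X)"
  unfolding istopology_def
proof (intro conjI strip)
  fix S T assume "k_open X S" "k_open X T"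
  moreover have "{z \<in> A. u z \<in> S \<inter> T} = {z \<in> A. u z \<in> S} \<inter> {z \<in> A. u z \<in> T}"
    for A and u :: "(nat \<times> 'a) set set \<Rightarrow> 'a"
    by auto
  ultimately show "k_open X (S \<inter> T)"
    unfolding k_open_def by (auto intro!: openin_Int)
next
  fix \<K> assume *: "\<forall>S\<in>\<K>. k_open X S"
  have "{z \<in> A. u z \<in> \<Union>\<K>} = (\<Union>S\<in>\<K>. {z \<in> A. u z \<in> S})"
    for A and u :: "(nat \<times> 'a) set set \<Rightarrow> 'a"
    by auto
  with * show "k_open X (\<Union>\<K>)"
    unfolding k_open_def by (auto intro!: openin_Union)
qed

lemma openin_imp_k_open: "openin X U \<Longrightarrow> k_open X U"
  unfolding k_open_def by (auto simp: openin_subset openin_continuous_map_preimage)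

lemma openin_k_ification: "openin (k_ification X) U \<longleftrightarrow> k_open X U"
  by (simp add: k_ification_def istopology_k_open topology_inverse')

lemma topspace_k_ification [simp]: "topspace (k_ification X) = topspace X"
  by (metis openin_k_ification openin_imp_k_open k_open_def openin_subset openin_topspace
      subset_antisym)

lemma topspace_k_prod_topology [simp]:
  "topspace (k_prod_topology X Y) = topspace X \<times> topspace Y"
  by (simp add: k_prod_topology_def)

subsection \<open>The test spaces suffice\<close>

text \<open>
  Suppose \<open>u : K \<rightarrow> X\<close> is a test map on an arbitrary type for which the preimage of \<open>O\<close> is not
  open.  A small witness is the Stone space of a Boolean algebra of subsets of
  the complement of that preimage; the algebra is the image under
  \<open>tm_set\<close> of the terms \<open>tm\<close>, which inject into \<open>(nat \<times> 'a) set\<close>.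
\<close>

datatype 'a tm = Leaf "'a set" | Neg "'a tm" | Meet "'a tm" "'a tm" | Pt "'a tm"
  | Sel "'a tm" "'a set list" nat

primrec tm_set :: "'k set \<Rightarrow> ('a set \<Rightarrow> 'k set) \<Rightarrow> ('k set \<Rightarrow> 'k set) \<Rightarrow>
    ('k set \<Rightarrow> 'a set list \<Rightarrow> nat \<Rightarrow> 'k set) \<Rightarrow> 'a tm \<Rightarrow> 'k set" where
  "tm_set B D P S (Leaf V) = D V"
| "tm_set B D P S (Neg t) = B - tm_set B D P S t"
| "tm_set B D P S (Meet s t) = tm_set B D P S s \<inter> tm_set B D P S t"
| "tm_set B D P S (Pt t) = P (tm_set B D P S t)"
| "tm_set B D P S (Sel t Vs n) = S (tm_set B D P S t) Vs n"

definition cd_pair :: "(nat \<times> 'a) set \<Rightarrow> (nat \<times> 'a) set \<Rightarrow> (nat \<times> 'a) set" where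
  "cd_pair P Q = {(2 * n, a) |n a. (n, a) \<in> P} \<union> {(2 * n + 1, a) |n a. (n, a) \<in> Q}"

definition cd_nat :: "nat \<Rightarrow> (nat \<times> 'a) set" where
  "cd_nat n = {n} \<times> UNIV"

definition cd_set :: "'a set \<Rightarrow> (nat \<times> 'a) set" where
  "cd_set V = {0} \<times> V"

primrec cd_list :: "'a set list \<Rightarrow> (nat \<times> 'a) set" where
  "cd_list [] = cd_pair (cd_nat 0) {}"
| "cd_list (V # Vs) = cd_pair (cd_nat 1) (cd_pair (cd_set V) (cd_list Vs))"

primrec cd_tm :: "'a tm \<Rightarrow> (nat \<times> 'a) set" where
  "cd_tm (Leaf V) = cd_pair (cd_nat 0) (cd_set V)"
| "cd_tm (Neg t) = cd_pair (cd_nat 1) (cd_tm t)"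
| "cd_tm (Meet s t) = cd_pair (cd_nat 2) (cd_pair (cd_tm s) (cd_tm t))"
| "cd_tm (Pt t) = cd_pair (cd_nat 3) (cd_tm t)"
| "cd_tm (Sel t Vs n) = cd_pair (cd_nat 4) (cd_pair (cd_tm t) (cd_pair (cd_list Vs) (cd_nat n)))"

lemma cd_pair_eq [simp]: "cd_pair P Q = cd_pair P' Q' \<longleftrightarrow> P = P' \<and> Q = Q'"
proof -
  have 1: "P = {(n, a). (2 * n, a) \<in> cd_pair P Q}" for P Q :: "(nat \<times> 'a) set"
    unfolding cd_pair_def by (auto; presburger)
  have 2: "Q = {(n, a). (2 * n + 1, a) \<in> cd_pair P Q}" for P Q :: "(nat \<times> 'a) set"
    unfolding cd_pair_def by (auto; presburger)
  show ?thesis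
    using 1 2 by metis
qed

lemma cd_nat_eq [simp]: "cd_nat m = cd_nat n \<longleftrightarrow> m = n"
  unfolding cd_nat_def by blast

lemma cd_set_eq [simp]: "cd_set V = cd_set W \<longleftrightarrow> V = W"
  unfolding cd_set_def by blast

lemma cd_list_eq [simp]: "cd_list Vs = cd_list Ws \<longleftrightarrow> Vs = Ws"
proof (induction Vs arbitrary: Ws)
  case Nil
  then show ?case by (cases Ws) auto
next
  case (Cons V Vs)
  then show ?case by (cases Ws) auto
qed

lemma cd_tm_eq: "cd_tm s = cd_tm t \<longleftrightarrow> s = t"
proof (induction s arbitrary: t)
  case (Leaf V) then show ?case by (cases t) auto
next
  case (Neg s) then show ?case by (cases t) auto
next
  case (Meet s1 s2) then show ?case by (cases t) auto
next
  case (Pt s) then show ?case by (cases t) auto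
next
  case (Sel s Vs n) then show ?case by (cases t) auto
qed

lemma k_open_transport:
  fixes L :: "'l topology" and j :: "'l \<Rightarrow> (nat \<times> 'a) set set" and X :: "'a topology"
  assumes U: "k_open X U" and L: "compact_space L" "Hausdorff_space L"
    and w: "continuous_map L X w" and j: "inj j"
  shows "openin L {q \<in> topspace L. w q \<in> U}"
proof -
  define K where "K = pullback_topology (range j) (inv_into UNIV j) L"
  have topK: "topspace K = j ` topspace L"
    using j by (auto simp: K_def topspace_pullback_topology)
  have c1: "continuous_map K L (inv_into UNIV j)"
    using continuous_map_pullback[OF continuous_map_id] by (simp add: K_def)
  have c2: "continuous_map L K j"
    unfolding K_def using j by (intro continuous_map_pullback') (auto simp: inv_o_cancel)
  have hom: "homeomorphic_maps K L (inv_into UNIV j) j"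
    using c1 c2 topK j by (auto simp: homeomorphic_maps_def)
  then have "K homeomorphic_space L"
    by (auto simp: homeomorphic_space_def)
  then have "compact_space K" "Hausdorff_space K"
    using L homeomorphic_compact_space homeomorphic_Hausdorff_space by blast+
  moreover have "continuous_map K X (w \<circ> inv_into UNIV j)"
    using c1 w continuous_map_compose by blast
  ultimately have "openin K {z \<in> topspace K. (w \<circ> inv_into UNIV j) z \<in> U}"
    using U unfolding k_open_def by blast
  then have "openin L {q \<in> topspace L. j q \<in> {z \<in> topspace K. (w \<circ> inv_into UNIV j) z \<in> U}}"
    using c2 openin_continuous_map_preimage by blast
  moreover have "{q \<in> topspace L. j q \<in> {z \<in> topspace K. (w \<circ> inv_into UNIV j) z \<in> U}}
      = {q \<in> topspace L. w q \<in> U}"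
    using j topK by auto
  ultimately show ?thesis
    by simp
qed

theorem k_open_test:
  fixes X :: "'a topology" and K :: "'k topology"
  assumes kU: "k_open X U" and K: "compact_space K" "Hausdorff_space K"
    and u: "continuous_map K X u"
  shows "openin K {z \<in> topspace K. u z \<in> U}"
proof (rule ccontr)
  assume nopen: "\<not> openin K {z \<in> topspace K. u z \<in> U}"
  define B where "B = {z \<in> topspace K. u z \<notin> U}"
  have BK: "B \<subseteq> topspace K"
    by (auto simp: B_def)
  have "topspace K - {z \<in> topspace K. u z \<in> U} = B"
    by (auto simp: B_def)
  then have "\<not> closedin K B"
    using nopen openin_closedin[of "{z \<in> topspace K. u z \<in> U}" K] by simp
  then obtain x0 where x0: "x0 \<in> K closure_of B" "x0 \<notin> B"
    by (metis BK closure_of_subset_eq subsetI)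
  then have x0K: "x0 \<in> topspace K" and ux0: "u x0 \<in> U"
    by (auto simp: B_def in_closure_of)

  have reg: "\<exists>N D. openin K N \<and> closedin K D \<and> z \<in> N \<and> N \<subseteq> D \<and> D \<subseteq> {y \<in> topspace K. u y \<in> V}"
    if "openin X V" "z \<in> topspace K" "u z \<in> V" for V z
  proof -
    have "regular_space K"
      using K compact_Hausdorff_imp_regular_space by blast
    then have "neighbourhood_base_of (closedin K) K"
      using neighbourhood_base_of_closedin by blast
    moreover have "openin K {y \<in> topspace K. u y \<in> V}"
      using u that openin_continuous_map_preimage by blast
    ultimately show ?thesis
      using that unfolding neighbourhood_base_of by (metis (mono_tags, lifting) mem_Collect_eq)
  qed

  define DD where "DD V = (SOME D. \<exists>N. openin K N \<and> closedin K D \<and> x0 \<in> N \<and> N \<subseteq> D \<and>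
    D \<subseteq> {y \<in> topspace K. u y \<in> V})" for V
  define PP :: "'k set \<Rightarrow> 'k set" where "PP C = (if C = {} then {} else {SOME b. b \<in> C})" for C
  define ok where "ok C Vs cs \<longleftrightarrow> C \<subseteq> \<Union>(set cs) \<and> length cs = length Vs \<and>
    (\<forall>i<length Vs. cs ! i \<subseteq> B \<and> u ` (K closure_of (cs ! i)) \<subseteq> Vs ! i)"
    for C :: "'k set" and Vs :: "'a set list" and cs :: "'k set list"
  define SS where "SS C Vs n = B \<inter> (SOME cs. ok C Vs cs) ! n"
    for C :: "'k set" and Vs :: "'a set list" and n
  define e :: "'a tm \<Rightarrow> 'k set" where "e = tm_set B (\<lambda>V. B \<inter> DD V) PP SS"
  have e_simps [simp]: "e (Leaf V) = B \<inter> DD V" "e (Neg t) = B - e t" "e (Meet s t) = e s \<inter> e t"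
    "e (Pt t) = PP (e t)" "e (Sel t Vs n) = SS (e t) Vs n" for V s t Vs n
    by (simp_all add: e_def)
  have eB: "e t \<subseteq> B" for t
  proof (induction t)
    case (Pt t)
    then show ?case using some_in_eq[of "e t"] by (auto simp: PP_def)
  qed (auto simp: SS_def)

  define UL where "UL = {q. (\<forall>t. q t \<longrightarrow> e t \<noteq> {}) \<and> (\<forall>t. q (Neg t) \<longleftrightarrow> \<not> q t) \<and>
     (\<forall>s t. q (Meet s t) \<longleftrightarrow> q s \<and> q t)}"
  define L0 where "L0 = product_topology (\<lambda>_::'a tm. discrete_topology (UNIV::bool set)) UNIV"
  define L where "L = subtopology L0 UL"
  have top0: "topspace L0 = UNIV"
    by (simp add: L0_def)
  have topL: "topspace L = UL"
    by (simp add: L_def top0)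
  have cop: "openin L0 {q. q t}" "closedin L0 {q. q t}" for t
  proof -
    have c: "continuous_map L0 (discrete_topology UNIV) (\<lambda>q. q t)"
      unfolding L0_def by (rule continuous_map_product_projection) auto
    show "openin L0 {q. q t}"
      using openin_continuous_map_preimage[OF c, of "{True}"] by (simp add: top0)
    show "closedin L0 {q. q t}"
      using closedin_continuous_map_preimage[OF c, of "{True}"] by (simp add: top0)
  qed
  have copN: "openin L0 {q. \<not> q t}" "closedin L0 {q. \<not> q t}" for t
  proof -
    have "{q. \<not> q t} = topspace L0 - {q. q t}" for t :: "'a tm" by (auto simp: top0)
    then show "openin L0 {q. \<not> q t}" "closedin L0 {q. \<not> q t}"
      using cop[of t] by auto
  qed
  have clUL: "closedin L0 UL"
  proof -
    have "UL = (\<Inter>t\<in>{t. e t = {}}. {q. \<not> q t}) \<inter>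
       (\<Inter>t. ({q. q (Neg t)} \<inter> {q. \<not> q t}) \<union> ({q. \<not> q (Neg t)} \<inter> {q. q t})) \<inter>
       (\<Inter>(s,t)\<in>UNIV. ({q. q (Meet s t)} \<inter> {q. q s} \<inter> {q. q t}) \<union> 
                 ({q. \<not> q (Meet s t)} \<inter> ({q. \<not> q s} \<union> {q. \<not> q t})))" (is "_ = ?A \<inter> ?B \<inter> ?C")
      by (auto simp: UL_def)
    moreover have "closedin L0 ?A"
    proof (cases "{t. e t = {}} = {}")
      case True
      then show ?thesis using top0 closedin_topspace[of L0] by simp
    next
      case False
      then show ?thesis using copN by (intro closedin_INT) auto
    qed
    moreover have "closedin L0 ?B" "closedin L0 ?C"
      by (intro closedin_INT, auto intro!: closedin_Un closedin_Int cop copN)+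
    ultimately show ?thesis
      by auto
  qed
  have "compact_space L0"
    by (simp add: L0_def compact_space_product_topology compact_space_discrete_topology)
  then have Lc: "compact_space L"
    unfolding L_def using clUL closedin_compact_space compact_space_subtopology by blast
  have Lh: "Hausdorff_space L"
    by (simp add: L_def L0_def Hausdorff_space_subtopology Hausdorff_space_product_topology)

  have UL_Neg: "q (Neg t) \<longleftrightarrow> \<not> q t" and UL_Meet: "q (Meet s t) \<longleftrightarrow> q s \<and> q t"
    and UL_ne: "q t \<Longrightarrow> e t \<noteq> {}" if "q \<in> UL" for q s t
    using that unfolding UL_def by blast+
  have some_t: "\<exists>t. q t" if "q \<in> UL" for q
    using UL_Neg[OF that] by blast
  have dec: "\<exists>t. q t \<and> (\<forall>q'\<in>UL. q' t \<longrightarrow> (\<forall>i\<in>F. q' i = q i))"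
    if "finite F" "q \<in> UL" for F q
    using that(1)
  proof (induction F)
    case empty
    then show ?case using some_t that by auto
  next
    case (insert i F)
    then obtain t where t: "q t" "\<forall>q'\<in>UL. q' t \<longrightarrow> (\<forall>i\<in>F. q' i = q i)"
      by auto
    show ?case
    proof (intro exI[of _ "Meet t (if q i then i else Neg i)"] conjI ballI impI)
      show "q (Meet t (if q i then i else Neg i))"
        using t(1) UL_Meet[OF that(2)] UL_Neg[OF that(2)] by simp
      fix q' j assume "q' \<in> UL" "q' (Meet t (if q i then i else Neg i))" "j \<in> insert i F"
      then show "q' j = q j"
        using t(2) UL_Meet[of q'] UL_Neg[of q'] by (auto split: if_splits)
    qed
  qed
  have basis: "\<exists>t. q t \<and> {q' \<in> UL. q' t} \<subseteq> W" if W: "openin L W" and q: "q \<in> W" for W q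
  proof -
    obtain T where T: "openin L0 T" "W = T \<inter> UL"
      using W by (auto simp: L_def openin_subtopology)
    then have "q \<in> T" "q \<in> UL"
      using q by auto
    then obtain C where C: "finite {i. C i \<noteq> UNIV}" "q \<in> Pi\<^sub>E UNIV C" "Pi\<^sub>E UNIV C \<subseteq> T"
      using T(1) unfolding L0_def openin_product_topology_alt topspace_discrete_topology
      by (metis (no_types, lifting) Collect_cong UNIV_I)
    obtain t where t: "q t" "\<forall>q'\<in>UL. q' t \<longrightarrow> (\<forall>i\<in>{i. C i \<noteq> UNIV}. q' i = q i)"
      using dec[OF C(1) \<open>q \<in> UL\<close>] by blast
    have "q' \<in> W" if "q' \<in> UL" "q' t" for q'
    proof -
      have "q' i \<in> C i" for i
      proof (cases "C i = UNIV")
        case False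
        then have "q' i = q i"
          using t(2) that by blast
        then show ?thesis
          using C(2) by (simp add: PiE_iff)
      qed simp
      then have "q' \<in> Pi\<^sub>E UNIV C"
        by (simp add: PiE_iff)
      then show ?thesis
        using C(3) T(2) that(1) by blast
    qed
    then have "{q' \<in> UL. q' t} \<subseteq> W"
      by blast
    then show ?thesis
      using t(1) by blast
  qed
  define ch where "ch b = (\<lambda>t. b \<in> e t)" for b
  have chUL: "ch b \<in> UL" if "b \<in> B" for b
    using that by (auto simp: UL_def ch_def)
  have openL: "openin L {q \<in> UL. q t}" for t
    unfolding L_def openin_subtopology using cop[of t] by auto

  \<comment> \<open>an ultrafilter converging to \<open>x0\<close>\<close>
  have "\<exists>q0. q0 \<in> UL \<and> (\<forall>N. openin K N \<and> x0 \<in> N \<longrightarrow> q0 \<in> L closure_of (ch ` (B \<inter> N)))"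
  proof -
    define \<U> where "\<U> = (\<lambda>N. L closure_of (ch ` (B \<inter> N))) ` {N. openin K N \<and> x0 \<in> N}"
    have "\<Inter>\<F> \<noteq> {}" if F: "finite \<F>" "\<F> \<subseteq> \<U>" for \<F>
    proof -
      obtain \<N> where \<N>: "finite \<N>" "\<N> \<subseteq> {N. openin K N \<and> x0 \<in> N}"
        "\<F> = (\<lambda>N. L closure_of (ch ` (B \<inter> N))) ` \<N>"
        using finite_subset_image[OF F(1) F(2)[unfolded \<U>_def]] by blast
      have "openin K (topspace K \<inter> \<Inter>\<N>)"
        using \<N>(1,2)
      proof (induction \<N>)
        case (insert N \<N>)
        then have "openin K N" "openin K (topspace K \<inter> \<Inter>\<N>)"
          by blast+
        then have "openin K (N \<inter> (topspace K \<inter> \<Inter>\<N>))"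
          by (rule openin_Int)
        moreover have "topspace K \<inter> \<Inter>(insert N \<N>) = N \<inter> (topspace K \<inter> \<Inter>\<N>)"
          by auto
        ultimately show ?case
          by metis
      qed simp
      moreover have "x0 \<in> topspace K \<inter> \<Inter>\<N>"
        using x0K \<N> by auto
      ultimately obtain b where b: "b \<in> B" "b \<in> \<Inter>\<N>"
        using x0(1) unfolding in_closure_of by (metis Int_iff)
      have "ch b \<in> L closure_of (ch ` (B \<inter> N))" if "N \<in> \<N>" for N
      proof (rule subsetD[OF closure_of_subset])
        show "ch ` (B \<inter> N) \<subseteq> topspace L"
          using chUL topL by auto
        show "ch b \<in> ch ` (B \<inter> N)"
          using b that by auto
      qed
      then have "ch b \<in> \<Inter>\<F>"
        unfolding \<N>(3) by blast
      then show ?thesis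
        by blast
    qed
    moreover have "\<forall>C\<in>\<U>. closedin L C"
      by (auto simp: \<U>_def)
    ultimately have "\<Inter>\<U> \<noteq> {}"
      using Lc[unfolded compact_space_fip, rule_format, of \<U>] by blast
    then obtain q0 where q0: "q0 \<in> \<Inter>\<U>"
      by blast
    then have *: "q0 \<in> L closure_of (ch ` (B \<inter> N))" if "openin K N" "x0 \<in> N" for N
      using that by (auto simp: \<U>_def)
    moreover have "q0 \<in> UL"
      using *[OF openin_topspace x0K] by (simp add: in_closure_of topL)
    ultimately show ?thesis
      by blast
  qed
  then obtain q0 where q0: "q0 \<in> UL"
    and q0cl: "\<And>N. openin K N \<Longrightarrow> x0 \<in> N \<Longrightarrow> q0 \<in> L closure_of (ch ` (B \<inter> N))"
    by blast
  have q0N: "e t \<inter> N \<noteq> {}" if "q0 t" "openin K N" "x0 \<in> N" for t N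
    using q0cl[OF that(2,3)] openL[of t] that(1) q0 unfolding in_closure_of ch_def
    by (smt (verit, ccfv_SIG) IntE disjoint_iff imageE mem_Collect_eq)

  define good where "good q z \<longleftrightarrow> (\<forall>t. q t \<longrightarrow> z \<in> K closure_of e t) \<and>
     (\<forall>V. openin X V \<and> u z \<in> V \<longrightarrow> (\<exists>t. q t \<and> u ` (K closure_of e t) \<subseteq> V))" for q z
  have good0: "good q0 x0"
    unfolding good_def
  proof (intro conjI allI impI)
    fix t assume "q0 t"
    then show "x0 \<in> K closure_of e t"
      using q0N x0K unfolding in_closure_of by blast
  next
    fix V assume V: "openin X V \<and> u x0 \<in> V"
    have "\<exists>N. openin K N \<and> closedin K (DD V) \<and> x0 \<in> N \<and> N \<subseteq> DD V \<and>
      DD V \<subseteq> {y \<in> topspace K. u y \<in> V}"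
      unfolding DD_def by (rule someI_ex) (use reg[of V x0] V x0K in blast)
    then obtain N where N: "openin K N" "closedin K (DD V)" "x0 \<in> N" "N \<subseteq> DD V"
      "DD V \<subseteq> {y \<in> topspace K. u y \<in> V}"
      by blast
    have "q0 (Leaf V)"
    proof (rule ccontr)
      assume "\<not> q0 (Leaf V)"
      then have "q0 (Neg (Leaf V))"
        using UL_Neg[OF q0] by simp
      from q0N[OF this N(1,3)] N(4) show False
        by auto
    qed
    moreover have "K closure_of e (Leaf V) \<subseteq> DD V"
      using N(2) by (simp add: closure_of_minimal)
    ultimately show "\<exists>t. q0 t \<and> u ` (K closure_of e t) \<subseteq> V"
      using N(5) by (intro exI[of _ "Leaf V"]) blast
  qed
  have ex_good: "\<exists>z. good q z" if q: "q \<in> UL" for q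
  proof (rule ccontr)
    assume bad: "\<nexists>z. good q z"
    define F where "F = (\<Inter>t\<in>{t. q t}. K closure_of e t)"
    have Fcl: "z \<in> K closure_of e t" if "z \<in> F" "q t" for z t
      using that by (simp add: F_def)
    have FK: "z \<in> topspace K" if "z \<in> F" for z
    proof -
      obtain t where "q t"
        using some_t[OF q] by blast
      then have "z \<in> K closure_of e t"
        using Fcl that by blast
      then show ?thesis
        by (simp add: in_closure_of)
    qed
    have "\<exists>V N. openin X V \<and> (\<forall>t. q t \<longrightarrow> \<not> u ` (K closure_of e t) \<subseteq> V) \<and>
        openin K N \<and> z \<in> N \<and> u ` (K closure_of N) \<subseteq> V" if z: "z \<in> F" for z
    proof -
      obtain V where V: "openin X V" "u z \<in> V" "\<forall>t. q t \<longrightarrow> \<not> u ` (K closure_of e t) \<subseteq> V"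
      proof -
        have "\<not> good q z"
          using bad by blast
        then have "\<exists>V. openin X V \<and> u z \<in> V \<and> \<not> (\<exists>t. q t \<and> u ` (K closure_of e t) \<subseteq> V)"
          unfolding good_def using Fcl[OF z] by metis
        then show ?thesis
          using that by metis
      qed
      obtain N D where N: "openin K N" "closedin K D" "z \<in> N" "N \<subseteq> D"
        "D \<subseteq> {y \<in> topspace K. u y \<in> V}"
        using reg[OF V(1) FK[OF z] V(2)] by blast
      then have "K closure_of N \<subseteq> D"
        by (simp add: closure_of_minimal)
      then have "u ` (K closure_of N) \<subseteq> V"
        using N(5) by blast
      then show ?thesis
        using V(1,3) N(1,3) by blast
    qed
    then obtain VV NN where VN: "\<And>z. z \<in> F \<Longrightarrow> openin X (VV z) \<and>
        (\<forall>t. q t \<longrightarrow> \<not> u ` (K closure_of e t) \<subseteq> VV z) \<and>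
        openin K (NN z) \<and> z \<in> NN z \<and> u ` (K closure_of (NN z)) \<subseteq> VV z"
      by metis
    then have VV: "\<And>z t. z \<in> F \<Longrightarrow> q t \<Longrightarrow> \<not> u ` (K closure_of e t) \<subseteq> VV z"
      and NN: "\<And>z. z \<in> F \<Longrightarrow> openin K (NN z)" "\<And>z. z \<in> F \<Longrightarrow> z \<in> NN z"
      and NV: "\<And>z. z \<in> F \<Longrightarrow> u ` (K closure_of (NN z)) \<subseteq> VV z"
      by blast+
    have "\<exists>G Z. finite G \<and> G \<subseteq> {t. q t} \<and> finite Z \<and> Z \<subseteq> F \<and>
        (\<Inter>t\<in>G. K closure_of e t) \<inter> topspace K \<subseteq> \<Union>(NN ` Z)"
    proof -
      define \<U> where "\<U> = (\<lambda>t. K closure_of e t) ` {t. q t} \<union> (\<lambda>z. topspace K - NN z) ` F"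
      have "\<forall>C\<in>\<U>. closedin K C"
        using NN(1) by (auto simp: \<U>_def)
      moreover have "z \<notin> \<Inter>\<U>" for z
      proof
        assume z: "z \<in> \<Inter>\<U>"
        then have "z \<in> F"
          by (auto simp: \<U>_def F_def)
        then have "topspace K - NN z \<in> \<U>" "z \<in> NN z"
          using NN(2) by (auto simp: \<U>_def)
        with z show False
          by blast
      qed
      then have "\<Inter>\<U> = {}"
        by blast
      ultimately obtain \<F> where \<F>: "finite \<F>" "\<F> \<subseteq> \<U>" "\<Inter>\<F> = {}"
        using K(1)[unfolded compact_space_fip, rule_format, of \<U>] by blast
      define \<F>1 where "\<F>1 = \<F> \<inter> (\<lambda>t. K closure_of e t) ` {t. q t}"
      define \<F>2 where "\<F>2 = \<F> \<inter> (\<lambda>z. topspace K - NN z) ` F"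
      have eq: "\<F> = \<F>1 \<union> \<F>2"
        using \<F>(2) by (auto simp: \<F>1_def \<F>2_def \<U>_def)
      obtain G where G: "finite G" "G \<subseteq> {t. q t}" "\<F>1 = (\<lambda>t. K closure_of e t) ` G"
        using finite_subset_image[of \<F>1 "\<lambda>t. K closure_of e t" "{t. q t}"] \<F>(1)
        unfolding \<F>1_def by blast
      obtain Z where Z: "finite Z" "Z \<subseteq> F" "\<F>2 = (\<lambda>z. topspace K - NN z) ` Z"
        using finite_subset_image[of \<F>2 "\<lambda>z. topspace K - NN z" F] \<F>(1)
        unfolding \<F>2_def by blast
      have "\<Inter>(\<F>1 \<union> \<F>2) = {}"
        using \<F>(3) eq by simp
      then have "(\<Inter>t\<in>G. K closure_of e t) \<inter> (\<Inter>z\<in>Z. topspace K - NN z) = {}"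
        unfolding G(3) Z(3) Inter_Un_distrib .
      then have "(\<Inter>t\<in>G. K closure_of e t) \<inter> topspace K \<subseteq> \<Union>(NN ` Z)"
        by auto
      then show ?thesis
        using G Z by blast
    qed
    then obtain G Z where GZ: "finite G" "G \<subseteq> {t. q t}" "finite Z" "Z \<subseteq> F"
        "(\<Inter>t\<in>G. K closure_of e t) \<inter> topspace K \<subseteq> \<Union>(NN ` Z)"
      by blast
    have "\<exists>t. q t \<and> (\<forall>s\<in>G. e t \<subseteq> e s)"
      using GZ(1,2)
    proof (induction G)
      case empty
      then show ?case using some_t[OF q] by auto
    next
      case (insert s G)
      then obtain t where t: "q t" "\<forall>s\<in>G. e t \<subseteq> e s"
        by auto
      then show ?case
        using insert.prems UL_Meet[OF q] by (intro exI[of _ "Meet s t"]) auto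
    qed
    then obtain t where t: "q t" "\<forall>s\<in>G. e t \<subseteq> e s"
      by blast
    have etcl: "e t \<subseteq> (\<Inter>t\<in>G. K closure_of e t) \<inter> topspace K"
    proof -
      have eK: "e s \<subseteq> topspace K" for s
        using eB BK by (rule subset_trans)
      then have "e s \<subseteq> K closure_of e s" for s
        by (rule closure_of_subset)
      then show ?thesis
        using t(2) eK by blast
    qed
    obtain zs where zs: "set zs = Z"
      using GZ(3) finite_list by blast
    define Vs where "Vs = map VV zs"
    have "ok (e t) Vs (map (\<lambda>z. e t \<inter> NN z) zs)"
      unfolding ok_def
    proof (intro conjI allI impI)
      show "e t \<subseteq> \<Union>(set (map (\<lambda>z. e t \<inter> NN z) zs))"
        using subset_trans[OF etcl GZ(5)] zs by auto
      show "length (map (\<lambda>z. e t \<inter> NN z) zs) = length Vs"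
        by (simp add: Vs_def)
      fix i assume i: "i < length Vs"
      then have i': "i < length zs" by (simp add: Vs_def)
      then have "zs ! i \<in> F"
        using zs GZ(4) nth_mem by blast
      then have "u ` (K closure_of (NN (zs ! i))) \<subseteq> VV (zs ! i)"
        using NV by blast
      moreover have "K closure_of (e t \<inter> NN (zs ! i)) \<subseteq> K closure_of (NN (zs ! i))"
        by (simp add: closure_of_mono)
      ultimately show "u ` (K closure_of (map (\<lambda>z. e t \<inter> NN z) zs ! i)) \<subseteq> Vs ! i"
        using i' by (auto simp: Vs_def)
      show "map (\<lambda>z. e t \<inter> NN z) zs ! i \<subseteq> B"
        using i' eB[of t] by auto
    qed
    then have ok0: "ok (e t) Vs (SOME cs. ok (e t) Vs cs)"
      by (rule someI)
    define cs where "cs = (SOME cs. ok (e t) Vs cs)"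
    have ok: "ok (e t) Vs cs"
      using ok0 by (simp only: cs_def)
    have cs: "e t \<subseteq> \<Union>(set cs)" "length cs = length zs"
      "\<And>i. i < length zs \<Longrightarrow> cs ! i \<subseteq> B \<and> u ` (K closure_of (cs ! i)) \<subseteq> VV (zs ! i)"
      using ok unfolding ok_def by (simp_all add: Vs_def)
    have eSel: "e (Sel t Vs i) = cs ! i" if "i < length zs" for i
      using cs(3)[OF that] by (simp add: SS_def cs_def[symmetric] Int_absorb1)
    have nq: "\<not> q (Sel t Vs i)" if "i < length zs" for i
    proof
      assume "q (Sel t Vs i)"
      moreover have "zs ! i \<in> F"
        using that zs GZ(4) nth_mem by blast
      ultimately show False
        using VV cs(3)[OF that] eSel[OF that] by metis
    qed
    have "\<exists>s. q s \<and> e s \<subseteq> e t - (\<Union>i<n. cs ! i)" if "n \<le> length zs" for n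
      using that
    proof (induction n)
      case 0
      then show ?case using t(1) by auto
    next
      case (Suc n)
      then obtain s where s: "q s" "e s \<subseteq> e t - (\<Union>i<n. cs ! i)"
        by auto
      have "q (Meet s (Neg (Sel t Vs n)))"
        using UL_Meet[OF q] UL_Neg[OF q] s(1) nq[of n] Suc.prems by simp
      moreover have "e (Meet s (Neg (Sel t Vs n))) \<subseteq> e t - (\<Union>i<Suc n. cs ! i)"
      proof -
        have "e (Meet s (Neg (Sel t Vs n))) \<subseteq> e s - cs ! n"
          using eSel[of n] Suc.prems by (auto simp del: e_simps(5))
        also have "\<dots> \<subseteq> e t - (\<Union>i<n. cs ! i) - cs ! n"
          using s(2) by (rule Diff_mono) simp
        also have "\<dots> = e t - (\<Union>i<Suc n. cs ! i)"
          by (auto simp: less_Suc_eq)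
        finally show ?thesis .
      qed
      ultimately show ?case
        by blast
    qed
    then obtain s where s: "q s" "e s \<subseteq> e t - (\<Union>i<length zs. cs ! i)"
      by blast
    have "set cs = (!) cs ` {..<length zs}"
      unfolding set_conv_nth cs(2) by auto
    then have "e t - (\<Union>i<length zs. cs ! i) = {}"
      using cs(1) by simp
    then have "e s = {}"
      using s(2) by (simp only: subset_empty)
    then show False
      using UL_ne[OF q] s(1) by blast
  qed

  define zz where "zz q = (if q = q0 then x0 else (SOME z. good q z))" for q
  have good_zz: "good q (zz q)" if "q \<in> UL" for q
    using good0 someI_ex[OF ex_good[OF that]] by (simp add: zz_def)
  define w where "w q = u (zz q)" for q
  have "continuous_map L X w"
    unfolding continuous_map_def topL
  proof (intro conjI allI impI)
    show "w \<in> UL \<rightarrow> topspace X"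
    proof
      fix q assume q: "q \<in> UL"
      then obtain t where "q t" using some_t by blast
      then have "zz q \<in> topspace K"
        using good_zz[OF q] unfolding good_def in_closure_of by blast
      then show "w q \<in> topspace X"
        using u unfolding w_def continuous_map_def by blast
    qed
    fix V assume V: "openin X V"
    have "\<exists>T. openin L T \<and> q \<in> T \<and> T \<subseteq> {q \<in> UL. w q \<in> V}" if q: "q \<in> UL" "w q \<in> V" for q
    proof -
      obtain t where t: "q t" "u ` (K closure_of e t) \<subseteq> V"
        using good_zz[OF q(1)] q(2) V unfolding good_def w_def by blast
      have "{q \<in> UL. q t} \<subseteq> {q \<in> UL. w q \<in> V}"
        using good_zz t(2) unfolding good_def w_def by blast
      then show ?thesis
        using openL[of t] q t by blast
    qed
    then show "openin L {q \<in> UL. w q \<in> V}"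
      by (subst openin_subopen) blast
  qed
  moreover have "inj (\<lambda>q. cd_tm ` {t :: 'a tm. q t})"
  proof (rule injI)
    fix q q' :: "'a tm \<Rightarrow> bool"
    assume "cd_tm ` {t. q t} = cd_tm ` {t. q' t}"
    moreover have "inj (cd_tm :: 'a tm \<Rightarrow> _)"
      by (simp add: inj_def cd_tm_eq)
    ultimately have "{t. q t} = {t. q' t}"
      by (simp add: inj_image_eq_iff)
    then show "q = q'"
      by (simp add: Collect_inj)
  qed
  ultimately have "openin L {q \<in> topspace L. w q \<in> U}"
    by (rule k_open_transport[OF kU Lc Lh])
  moreover have "q0 \<in> {q \<in> topspace L. w q \<in> U}"
    using q0 ux0 by (simp add: topL w_def zz_def)
  ultimately obtain t where t: "q0 t" "{q \<in> UL. q t} \<subseteq> {q \<in> topspace L. w q \<in> U}"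
    using basis by blast
  have "e t \<noteq> {}"
    using t(1) UL_ne[OF q0] by blast
  define b where "b = (SOME b. b \<in> e t)"
  have b: "b \<in> e t" "e (Pt t) = {b}"
    using \<open>e t \<noteq> {}\<close> some_in_eq[of "e t"] by (auto simp: b_def PP_def)
  then have bB: "b \<in> B"
    using eB by blast
  have "ch b t" "ch b (Pt t)"
    using b by (simp_all add: ch_def del: e_simps)
  then have "zz (ch b) \<in> K closure_of {b}"
    using good_zz[OF chUL[OF bB]] b(2) unfolding good_def by metis
  moreover have "closedin K {b}"
    using bB BK K(2) by (metis Hausdorff_imp_t1_space closedin_t1_singleton subsetD)
  ultimately have "zz (ch b) = b"
    by (simp add: closure_of_closedin)
  then have "w (ch b) \<notin> U"
    using bB by (simp add: w_def B_def)
  then show False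
    using t(2) \<open>ch b t\<close> chUL[OF bB] by blast
qed


section \<open>Homotopy groups and \<open>k\<close>-connected maps\<close>

definition cube :: "nat \<Rightarrow> (nat \<Rightarrow> real) topology" where
  "cube n = product_topology (\<lambda>_. top_of_set {0..1}) {..<n}"

definition cube_boundary :: "nat \<Rightarrow> (nat \<Rightarrow> real) set" where
  "cube_boundary n = {t \<in> topspace (cube n). \<exists>i<n. t i = 0 \<or> t i = 1}"

definition homotopic_spheroids ::
    "nat \<Rightarrow> 'a topology \<Rightarrow> 'a \<Rightarrow> ((nat \<Rightarrow> real) \<Rightarrow> 'a) \<Rightarrow> ((nat \<Rightarrow> real) \<Rightarrow> 'a) \<Rightarrow> bool" where
  "homotopic_spheroids n X x0 = homotopic_with (\<lambda>g. \<forall>t\<in>cube_boundary n. g t = x0) (cube n) X"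

text \<open>
  The underlying set of \<open>\<pi>\<^sub>n(X, x0)\<close>: homotopy classes of maps
  \<open>(I\<^sup>n, \<partial>I\<^sup>n) \<rightarrow> (X, x0)\<close>.  As \<open>\<partial>I\<^sup>0\<close> is empty, \<open>\<pi>\<^sub>0\<close> is the set of path components, whatever \<open>x0\<close> is.
\<close>

definition homotopy_group :: "nat \<Rightarrow> 'a topology \<Rightarrow> 'a \<Rightarrow> ((nat \<Rightarrow> real) \<Rightarrow> 'a) set set" where
  "homotopy_group n X x0 =
     {{h. homotopic_spheroids n X x0 g h} |g.
        continuous_map (cube n) X g \<and> (\<forall>t\<in>cube_boundary n. g t = x0)}"

definition homotopy_group_map ::
    "nat \<Rightarrow> 'b topology \<Rightarrow> ('a \<Rightarrow> 'b) \<Rightarrow> 'a \<Rightarrow> ((nat \<Rightarrow> real) \<Rightarrow> 'a) set \<Rightarrow> ((nat \<Rightarrow> real) \<Rightarrow> 'b) set" where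
  "homotopy_group_map n Y f x0 c = {h. \<exists>g\<in>c. homotopic_spheroids n Y (f x0) (f \<circ> g) h}"

text \<open>
  Surjectivity on \<open>\<pi>\<^sub>0\<close> is a condition without basepoint and is stated separately:
  with an empty source there is no basepoint, but for \<open>k \<ge> 0\<close> the target must then be empty too.
\<close>

definition k_connected_map :: "int \<Rightarrow> 'a topology \<Rightarrow> 'b topology \<Rightarrow> ('a \<Rightarrow> 'b) \<Rightarrow> bool" where
  "k_connected_map k X Y f \<longleftrightarrow> continuous_map X Y f \<and>
     (k \<ge> 0 \<longrightarrow> (\<forall>C\<in>path_components_of Y. \<exists>x\<in>topspace X. f x \<in> C)) \<and>
     (\<forall>x0\<in>topspace X. \<forall>i::nat.
        (int i < k \<longrightarrow> bij_betw (homotopy_group_map i Y f x0)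
                         (homotopy_group i X x0) (homotopy_group i Y (f x0))) \<and>
        (int i = k \<longrightarrow> homotopy_group_map i Y f x0 ` homotopy_group i X x0
                         = homotopy_group i Y (f x0)))"


section \<open>Semi-simplicial spaces and geometric realisation\<close>

text \<open>
  \<open>d p i\<close> is the face map \<open>d\<^sub>i : X\<^sub>p \<rightarrow> X\<^sub>p\<^sub>-\<^sub>1\<close>, relevant for \<open>p \<ge> 1\<close> and \<open>i \<le> p\<close>.
\<close>

definition semisimplicial_space ::
    "(nat \<Rightarrow> 'a topology) \<Rightarrow> (nat \<Rightarrow> nat \<Rightarrow> 'a \<Rightarrow> 'a) \<Rightarrow> bool" where
  "semisimplicial_space X d \<longleftrightarrow>
     (\<forall>p. compactly_generated (X p)) \<and>
     (\<forall>p. \<forall>i\<le>Suc p. continuous_map (X (Suc p)) (X p) (d (Suc p) i)) \<and>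
     (\<forall>p i j. i < j \<and> j \<le> Suc (Suc p) \<longrightarrow>
        (\<forall>x\<in>topspace (X (Suc (Suc p))).
           d (Suc p) i (d (Suc (Suc p)) j x) = d (Suc p) (j - 1) (d (Suc (Suc p)) i x)))"

definition semisimplicial_map ::
    "(nat \<Rightarrow> 'a topology) \<Rightarrow> (nat \<Rightarrow> nat \<Rightarrow> 'a \<Rightarrow> 'a) \<Rightarrow>
     (nat \<Rightarrow> 'b topology) \<Rightarrow> (nat \<Rightarrow> nat \<Rightarrow> 'b \<Rightarrow> 'b) \<Rightarrow> (nat \<Rightarrow> 'a \<Rightarrow> 'b) \<Rightarrow> bool" where
  "semisimplicial_map X d Y e f \<longleftrightarrow>
     (\<forall>p. continuous_map (X p) (Y p) (f p)) \<and>
     (\<forall>p. \<forall>i\<le>Suc p. \<forall>x\<in>topspace (X (Suc p)).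
        f p (d (Suc p) i x) = e (Suc p) i (f (Suc p) x))"

definition simplex_space :: "nat \<Rightarrow> (nat \<Rightarrow> real) topology" where
  "simplex_space p = subtopology (powertop_real UNIV) (standard_simplex p)"

definition prerealisation ::
    "(nat \<Rightarrow> 'a topology) \<Rightarrow> (nat \<times> 'a \<times> (nat \<Rightarrow> real)) topology" where
  "prerealisation X = sum_topology (\<lambda>p. k_prod_topology (X p) (simplex_space p)) UNIV"

text \<open>\<^const>\<open>simplical_face\<close>\<open> i\<close> is the coface inclusion \<open>d\<^sup>i\<close>.\<close>

definition realisation_gluing ::
    "(nat \<Rightarrow> 'a topology) \<Rightarrow> (nat \<Rightarrow> nat \<Rightarrow> 'a \<Rightarrow> 'a) \<Rightarrow>
     ((nat \<times> 'a \<times> (nat \<Rightarrow> real)) \<times> (nat \<times> 'a \<times> (nat \<Rightarrow> real))) set" where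
  "realisation_gluing X d =
     {((Suc p, x, simplical_face i t), (p, d (Suc p) i x, t)) |p i x t.
        i \<le> Suc p \<and> x \<in> topspace (X (Suc p)) \<and> t \<in> standard_simplex p}"

definition realisation_rel ::
    "(nat \<Rightarrow> 'a topology) \<Rightarrow> (nat \<Rightarrow> nat \<Rightarrow> 'a \<Rightarrow> 'a) \<Rightarrow>
     ((nat \<times> 'a \<times> (nat \<Rightarrow> real)) \<times> (nat \<times> 'a \<times> (nat \<Rightarrow> real))) set" where
  "realisation_rel X d = (realisation_gluing X d \<union> (realisation_gluing X d)\<inverse>)\<^sup>*"

definition quotient_space :: "'a topology \<Rightarrow> ('a \<times> 'a) set \<Rightarrow> 'a set topology" where
  "quotient_space X R = topology (\<lambda>U. U \<subseteq> topspace X // R \<and>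
     openin X {x \<in> topspace X. R `` {x} \<in> U})"

lemma openin_quotient_space:
  "openin (quotient_space X R) U \<longleftrightarrow>
     U \<subseteq> topspace X // R \<and> openin X {x \<in> topspace X. R `` {x} \<in> U}"
proof -
  have "istopology (\<lambda>U. U \<subseteq> topspace X // R \<and> openin X {x \<in> topspace X. R `` {x} \<in> U})"
    unfolding istopology_def
  proof (intro conjI strip)
    fix S T
    assume *: "S \<subseteq> topspace X // R \<and> openin X {x \<in> topspace X. R `` {x} \<in> S}"
      "T \<subseteq> topspace X // R \<and> openin X {x \<in> topspace X. R `` {x} \<in> T}"
    have "{x \<in> topspace X. R `` {x} \<in> S \<inter> T} =
        {x \<in> topspace X. R `` {x} \<in> S} \<inter> {x \<in> topspace X. R `` {x} \<in> T}"
      by auto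
    then show "S \<inter> T \<subseteq> topspace X // R" "openin X {x \<in> topspace X. R `` {x} \<in> S \<inter> T}"
      using * by (auto intro: openin_Int)
  next
    fix \<K>
    assume *: "\<forall>S\<in>\<K>. S \<subseteq> topspace X // R \<and> openin X {x \<in> topspace X. R `` {x} \<in> S}"
    have "{x \<in> topspace X. R `` {x} \<in> \<Union>\<K>} = (\<Union>S\<in>\<K>. {x \<in> topspace X. R `` {x} \<in> S})"
      by auto
    then show "\<Union>\<K> \<subseteq> topspace X // R" "openin X {x \<in> topspace X. R `` {x} \<in> \<Union>\<K>}"
      using * by (auto intro!: openin_Union)
  qed
  then show ?thesis
    by (simp add: quotient_space_def topology_inverse')
qed

lemma topspace_quotient_space [simp]: "topspace (quotient_space X R) = topspace X // R"
proof (rule subset_antisym)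
  show "topspace (quotient_space X R) \<subseteq> topspace X // R"
    using openin_topspace[of "quotient_space X R"] unfolding openin_quotient_space by blast
  have "{x \<in> topspace X. R `` {x} \<in> topspace X // R} = topspace X"
    by (auto simp: quotient_def)
  then have "openin (quotient_space X R) (topspace X // R)"
    by (simp add: openin_quotient_space)
  then show "topspace X // R \<subseteq> topspace (quotient_space X R)"
    by (rule openin_subset)
qed

lemma quotient_map_quotient_space: "quotient_map X (quotient_space X R) (\<lambda>x. R `` {x})"
  unfolding quotient_map_def by (auto simp: openin_quotient_space quotient_def)

definition realisation ::
    "(nat \<Rightarrow> 'a topology) \<Rightarrow> (nat \<Rightarrow> nat \<Rightarrow> 'a \<Rightarrow> 'a) \<Rightarrow>
     (nat \<times> 'a \<times> (nat \<Rightarrow> real)) set topology" where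
  "realisation X d = quotient_space (prerealisation X) (realisation_rel X d)"

definition realisation_map ::
    "(nat \<Rightarrow> 'b topology) \<Rightarrow> (nat \<Rightarrow> nat \<Rightarrow> 'b \<Rightarrow> 'b) \<Rightarrow> (nat \<Rightarrow> 'a \<Rightarrow> 'b) \<Rightarrow>
     (nat \<times> 'a \<times> (nat \<Rightarrow> real)) set \<Rightarrow> (nat \<times> 'b \<times> (nat \<Rightarrow> real)) set" where
  "realisation_map Y e f c = realisation_rel Y e `` ((\<lambda>(p, x, t). (p, f p x, t)) ` c)"

end

theory Submission
  imports Defs
begin

text \<open>
  A map \<open>X \<rightarrow> Y\<close> is \<open>k\<close>-connected iff for all \<open>n \<le> k\<close> every square from \<open>(I\<^sup>n, \<partial>I\<^sup>n)\<close> to \<open>(Y, X)\<close> lifts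
  up to homotopy relative to the boundary.  Let \<open>V\<^sub>p\<close> be the open part of the realisation where
  some barycentric coordinate exceeds \<open>1 / (p + 1)\<close>.  Then \<open>V\<^sub>0\<close> is empty and every map from
  a cube lands in some \<open>V\<^sub>p\<close>, so it suffices to pass from \<open>V\<^sub>p\<close> to \<open>V\<^sub>p\<^sub>+\<^sub>1\<close>.  Subtracting
  \<open>1 / (p + 2)\<close> from all coordinates, truncating at \<open>0\<close> and normalising deforms \<open>V\<^sub>p\<^sub>+\<^sub>1\<close> into the
  \<open>p\<close>-skeleton, in which the complement of \<open>V\<^sub>p\<close> consists of the barycentres of the \<open>p\<close>-simplices.
  On a fine grid the map from the cube is then deformed until the preimage of these barycentres
  is a subcomplex of dimension at most \<open>n - p\<close>.  Over it the connectivity of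
  \<open>f\<^sub>p\<close> gives a lift, which extends to a neighbourhood; the rest of the cube is mapped to \<open>V\<^sub>p\<close>.
\<close>

section \<open>Lifting up to homotopy\<close>

text \<open>Connectivity is recast as a lifting property because lifts, unlike homotopy classes, can
  be glued over closed pieces of a cube and need no base points. The threshold
  \<open>1 / (p + 1)\<close> comes from the standard p-simplex: each of its points has a coordinate
  above it, except the barycentre. So the passage to the next open set is governed by one point of
  each p-simplex, and being at that point amounts to \<open>p\<close> equations. The obstacle is
  that maps into the simplex are merely continuous, so that there are no regular values to appeal
  to. Instead, for each of the \<open>p\<close> coordinates the cells of a fine grid are coloured as
  nearly negative or nearly positive. Distinct cells meet in a smaller cell, so the locus where both
  colours meet loses one dimension per coordinate, and the map is perturbed until it meets the
  barycentre on this combinatorial locus only. The loss of \<open>p\<close> dimensions matches the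
  loss of connectivity from \<open>k\<close> to \<open>k - p\<close>. A lift over the locus must be
  defined on a neighbourhood before the rest of the cube can be left to the induction hypothesis.
  Precomposition with a map that pushes neighbourhoods of cells into the cells provides
  this.\<close>

lemma cmap_compose:
  assumes "continuous_map (top_of_set K) Y g" "continuous_on S \<phi>" "\<And>x. x \<in> S \<Longrightarrow> \<phi> x \<in> K"
  shows "continuous_map (top_of_set S) Y (\<lambda>x. g (\<phi> x))"
proof -
  have "continuous_map (top_of_set S) (top_of_set K) \<phi>"
    using assms(2,3) by (auto simp: continuous_map_in_subtopology)
  from continuous_map_compose[OF this assms(1)] show ?thesis by (simp add: o_def)
qed

lemma cmap_subset:
  "continuous_map (top_of_set K) Y g \<Longrightarrow> S \<subseteq> K \<Longrightarrow> continuous_map (top_of_set S) Y g"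
  using continuous_map_from_subtopology_mono by blast

lemma cmap_cong:
  "continuous_map (top_of_set K) Y g \<Longrightarrow> (\<And>x. x \<in> K \<Longrightarrow> g x = h x) \<Longrightarrow>
    continuous_map (top_of_set K) Y h"
  using continuous_map_eq[of "top_of_set K" Y g h] by simp

lemma cmap_closed_Un:
  fixes K1 K2 :: "'c::topological_space set"
  assumes "closed K1" "closed K2" "continuous_map (top_of_set K1) Y g"
    "continuous_map (top_of_set K2) Y g"
  shows "continuous_map (top_of_set (K1 \<union> K2)) Y g"
proof (rule pasting_lemma_closed[where I="{True,False}" and T="\<lambda>b. if b then K1 else K2" and f="\<lambda>_. g"])
  show "closedin (top_of_set (K1 \<union> K2)) (if i then K1 else K2)" for i
    using assms(1,2) by (auto intro: closed_subset)
  show "continuous_map (subtopology (top_of_set (K1 \<union> K2)) (if i then K1 else K2)) Y g" for i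
    using assms(3,4) by (auto simp: subtopology_subtopology Int_absorb1)
qed auto

lemma cmap_closed_Un_if:
  fixes K1 K2 :: "'c::topological_space set"
  assumes "closed K1" "closed K2" "continuous_map (top_of_set K1) Y g"
    "continuous_map (top_of_set K2) Y g'" "\<And>x. x \<in> K1 \<Longrightarrow> x \<in> K2 \<Longrightarrow> g x = g' x"
  shows "continuous_map (top_of_set (K1 \<union> K2)) Y (\<lambda>x. if x \<in> K1 then g x else g' x)"
proof (rule cmap_closed_Un[OF assms(1,2)])
  show "continuous_map (top_of_set K1) Y (\<lambda>x. if x \<in> K1 then g x else g' x)"
    by (rule cmap_cong[OF assms(3)]) auto
  show "continuous_map (top_of_set K2) Y (\<lambda>x. if x \<in> K1 then g x else g' x)"
    using assms(5) by (intro cmap_cong[OF assms(4)]) auto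
qed

text \<open>For \<open>f = id\<close> this is the homotopy extension property of \<open>(K, L)\<close>.\<close>

definition lifts :: "'a topology \<Rightarrow> 'b topology \<Rightarrow> ('a \<Rightarrow> 'b) \<Rightarrow>
    'c::topological_space set \<Rightarrow> 'c set \<Rightarrow> bool" where
  "lifts X Y f K L \<longleftrightarrow> (\<forall>a b h.
     continuous_map (top_of_set K) Y a \<longrightarrow> continuous_map (top_of_set L) X b \<longrightarrow>
     continuous_map (top_of_set (L \<times> {0..1::real})) Y h \<longrightarrow>
     (\<forall>z\<in>L. h (z, 0) = a z \<and> h (z, 1) = f (b z)) \<longrightarrow>
     (\<exists>b' h'. continuous_map (top_of_set K) X b' \<and>
        continuous_map (top_of_set (K \<times> {0..1::real})) Y h' \<and>
        (\<forall>z\<in>K. h' (z, 0) = a z \<and> h' (z, 1) = f (b' z)) \<and>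
        (\<forall>z\<in>L. b' z = b z \<and> (\<forall>t\<in>{0..1}. h' (z, t) = h (z, t)))))"

lemma liftsI:
  assumes "\<And>a b h. continuous_map (top_of_set K) Y a \<Longrightarrow> continuous_map (top_of_set L) X b \<Longrightarrow>
     continuous_map (top_of_set (L \<times> {0..1::real})) Y h \<Longrightarrow>
     \<forall>z\<in>L. h (z, 0) = a z \<and> h (z, 1) = f (b z) \<Longrightarrow>
     \<exists>b' h'. continuous_map (top_of_set K) X b' \<and>
        continuous_map (top_of_set (K \<times> {0..1::real})) Y h' \<and>
        (\<forall>z\<in>K. h' (z, 0) = a z \<and> h' (z, 1) = f (b' z)) \<and>
        (\<forall>z\<in>L. b' z = b z \<and> (\<forall>t\<in>{0..1}. h' (z, t) = h (z, t)))"
  shows "lifts X Y f K L"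
  unfolding lifts_def using assms by blast

lemma liftsE:
  assumes "lifts X Y f K L"
    and "continuous_map (top_of_set K) Y a" "continuous_map (top_of_set L) X b"
     "continuous_map (top_of_set (L \<times> {0..1::real})) Y h"
     "\<forall>z\<in>L. h (z, 0) = a z \<and> h (z, 1) = f (b z)"
  obtains b' h' where "continuous_map (top_of_set K) X b'"
    "continuous_map (top_of_set (K \<times> {0..1::real})) Y h'"
    "\<forall>z\<in>K. h' (z, 0) = a z \<and> h' (z, 1) = f (b' z)"
    "\<forall>z\<in>L. b' z = b z \<and> (\<forall>t\<in>{0..1}. h' (z, t) = h (z, t))"
  using assms(1)[unfolded lifts_def, THEN spec, THEN spec, THEN spec, THEN mp, THEN mp, THEN mp, THEN mp, OF assms(2-5)]
  by (elim exE conjE) (rule that)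

lemma lifts_refl: "lifts X Y f K K"
proof (rule liftsI, intro exI conjI)
qed auto

lemma lifts_trans:
  assumes "lifts X Y f K1 L" "lifts X Y f K K1" "L \<subseteq> K1" "K1 \<subseteq> K"
  shows "lifts X Y f K L"
proof (rule liftsI)
  fix a b h
  assume a: "continuous_map (top_of_set K) Y a" and b: "continuous_map (top_of_set L) X b"
    and h: "continuous_map (top_of_set (L \<times> {0..1::real})) Y h"
    and e: "\<forall>z\<in>L. h (z, 0) = a z \<and> h (z, 1) = f (b z)"
  obtain b1 h1 where 1: "continuous_map (top_of_set K1) X b1"
    "continuous_map (top_of_set (K1 \<times> {0..1::real})) Y h1"
    "\<forall>z\<in>K1. h1 (z, 0) = a z \<and> h1 (z, 1) = f (b1 z)"
    "\<forall>z\<in>L. b1 z = b z \<and> (\<forall>t\<in>{0..1}. h1 (z, t) = h (z, t))"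
    by (rule liftsE[OF assms(1) cmap_subset[OF a assms(4)] b h e])
  obtain b2 h2 where "continuous_map (top_of_set K) X b2"
    "continuous_map (top_of_set (K \<times> {0..1::real})) Y h2"
    "\<forall>z\<in>K. h2 (z, 0) = a z \<and> h2 (z, 1) = f (b2 z)"
    "\<forall>z\<in>K1. b2 z = b1 z \<and> (\<forall>t\<in>{0..1}. h2 (z, t) = h1 (z, t))"
    by (rule liftsE[OF assms(2) a 1(1-3)])
  with 1 e show "\<exists>b' h'. continuous_map (top_of_set K) X b' \<and>
        continuous_map (top_of_set (K \<times> {0..1::real})) Y h' \<and>
        (\<forall>z\<in>K. h' (z, 0) = a z \<and> h' (z, 1) = f (b' z)) \<and>
        (\<forall>z\<in>L. b' z = b z \<and> (\<forall>t\<in>{0..1}. h' (z, t) = h (z, t)))"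
    using assms(3,4) by (intro exI[of _ b2] exI[of _ h2] conjI ballI) (auto simp: subset_iff)
qed

text \<open>Excision: the problem on \<open>Q\<close> only sees the data on the overlap, and the two
  solutions paste along closed sets.\<close>

lemma lifts_Un:
  fixes P Q :: "'c::topological_space set"
  assumes "lifts X Y f Q (Q \<inter> P)" "closed P" "closed Q"
  shows "lifts X Y f (P \<union> Q) P"
proof (rule liftsI)
  fix a b h
  assume a: "continuous_map (top_of_set (P \<union> Q)) Y a" and b: "continuous_map (top_of_set P) X b"
    and h: "continuous_map (top_of_set (P \<times> {0..1::real})) Y h"
    and e: "\<forall>z\<in>P. h (z, 0) = a z \<and> h (z, 1) = f (b z)"
  obtain b1 h1 where 1: "continuous_map (top_of_set Q) X b1"
    "continuous_map (top_of_set (Q \<times> {0..1::real})) Y h1"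
    "\<forall>z\<in>Q. h1 (z, 0) = a z \<and> h1 (z, 1) = f (b1 z)"
    "\<forall>z\<in>Q \<inter> P. b1 z = b z \<and> (\<forall>t\<in>{0..1}. h1 (z, t) = h (z, t))"
  proof (rule liftsE[OF assms(1)])
    show "continuous_map (top_of_set Q) Y a" using a by (rule cmap_subset) auto
    show "continuous_map (top_of_set (Q \<inter> P)) X b" using b by (rule cmap_subset) auto
    show "continuous_map (top_of_set ((Q \<inter> P) \<times> {0..1})) Y h" using h by (rule cmap_subset) auto
  qed (use e in auto)
  define b' where "b' = (\<lambda>z. if z \<in> P then b z else b1 z)"
  define h' where "h' = (\<lambda>w. if w \<in> P \<times> {0..1} then h w else h1 w)"
  have "continuous_map (top_of_set (P \<union> Q)) X b'"
    unfolding b'_def using 1 by (intro cmap_closed_Un_if assms b) auto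
  moreover have "continuous_map (top_of_set ((P \<times> {0..1}) \<union> (Q \<times> {0..1}))) Y h'"
    unfolding h'_def using 1 by (intro cmap_closed_Un_if closed_Times assms h) auto
  ultimately show "\<exists>b' h'. continuous_map (top_of_set (P \<union> Q)) X b' \<and>
        continuous_map (top_of_set ((P \<union> Q) \<times> {0..1::real})) Y h' \<and>
        (\<forall>z\<in>P \<union> Q. h' (z, 0) = a z \<and> h' (z, 1) = f (b' z)) \<and>
        (\<forall>z\<in>P. b' z = b z \<and> (\<forall>t\<in>{0..1}. h' (z, t) = h (z, t)))"
    using 1 e by (intro exI[of _ b'] exI[of _ h']) (auto simp: b'_def h'_def Sigma_Un_distrib1)
qed

lemma lifts_homeo:
  fixes \<phi> :: "'c::topological_space \<Rightarrow> 'd::topological_space"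
  assumes l: "lifts X Y f K L"
    and \<phi>: "continuous_on K' \<phi>" "\<And>z. z \<in> K' \<Longrightarrow> \<phi> z \<in> K" "\<And>z. z \<in> L' \<Longrightarrow> \<phi> z \<in> L"
    and \<psi>: "continuous_on K \<psi>" "\<And>z. z \<in> K \<Longrightarrow> \<psi> z \<in> K'" "\<And>z. z \<in> L \<Longrightarrow> \<psi> z \<in> L'"
    and inv: "\<And>z. z \<in> K' \<Longrightarrow> \<psi> (\<phi> z) = z" "\<And>z. z \<in> K \<Longrightarrow> \<phi> (\<psi> z) = z"
    and sub: "L \<subseteq> K" "L' \<subseteq> K'"
  shows "lifts X Y f K' L'"
proof (rule liftsI)
  fix a b h
  assume a: "continuous_map (top_of_set K') Y a" and b: "continuous_map (top_of_set L') X b"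
    and h: "continuous_map (top_of_set (L' \<times> {0..1::real})) Y h"
    and e: "\<forall>z\<in>L'. h (z, 0) = a z \<and> h (z, 1) = f (b z)"
  have cL: "continuous_on L \<psi>" using \<psi>(1) sub(1) continuous_on_subset by blast
  obtain b1 h1 where 1: "continuous_map (top_of_set K) X b1"
    "continuous_map (top_of_set (K \<times> {0..1::real})) Y h1"
    "\<forall>z\<in>K. h1 (z, 0) = a (\<psi> z) \<and> h1 (z, 1) = f (b1 z)"
    "\<forall>z\<in>L. b1 z = b (\<psi> z) \<and> (\<forall>t\<in>{0..1}. h1 (z, t) = h (\<psi> z, t))"
  proof (rule liftsE[OF l])
    show "continuous_map (top_of_set K) Y (\<lambda>z. a (\<psi> z))"
      using \<psi> by (intro cmap_compose[OF a]) auto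
    show "continuous_map (top_of_set L) X (\<lambda>z. b (\<psi> z))"
      using \<psi> cL by (intro cmap_compose[OF b]) auto
    have "continuous_on (L \<times> {0..1::real}) (\<lambda>w. (\<psi> (fst w), snd w))"
      by (intro continuous_intros continuous_on_compose2[OF cL]) auto
    then show "continuous_map (top_of_set (L \<times> {0..1})) Y (\<lambda>w. h ((\<lambda>w. (\<psi> (fst w), snd w)) w))"
      using \<psi> by (intro cmap_compose[OF h]) auto
  qed (use e \<psi> in auto)
  have "continuous_on (K' \<times> {0..1::real}) (\<lambda>w. (\<phi> (fst w), snd w))"
    by (intro continuous_intros continuous_on_compose2[OF \<phi>(1)]) auto
  then have "continuous_map (top_of_set (K' \<times> {0..1})) Y (\<lambda>w. h1 ((\<lambda>w. (\<phi> (fst w), snd w)) w))"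
    using \<phi> by (intro cmap_compose[OF 1(2)]) auto
  moreover have "continuous_map (top_of_set K') X (\<lambda>z. b1 (\<phi> z))"
    using \<phi> by (intro cmap_compose[OF 1(1)]) auto
  ultimately show "\<exists>b' h'. continuous_map (top_of_set K') X b' \<and>
        continuous_map (top_of_set (K' \<times> {0..1::real})) Y h' \<and>
        (\<forall>z\<in>K'. h' (z, 0) = a z \<and> h' (z, 1) = f (b' z)) \<and>
        (\<forall>z\<in>L'. b' z = b z \<and> (\<forall>t\<in>{0..1}. h' (z, t) = h (z, t)))"
    using 1 \<phi> inv sub
    by (intro exI[of _ "\<lambda>z. b1 (\<phi> z)"] exI[of _ "\<lambda>w. h1 ((\<lambda>w. (\<phi> (fst w), snd w)) w)"]) auto
qed

section \<open>Lifting problems on cubes\<close>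

text \<open>Beyond \<open>n\<close> the coordinates are 0 rather than \<open>undefined\<close>.
  Cubes of all dimensions then lie in one space of functions, and \<open>z(n := t)\<close> joins a
  point of \<open>bx n\<close> and a time to a point of \<open>bx (Suc n)\<close>.\<close>

definition bx :: "nat \<Rightarrow> (nat \<Rightarrow> real) set" where
  "bx n = {z. (\<forall>i<n. 0 \<le> z i \<and> z i \<le> 1) \<and> (\<forall>i\<ge>n. z i = 0)}"

definition bdy :: "nat \<Rightarrow> (nat \<Rightarrow> real) set" where
  "bdy n = {z \<in> bx n. \<exists>i<n. z i = 0 \<or> z i = 1}"

text \<open>Twice the distance from the centre of the cube in the maximum norm, so that the boundary
  is the unit sphere. The value 0 for \<open>n = 0\<close> agrees with the boundary of a point being
  empty.\<close>

primrec cn :: "nat \<Rightarrow> (nat \<Rightarrow> real) \<Rightarrow> real" where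
  "cn 0 z = 0"
| "cn (Suc n) z = max (cn n z) \<bar>2 * z n - 1\<bar>"

definition sc :: "nat \<Rightarrow> real \<Rightarrow> (nat \<Rightarrow> real) \<Rightarrow> nat \<Rightarrow> real" where
  "sc n r z = (\<lambda>i. if i < n then 1/2 + r * (z i - 1/2) else 0)"

declare continuous_on_coordinatewise_then_product [continuous_intros del]

lemma continuous_on_coord:
  "continuous_on S g \<Longrightarrow> continuous_on S (\<lambda>x. (g x :: nat \<Rightarrow> real) i)"
  using continuous_on_product_then_coordinatewise[of S g i] by blast

lemma continuous_on_coords [continuous_intros]:
  "continuous_on S (\<lambda>x :: nat \<Rightarrow> real. x i)"
  "continuous_on T (\<lambda>x :: (nat \<Rightarrow> real) \<times> 'd::topological_space. fst x i)"
  by (rule continuous_on_coord, intro continuous_intros)+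

lemma continuous_on_cn [continuous_intros]:
  "continuous_on S g \<Longrightarrow> continuous_on S (\<lambda>x. cn n (g x))"
  by (induction n) (auto intro!: continuous_intros continuous_on_coord[of S g])

lemma continuous_on_sc [continuous_intros]:
  "continuous_on S r \<Longrightarrow> continuous_on S g \<Longrightarrow> continuous_on S (\<lambda>x. sc n (r x) (g x))"
  unfolding sc_def
  by (rule continuous_on_coordinatewise_then_product, rename_tac i, case_tac "i < n")
    (auto intro!: continuous_intros continuous_on_coord[of S g])

lemma cn_nonneg: "0 \<le> cn n z"
  by (induction n) auto

lemma cn_le_iff: "0 \<le> c \<Longrightarrow> cn n z \<le> c \<longleftrightarrow> (\<forall>i<n. \<bar>2 * z i - 1\<bar> \<le> c)"
  by (induction n) (auto simp: less_Suc_eq)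

lemma cn_cong: "(\<And>i. i < n \<Longrightarrow> z i = w i) \<Longrightarrow> cn n z = cn n w"
  by (induction n) auto

lemma cn_sc: "0 \<le> r \<Longrightarrow> cn n (sc n r z) = r * cn n z"
proof -
  assume r: "0 \<le> r"
  have "cn m (sc n r z) = r * cn m z" if "m \<le> n" for m
    using that
  proof (induction m)
    case (Suc m)
    have "2 * sc n r z m - 1 = r * (2 * z m - 1)"
      using Suc.prems by (simp add: sc_def algebra_simps)
    then have "\<bar>2 * sc n r z m - 1\<bar> = r * \<bar>2 * z m - 1\<bar>"
      using r by (simp only: abs_mult abs_of_nonneg)
    then show ?case
      using Suc r by (simp add: max_mult_distrib_left)
  qed auto
  then show ?thesis by simp
qed

lemma bx_cn: "z \<in> bx n \<longleftrightarrow> cn n z \<le> 1 \<and> (\<forall>i\<ge>n. z i = 0)"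
  unfolding bx_def by (subst cn_le_iff) (auto simp: abs_le_iff)

lemma cn_eq_1: "cn n z \<le> 1 \<Longrightarrow> cn n z = 1 \<longleftrightarrow> (\<exists>i<n. z i = 0 \<or> z i = 1)"
proof (induction n)
  case (Suc n)
  then have "\<bar>2 * z n - 1\<bar> = 1 \<longleftrightarrow> z n = 0 \<or> z n = 1" "cn n z \<le> 1" "\<bar>2 * z n - 1\<bar> \<le> 1"
    by auto
  with Suc.IH show ?case
    by (auto simp: max_def less_Suc_eq)
qed auto

lemma bdy_cn: "z \<in> bdy n \<longleftrightarrow> z \<in> bx n \<and> cn n z = 1"
  unfolding bdy_def using cn_eq_1 by (auto simp: bx_cn)

lemma sc_in_bx: "0 \<le> r \<Longrightarrow> r * cn n z \<le> 1 \<Longrightarrow> sc n r z \<in> bx n"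
  by (simp add: bx_cn cn_sc) (simp add: sc_def)

lemma sc_1: "z \<in> bx n \<Longrightarrow> sc n 1 z = z"
  by (auto simp: sc_def bx_def)

lemma sc_sc: "sc n r (sc n s z) = sc n (r * s) z"
  by (auto simp: sc_def)

lemma closed_bx: "closed (bx n)"
proof -
  have "bx n = (\<Inter>i\<in>{..<n}. {z. 0 \<le> z i} \<inter> {z. z i \<le> 1}) \<inter> (\<Inter>i\<in>{n..}. {z. z i = 0})"
    by (auto simp: bx_def)
  then show ?thesis
    by (simp only:) (intro closed_Int closed_INT ballI closed_Collect_le closed_Collect_eq
      continuous_intros)
qed

lemma closed_bdy: "closed (bdy n)"
proof -
  have "bdy n = bx n \<inter> {z. cn n z = 1}"
    by (auto simp: bdy_cn)
  then show ?thesis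
    by (simp only:) (intro closed_Int closed_bx closed_Collect_eq continuous_intros)
qed

lemma bdy_subset: "bdy n \<subseteq> bx n"
  by (auto simp: bdy_def)

lemma bdyD [dest]: "z \<in> bdy n \<Longrightarrow> z \<in> bx n"
  using bdy_subset by blast

lemma compact_bx: "compact (bx n)"
proof -
  let ?S = "\<lambda>i. if i < n then {0..1::real} else {0}"
  have "\<forall>i\<in>UNIV. compactin euclidean (?S i)"
    by (simp add: compactin_euclidean_iff)
  then have "compactin (product_topology (\<lambda>i. euclidean) UNIV) (PiE UNIV ?S)"
    using compactin_PiE by blast
  moreover have "PiE UNIV ?S = bx n"
  proof (intro Set.set_eqI iffI)
    fix z assume "z \<in> PiE UNIV ?S"
    then have z: "z i \<in> ?S i" for i using PiE_mem[of z UNIV ?S i] by blast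
    have "z i \<in> {0..1}" if "i < n" for i using z[of i] that by simp
    moreover have "z i = 0" if "\<not> i < n" for i using z[of i] that by simp
    ultimately show "z \<in> bx n" by (simp add: bx_def)
  next
    fix z assume "z \<in> bx n"
    then have "z i \<in> ?S i" for i by (cases "i < n") (simp_all add: bx_def)
    then show "z \<in> PiE UNIV ?S" by (simp add: PiE_UNIV_domain)
  qed
  ultimately show ?thesis
    by (simp add: euclidean_product_topology)
qed

text \<open>Radial projection of \<open>bx n \<times> {0..1}\<close> from the point at height \<open>2\<close> above the centre.\<close>

definition box_retract :: "nat \<Rightarrow> (nat \<Rightarrow> real) \<times> real \<Rightarrow> (nat \<Rightarrow> real) \<times> real" where
  "box_retract n = (\<lambda>(z, t). let m = max (cn n z) (1 - t/2) in (sc n (1/m) z, 2 - (2 - t) / m))"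

lemma continuous_on_box_retract: "continuous_on (bx n \<times> {0..1}) (box_retract n)"
proof -
  have "max (cn n (fst w)) (1 - snd w / 2) \<noteq> 0" if "w \<in> bx n \<times> {0..1}" for w
  proof -
    have "0 < max (cn n (fst w)) (1 - snd w / 2)"
      using that by (auto simp: less_max_iff_disj)
    then show ?thesis by simp
  qed
  then show ?thesis
    unfolding box_retract_def Let_def split_def
    by (intro continuous_intros) auto
qed

text \<open>The ray from the projection centre leaves through the bottom when \<open>1 - t/2\<close>
  is the larger term of the maximum, and through a side when \<open>cn n z\<close> is.\<close>

lemma box_retract_in:
  assumes "z \<in> bx n" "t \<in> {0..1}"
  shows "box_retract n (z, t) \<in> bx n \<times> {0} \<union> bdy n \<times> {0..1}"
proof -
  let ?m = "max (cn n z) (1 - t/2)"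
  have m: "1/2 \<le> ?m" "cn n z \<le> 1" "?m \<le> 1" using assms by (simp_all add: bx_cn le_max_iff_disj)
  have 1: "sc n (1 / ?m) z \<in> bx n"
    using m cn_nonneg[of n z] by (intro sc_in_bx) (auto simp: field_simps)
  show ?thesis
  proof (cases "cn n z \<le> 1 - t/2")
    case True
    then have "2 - (2 - t) / ?m = 0" using assms by (auto simp: max_def field_simps)
    with 1 show ?thesis by (auto simp: box_retract_def Let_def)
  next
    case False
    then have e: "?m = cn n z" by simp
    have "cn n (sc n (1 / ?m) z) = 1"
      using m unfolding e by (subst cn_sc) auto
    with 1 have "sc n (1 / ?m) z \<in> bdy n" by (simp add: bdy_cn)
    moreover have "2 - (2 - t) / ?m \<ge> 0" "2 - (2 - t) / ?m \<le> 1"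
      using False m assms unfolding e by (auto simp: field_simps)
    ultimately show ?thesis by (auto simp: box_retract_def Let_def)
  qed
qed

lemma box_retract_bottom: "z \<in> bx n \<Longrightarrow> box_retract n (z, 0) = (z, 0)"
  by (auto simp: box_retract_def Let_def bx_cn max_def sc_1)

lemma box_retract_side: "z \<in> bdy n \<Longrightarrow> t \<in> {0..1} \<Longrightarrow> box_retract n (z, t) = (z, t)"
  by (auto simp: box_retract_def Let_def bdy_cn max_def sc_1)

text \<open>The data live on the bottom and the sides of the cylinder over \<open>bx n\<close>;
  composing them with the retraction \<open>box_retract n\<close> extends them to all of it.\<close>

lemma hep_bx: "lifts Y Y (\<lambda>x. x) (bx n) (bdy n)"
proof (rule liftsI)
  fix a b h
  assume a: "continuous_map (top_of_set (bx n)) Y a"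
    and h: "continuous_map (top_of_set (bdy n \<times> {0..1::real})) Y h"
    and e: "\<forall>z\<in>bdy n. h (z, 0) = a z \<and> h (z, 1) = b z"
  define g where "g = (\<lambda>w::(nat \<Rightarrow> real) \<times> real. if w \<in> bx n \<times> {0} then a (fst w) else h w)"
  have g: "continuous_map (top_of_set (bx n \<times> {0} \<union> bdy n \<times> {0..1})) Y g"
    unfolding g_def
  proof (rule cmap_closed_Un_if)
    show "continuous_map (top_of_set (bx n \<times> {0})) Y (\<lambda>w. a (fst w))"
      by (rule cmap_compose[OF a]) (auto intro!: continuous_intros)
  qed (use e h in \<open>auto intro!: closed_Times closed_bx closed_bdy closed_singleton\<close>)
  define h' where "h' = (\<lambda>w. g (box_retract n w))"
  have h': "continuous_map (top_of_set (bx n \<times> {0..1})) Y h'"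
    unfolding h'_def using box_retract_in
    by (intro cmap_compose[OF g] continuous_on_box_retract) blast
  have "continuous_map (top_of_set (bx n)) Y (\<lambda>z. h' (z, 1))"
    by (rule cmap_compose[OF h']) (auto intro!: continuous_intros)
  moreover have "h' (z, 0) = a z" if "z \<in> bx n" for z
    using that by (simp add: h'_def box_retract_bottom g_def)
  moreover have "h' (z, t) = h (z, t)" if "z \<in> bdy n" "t \<in> {0..1}" for z t
    using that e bdy_subset by (auto simp: h'_def box_retract_side g_def)
  ultimately show "\<exists>b' h'. continuous_map (top_of_set (bx n)) Y b' \<and>
        continuous_map (top_of_set (bx n \<times> {0..1})) Y h' \<and>
        (\<forall>z\<in>bx n. h' (z, 0) = a z \<and> h' (z, 1) = b' z) \<and>
        (\<forall>z\<in>bdy n. b' z = b z \<and> (\<forall>t\<in>{0..1}. h' (z, t) = h (z, t)))"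
    using h' e by (intro exI[of _ "\<lambda>z. h' (z, 1)"] exI[of _ h']) auto
qed

lemma bx_Suc_join: "z \<in> bx n \<Longrightarrow> t \<in> {0..1} \<Longrightarrow> z(n := t) \<in> bx (Suc n)"
  by (auto simp: bx_def less_Suc_eq)

lemma bdy_Suc_join:
  "z \<in> bx n \<Longrightarrow> t \<in> {0..1} \<Longrightarrow> z(n := t) \<in> bdy (Suc n) \<longleftrightarrow> z \<in> bdy n \<or> t = 0 \<or> t = 1"
  by (auto simp: bx_def bdy_def less_Suc_eq)

lemma bx_Suc_split: "z \<in> bx (Suc n) \<Longrightarrow> z(n := 0) \<in> bx n \<and> z n \<in> {0..1}"
  by (auto simp: bx_def less_Suc_eq)

lemma bdy_Suc_split: "z \<in> bdy (Suc n) \<Longrightarrow> z(n := 0) \<in> bdy n \<or> z n = 0 \<or> z n = 1"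
  by (auto simp: bx_def bdy_def less_Suc_eq)

lemma continuous_on_upd [continuous_intros]:
  "continuous_on S g \<Longrightarrow> continuous_on S r \<Longrightarrow>
    continuous_on S (\<lambda>x. (g x :: nat \<Rightarrow> real)(n := r x))"
  by (rule continuous_on_coordinatewise_then_product, rename_tac i, case_tac "i = n")
    (auto intro!: continuous_intros continuous_on_coord[of S g])

text \<open>The cylinder over \<open>bx n\<close> is the cube \<open>bx (Suc n)\<close>, with sides,
  bottom and top forming its boundary. This version extends deformations of homotopies.\<close>

lemma hep_bx_times:
  "lifts Y Y (\<lambda>x. x) (bx n \<times> {0..1::real}) (bdy n \<times> {0..1} \<union> bx n \<times> {0} \<union> bx n \<times> {1})"
proof (rule lifts_homeo[where K="bx (Suc n)" and L="bdy (Suc n)" and \<phi>="\<lambda>(z, t). z(n := t)" and \<psi>="\<lambda>z. (z(n := 0), z n)"])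
  show "lifts Y Y (\<lambda>x. x) (bx (Suc n)) (bdy (Suc n))" by (rule hep_bx)
  show "continuous_on (bx n \<times> {0..1}) (\<lambda>(z, t). z(n := t))"
    unfolding split_def by (intro continuous_intros)
  show "continuous_on (bx (Suc n)) (\<lambda>z. (z(n := 0), z n))"
    by (intro continuous_intros)
  show "(z(n := 0), z n) \<in> bx n \<times> {0..1}" if "z \<in> bx (Suc n)" for z
    using bx_Suc_split[OF that] by auto
  show "(z(n := 0), z n) \<in> bdy n \<times> {0..1} \<union> bx n \<times> {0} \<union> bx n \<times> {1}" if "z \<in> bdy (Suc n)" for z
    using bx_Suc_split[of z n] bdy_Suc_split[OF that] that bdy_subset by auto
  show "(case w of (z, t) \<Rightarrow> z(n := t)) \<in> bx (Suc n)" if "w \<in> bx n \<times> {0..1}" for w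
    using bx_Suc_join that by auto
  show "(case w of (z, t) \<Rightarrow> z(n := t)) \<in> bdy (Suc n)"
    if "w \<in> bdy n \<times> {0..1} \<union> bx n \<times> {0} \<union> bx n \<times> {1}" for w
    using bdy_Suc_join[of "fst w" n "snd w"] that bdyD[of "fst w" n] by (auto simp: split_def)
qed (use bdy_subset in \<open>auto simp: bx_def\<close>)

text \<open>The compression problem behind relative homotopy groups, with a homotopy that is
  stationary on the boundary. It is a property of one pair \<open>a\<close>, \<open>b\<close>,
  because such a pair is usually deformed into an easier one before it is solved.\<close>

definition solvable :: "'a topology \<Rightarrow> 'b topology \<Rightarrow> ('a \<Rightarrow> 'b) \<Rightarrow> nat \<Rightarrow>
    ((nat \<Rightarrow> real) \<Rightarrow> 'b) \<Rightarrow> ((nat \<Rightarrow> real) \<Rightarrow> 'a) \<Rightarrow> bool" where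
  "solvable X Y f n a b \<longleftrightarrow> (\<exists>b' G. continuous_map (top_of_set (bx n)) X b' \<and>
     continuous_map (top_of_set (bx n \<times> {0..1::real})) Y G \<and>
     (\<forall>z\<in>bx n. G (z, 0) = a z \<and> G (z, 1) = f (b' z)) \<and>
     (\<forall>z\<in>bdy n. b' z = b z \<and> (\<forall>t\<in>{0..1}. G (z, t) = a z)))"

definition solves :: "'a topology \<Rightarrow> 'b topology \<Rightarrow> ('a \<Rightarrow> 'b) \<Rightarrow> nat \<Rightarrow> bool" where
  "solves X Y f n \<longleftrightarrow> (\<forall>a b. continuous_map (top_of_set (bx n)) Y a \<longrightarrow>
     continuous_map (top_of_set (bdy n)) X b \<longrightarrow> (\<forall>z\<in>bdy n. f (b z) = a z) \<longrightarrow>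
     solvable X Y f n a b)"

lemma solvesD:
  assumes "solves X Y f n" "continuous_map (top_of_set (bx n)) Y a"
    "continuous_map (top_of_set (bdy n)) X b" "\<And>z. z \<in> bdy n \<Longrightarrow> f (b z) = a z"
  shows "solvable X Y f n a b"
  using assms(1)[unfolded solves_def, THEN spec, THEN spec, THEN mp, THEN mp, THEN mp, OF assms(2,3)] assms(4)
  by blast

lemma solvableE:
  assumes "solvable X Y f n a b"
  obtains b' G where "continuous_map (top_of_set (bx n)) X b'"
     "continuous_map (top_of_set (bx n \<times> {0..1::real})) Y G"
     "\<forall>z\<in>bx n. G (z, 0) = a z \<and> G (z, 1) = f (b' z)"
     "\<forall>z\<in>bdy n. b' z = b z \<and> (\<forall>t\<in>{0..1}. G (z, t) = a z)"
  using assms unfolding solvable_def by (elim exE conjE) (rule that)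

lemma solvableI:
  assumes "continuous_map (top_of_set (bx n)) X b'"
     "continuous_map (top_of_set (bx n \<times> {0..1::real})) Y G"
     "\<And>z. z \<in> bx n \<Longrightarrow> G (z, 0) = a z" "\<And>z. z \<in> bx n \<Longrightarrow> G (z, 1) = f (b' z)"
     "\<And>z. z \<in> bdy n \<Longrightarrow> b' z = b z" "\<And>z t. z \<in> bdy n \<Longrightarrow> t \<in> {0..1} \<Longrightarrow> G (z, t) = a z"
  shows "solvable X Y f n a b"
  unfolding solvable_def using assms by (intro exI[of _ b'] exI[of _ G] conjI ballI) simp_all

lemma lifts_imp_solves:
  assumes "lifts X Y f (bx n) (bdy n)"
  shows "solves X Y f n"
  unfolding solves_def
proof (intro allI impI)
  fix a b
  assume a: "continuous_map (top_of_set (bx n)) Y a" and b: "continuous_map (top_of_set (bdy n)) X b"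
    and e: "\<forall>z\<in>bdy n. f (b z) = a z"
  have "continuous_map (top_of_set (bdy n \<times> {0..1::real})) Y (\<lambda>w. a (fst w))"
    by (rule cmap_compose[OF a]) (auto intro!: continuous_intros)
  then obtain b' h' where "continuous_map (top_of_set (bx n)) X b'"
    "continuous_map (top_of_set (bx n \<times> {0..1::real})) Y h'"
    "\<forall>z\<in>bx n. h' (z, 0) = a z \<and> h' (z, 1) = f (b' z)"
    "\<forall>z\<in>bdy n. b' z = b z \<and> (\<forall>t\<in>{0..1}. h' (z, t) = a (fst (z, t)))"
    by (rule liftsE[OF assms a b]) (use e in auto)
  then show "solvable X Y f n a b"
    by (intro solvableI[of _ _ b' _ h']) auto
qed

text \<open>The collar \<open>cn n z \<ge> 1/2\<close> absorbs the given homotopy; the map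
  \<open>(z, t) \<mapsto> sc n ((1 - t)/2 + t / max (cn n z) (1/2)) z\<close> slides from the inner half of the cube to the cube
  stretched onto its boundary along the collar.\<close>

lemma solves_imp_lifts:
  assumes "solves X Y f n"
  shows "lifts X Y f (bx n) (bdy n)"
proof (rule liftsI)
  fix a b h
  assume a: "continuous_map (top_of_set (bx n)) Y a"
    and b: "continuous_map (top_of_set (bdy n)) X b"
    and h: "continuous_map (top_of_set (bdy n \<times> {0..1::real})) Y h"
    and e: "\<forall>z\<in>bdy n. h (z, 0) = a z \<and> h (z, 1) = f (b z)"
  let ?K1 = "bx n \<inter> {z. cn n z \<le> 1/2}" and ?K2 = "bx n \<inter> {z. 1/2 \<le> cn n z}"
  define a' where "a' = (\<lambda>z. if z \<in> ?K1 then a (sc n 2 z) else h (sc n (1 / cn n z) z, 2 * cn n z - 1))"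
  have in_bdy: "sc n (1 / cn n z) z \<in> bdy n" if "z \<in> ?K2" for z
  proof -
    have "sc n (1 / cn n z) z \<in> bx n" using that by (intro sc_in_bx) auto
    moreover have "cn n (sc n (1 / cn n z) z) = 1" using that by (subst cn_sc) auto
    ultimately show ?thesis by (simp add: bdy_cn)
  qed
  have a'_in: "a' z = h (sc n (1 / cn n z) z, 2 * cn n z - 1)" if "z \<in> ?K2" for z
  proof (cases "cn n z = 1/2")
    case True
    have "sc n 2 z \<in> bdy n" using in_bdy[OF that] by (simp add: True)
    with e that show ?thesis by (simp add: a'_def True)
  qed (use that in \<open>auto simp: a'_def\<close>)
  have "continuous_map (top_of_set (?K1 \<union> ?K2)) Y a'"
  proof (rule cmap_closed_Un)
    show "closed ?K1" "closed ?K2"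
      by (auto intro!: closed_Int closed_bx closed_Collect_le continuous_intros)
    have "continuous_map (top_of_set ?K1) Y (\<lambda>z. a (sc n 2 z))"
      by (rule cmap_compose[OF a]) (auto intro!: continuous_intros sc_in_bx)
    then show "continuous_map (top_of_set ?K1) Y a'"
      by (rule cmap_cong) (auto simp: a'_def)
    have "continuous_map (top_of_set ?K2) Y (\<lambda>z. h (sc n (1 / cn n z) z, 2 * cn n z - 1))"
      using in_bdy by (intro cmap_compose[OF h]) (auto intro!: continuous_intros simp: bx_cn)
    then show "continuous_map (top_of_set ?K2) Y a'"
      by (rule cmap_cong) (use a'_in in auto)
  qed
  moreover have "?K1 \<union> ?K2 = bx n" by auto
  ultimately have a': "continuous_map (top_of_set (bx n)) Y a'" by simp
  have "f (b z) = a' z" if "z \<in> bdy n" for z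
    using that e a'_in[of z] by (auto simp: bdy_cn sc_1)
  then have "solvable X Y f n a' b"
    by (rule solvesD[OF assms a' b])
  then obtain b' G where b': "continuous_map (top_of_set (bx n)) X b'"
    and G: "continuous_map (top_of_set (bx n \<times> {0..1::real})) Y G"
    and G1': "\<forall>z\<in>bx n. G (z, 0) = a' z \<and> G (z, 1) = f (b' z)"
    and G2': "\<forall>z\<in>bdy n. b' z = b z \<and> (\<forall>t\<in>{0..1}. G (z, t) = a' z)"
    by (rule solvableE)
  have G1: "G (z, 0) = a' z \<and> G (z, 1) = f (b' z)" if "z \<in> bx n" for z using G1' that by blast
  have G2: "b' z = b z \<and> (\<forall>t\<in>{0..1}. G (z, t) = a' z)" if "z \<in> bdy n" for z using G2' that by blast
  define mx where "mx z = max (cn n z) (1/2)" for z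
  define b'' where "b'' = (\<lambda>z. b' (sc n (1 / mx z) z))"
  define w where "w z t = sc n ((1 - t)/2 + t / mx z) z" for z t
  \<comment> \<open>The time of \<open>G\<close> is damped to 0 at the boundary, where the
    prescribed homotopy alone must appear. The damping does not spoil the end \<open>t = 1\<close>:
    for \<open>cn n z \<ge> 1/2\<close> the point \<open>w z 1\<close> lies on the boundary, where
    \<open>G\<close> is stationary.\<close>
  define th where "th z t = t * min 1 (2 - 2 * cn n z)" for z t
  define h' where "h' = (\<lambda>(z, t). G (w z t, th z t))"
  have mx: "mx z \<ge> 1/2" "cn n z \<le> mx z" for z by (auto simp: mx_def)
  have mx_le: "cn n z / mx z \<le> 1" for z
    using mx[of z] by (auto simp: divide_le_eq)
  have mx0: "mx z \<noteq> 0" for z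
    using mx(1)[of z] by linarith
  have cmx: "continuous_on S mx" "continuous_on T (\<lambda>v. mx (fst v))"
    for S and T :: "((nat \<Rightarrow> real) \<times> real) set"
    unfolding mx_def by (intro continuous_intros)+
  have w_in: "w z t \<in> bx n" if "z \<in> bx n" "t \<in> {0..1}" for z t
    unfolding w_def
  proof (rule sc_in_bx)
    show "0 \<le> (1 - t) / 2 + t / mx z" using that mx[of z] by auto
    have "((1 - t) / 2 + t / mx z) * cn n z = (1 - t) * (cn n z / 2) + t * (cn n z / mx z)"
      by (simp add: algebra_simps)
    also have "\<dots> \<le> (1 - t) * 1 + t * 1"
      using that mx_le[of z] by (intro add_mono mult_left_mono) (auto simp: bx_cn)
    finally show "((1 - t) / 2 + t / mx z) * cn n z \<le> 1" by simp
  qed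
  have st_in: "sc n (1 / mx z) z \<in> bx n" for z
    using mx[of z] mx_le[of z] by (intro sc_in_bx) auto
  have "continuous_map (top_of_set (bx n)) X b''"
    unfolding b''_def using mx st_in
    by (intro cmap_compose[OF b']) (auto intro!: continuous_intros cmx simp: mx0)
  moreover have "continuous_map (top_of_set (bx n \<times> {0..1})) Y h'"
  proof -
    have "continuous_map (top_of_set (bx n \<times> {0..1})) Y (\<lambda>v. G (w (fst v) (snd v), th (fst v) (snd v)))"
    proof (rule cmap_compose[OF G])
      show "continuous_on (bx n \<times> {0..1}) (\<lambda>v. (w (fst v) (snd v), th (fst v) (snd v)))"
        unfolding w_def th_def by (intro continuous_intros cmx) (simp_all add: mx0)
      show "(w (fst v) (snd v), th (fst v) (snd v)) \<in> bx n \<times> {0..1}" if "v \<in> bx n \<times> {0..1}" for v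
        using that w_in by (auto simp: th_def bx_cn intro!: mult_le_one)
    qed
    then show ?thesis by (simp add: h'_def split_def)
  qed
  moreover have "h' (z, 0) = a z" if "z \<in> bx n" for z
  proof -
    have "w z 0 \<in> ?K1"
      using w_in[OF that, of 0] that by (auto simp: w_def cn_sc bx_cn[of z])
    moreover have "sc n 2 (w z 0) = z"
      using that by (simp add: w_def sc_sc sc_1)
    ultimately show ?thesis
      using G1[of "w z 0"] by (simp add: h'_def th_def a'_def)
  qed
  moreover have "h' (z, 1) = f (b'' z)" if "z \<in> bx n" for z
  proof (cases "cn n z \<le> 1/2")
    case True
    then have "th z 1 = 1" by (simp add: th_def)
    then show ?thesis using G1 w_in[OF that, of 1] by (simp add: h'_def b''_def w_def)
  next
    case False
    with that have "w z 1 \<in> bdy n" "th z 1 \<in> {0..1}"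
      using in_bdy[of z] by (auto simp: w_def mx_def max_def th_def bx_cn)
    then have "G (w z 1, th z 1) = G (w z 1, 1)" using G2 by auto
    then show ?thesis using G1 w_in[OF that, of 1] by (simp add: h'_def b''_def w_def)
  qed
  moreover have "b'' z = b z" if "z \<in> bdy n" for z
    using that G2 by (simp add: b''_def mx_def bdy_cn sc_1)
  moreover have "h' (z, t) = h (z, t)" if z: "z \<in> bdy n" and t: "t \<in> {0..1}" for z t
  proof -
    have z': "z \<in> bx n" "cn n z = 1" using z by (auto simp: bdy_cn)
    have r: "(1 - t) / 2 + t = (1 + t) / 2" by (simp add: field_simps)
    then have c: "cn n (w z t) = (1 + t) / 2"
      using z' t by (simp add: w_def mx_def cn_sc)
    have "h' (z, t) = a' (w z t)"
      using G1[OF w_in[OF z'(1) t]] z' by (simp add: h'_def th_def)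
    also have "\<dots> = h (sc n (1 / cn n (w z t)) (w z t), 2 * cn n (w z t) - 1)"
      using w_in[OF z'(1) t] t c by (intro a'_in) auto
    also have "2 * cn n (w z t) - 1 = t"
      by (simp add: c field_simps)
    also have "sc n (1 / cn n (w z t)) (w z t) = z"
    proof -
      have "1 / cn n (w z t) * ((1 - t) / 2 + t / mx z) = 1"
        using t z' unfolding c r by (simp add: mx_def r)
      then show ?thesis using z' by (simp only: w_def sc_sc sc_1)
    qed
    finally show ?thesis .
  qed
  ultimately show "\<exists>b' h'. continuous_map (top_of_set (bx n)) X b' \<and>
        continuous_map (top_of_set (bx n \<times> {0..1::real})) Y h' \<and>
        (\<forall>z\<in>bx n. h' (z, 0) = a z \<and> h' (z, 1) = f (b' z)) \<and>
        (\<forall>z\<in>bdy n. b' z = b z \<and> (\<forall>t\<in>{0..1}. h' (z, t) = h (z, t)))"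
    by (intro exI[of _ b''] exI[of _ h']) auto
qed

text \<open>A solution at time 1 is a map on the cylinder over the cube. The given homotopies, run
  backwards, deform it on the boundary of the cylinder, and \<open>hep_bx_times\<close> extends this
  deformation inside. Compared with concatenating homotopies, this keeps the result stationary on
  \<open>bdy n\<close>.\<close>

lemma solvable_homotopy:
  assumes f: "continuous_map X Y f"
    and a: "continuous_map (top_of_set (bx n \<times> {0..1::real})) Y a"
    and b: "continuous_map (top_of_set (bdy n \<times> {0..1::real})) X b"
    and ab: "\<And>z t. z \<in> bdy n \<Longrightarrow> t \<in> {0..1} \<Longrightarrow> f (b (z, t)) = a (z, t)"
    and s: "solvable X Y f n (\<lambda>z. a (z, 1)) (\<lambda>z. b (z, 1))"
  shows "solvable X Y f n (\<lambda>z. a (z, 0)) (\<lambda>z. b (z, 0))"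
proof -
  obtain b1 G where b1: "continuous_map (top_of_set (bx n)) X b1"
    and G: "continuous_map (top_of_set (bx n \<times> {0..1::real})) Y G"
    and G1': "\<forall>z\<in>bx n. G (z, 0) = a (z, 1) \<and> G (z, 1) = f (b1 z)"
    and G2': "\<forall>z\<in>bdy n. b1 z = b (z, 1) \<and> (\<forall>t\<in>{0..1}. G (z, t) = a (z, 1))"
    by (rule solvableE[OF s])
  have G1: "G (z, 0) = a (z, 1) \<and> G (z, 1) = f (b1 z)" if "z \<in> bx n" for z using G1' that by blast
  have G2: "b1 z = b (z, 1) \<and> (\<forall>t\<in>{0..1}. G (z, t) = a (z, 1))" if "z \<in> bdy n" for z
    using G2' that by blast
  have "continuous_map (top_of_set (bdy n \<times> {0..1::real})) X (\<lambda>w. b (fst w, 1 - snd w))"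
    by (rule cmap_compose[OF b]) (auto intro!: continuous_intros)
  moreover have "continuous_map (top_of_set (bdy n)) X (\<lambda>z. b (z, 0))"
    by (rule cmap_compose[OF b]) (auto intro!: continuous_intros)
  \<comment> \<open>\<open>B\<close> carries the lift \<open>b1\<close> along the reversed
    \<open>b\<close>; its end \<open>b0\<close> has the boundary values required at time 0.\<close>
  ultimately obtain b0 B where b0: "continuous_map (top_of_set (bx n)) X b0"
    and B: "continuous_map (top_of_set (bx n \<times> {0..1::real})) X B"
    and B1: "\<forall>z\<in>bx n. B (z, 0) = b1 z \<and> B (z, 1) = b0 z"
    and B2: "\<forall>z\<in>bdy n. b0 z = b (z, 0) \<and> (\<forall>t\<in>{0..1}. B (z, t) = b (fst (z, t), 1 - snd (z, t)))"
    using G2 by (elim liftsE[OF hep_bx b1, rotated]) auto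
  let ?L1 = "(bx n \<times> {1::real}) \<times> {0..1::real}"
    and ?L2 = "(bdy n \<times> {0..1::real} \<union> bx n \<times> {0}) \<times> {0..1::real}"
    and ?L = "bdy n \<times> {0..1} \<union> bx n \<times> {0} \<union> bx n \<times> {1::real}"
  \<comment> \<open>On the boundary of the cylinder, \<open>h\<close> turns the bottom
    \<open>a (z, 1)\<close> into \<open>a (z, 0)\<close> and the top \<open>f (b1 z)\<close> into
    \<open>f (b0 z)\<close>. On the sides it does not depend on the height, so these stay
    stationary.\<close>
  define h where "h = (\<lambda>w::((nat \<Rightarrow> real) \<times> real) \<times> real. if w \<in> ?L1 then f (B (fst (fst w), snd w))
    else a (fst (fst w), 1 - snd w))"
  have fB: "continuous_map (top_of_set (bx n \<times> {0..1::real})) Y (\<lambda>w. f (B w))"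
    using continuous_map_compose[OF B f] by (simp add: o_def)
  have "continuous_map (top_of_set (?L1 \<union> ?L2)) Y h"
    unfolding h_def
  proof (rule cmap_closed_Un_if)
    show "closed ?L1" "closed ?L2"
      by (auto intro!: closed_Times closed_Un closed_bx closed_bdy closed_singleton)
    show "continuous_map (top_of_set ?L1) Y (\<lambda>w. f (B (fst (fst w), snd w)))"
      by (rule cmap_compose[OF fB]) (auto intro!: continuous_intros)
    show "continuous_map (top_of_set ?L2) Y (\<lambda>w. a (fst (fst w), 1 - snd w))"
      using bdy_subset by (intro cmap_compose[OF a]) (auto intro!: continuous_intros)
  next
    fix w assume "w \<in> ?L1" "w \<in> ?L2"
    then have "fst (fst w) \<in> bdy n" "snd w \<in> {0..1}" by auto
    then show "f (B (fst (fst w), snd w)) = a (fst (fst w), 1 - snd w)"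
      using B2 ab by simp
  qed
  moreover have "?L1 \<union> ?L2 = ?L \<times> {0..1}" by auto
  ultimately have h: "continuous_map (top_of_set (?L \<times> {0..1})) Y h" by simp
  have G_L: "continuous_map (top_of_set ?L) Y (\<lambda>w. h (w, 1))"
    by (rule cmap_compose[OF h]) (auto intro!: continuous_intros)
  have eq: "\<forall>w\<in>?L. h (w, 0) = G w \<and> h (w, 1) = h (w, 1)"
    using G1 G2 B1 B2 bdy_subset by (auto simp: h_def)
  obtain H1 H where H1: "continuous_map (top_of_set (bx n \<times> {0..1::real})) Y H1"
    and "continuous_map (top_of_set ((bx n \<times> {0..1::real}) \<times> {0..1::real})) Y H"
    and "\<forall>w\<in>bx n \<times> {0..1}. H (w, 0) = G w \<and> H (w, 1) = H1 w"
    and H2: "\<forall>w\<in>?L. H1 w = h (w, 1) \<and> (\<forall>t\<in>{0..1}. H (w, t) = h (w, t))"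
    using liftsE[OF hep_bx_times G G_L h eq] .
  have H1h: "H1 w = h (w, 1)" if "w \<in> ?L" for w
    using H2 that by blast
  have "H1 (z, 0) = a (z, 0)" if "z \<in> bx n" for z
    using H1h[of "(z, 0)"] that by (simp add: h_def)
  moreover have "H1 (z, 1) = f (b0 z)" if "z \<in> bx n" for z
    using H1h[of "(z, 1)"] that B1 by (simp add: h_def)
  moreover have "H1 (z, t) = a (z, 0)" if z: "z \<in> bdy n" and t: "t \<in> {0..1}" for z t
  proof (cases "t = 1")
    case True
    have "f (b0 z) = a (z, 0)" using B2 ab[of z 0] z by simp
    then show ?thesis using calculation(2) z True bdy_subset by auto
  next
    case False
    with H1h[of "(z, t)"] z t show ?thesis by (simp add: h_def)
  qed
  ultimately show ?thesis
    using b0 B2 H1 by (intro solvableI[of _ _ b0 _ H1]) auto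
qed

section \<open>Connectivity of a map as a lifting property\<close>

definition sphere_map :: "nat \<Rightarrow> 'a topology \<Rightarrow> 'a \<Rightarrow> ((nat \<Rightarrow> real) \<Rightarrow> 'a) \<Rightarrow> bool" where
  "sphere_map n X x0 g \<longleftrightarrow> continuous_map (top_of_set (bx n)) X g \<and> (\<forall>z\<in>bdy n. g z = x0)"

definition sphere_homotopic ::
    "nat \<Rightarrow> 'a topology \<Rightarrow> 'a \<Rightarrow> ((nat \<Rightarrow> real) \<Rightarrow> 'a) \<Rightarrow> ((nat \<Rightarrow> real) \<Rightarrow> 'a) \<Rightarrow> bool" where
  "sphere_homotopic n X x0 g h \<longleftrightarrow> (\<exists>H. continuous_map (top_of_set (bx n \<times> {0..1::real})) X H \<and>
     (\<forall>z\<in>bx n. H (z, 0) = g z \<and> H (z, 1) = h z) \<and> (\<forall>z\<in>bdy n. \<forall>t\<in>{0..1}. H (z, t) = x0))"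

text \<open>Inverse of restriction between \<open>bx n\<close> and \<open>cube n\<close>, whose
  elements are \<open>undefined\<close> beyond \<open>n\<close>.\<close>

definition ex :: "nat \<Rightarrow> (nat \<Rightarrow> real) \<Rightarrow> nat \<Rightarrow> real" where
  "ex n z = (\<lambda>i. if i < n then z i else 0)"

lemma topspace_cube: "topspace (cube n) = PiE {..<n} (\<lambda>_. {0..1})"
  by (simp add: cube_def)

lemma ex_in: "x \<in> topspace (cube n) \<Longrightarrow> ex n x \<in> bx n"
  by (auto simp: topspace_cube ex_def bx_def PiE_def Pi_def)

lemma ex_in_bdy: "x \<in> cube_boundary n \<Longrightarrow> ex n x \<in> bdy n"
  using ex_in by (auto simp: cube_boundary_def bdy_def ex_def)

lemma restrict_in: "z \<in> bx n \<Longrightarrow> restrict z {..<n} \<in> topspace (cube n)"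
  by (auto simp: topspace_cube bx_def)

lemma restrict_in_boundary: "z \<in> bdy n \<Longrightarrow> restrict z {..<n} \<in> cube_boundary n"
  using restrict_in by (auto simp: cube_boundary_def bdy_def)

lemma ex_restrict: "z \<in> bx n \<Longrightarrow> ex n (restrict z {..<n}) = z"
  by (auto simp: ex_def bx_def)

lemma restrict_ex: "x \<in> topspace (cube n) \<Longrightarrow> restrict (ex n x) {..<n} = x"
  by (auto simp: topspace_cube ex_def fun_eq_iff PiE_def extensional_def restrict_def)

lemma continuous_map_ex: "continuous_map (cube n) (top_of_set (bx n)) (ex n)"
proof -
  have "continuous_map (cube n) euclidean (\<lambda>x. ex n x i)" for i
  proof (cases "i < n")
    case True
    then have "continuous_map (cube n) (top_of_set {0..1}) (\<lambda>x. x i)"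
      unfolding cube_def by (intro continuous_map_product_projection) auto
    then show ?thesis using True by (simp add: ex_def continuous_map_in_subtopology)
  qed (simp add: ex_def)
  then have "continuous_map (cube n) euclidean (ex n)"
    by (simp add: euclidean_product_topology[symmetric] continuous_map_componentwise_UNIV)
  then show ?thesis using ex_in by (auto simp: continuous_map_in_subtopology)
qed

lemma continuous_map_restrict_cube:
  "continuous_map (top_of_set (bx n)) (cube n) (\<lambda>z. restrict z {..<n})"
  unfolding cube_def
proof (subst continuous_map_componentwise, intro conjI ballI)
  show "(\<lambda>z. restrict z {..<n}) ` topspace (top_of_set (bx n)) \<subseteq> extensional {..<n}" by auto
  fix i assume "i \<in> {..<n}"
  then show "continuous_map (top_of_set (bx n)) (top_of_set {0..1}) (\<lambda>z. restrict z {..<n} i)"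
    by (auto simp: continuous_map_in_subtopology bx_def intro!: continuous_intros)
qed

lemma homotopic_spheroids_iff:
  "homotopic_spheroids n X x0 g h \<longleftrightarrow>
    sphere_homotopic n X x0 (\<lambda>z. g (restrict z {..<n})) (\<lambda>z. h (restrict z {..<n}))"
proof -
  have cbsub: "cube_boundary n \<subseteq> topspace (cube n)"
    by (auto simp: cube_boundary_def)
  have "homotopic_spheroids n X x0 g h \<longleftrightarrow>
    (\<exists>H. continuous_map (prod_topology (top_of_set {0..1::real}) (cube n)) X H \<and>
       (\<forall>x\<in>topspace (cube n). H (0, x) = g x) \<and> (\<forall>x\<in>topspace (cube n). H (1, x) = h x) \<and>
       (\<forall>t\<in>{0..1}. \<forall>x\<in>cube_boundary n. H (t, x) = x0))"
    unfolding homotopic_spheroids_def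
  proof (rule homotopic_with)
    fix p q :: "(nat \<Rightarrow> real) \<Rightarrow> 'a"
    assume "\<And>x. x \<in> topspace (cube n) \<Longrightarrow> p x = q x"
    with cbsub show "(\<forall>t\<in>cube_boundary n. p t = x0) = (\<forall>t\<in>cube_boundary n. q t = x0)"
      by (metis subsetD)
  qed
  also have "\<dots> \<longleftrightarrow> sphere_homotopic n X x0 (\<lambda>z. g (restrict z {..<n})) (\<lambda>z. h (restrict z {..<n}))"
  proof
    assume "\<exists>H. continuous_map (prod_topology (top_of_set {0..1::real}) (cube n)) X H \<and>
       (\<forall>x\<in>topspace (cube n). H (0, x) = g x) \<and> (\<forall>x\<in>topspace (cube n). H (1, x) = h x) \<and>
       (\<forall>t\<in>{0..1}. \<forall>x\<in>cube_boundary n. H (t, x) = x0)"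
    then obtain H where H: "continuous_map (prod_topology (top_of_set {0..1::real}) (cube n)) X H"
      "\<forall>x\<in>topspace (cube n). H (0, x) = g x" "\<forall>x\<in>topspace (cube n). H (1, x) = h x"
      "\<forall>t\<in>{0..1}. \<forall>x\<in>cube_boundary n. H (t, x) = x0"
      by (elim exE conjE)
    have "continuous_map (prod_topology (top_of_set (bx n)) (top_of_set {0..1::real})) (cube n)
        (\<lambda>w. restrict (fst w) {..<n})"
      using continuous_map_compose[OF continuous_map_fst continuous_map_restrict_cube]
      unfolding o_def .
    then have "continuous_map (prod_topology (top_of_set (bx n)) (top_of_set {0..1::real}))
        (prod_topology (top_of_set {0..1::real}) (cube n)) (\<lambda>w. (snd w, restrict (fst w) {..<n}))"
      by (intro continuous_map_pairedI continuous_map_snd)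
    from continuous_map_compose[OF this H(1)]
    have "continuous_map (top_of_set (bx n \<times> {0..1::real})) X (\<lambda>w. H (snd w, restrict (fst w) {..<n}))"
      by (simp add: o_def)
    then show "sphere_homotopic n X x0 (\<lambda>z. g (restrict z {..<n})) (\<lambda>z. h (restrict z {..<n}))"
      unfolding sphere_homotopic_def using H(2-4) restrict_in restrict_in_boundary
      by (intro exI[of _ "\<lambda>w. H (snd w, restrict (fst w) {..<n})"]) auto
  next
    assume "sphere_homotopic n X x0 (\<lambda>z. g (restrict z {..<n})) (\<lambda>z. h (restrict z {..<n}))"
    then obtain H where H: "continuous_map (top_of_set (bx n \<times> {0..1::real})) X H"
      "\<forall>z\<in>bx n. H (z, 0) = g (restrict z {..<n}) \<and> H (z, 1) = h (restrict z {..<n})"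
      "\<forall>z\<in>bdy n. \<forall>t\<in>{0..1}. H (z, t) = x0"
      unfolding sphere_homotopic_def by (elim exE conjE)
    have "continuous_map (prod_topology (top_of_set {0..1::real}) (cube n)) (top_of_set (bx n))
        (\<lambda>w. ex n (snd w))"
      using continuous_map_compose[OF continuous_map_snd continuous_map_ex]
      unfolding o_def .
    then have "continuous_map (prod_topology (top_of_set {0..1::real}) (cube n))
        (prod_topology (top_of_set (bx n)) (top_of_set {0..1::real})) (\<lambda>w. (ex n (snd w), fst w))"
      by (intro continuous_map_pairedI continuous_map_fst)
    then have "continuous_map (prod_topology (top_of_set {0..1::real}) (cube n))
        (top_of_set (bx n \<times> {0..1::real})) (\<lambda>w. (ex n (snd w), fst w))"
      by simp
    from continuous_map_compose[OF this H(1)]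
    have "continuous_map (prod_topology (top_of_set {0..1::real}) (cube n)) X (\<lambda>w. H (ex n (snd w), fst w))"
      by (simp add: o_def)
    then show "\<exists>H. continuous_map (prod_topology (top_of_set {0..1::real}) (cube n)) X H \<and>
       (\<forall>x\<in>topspace (cube n). H (0, x) = g x) \<and> (\<forall>x\<in>topspace (cube n). H (1, x) = h x) \<and>
       (\<forall>t\<in>{0..1}. \<forall>x\<in>cube_boundary n. H (t, x) = x0)"
      using H(2,3) ex_in ex_in_bdy restrict_ex
      by (intro exI[of _ "\<lambda>w. H (ex n (snd w), fst w)"]) auto
  qed
  finally show ?thesis .
qed

abbreviation spheroid :: "nat \<Rightarrow> 'a topology \<Rightarrow> 'a \<Rightarrow> ((nat \<Rightarrow> real) \<Rightarrow> 'a) \<Rightarrow> bool" where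
  "spheroid n X x0 g \<equiv> continuous_map (cube n) X g \<and> (\<forall>t\<in>cube_boundary n. g t = x0)"

lemma sphere_map_spheroid:
  assumes "spheroid n X x0 g"
  shows "sphere_map n X x0 (\<lambda>z. g (restrict z {..<n}))"
  using assms continuous_map_compose[OF continuous_map_restrict_cube, of n X g] restrict_in_boundary
  by (auto simp: sphere_map_def o_def)

lemma spheroid_sphere_map:
  assumes "sphere_map n X x0 g"
  shows "spheroid n X x0 (\<lambda>x. g (ex n x))"
  using assms continuous_map_compose[OF continuous_map_ex, of n X g] ex_in_bdy
  by (auto simp: sphere_map_def o_def)

lemma sphere_homotopic_cong:
  assumes "\<And>z. z \<in> bx n \<Longrightarrow> g z = g' z" "\<And>z. z \<in> bx n \<Longrightarrow> h z = h' z"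
  shows "sphere_homotopic n X x0 g h \<longleftrightarrow> sphere_homotopic n X x0 g' h'"
  using assms by (simp add: sphere_homotopic_def)

lemma homotopic_spheroids_ex:
  "homotopic_spheroids n X x0 (\<lambda>x. g (ex n x)) (\<lambda>x. h (ex n x)) \<longleftrightarrow> sphere_homotopic n X x0 g h"
  unfolding homotopic_spheroids_iff
  by (rule sphere_homotopic_cong) (simp_all add: ex_restrict)

lemma homotopic_spheroids_refl:
  "spheroid n X x0 g \<Longrightarrow> homotopic_spheroids n X x0 g g"
  by (simp add: homotopic_spheroids_def)

lemma homotopic_spheroids_sym:
  "homotopic_spheroids n X x0 g h \<Longrightarrow> homotopic_spheroids n X x0 h g"
  using homotopic_with_symD by (auto simp: homotopic_spheroids_def)

lemma homotopic_spheroids_trans: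
  "homotopic_spheroids n X x0 g h \<Longrightarrow> homotopic_spheroids n X x0 h k \<Longrightarrow> homotopic_spheroids n X x0 g k"
  unfolding homotopic_spheroids_def by (rule homotopic_with_trans)

lemma homotopic_spheroids_compose:
  assumes "homotopic_spheroids n X x0 g h" "continuous_map X Y f"
  shows "homotopic_spheroids n Y (f x0) (f \<circ> g) (f \<circ> h)"
  using assms unfolding homotopic_spheroids_def
  by (elim homotopic_with_compose_continuous_map_left) auto

lemma homotopy_class_eq_iff:
  assumes "spheroid n X x0 g"
  shows "{k. homotopic_spheroids n X x0 g k} = {k. homotopic_spheroids n X x0 h k} \<longleftrightarrow>
    homotopic_spheroids n X x0 h g"
proof
  show "homotopic_spheroids n X x0 h g"
    if "{k. homotopic_spheroids n X x0 g k} = {k. homotopic_spheroids n X x0 h k}"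
    using that homotopic_spheroids_refl[OF assms] by auto
  show "{k. homotopic_spheroids n X x0 g k} = {k. homotopic_spheroids n X x0 h k}"
    if hg: "homotopic_spheroids n X x0 h g"
    using homotopic_spheroids_trans[OF hg] homotopic_spheroids_trans[OF homotopic_spheroids_sym[OF hg]]
    by (intro Collect_cong iffI)
qed

lemma homotopy_group_map_class:
  assumes g: "spheroid n X x0 g" and f: "continuous_map X Y f"
  shows "homotopy_group_map n Y f x0 {h. homotopic_spheroids n X x0 g h} =
    {h. homotopic_spheroids n Y (f x0) (f \<circ> g) h}"
proof (intro subset_antisym subsetI)
  fix h assume "h \<in> homotopy_group_map n Y f x0 {h. homotopic_spheroids n X x0 g h}"
  then obtain k where "homotopic_spheroids n X x0 g k" "homotopic_spheroids n Y (f x0) (f \<circ> k) h"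
    unfolding homotopy_group_map_def by blast
  then show "h \<in> {h. homotopic_spheroids n Y (f x0) (f \<circ> g) h}"
    using homotopic_spheroids_trans[OF homotopic_spheroids_compose[OF _ f]] by simp
next
  fix h assume "h \<in> {h. homotopic_spheroids n Y (f x0) (f \<circ> g) h}"
  then show "h \<in> homotopy_group_map n Y f x0 {h. homotopic_spheroids n X x0 g h}"
    unfolding homotopy_group_map_def using homotopic_spheroids_refl[OF g] by blast
qed

lemma homotopy_groupE:
  assumes "c \<in> homotopy_group n X x0"
  obtains g where "spheroid n X x0 g" "c = {h. homotopic_spheroids n X x0 g h}"
  using assms unfolding homotopy_group_def by blast

lemma homotopy_groupI:
  "spheroid n X x0 g \<Longrightarrow> {h. homotopic_spheroids n X x0 g h} \<in> homotopy_group n X x0"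
  unfolding homotopy_group_def by blast

text \<open>Surjectivity on homotopy groups, and below it injectivity, in terms of representatives
  on \<open>bx n\<close>: this is the form that lifting problems produce and consume.\<close>

definition pi_surj :: "nat \<Rightarrow> 'a topology \<Rightarrow> 'b topology \<Rightarrow> ('a \<Rightarrow> 'b) \<Rightarrow> 'a \<Rightarrow> bool" where
  "pi_surj n X Y f x0 \<longleftrightarrow> (\<forall>a. sphere_map n Y (f x0) a \<longrightarrow>
     (\<exists>b. sphere_map n X x0 b \<and> sphere_homotopic n Y (f x0) a (\<lambda>z. f (b z))))"

definition pi_inj :: "nat \<Rightarrow> 'a topology \<Rightarrow> 'b topology \<Rightarrow> ('a \<Rightarrow> 'b) \<Rightarrow> 'a \<Rightarrow> bool" where
  "pi_inj n X Y f x0 \<longleftrightarrow> (\<forall>g h. sphere_map n X x0 g \<longrightarrow> sphere_map n X x0 h \<longrightarrow>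
     sphere_homotopic n Y (f x0) (\<lambda>z. f (g z)) (\<lambda>z. f (h z)) \<longrightarrow> sphere_homotopic n X x0 g h)"

lemma spheroid_compose:
  "spheroid n X x0 g \<Longrightarrow> continuous_map X Y f \<Longrightarrow> spheroid n Y (f x0) (f \<circ> g)"
  by (auto intro: continuous_map_compose)

lemma homotopy_group_map_surj_iff:
  assumes f: "continuous_map X Y f"
  shows "homotopy_group_map n Y f x0 ` homotopy_group n X x0 = homotopy_group n Y (f x0) \<longleftrightarrow>
    pi_surj n X Y f x0"
proof
  assume L: "homotopy_group_map n Y f x0 ` homotopy_group n X x0 = homotopy_group n Y (f x0)"
  show "pi_surj n X Y f x0"
    unfolding pi_surj_def
  proof (intro allI impI)
    fix a assume "sphere_map n Y (f x0) a"
    then have a: "spheroid n Y (f x0) (\<lambda>x. a (ex n x))" by (rule spheroid_sphere_map)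
    then have "{h. homotopic_spheroids n Y (f x0) (\<lambda>x. a (ex n x)) h} \<in>
        homotopy_group_map n Y f x0 ` homotopy_group n X x0"
      unfolding L by (rule homotopy_groupI)
    then obtain c where c: "c \<in> homotopy_group n X x0"
      and ec: "{h. homotopic_spheroids n Y (f x0) (\<lambda>x. a (ex n x)) h} = homotopy_group_map n Y f x0 c"
      by blast
    from c obtain g where g: "spheroid n X x0 g" and cg: "c = {h. homotopic_spheroids n X x0 g h}"
      by (rule homotopy_groupE)
    note e = ec[unfolded cg]
    have "homotopic_spheroids n Y (f x0) (f \<circ> g) (\<lambda>x. a (ex n x))"
      using e homotopy_class_eq_iff[OF a] unfolding homotopy_group_map_class[OF g f] by blast
    then have "homotopic_spheroids n Y (f x0) (\<lambda>x. a (ex n x)) (f \<circ> g)"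
      by (rule homotopic_spheroids_sym)
    then have "sphere_homotopic n Y (f x0) (\<lambda>z. a (ex n (restrict z {..<n})))
        (\<lambda>z. (f \<circ> g) (restrict z {..<n}))"
      unfolding homotopic_spheroids_iff .
    then have "sphere_homotopic n Y (f x0) a (\<lambda>z. f (g (restrict z {..<n})))"
      by (subst sphere_homotopic_cong[where g'="\<lambda>z. a (ex n (restrict z {..<n}))"
            and h'="\<lambda>z. (f \<circ> g) (restrict z {..<n})"]) (simp_all add: ex_restrict)
    with sphere_map_spheroid[OF g]
    show "\<exists>b. sphere_map n X x0 b \<and> sphere_homotopic n Y (f x0) a (\<lambda>z. f (b z))"
      by blast
  qed
next
  assume R: "pi_surj n X Y f x0"
  show "homotopy_group_map n Y f x0 ` homotopy_group n X x0 = homotopy_group n Y (f x0)"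
  proof (intro subset_antisym subsetI)
    fix c assume "c \<in> homotopy_group_map n Y f x0 ` homotopy_group n X x0"
    then obtain g where g: "spheroid n X x0 g"
      and "c = homotopy_group_map n Y f x0 {h. homotopic_spheroids n X x0 g h}"
      by (auto elim: homotopy_groupE)
    then have "c = {h. homotopic_spheroids n Y (f x0) (f \<circ> g) h}"
      by (simp add: homotopy_group_map_class[OF g f])
    then show "c \<in> homotopy_group n Y (f x0)"
      using homotopy_groupI[OF spheroid_compose[OF g f]] by simp
  next
    fix c assume "c \<in> homotopy_group n Y (f x0)"
    then obtain a where a: "spheroid n Y (f x0) a" and c: "c = {h. homotopic_spheroids n Y (f x0) a h}"
      by (rule homotopy_groupE)
    obtain b where b: "sphere_map n X x0 b"
      and h: "sphere_homotopic n Y (f x0) (\<lambda>z. a (restrict z {..<n})) (\<lambda>z. f (b z))"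
      using R sphere_map_spheroid[OF a] unfolding pi_surj_def by blast
    have g: "spheroid n X x0 (\<lambda>x. b (ex n x))" using b by (rule spheroid_sphere_map)
    have "homotopic_spheroids n Y (f x0) a (f \<circ> (\<lambda>x. b (ex n x)))"
      unfolding homotopic_spheroids_iff using h
      by (subst sphere_homotopic_cong[where g'="\<lambda>z. a (restrict z {..<n})" and h'="\<lambda>z. f (b z)"])
        (simp_all add: ex_restrict)
    then have "homotopic_spheroids n Y (f x0) (f \<circ> (\<lambda>x. b (ex n x))) a"
      by (rule homotopic_spheroids_sym)
    then have "c = homotopy_group_map n Y f x0 {h. homotopic_spheroids n X x0 (\<lambda>x. b (ex n x)) h}"
      unfolding c homotopy_group_map_class[OF g f] using homotopy_class_eq_iff[OF a] by blast
    then show "c \<in> homotopy_group_map n Y f x0 ` homotopy_group n X x0"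
      using homotopy_groupI[OF g] by blast
  qed
qed

lemma homotopy_group_map_inj_iff:
  assumes f: "continuous_map X Y f"
  shows "inj_on (homotopy_group_map n Y f x0) (homotopy_group n X x0) \<longleftrightarrow> pi_inj n X Y f x0"
proof
  assume L: "inj_on (homotopy_group_map n Y f x0) (homotopy_group n X x0)"
  show "pi_inj n X Y f x0"
    unfolding pi_inj_def
  proof (intro allI impI)
    fix g h assume g: "sphere_map n X x0 g" and h: "sphere_map n X x0 h"
      and gh: "sphere_homotopic n Y (f x0) (\<lambda>z. f (g z)) (\<lambda>z. f (h z))"
    note s = spheroid_sphere_map[OF g] spheroid_sphere_map[OF h]
    have "homotopic_spheroids n Y (f x0) (f \<circ> (\<lambda>x. g (ex n x))) (f \<circ> (\<lambda>x. h (ex n x)))"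
      using gh homotopic_spheroids_ex[of n Y "f x0" "\<lambda>z. f (g z)" "\<lambda>z. f (h z)"] by (simp add: o_def)
    then have "{k. homotopic_spheroids n Y (f x0) (f \<circ> (\<lambda>x. h (ex n x))) k} =
        {k. homotopic_spheroids n Y (f x0) (f \<circ> (\<lambda>x. g (ex n x))) k}"
      using homotopy_class_eq_iff[OF spheroid_compose[OF s(2) f]] by blast
    then have "homotopy_group_map n Y f x0 {k. homotopic_spheroids n X x0 (\<lambda>x. h (ex n x)) k} =
        homotopy_group_map n Y f x0 {k. homotopic_spheroids n X x0 (\<lambda>x. g (ex n x)) k}"
      by (simp only: homotopy_group_map_class[OF s(1) f] homotopy_group_map_class[OF s(2) f])
    then have "{k. homotopic_spheroids n X x0 (\<lambda>x. h (ex n x)) k} =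
        {k. homotopic_spheroids n X x0 (\<lambda>x. g (ex n x)) k}"
      by (rule inj_onD[OF L]) (rule homotopy_groupI[OF s(2)] homotopy_groupI[OF s(1)])+
    then have "homotopic_spheroids n X x0 (\<lambda>x. g (ex n x)) (\<lambda>x. h (ex n x))"
      using homotopy_class_eq_iff[OF s(2)] by blast
    then show "sphere_homotopic n X x0 g h"
      by (simp only: homotopic_spheroids_ex)
  qed
next
  assume R: "pi_inj n X Y f x0"
  show "inj_on (homotopy_group_map n Y f x0) (homotopy_group n X x0)"
  proof (rule inj_onI)
    fix c c' assume "c \<in> homotopy_group n X x0" "c' \<in> homotopy_group n X x0"
      and e: "homotopy_group_map n Y f x0 c = homotopy_group_map n Y f x0 c'"
    then obtain g h where g: "spheroid n X x0 g" and c: "c = {k. homotopic_spheroids n X x0 g k}"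
      and h: "spheroid n X x0 h" and c': "c' = {k. homotopic_spheroids n X x0 h k}"
      by (elim homotopy_groupE)
    have "homotopic_spheroids n Y (f x0) (f \<circ> h) (f \<circ> g)"
      using e homotopy_class_eq_iff[OF spheroid_compose[OF g f]]
      unfolding c c' homotopy_group_map_class[OF g f] homotopy_group_map_class[OF h f] by blast
    then have "sphere_homotopic n Y (f x0) (\<lambda>z. f (h (restrict z {..<n}))) (\<lambda>z. f (g (restrict z {..<n})))"
      unfolding homotopic_spheroids_iff by (simp add: o_def)
    then have "homotopic_spheroids n X x0 h g"
      unfolding homotopic_spheroids_iff
      using R sphere_map_spheroid[OF g] sphere_map_spheroid[OF h] unfolding pi_inj_def by blast
    then show "c = c'"
      unfolding c c' using homotopy_class_eq_iff[OF g] by blast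
  qed
qed

lemma k_connected_map_iff:
  "k_connected_map k X Y f \<longleftrightarrow> continuous_map X Y f \<and>
     (k \<ge> 0 \<longrightarrow> (\<forall>y\<in>topspace Y. \<exists>x\<in>topspace X. path_component_of Y y (f x))) \<and>
     (\<forall>x0\<in>topspace X. \<forall>i::nat. (int i < k \<longrightarrow> pi_inj i X Y f x0) \<and> (int i \<le> k \<longrightarrow> pi_surj i X Y f x0))"
proof (cases "continuous_map X Y f")
  case True
  then have "(\<forall>C\<in>path_components_of Y. \<exists>x\<in>topspace X. f x \<in> C) \<longleftrightarrow>
      (\<forall>y\<in>topspace Y. \<exists>x\<in>topspace X. path_component_of Y y (f x))"
    by (auto simp: path_components_of_def)
  with True show ?thesis
    unfolding k_connected_map_def bij_betw_def homotopy_group_map_surj_iff[OF True]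
      homotopy_group_map_inj_iff[OF True]
    by (smt (verit, best))
qed (simp add: k_connected_map_def)

section \<open>From homotopy groups to lifting problems and back\<close>

lemma bx_0: "bx 0 = {\<lambda>_. 0}" and bdy_0: "bdy 0 = {}"
  by (auto simp: bx_def bdy_def)

lemma bx_scale:
  "z \<in> bx n \<Longrightarrow> 0 \<le> r \<Longrightarrow> r \<le> 1 \<Longrightarrow> (\<lambda>i. r * z i) \<in> bx n"
  by (auto simp: bx_def intro: mult_le_one)

lemma continuous_on_scale:
  fixes g :: "'c::topological_space \<Rightarrow> nat \<Rightarrow> real"
  assumes "continuous_on S r" "continuous_on S g"
  shows "continuous_on S (\<lambda>x i. r x * g x i)"
  by (rule continuous_on_coordinatewise_then_product)
    (intro continuous_intros assms continuous_on_coord[OF assms(2)])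

lemma cmap_in_topspace:
  "continuous_map (top_of_set K) X g \<Longrightarrow> z \<in> K \<Longrightarrow> g z \<in> topspace X"
  using continuous_map_image_subset_topspace by fastforce

lemma solves_0:
  assumes "\<And>y. y \<in> topspace Y \<Longrightarrow> \<exists>x\<in>topspace X. path_component_of Y y (f x)"
  shows "solves X Y f 0"
  unfolding solves_def
proof (intro allI impI)
  fix a b
  assume a: "continuous_map (top_of_set (bx 0)) Y a"
  then have "a (\<lambda>_. 0) \<in> topspace Y"
    by (rule cmap_in_topspace) (simp add: bx_0)
  then obtain x p where x: "x \<in> topspace X" and p: "pathin Y p" "p 0 = a (\<lambda>_. 0)" "p 1 = f x"
    using assms unfolding path_component_of_def by blast
  have "continuous_map (top_of_set (bx 0 \<times> {0..1::real})) Y (\<lambda>w. p (snd w))"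
    by (rule cmap_compose[of "{0..1}"]) (use p(1) in \<open>auto simp: pathin_def intro!: continuous_intros\<close>)
  then show "solvable X Y f 0 a b"
    using p x by (intro solvableI[of _ _ "\<lambda>_. x" _ "\<lambda>w. p (snd w)"]) (auto simp: bx_0 bdy_0)
qed

lemma path_component_if_solves_0:
  assumes "solves X Y f 0" "y \<in> topspace Y"
  shows "\<exists>x\<in>topspace X. path_component_of Y y (f x)"
proof -
  have "solvable X Y f 0 (\<lambda>_. y) undefined"
    by (rule solvesD[OF assms(1)]) (use assms(2) in \<open>auto simp: bdy_0\<close>)
  then obtain b G where b: "continuous_map (top_of_set (bx 0)) X b"
     and G: "continuous_map (top_of_set (bx 0 \<times> {0..1::real})) Y G"
     and e: "\<forall>z\<in>bx 0. G (z, 0) = y \<and> G (z, 1) = f (b z)"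
    by (rule solvableE)
  have "continuous_map (top_of_set {0..1::real}) Y (\<lambda>t. G ((\<lambda>_. 0), t))"
    by (rule cmap_compose[OF G]) (auto intro!: continuous_intros simp: bx_0)
  then have "path_component_of Y y (f (b (\<lambda>_. 0)))"
    unfolding path_component_of_def pathin_def using e
    by (intro exI[of _ "\<lambda>t. G ((\<lambda>_. 0), t)"]) (auto simp: bx_0)
  moreover have "b (\<lambda>_. 0) \<in> topspace X"
    using b by (rule cmap_in_topspace) (simp add: bx_0)
  ultimately show ?thesis by blast
qed

text \<open>To simplify the boundary values it is enough to deform them in \<open>X\<close>: the
  image of the deformation in \<open>Y\<close> extends from the boundary over the cube, which
  supplies the matching deformation of \<open>a\<close>.\<close>

lemma solvable_extend_homotopy:
  assumes f: "continuous_map X Y f"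
    and a: "continuous_map (top_of_set (bx n)) Y a"
    and B: "continuous_map (top_of_set (bdy n \<times> {0..1::real})) X B"
    and e: "\<And>z. z \<in> bdy n \<Longrightarrow> f (B (z, 0)) = a z"
    and s: "\<And>a. continuous_map (top_of_set (bx n)) Y a \<Longrightarrow> (\<And>z. z \<in> bdy n \<Longrightarrow> f (B (z, 1)) = a z) \<Longrightarrow>
      solvable X Y f n a (\<lambda>z. B (z, 1))"
  shows "solvable X Y f n a (\<lambda>z. B (z, 0))"
proof -
  have fB: "continuous_map (top_of_set (bdy n \<times> {0..1::real})) Y (\<lambda>w. f (B w))"
    using continuous_map_compose[OF B f] by (simp add: o_def)
  have fB1: "continuous_map (top_of_set (bdy n)) Y (\<lambda>z. f (B (z, 1)))"
    by (rule cmap_compose[OF fB]) (auto intro!: continuous_intros)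
  obtain a1 A where a1: "continuous_map (top_of_set (bx n)) Y a1"
    and A: "continuous_map (top_of_set (bx n \<times> {0..1::real})) Y A"
    and A1: "\<forall>z\<in>bx n. A (z, 0) = a z \<and> A (z, 1) = a1 z"
    and A2: "\<forall>z\<in>bdy n. a1 z = f (B (z, 1)) \<and> (\<forall>t\<in>{0..1}. A (z, t) = f (B (z, t)))"
    by (rule liftsE[OF hep_bx a fB1 fB]) (use e in auto)
  have "solvable X Y f n a1 (\<lambda>z. B (z, 1))"
    by (rule s[OF a1]) (use A2 in auto)
  then have "solvable X Y f n (\<lambda>z. A (z, 1)) (\<lambda>z. B (z, 1))"
    using A1 unfolding solvable_def by (metis bdyD)
  then have "solvable X Y f n (\<lambda>z. A (z, 0)) (\<lambda>z. B (z, 0))"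
    by (intro solvable_homotopy[OF f A B]) (use A2 in auto)
  then show ?thesis
    using A1 unfolding solvable_def by (metis bdyD)
qed

text \<open>This is the boundary of \<open>bx (Suc m)\<close> without the open top face.\<close>

definition open_box :: "nat \<Rightarrow> (nat \<Rightarrow> real) set" where
  "open_box m = {z \<in> bx (Suc m). z m = 0 \<or> z(m := 0) \<in> bdy m}"

lemma closed_open_box: "closed (open_box m)"
proof -
  have "open_box m = bx (Suc m) \<inter> ({z. z m = 0} \<union> {z. cn m z = 1})"
  proof -
    have "z(m := 0) \<in> bdy m \<longleftrightarrow> cn m z = 1" if "z \<in> bx (Suc m)" for z
      using bx_Suc_split[OF that] cn_cong[of m "z(m := 0)" z] by (auto simp: bdy_cn)
    then show ?thesis by (auto simp: open_box_def)
  qed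
  then show ?thesis
    by (simp only:) (intro closed_Int closed_Un closed_bx closed_Collect_eq continuous_intros)
qed

lemma open_box_subset: "open_box m \<subseteq> bdy (Suc m)"
proof
  fix z assume z: "z \<in> open_box m"
  then have "z(m := 0) \<in> bx m" "z m \<in> {0..1}" "z m = 0 \<or> z(m := 0) \<in> bdy m"
    using bx_Suc_split[of z m] by (auto simp: open_box_def)
  then show "z \<in> bdy (Suc m)"
    using bdy_Suc_join[of "z(m := 0)" m "z m"] by auto
qed

lemma open_boxD [dest]: "z \<in> open_box m \<Longrightarrow> z \<in> bdy (Suc m)"
  using open_box_subset by blast

text \<open>The boundary arises from the open box by gluing in the top face, which is a cube of
  dimension \<open>m\<close> that meets the open box in its own boundary.\<close>

lemma lifts_bdy_open_box: "lifts X X (\<lambda>x. x) (bdy (Suc m)) (open_box m)"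
proof -
  let ?F = "bx (Suc m) \<inter> {z. z m = 1}"
  have F: "z(m := 0) \<in> bx m" "z(m := 0) \<in> bdy m \<longleftrightarrow> z \<in> open_box m" if "z \<in> ?F" for z
    using bx_Suc_split[of z m] that by (auto simp: open_box_def)
  have "lifts X X (\<lambda>x. x) ?F (?F \<inter> open_box m)"
  proof (rule lifts_homeo[where K="bx m" and L="bdy m" and \<phi>="\<lambda>z. z(m := 0)" and \<psi>="\<lambda>z. z(m := 1)"])
    show "lifts X X (\<lambda>x. x) (bx m) (bdy m)" by (rule hep_bx)
    show "continuous_on ?F (\<lambda>z. z(m := 0))" "continuous_on (bx m) (\<lambda>z. z(m := 1))"
      by (intro continuous_intros)+
    show "z(m := 1) \<in> ?F" if "z \<in> bx m" for z
      using bx_Suc_join[OF that, of 1] by simp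
    show "z(m := 1) \<in> ?F \<inter> open_box m" if "z \<in> bdy m" for z
      using bx_Suc_join[of z m 1] that by (auto simp: open_box_def bx_def bdy_def)
    show "(z(m := 0))(m := 1) = z" if "z \<in> ?F" for z
      using that by auto
    show "(z(m := 1))(m := 0) = z" if "z \<in> bx m" for z
      using that by (auto simp: bx_def)
  qed (use F bdy_subset in auto)
  then have "lifts X X (\<lambda>x. x) (open_box m \<union> ?F) (open_box m)"
    by (intro lifts_Un closed_open_box closed_Int closed_bx closed_Collect_eq continuous_intros)
  moreover have "open_box m \<union> ?F = bdy (Suc m)"
  proof (intro subset_antisym subsetI)
    fix z assume "z \<in> open_box m \<union> ?F"
    then show "z \<in> bdy (Suc m)"
      using open_box_subset[of m] by (auto simp: bdy_def)
  next
    fix z assume "z \<in> bdy (Suc m)"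
    then show "z \<in> open_box m \<union> ?F"
      using bdy_Suc_split[of z m] bdyD[of z "Suc m"] by (auto simp: open_box_def)
  qed
  ultimately show ?thesis by simp
qed

text \<open>The boundary values are made constant in two moves. The open box is contractible, so
  they can be made constant there, which leaves a spheroid on the top face. Its image bounds in
  \<open>Y\<close> by means of \<open>a\<close>, so injectivity in degree \<open>m\<close> contracts
  it. With constant boundary values the problem is surjectivity in degree
  \<open>m + 1\<close>.\<close>

lemma solves_if_pi:
  assumes f: "continuous_map X Y f"
    and inj: "\<And>x0. x0 \<in> topspace X \<Longrightarrow> pi_inj m X Y f x0"
    and surj: "\<And>x0. x0 \<in> topspace X \<Longrightarrow> pi_surj (Suc m) X Y f x0"
  shows "solves X Y f (Suc m)"
proof -
  let ?n = "Suc m" and ?o = "\<lambda>_::nat. 0::real"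
  have o: "?o \<in> open_box m" by (auto simp: open_box_def bx_def)
  then have ob: "?o \<in> bdy ?n" using open_box_subset by blast
  have step1: "solvable X Y f ?n a b"
    if x1: "x1 \<in> topspace X" and a: "continuous_map (top_of_set (bx ?n)) Y a"
      and b: "\<And>z. z \<in> bdy ?n \<Longrightarrow> b z = x1" and e: "\<And>z. z \<in> bdy ?n \<Longrightarrow> f (b z) = a z" for a b x1
  proof -
    have "sphere_map ?n Y (f x1) a" using a b e by (auto simp: sphere_map_def)
    then obtain b' where b': "sphere_map ?n X x1 b'" "sphere_homotopic ?n Y (f x1) a (\<lambda>z. f (b' z))"
      using surj[OF x1] unfolding pi_surj_def by blast
    then obtain H where H: "continuous_map (top_of_set (bx ?n \<times> {0..1::real})) Y H"
       "\<forall>z\<in>bx ?n. H (z, 0) = a z \<and> H (z, 1) = f (b' z)" "\<forall>z\<in>bdy ?n. \<forall>t\<in>{0..1}. H (z, t) = f x1"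
      unfolding sphere_homotopic_def by (elim exE conjE)
    show ?thesis
    proof (rule solvableI[OF _ H(1)])
      show "continuous_map (top_of_set (bx ?n)) X b'" using b'(1) by (simp add: sphere_map_def)
      show "b' z = b z" if "z \<in> bdy ?n" for z using b'(1) b[OF that] that by (simp add: sphere_map_def)
      show "H (z, t) = a z" if "z \<in> bdy ?n" "t \<in> {0..1}" for z t
        using H(3) that e[OF that(1)] b[OF that(1)] by simp
    qed (use H(2) in auto)
  qed
  have step2: "solvable X Y f ?n a b"
    if x0: "x0 \<in> topspace X" and a: "continuous_map (top_of_set (bx ?n)) Y a"
      and b: "continuous_map (top_of_set (bdy ?n)) X b" and e: "\<And>z. z \<in> bdy ?n \<Longrightarrow> f (b z) = a z"
      and bJ: "\<And>z. z \<in> open_box m \<Longrightarrow> b z = x0" for a b x0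
  proof -
    have top: "w(m := 1) \<in> bdy ?n" if "w \<in> bx m" for w
      using bdy_Suc_join[OF that, of 1] by simp
    have side: "w(m := t) \<in> open_box m" if "w \<in> bdy m" "t \<in> {0..1}" for w t
    proof -
      have "(w(m := t))(m := 0) = w" using that(1) by (auto simp: bdy_def bx_def)
      then show ?thesis using that bx_Suc_join[of w m t] by (auto simp: open_box_def)
    qed
    have bot: "w(m := 0) \<in> open_box m" if "w \<in> bx m" for w
      using bx_Suc_join[OF that, of 0] by (simp add: open_box_def)
    define g where "g = (\<lambda>w. b (w(m := 1)))"
    have "continuous_map (top_of_set (bx m)) X g"
      unfolding g_def using top by (intro cmap_compose[OF b] continuous_intros) auto
    then have g: "sphere_map m X x0 g"
      using bJ side by (auto simp: sphere_map_def g_def)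
    have c: "sphere_map m X x0 (\<lambda>_. x0)"
      using x0 by (simp add: sphere_map_def)
    have "continuous_map (top_of_set (bx m \<times> {0..1::real})) Y (\<lambda>w. a ((fst w)(m := 1 - snd w)))"
      using bx_Suc_join by (intro cmap_compose[OF a] continuous_intros) auto
    moreover have "a (w(m := 1)) = f (g w)" if "w \<in> bx m" for w
      using e[OF top[OF that]] by (simp add: g_def)
    moreover have "a (w(m := 0)) = f x0" if "w \<in> bx m" for w
      using e[of "w(m := 0)"] bJ[OF bot[OF that]] bot[OF that] by auto
    moreover have "a (w(m := 1 - t)) = f x0" if "w \<in> bdy m" "t \<in> {0..1}" for w t
      \<comment> \<open>The vertical direction of the cube serves as time: read from top to bottom,
        \<open>a\<close> is a null homotopy of the image of the top face.\<close>
      using e[of "w(m := 1 - t)"] bJ[OF side[of w "1 - t"]] side[of w "1 - t"] that by auto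
    ultimately have "sphere_homotopic m Y (f x0) (\<lambda>z. f (g z)) (\<lambda>z. f x0)"
      unfolding sphere_homotopic_def
      by (intro exI[of _ "\<lambda>w. a ((fst w)(m := 1 - snd w))"]) auto
    then have "sphere_homotopic m X x0 g (\<lambda>_. x0)"
      using inj[OF x0] g c unfolding pi_inj_def by blast
    then obtain B where B: "continuous_map (top_of_set (bx m \<times> {0..1::real})) X B"
      "\<forall>z\<in>bx m. B (z, 0) = g z \<and> B (z, 1) = x0" "\<forall>z\<in>bdy m. \<forall>t\<in>{0..1}. B (z, t) = x0"
      unfolding sphere_homotopic_def by (elim exE conjE)
    \<comment> \<open>The null homotopy fills the cube below the top face, so \<open>b\<close>
      extends over the whole cube inside \<open>X\<close>.\<close>
    define b1 where "b1 = (\<lambda>z. B (z(m := 0), 1 - z m))"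
    have b1: "continuous_map (top_of_set (bx ?n)) X b1"
      unfolding b1_def using bx_Suc_split by (intro cmap_compose[OF B(1)] continuous_intros) force
    have b1b: "b1 z = b z" if z: "z \<in> bdy ?n" for z
    proof -
      have s: "z(m := 0) \<in> bx m" "z m \<in> {0..1}" using bx_Suc_split[OF bdyD[OF z]] by auto
      consider "z(m := 0) \<in> bdy m" | "z m = 0" | "z m = 1" using bdy_Suc_split[OF z] by blast
      then show ?thesis
      proof cases
        case 1
        then have "z \<in> open_box m" using z by (auto simp: open_box_def)
        then show ?thesis using B(3) 1 s bJ by (simp add: b1_def)
      next
        case 2
        then have "z \<in> open_box m" using z by (auto simp: open_box_def)
        then show ?thesis using B(2) 2 s bJ by (simp add: b1_def)
      next
        case 3
        then have "(z(m := 0))(m := 1) = z" by auto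
        then show ?thesis using B(2) 3 s by (simp add: b1_def g_def)
      qed
    qed
    \<comment> \<open>Scaling towards the origin contracts this extension and thereby deforms
      \<open>b\<close> to a constant map.\<close>
    define C where "C = (\<lambda>w. b1 (\<lambda>i. (1 - snd w) * fst w i))"
    have C: "continuous_map (top_of_set (bdy ?n \<times> {0..1::real})) X C"
      unfolding C_def
      by (rule cmap_compose[OF b1])
        (auto intro!: continuous_on_scale continuous_intros bx_scale)
    have C1: "C (z, 1) = b1 ?o" for z by (simp add: C_def)
    have "solvable X Y f ?n a (\<lambda>z. C (z, 0))"
    proof (rule solvable_extend_homotopy[OF f a C])
      show "f (C (z, 0)) = a z" if "z \<in> bdy ?n" for z
        using e b1b that by (simp add: C_def)
      show "solvable X Y f ?n a (\<lambda>z. C (z, 1))"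
        if "continuous_map (top_of_set (bx ?n)) Y a" "\<And>z. z \<in> bdy ?n \<Longrightarrow> f (C (z, 1)) = a z" for a
      proof (rule step1[of "b1 ?o", OF _ that(1)])
        show "b1 ?o \<in> topspace X" using cmap_in_topspace[OF b1, of ?o] ob by auto
      qed (use C1 that(2) in auto)
    qed
    then show ?thesis
      using b1b unfolding solvable_def by (simp add: C_def)
  qed
  show ?thesis
    unfolding solves_def
  proof (intro allI impI)
    fix a b
    assume a: "continuous_map (top_of_set (bx ?n)) Y a" and b: "continuous_map (top_of_set (bdy ?n)) X b"
      and e: "\<forall>z\<in>bdy ?n. f (b z) = a z"
    \<comment> \<open>\<open>r\<close> is \<open>box_retract m\<close> read in
      \<open>bx (Suc m)\<close>, a retraction of the cube onto the open box. The origin lies in the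
      open box, so scaling towards it followed by \<open>r\<close> contracts the open box within
      itself.\<close>
    define r where "r z = (case box_retract m (z(m := 0), z m) of (w, t) \<Rightarrow> w(m := t))" for z
    have r_in: "r z \<in> open_box m" if "z \<in> bx ?n" for z
    proof -
      obtain w t where wt: "box_retract m (z(m := 0), z m) = (w, t)" by fastforce
      then have in': "(w, t) \<in> bx m \<times> {0} \<union> bdy m \<times> {0..1}"
        using box_retract_in[of "z(m := 0)" m "z m"] bx_Suc_split[OF that] by simp
      then have "w \<in> bx m" "t \<in> {0..1}" by auto
      moreover from this have "(w(m := t))(m := 0) = w" by (auto simp: bx_def)
      ultimately show ?thesis
        using in' bx_Suc_join[of w m t] by (auto simp: r_def wt open_box_def)
    qed
    have r_id: "r z = z" if "z \<in> open_box m" for z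
    proof -
      have "z(m := 0) \<in> bx m" "z m \<in> {0..1}" "z m = 0 \<or> z(m := 0) \<in> bdy m"
        using that bx_Suc_split[of z m] by (auto simp: open_box_def)
      then have "box_retract m (z(m := 0), z m) = (z(m := 0), z m)"
        using box_retract_bottom box_retract_side by auto
      then show ?thesis by (simp add: r_def)
    qed
    have cr: "continuous_on (bx ?n) r"
    proof -
      have "continuous_on (bx ?n) (\<lambda>z. box_retract m (z(m := 0), z m))"
        using bx_Suc_split
        by (intro continuous_on_compose2[OF continuous_on_box_retract] continuous_intros) auto
      then show ?thesis
        unfolding r_def split_def by (intro continuous_intros)
    qed
    define h where "h = (\<lambda>w. b (r (\<lambda>i. (1 - snd w) * fst w i)))"
    have sub: "open_box m \<subseteq> bx ?n" using open_box_subset bdy_subset by blast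
    have h: "continuous_map (top_of_set (open_box m \<times> {0..1::real})) X h"
      unfolding h_def
    proof (rule cmap_compose[OF b])
      show "continuous_on (open_box m \<times> {0..1}) (\<lambda>w. r (\<lambda>i. (1 - snd w) * fst w i))"
        using sub by (intro continuous_on_compose2[OF cr] continuous_on_scale continuous_intros)
          (auto intro!: bx_scale)
      show "r (\<lambda>i. (1 - snd w) * fst w i) \<in> bdy ?n" if "w \<in> open_box m \<times> {0..1}" for w
        using that sub open_box_subset by (intro subsetD[OF open_box_subset] r_in bx_scale) auto
    qed
    have h1: "h (z, 1) = b ?o" for z
      using r_id[OF o] by (simp add: h_def)
    have bo: "continuous_map (top_of_set (open_box m)) X (\<lambda>_. b ?o)"
      using cmap_in_topspace[OF b ob] by simp
    obtain b1 B where b1: "continuous_map (top_of_set (bdy ?n)) X b1"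
      and B: "continuous_map (top_of_set (bdy ?n \<times> {0..1::real})) X B"
      and B1: "\<forall>z\<in>bdy ?n. B (z, 0) = b z \<and> B (z, 1) = b1 z"
      and B2: "\<forall>z\<in>open_box m. b1 z = b ?o \<and> (\<forall>t\<in>{0..1}. B (z, t) = h (z, t))"
      by (rule liftsE[OF lifts_bdy_open_box b bo h]) (auto simp: h1, simp add: h_def r_id)
    have "solvable X Y f ?n a (\<lambda>z. B (z, 0))"
    proof (rule solvable_extend_homotopy[OF f a B])
      show "f (B (z, 0)) = a z" if "z \<in> bdy ?n" for z using e B1 that by simp
      show "solvable X Y f ?n a (\<lambda>z. B (z, 1))"
        if "continuous_map (top_of_set (bx ?n)) Y a" "\<And>z. z \<in> bdy ?n \<Longrightarrow> f (B (z, 1)) = a z" for a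
      proof (rule step2[OF _ that(1)])
        show "b ?o \<in> topspace X" using cmap_in_topspace[OF b ob] .
        show "continuous_map (top_of_set (bdy ?n)) X (\<lambda>z. B (z, 1))"
          using B1 by (intro cmap_cong[OF b1]) simp
        show "B (z, 1) = b ?o" if "z \<in> open_box m" for z
          using B1 B2 that h1[of z] by auto
      qed (use that in auto)
    qed
    then show "solvable X Y f ?n a b"
      using B1 unfolding solvable_def by simp
  qed
qed

theorem k_connected_map_imp_solves:
  assumes "k_connected_map k X Y f" "int n \<le> k"
  shows "solves X Y f n"
proof (cases n)
  case 0
  with assms show ?thesis
    using solves_0[of Y X f] unfolding k_connected_map_iff by auto
next
  case (Suc m)
  with assms show ?thesis
    using solves_if_pi[of X Y f m] unfolding k_connected_map_iff by auto
qed

text \<open>Surjectivity in degree \<open>i\<close> is the problem in dimension \<open>i\<close>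
  with constant boundary values. Injectivity in degree \<open>i\<close> is a problem in dimension
  \<open>i + 1\<close>: the homotopy between the images fills the cube, the two spheroids sit on
  opposite faces and the base point on the others.\<close>

theorem k_connected_map_if_solves:
  assumes f: "continuous_map X Y f" and s: "\<And>n. int n \<le> k \<Longrightarrow> solves X Y f n"
  shows "k_connected_map k X Y f"
  unfolding k_connected_map_iff
proof (intro conjI ballI impI allI f)
  show "\<exists>x\<in>topspace X. path_component_of Y y (f x)" if "0 \<le> k" "y \<in> topspace Y" for y
    using path_component_if_solves_0[OF s[of 0]] that by simp
next
  fix x0 and i :: nat assume x0: "x0 \<in> topspace X" and i: "int i \<le> k"
  show "pi_surj i X Y f x0"
    unfolding pi_surj_def
  proof (intro allI impI)
    fix a assume a: "sphere_map i Y (f x0) a"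
    have "solvable X Y f i a (\<lambda>_. x0)"
      by (rule solvesD[OF s[OF i]]) (use a x0 in \<open>auto simp: sphere_map_def\<close>)
    then obtain b' G where "continuous_map (top_of_set (bx i)) X b'"
     "continuous_map (top_of_set (bx i \<times> {0..1::real})) Y G"
     "\<forall>z\<in>bx i. G (z, 0) = a z \<and> G (z, 1) = f (b' z)"
     "\<forall>z\<in>bdy i. b' z = x0 \<and> (\<forall>t\<in>{0..1}. G (z, t) = a z)"
      by (rule solvableE)
    then show "\<exists>b. sphere_map i X x0 b \<and> sphere_homotopic i Y (f x0) a (\<lambda>z. f (b z))"
      using a unfolding sphere_map_def sphere_homotopic_def
      by (intro exI[of _ b'] conjI exI[of _ G]) auto
  qed
next
  fix x0 and i :: nat assume x0: "x0 \<in> topspace X" and i: "int i < k"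
  show "pi_inj i X Y f x0"
    unfolding pi_inj_def
  proof (intro allI impI)
    fix g h assume g: "sphere_map i X x0 g" and h: "sphere_map i X x0 h"
      and "sphere_homotopic i Y (f x0) (\<lambda>z. f (g z)) (\<lambda>z. f (h z))"
    then obtain H where H: "continuous_map (top_of_set (bx i \<times> {0..1::real})) Y H"
      "\<forall>z\<in>bx i. H (z, 0) = f (g z) \<and> H (z, 1) = f (h z)" "\<forall>z\<in>bdy i. \<forall>t\<in>{0..1}. H (z, t) = f x0"
      unfolding sphere_homotopic_def by (elim exE conjE)
    let ?n = "Suc i"
    let ?K0 = "bx ?n \<inter> {z. z i = 0}" and ?K1 = "bx ?n \<inter> {z. z i = 1}"
      and ?S = "bx ?n \<inter> {z. cn i z = 1}"
    define b where "b = (\<lambda>z. if z i = 0 then g (z(i := 0)) else if z i = 1 then h (z(i := 0)) else x0)"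
    have S: "z \<in> ?S \<longleftrightarrow> z(i := 0) \<in> bdy i" if "z \<in> bx ?n" for z
      using that bx_Suc_split[OF that] cn_cong[of i "z(i := 0)" z] by (auto simp: bdy_cn)
    have bS: "b z = x0" if "z \<in> ?S" for z
      using S that g h by (auto simp: b_def sphere_map_def)
    have cl: "closed ?K0" "closed ?K1" "closed ?S"
      by (intro closed_Int closed_bx closed_Collect_eq continuous_intros)+
    have in_bx: "z(i := 0) \<in> bx i" if "z \<in> bx ?n" for z
      using bx_Suc_split[OF that] by simp
    have c: "continuous_map (top_of_set (bx ?n)) X (\<lambda>z. g (z(i := 0)))"
      "continuous_map (top_of_set (bx ?n)) X (\<lambda>z. h (z(i := 0)))"
      using g h in_bx
      by (auto simp: sphere_map_def intro!: cmap_compose[of "bx i"] continuous_intros)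
    have "continuous_map (top_of_set ?K0) X b"
      by (rule cmap_cong[OF cmap_subset[OF c(1)]]) (auto simp: b_def)
    moreover have "continuous_map (top_of_set ?K1) X b"
      by (rule cmap_cong[OF cmap_subset[OF c(2)]]) (auto simp: b_def)
    moreover have "continuous_map (top_of_set ?S) X b"
      by (rule cmap_cong[of _ _ "\<lambda>_. x0"]) (use x0 bS in auto)
    ultimately have "continuous_map (top_of_set ((?K0 \<union> ?K1) \<union> ?S)) X b"
      by (intro cmap_closed_Un cl closed_Un)
    moreover have "bdy ?n \<subseteq> (?K0 \<union> ?K1) \<union> ?S"
    proof
      fix z assume z: "z \<in> bdy ?n"
      then have "z \<in> bx ?n" by (rule bdyD)
      with bdy_Suc_split[OF z] S[of z] show "z \<in> (?K0 \<union> ?K1) \<union> ?S" by blast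
    qed
    ultimately have b: "continuous_map (top_of_set (bdy ?n)) X b"
      by (rule cmap_subset)
    define a where "a = (\<lambda>z. H (z(i := 0), z i))"
    have a: "continuous_map (top_of_set (bx ?n)) Y a"
      unfolding a_def using bx_Suc_split by (intro cmap_compose[OF H(1)] continuous_intros) force
    have fb: "f (b z) = a z" if z: "z \<in> bdy ?n" for z
    proof -
      have s: "z(i := 0) \<in> bx i" "z i \<in> {0..1}" using bx_Suc_split[OF bdyD[OF z]] by auto
      consider "z(i := 0) \<in> bdy i" | "z i = 0" | "z i = 1" using bdy_Suc_split[OF z] by blast
      then show ?thesis
      proof cases
        case 1
        then show ?thesis using H(3) s bS[of z] S[of z] z by (auto simp: a_def)
      qed (use H(2) s in \<open>simp_all add: a_def b_def\<close>)
    qed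
    have "solvable X Y f ?n a b"
      using i by (intro solvesD[OF s a b fb]) auto
    then obtain b' G where b': "continuous_map (top_of_set (bx ?n)) X b'"
      and bb: "\<forall>z\<in>bdy ?n. b' z = b z \<and> (\<forall>t\<in>{0..1::real}. G (z, t) = a z)"
      by (rule solvableE)
    have jo: "w(i := t) \<in> bdy ?n" "w(i := t) \<in> bx ?n" "(w(i := t))(i := 0) = w"
      if "w \<in> bx i" "t \<in> {0..1}" "w \<in> bdy i \<or> t = 0 \<or> t = 1" for w t
      using that bdy_Suc_join[of w i t] by (auto simp: bx_def)
    have "continuous_map (top_of_set (bx i \<times> {0..1::real})) X (\<lambda>w. b' ((fst w)(i := snd w)))"
      using bx_Suc_join by (intro cmap_compose[OF b'] continuous_intros) auto
    moreover have "b' (w(i := 0)) = g w \<and> b' (w(i := 1)) = h w" if w: "w \<in> bx i" for w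
    proof -
      have "b' (w(i := 0)) = b (w(i := 0))" "b' (w(i := 1)) = b (w(i := 1))"
        using bb jo(1)[OF w] by simp_all
      moreover have "w(i := 0) = w" using w by (auto simp: bx_def)
      ultimately show ?thesis by (simp add: b_def fun_upd_same) (metis fun_upd_same)
    qed
    moreover have "b' (w(i := t)) = x0" if "w \<in> bdy i" "t \<in> {0..1}" for w t
      using bb jo[of w t] that bdyD[OF that(1)] bS[of "w(i := t)"] S[of "w(i := t)"] by auto
    ultimately show "sphere_homotopic i X x0 g h"
      unfolding sphere_homotopic_def by (intro exI[of _ "\<lambda>w. b' ((fst w)(i := snd w))"]) auto
  qed
qed

section \<open>Grids\<close>

text \<open>A cell of the grid of mesh \<open>1 / M\<close> is given by its lower and upper corner, in units of \<open>1 / M\<close>.\<close>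

type_synonym gcell = "(nat \<Rightarrow> nat) \<times> (nat \<Rightarrow> nat)"

definition gcells :: "nat \<Rightarrow> nat \<Rightarrow> gcell set" where
  "gcells M n = {(l, u). \<forall>i. l i \<le> u i \<and> u i \<le> Suc (l i) \<and> u i \<le> (if i < n then M else 0)}"

definition cellset :: "nat \<Rightarrow> gcell \<Rightarrow> (nat \<Rightarrow> real) set" where
  "cellset M c = {z. \<forall>i. real (fst c i) \<le> real M * z i \<and> real M * z i \<le> real (snd c i)}"

definition cdim :: "gcell \<Rightarrow> nat" where
  "cdim c = card {i. fst c i < snd c i}"

text \<open>A union of cells of dimension at most \<open>d\<close>, stated pointwise to make unions
  immediate. For \<open>d = n\<close> the bound is void by \<open>cdim_le\<close>.\<close>

definition gset :: "nat \<Rightarrow> nat \<Rightarrow> nat \<Rightarrow> (nat \<Rightarrow> real) set \<Rightarrow> bool" where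
  "gset M n d K \<longleftrightarrow> (\<forall>z\<in>K. \<exists>c\<in>gcells M n. z \<in> cellset M c \<and> cellset M c \<subseteq> K \<and> cdim c \<le> d)"

lemma gcells_iff: "c \<in> gcells M n \<longleftrightarrow>
    (\<forall>i. fst c i \<le> snd c i \<and> snd c i \<le> Suc (fst c i) \<and> snd c i \<le> (if i < n then M else 0))"
  by (auto simp: gcells_def split_def)

lemma gcellsD:
  assumes "c \<in> gcells M n"
  shows "fst c i \<le> snd c i" "snd c i \<le> Suc (fst c i)" "snd c i \<le> M" "fst c i \<le> M"
    "n \<le> i \<Longrightarrow> snd c i = 0" "n \<le> i \<Longrightarrow> fst c i = 0"
proof -
  have "fst c i \<le> snd c i \<and> snd c i \<le> Suc (fst c i) \<and> snd c i \<le> (if i < n then M else 0)"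
    using assms by (simp add: gcells_iff)
  then show "fst c i \<le> snd c i" "snd c i \<le> Suc (fst c i)" "snd c i \<le> M" "fst c i \<le> M"
    "n \<le> i \<Longrightarrow> snd c i = 0" "n \<le> i \<Longrightarrow> fst c i = 0"
    by (auto split: if_splits)
qed

lemma cellsetD:
  "z \<in> cellset M c \<Longrightarrow> real (fst c i) \<le> real M * z i"
  "z \<in> cellset M c \<Longrightarrow> real M * z i \<le> real (snd c i)"
  by (simp_all add: cellset_def)

lemma finite_gcells: "finite (gcells M n)"
proof -
  let ?F = "{g. \<forall>i. (i \<in> {..<n} \<longrightarrow> g i \<in> {..M}) \<and> (i \<notin> {..<n} \<longrightarrow> g i = (0::nat))}"
  have "finite ?F" by (rule finite_set_of_finite_funs) auto
  moreover have "gcells M n \<subseteq> ?F \<times> ?F"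
  proof
    fix c assume c: "c \<in> gcells M n"
    have F: "(i \<in> {..<n} \<longrightarrow> fst c i \<in> {..M}) \<and> (i \<notin> {..<n} \<longrightarrow> fst c i = 0)"
      "(i \<in> {..<n} \<longrightarrow> snd c i \<in> {..M}) \<and> (i \<notin> {..<n} \<longrightarrow> snd c i = 0)" for i
      using gcellsD(3-6)[OF c, of i] by (simp_all add: not_less)
    have "fst c \<in> ?F" by (rule CollectI, rule allI, rule F(1))
    moreover have "snd c \<in> ?F" by (rule CollectI, rule allI, rule F(2))
    ultimately show "c \<in> ?F \<times> ?F" by (simp only: mem_Times_iff)
  qed
  ultimately show ?thesis using finite_subset by blast
qed

lemma free_subset: "c \<in> gcells M n \<Longrightarrow> {i. fst c i < snd c i} \<subseteq> {..<n}"
proof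
  fix i assume "c \<in> gcells M n" "i \<in> {i. fst c i < snd c i}"
  then show "i \<in> {..<n}"
    using gcellsD(5)[of c M n i] by (metis lessThan_iff linorder_not_le mem_Collect_eq not_less_zero)
qed

lemma finite_free: "c \<in> gcells M n \<Longrightarrow> finite {i. fst c i < snd c i}"
  by (rule finite_subset[OF free_subset]) auto

lemma cdim_le: "c \<in> gcells M n \<Longrightarrow> cdim c \<le> n"
  unfolding cdim_def using card_mono[OF _ free_subset, of n c M] by simp

lemma cellset_subset_bx:
  assumes "0 < M" "c \<in> gcells M n"
  shows "cellset M c \<subseteq> bx n"
proof
  fix z assume z: "z \<in> cellset M c"
  have z: "0 \<le> real M * z i" "real M * z i \<le> real M" "n \<le> i \<Longrightarrow> real M * z i \<le> 0" for i
    using cellsetD[OF z, of i] gcellsD(3,5)[OF assms(2), of i] by auto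
  have "0 \<le> z i" "z i \<le> 1" "n \<le> i \<Longrightarrow> z i = 0" for i
    using z[of i] assms(1) by (auto simp: zero_le_mult_iff mult_le_0_iff)
  then show "z \<in> bx n" by (simp add: bx_def)
qed

lemma closed_cellset: "closed (cellset M c)"
proof -
  have "cellset M c = (\<Inter>i. {z. real (fst c i) \<le> real M * z i} \<inter> {z. real M * z i \<le> real (snd c i)})"
    by (auto simp: cellset_def)
  then show ?thesis
    by (simp only:) (intro closed_INT ballI closed_Int closed_Collect_le continuous_intros)
qed

lemma gset_top: "gset M n d K \<Longrightarrow> gset M n n K"
  unfolding gset_def using cdim_le by blast

lemma gset_Un: "gset M n d K \<Longrightarrow> gset M n d L \<Longrightarrow> gset M n d (K \<union> L)"
  unfolding gset_def by (metis Un_iff le_supI1 le_supI2)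

lemma gset_cell: "c \<in> gcells M n \<Longrightarrow> cdim c \<le> d \<Longrightarrow> gset M n d (cellset M c)"
  unfolding gset_def by blast

lemma gset_Union: "(\<And>c. c \<in> S \<Longrightarrow> c \<in> gcells M n \<and> cdim c \<le> d) \<Longrightarrow> gset M n d (\<Union>c\<in>S. cellset M c)"
  unfolding gset_def by blast

text \<open>The corners of the intersection of two boxes. By \<open>cmeet_in\<close> they define a
  cell as soon as the boxes have a common point.\<close>

definition cmeet :: "gcell \<Rightarrow> gcell \<Rightarrow> gcell" where
  "cmeet c c' = (\<lambda>i. max (fst c i) (fst c' i), \<lambda>i. min (snd c i) (snd c' i))"

lemma cellset_meet: "cellset M c \<inter> cellset M c' = cellset M (cmeet c c')"
  by (auto simp: cellset_def cmeet_def of_nat_max of_nat_min)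

lemma cmeet_in:
  assumes "c \<in> gcells M n" "c' \<in> gcells M n" "z \<in> cellset M c" "z \<in> cellset M c'"
  shows "cmeet c c' \<in> gcells M n"
proof -
  have "max (fst c i) (fst c' i) \<le> min (snd c i) (snd c' i)" for i
  proof -
    have "real (fst c i) \<le> snd c' i" "real (fst c' i) \<le> snd c i"
      using cellsetD[OF assms(3), of i] cellsetD[OF assms(4), of i] by linarith+
    then show ?thesis using gcellsD(1)[OF assms(1), of i] gcellsD(1)[OF assms(2), of i] by simp
  qed
  moreover have "min (snd c i) (snd c' i) \<le> Suc (max (fst c i) (fst c' i))"
    "min (snd c i) (snd c' i) \<le> (if i < n then M else 0)" for i
    using gcellsD(2,3,5)[OF assms(1), of i] by (auto simp: min_le_iff_disj)
  ultimately show ?thesis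
    unfolding gcells_iff cmeet_def fst_conv snd_conv by blast
qed

text \<open>If the intersection still had dimension \<open>d\<close>, it would have the same free
  directions as both cells. Sides have length at most 1, so the cells would then agree in every
  direction.\<close>

lemma cdim_meet_less:
  assumes "c \<in> gcells M n" "c' \<in> gcells M n" "z \<in> cellset M c" "z \<in> cellset M c'"
    "c \<noteq> c'" "cdim c \<le> d" "cdim c' \<le> d"
  shows "cdim (cmeet c c') < d"
proof (rule ccontr)
  assume "\<not> ?thesis"
  then have ge: "d \<le> cdim (cmeet c c')" by simp
  let ?E = "\<lambda>c::gcell. {i. fst c i < snd c i}"
  have m: "cmeet c c' \<in> gcells M n" by (rule cmeet_in[OF assms(1-4)])
  have sub: "?E (cmeet c c') \<subseteq> ?E c" "?E (cmeet c c') \<subseteq> ?E c'"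
    by (auto simp: cmeet_def)
  have e1: "?E (cmeet c c') = ?E c"
    using ge assms(6) by (intro card_seteq[OF finite_free[OF assms(1)] sub(1)]) (simp add: cdim_def)
  have e2: "?E (cmeet c c') = ?E c'"
    using ge assms(7) by (intro card_seteq[OF finite_free[OF assms(2)] sub(2)]) (simp add: cdim_def)
  have "fst c i = fst c' i \<and> snd c i = snd c' i" for i
  proof -
    have a: "fst c i \<le> snd c i" "snd c i \<le> Suc (fst c i)" "fst c' i \<le> snd c' i" "snd c' i \<le> Suc (fst c' i)"
      "max (fst c i) (fst c' i) \<le> min (snd c i) (snd c' i)"
      using gcellsD[OF assms(1), of i] gcellsD[OF assms(2), of i] gcellsD(1)[OF m, of i]
      by (simp_all add: cmeet_def)
    have "fst c i < snd c i \<longleftrightarrow> max (fst c i) (fst c' i) < min (snd c i) (snd c' i)"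
      using e1 by (simp add: cmeet_def set_eq_iff) 
    moreover have "fst c' i < snd c' i \<longleftrightarrow> max (fst c i) (fst c' i) < min (snd c i) (snd c' i)"
      using e2 by (simp add: cmeet_def set_eq_iff)
    ultimately show ?thesis
      using a by linarith
  qed
  then have "c = c'" by (simp add: prod_eq_iff fun_eq_iff)
  with assms(5) show False ..
qed

lemma gset_Int:
  assumes K: "gset M n d K" and L: "gset M n e L"
  shows "gset M n d (K \<inter> L)"
  unfolding gset_def
proof
  fix z assume "z \<in> K \<inter> L"
  then obtain c c' where c: "c \<in> gcells M n" "z \<in> cellset M c" "cellset M c \<subseteq> K" "cdim c \<le> d"
    and c': "c' \<in> gcells M n" "z \<in> cellset M c'" "cellset M c' \<subseteq> L"
    using K L unfolding gset_def by blast
  have m: "cmeet c c' \<in> gcells M n" using cmeet_in c c' by blast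
  have "{i. fst (cmeet c c') i < snd (cmeet c c') i} \<subseteq> {i. fst c i < snd c i}"
    by (auto simp: cmeet_def)
  then have "cdim (cmeet c c') \<le> cdim c"
    unfolding cdim_def by (rule card_mono[OF finite_free[OF c(1)]])
  then show "\<exists>c\<in>gcells M n. z \<in> cellset M c \<and> cellset M c \<subseteq> K \<inter> L \<and> cdim c \<le> d"
    using m c c' cellset_meet[of M c c'] by (intro bexI[of _ "cmeet c c'"]) auto
qed

lemma closed_gset:
  assumes "gset M n d K"
  shows "closed K"
proof -
  have "K = (\<Union>c\<in>{c \<in> gcells M n. cellset M c \<subseteq> K}. cellset M c)"
    using assms unfolding gset_def by blast
  moreover have "closed \<dots>"
    by (rule closed_UN) (use finite_gcells closed_cellset in auto)
  ultimately show ?thesis by simp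
qed

lemma gset_subset_bx: "0 < M \<Longrightarrow> gset M n d K \<Longrightarrow> K \<subseteq> bx n"
  unfolding gset_def using cellset_subset_bx by blast

text \<open>Rounding down and up gives the smallest cell around \<open>z\<close>. It is degenerate
  in each direction where \<open>M * z i\<close> is an integer, and therefore the cell of a boundary
  point lies in the boundary.\<close>

definition carrier_cell :: "nat \<Rightarrow> (nat \<Rightarrow> real) \<Rightarrow> gcell" where
  "carrier_cell M z = (\<lambda>i. nat \<lfloor>real M * z i\<rfloor>, \<lambda>i. nat \<lceil>real M * z i\<rceil>)"

lemma carrier_cell:
  assumes "z \<in> bx n"
  shows "carrier_cell M z \<in> gcells M n" "z \<in> cellset M (carrier_cell M z)"
proof -
  have z: "0 \<le> z i" "z i \<le> (if i < n then 1 else 0)" for i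
    using assms by (cases "i < n"; simp add: bx_def)+
  have b: "0 \<le> real M * z i" "real M * z i \<le> (if i < n then real M else 0)" for i
    using z[of i] mult_left_mono[OF z(2)[of i], of "real M"] by (auto split: if_splits)
  have "nat \<lfloor>real M * z i\<rfloor> \<le> nat \<lceil>real M * z i\<rceil>" for i by linarith
  moreover have "nat \<lceil>real M * z i\<rceil> \<le> Suc (nat \<lfloor>real M * z i\<rfloor>)" for i
    using b(1)[of i] by linarith
  moreover have "nat \<lceil>real M * z i\<rceil> \<le> (if i < n then M else 0)" for i
    using b(2)[of i] by (auto simp: ceiling_le_iff nat_le_iff split: if_splits)
  ultimately show "carrier_cell M z \<in> gcells M n"
    by (simp add: gcells_iff carrier_cell_def)
  show "z \<in> cellset M (carrier_cell M z)"
    using b by (auto simp: cellset_def carrier_cell_def of_nat_nat of_nat_ceiling)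
qed

lemma gset_bx: "0 < M \<Longrightarrow> gset M n n (bx n)"
  unfolding gset_def using carrier_cell cellset_subset_bx cdim_le by blast

lemma gset_bdy:
  assumes "0 < M"
  shows "gset M n n (bdy n)"
  unfolding gset_def
proof
  fix z assume z: "z \<in> bdy n"
  then obtain i where i: "i < n" "z i = 0 \<or> z i = 1" by (auto simp: bdy_def)
  have c: "carrier_cell M z \<in> gcells M n" "z \<in> cellset M (carrier_cell M z)"
    using carrier_cell z by blast+
  have "cellset M (carrier_cell M z) \<subseteq> bdy n"
  proof
    fix w assume w: "w \<in> cellset M (carrier_cell M z)"
    have "w i = 0 \<or> w i = 1"
      using i(2) cellsetD[OF w, of i] assms by (auto simp: carrier_cell_def mult_le_0_iff zero_le_mult_iff)
    with i w show "w \<in> bdy n" using cellset_subset_bx[OF assms c(1)] by (auto simp: bdy_def)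
  qed
  with c cdim_le show "\<exists>c\<in>gcells M n. z \<in> cellset M c \<and> cellset M c \<subseteq> bdy n \<and> cdim c \<le> n" by blast
qed

section \<open>Extending lifts cell by cell\<close>

definition cell_bdy :: "nat \<Rightarrow> gcell \<Rightarrow> (nat \<Rightarrow> real) set" where
  "cell_bdy M c = {z \<in> cellset M c. \<exists>i. fst c i < snd c i \<and>
     (real M * z i = real (fst c i) \<or> real M * z i = real (snd c i))}"

text \<open>An enumeration \<open>e\<close> of the free directions and a rescaling identify the cell
  with the cube of dimension \<open>cdim c\<close>.\<close>

lemma lifts_cell:
  assumes M: "0 < M" and c: "c \<in> gcells M n" and l: "lifts X Y f (bx (cdim c)) (bdy (cdim c))"
  shows "lifts X Y f (cellset M c) (cell_bdy M c)"
proof -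
  let ?E = "{i. fst c i < snd c i}" and ?j = "cdim c"
  obtain e where e: "bij_betw e {0..<card ?E} ?E"
    using ex_bij_betw_nat_finite[OF finite_free[OF c]] by blast
  define ei where "ei = inv_into {0..<?j} e"
  have e: "bij_betw e {0..<?j} ?E" using e by (simp add: cdim_def)
  have eE: "fst c (e r) < snd c (e r)" if "r < ?j" for r
    using bij_betwE[OF e] that by auto
  have ei: "ei (e r) = r" if "r < ?j" for r
    using e that unfolding ei_def by (intro inv_into_f_f) (auto simp: bij_betw_def)
  have ei2: "ei i < ?j" "e (ei i) = i" if "fst c i < snd c i" for i
  proof -
    have "i \<in> e ` {0..<?j}" using e that by (auto simp: bij_betw_def)
    then show "ei i < ?j" "e (ei i) = i"
      unfolding ei_def using inv_into_into[of i e "{0..<?j}"] f_inv_into_f[of i e "{0..<?j}"] by auto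
  qed
  have su: "snd c i = Suc (fst c i)" if "fst c i < snd c i" for i
    using gcellsD(2)[OF c, of i] that by simp
  have nsu: "snd c i = fst c i" if "\<not> fst c i < snd c i" for i
    using gcellsD(1)[OF c, of i] that by simp
  define \<phi> where "\<phi> z = (\<lambda>r. if r < ?j then real M * z (e r) - real (fst c (e r)) else 0)" for z
  define \<psi> where "\<psi> w = (\<lambda>i. (real (fst c i) + (if fst c i < snd c i then w (ei i) else 0)) / real M)"
    for w :: "nat \<Rightarrow> real"
  have cs: "z \<in> cellset M c \<longleftrightarrow> (\<forall>i. real (fst c i) \<le> real M * z i \<and> real M * z i \<le> real (snd c i))" for z
    by (simp add: cellset_def)
  have M\<psi>: "real M * \<psi> w i = real (fst c i) + (if fst c i < snd c i then w (ei i) else 0)" for w i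
    using M by (simp add: \<psi>_def)
  have \<phi>_in: "\<phi> z \<in> bx ?j" if "z \<in> cellset M c" for z
  proof -
    have "0 \<le> \<phi> z r \<and> \<phi> z r \<le> 1" if "r < ?j" for r
      using cellsetD[OF \<open>z \<in> cellset M c\<close>, of "e r"] su[OF eE[OF that]] that
      by (simp add: \<phi>_def)
    then show ?thesis by (simp add: bx_def \<phi>_def)
  qed
  have \<psi>_in: "\<psi> w \<in> cellset M c" if "w \<in> bx ?j" for w
    unfolding cs
  proof
    fix i
    show "real (fst c i) \<le> real M * \<psi> w i \<and> real M * \<psi> w i \<le> real (snd c i)"
    proof (cases "fst c i < snd c i")
      case True
      have "0 \<le> w (ei i) \<and> w (ei i) \<le> 1"
        using \<open>w \<in> bx ?j\<close> ei2(1)[OF True] by (simp add: bx_def)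
      with True su[OF True] show ?thesis by (simp add: M\<psi>)
    next
      case False
      with nsu[OF False] show ?thesis by (simp add: M\<psi>)
    qed
  qed
  show ?thesis
  proof (rule lifts_homeo[OF l, where \<phi>=\<phi> and \<psi>=\<psi>])
    show "continuous_on (cellset M c) \<phi>"
    proof (rule continuous_on_coordinatewise_then_product)
      show "continuous_on (cellset M c) (\<lambda>z. \<phi> z r)" for r
        by (cases "r < ?j") (auto simp: \<phi>_def intro!: continuous_intros)
    qed
    show "continuous_on (bx ?j) \<psi>"
    proof (rule continuous_on_coordinatewise_then_product)
      show "continuous_on (bx ?j) (\<lambda>w. \<psi> w i)" for i
        using M by (cases "fst c i < snd c i") (auto simp: \<psi>_def intro!: continuous_intros)
    qed
    show "\<phi> z \<in> bx ?j" if "z \<in> cellset M c" for z using \<phi>_in[OF that] .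
    show "\<psi> w \<in> cellset M c" if "w \<in> bx ?j" for w using \<psi>_in[OF that] .
    show "\<phi> z \<in> bdy ?j" if z: "z \<in> cell_bdy M c" for z
    proof -
      obtain i where i: "fst c i < snd c i" "real M * z i = fst c i \<or> real M * z i = snd c i"
        using z by (auto simp: cell_bdy_def)
      then have "\<phi> z (ei i) = 0 \<or> \<phi> z (ei i) = 1"
        using ei2[OF i(1)] su[OF i(1)] by (auto simp: \<phi>_def)
      then show ?thesis
        using \<phi>_in[of z] z ei2(1)[OF i(1)] by (auto simp: bdy_def cell_bdy_def)
    qed
    show "\<psi> w \<in> cell_bdy M c" if w: "w \<in> bdy ?j" for w
    proof -
      obtain r where r: "r < ?j" "w r = 0 \<or> w r = 1"
        using w by (auto simp: bdy_def)
      then have "real M * \<psi> w (e r) = fst c (e r) \<or> real M * \<psi> w (e r) = snd c (e r)"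
        using eE[OF r(1)] su[OF eE[OF r(1)]] ei[OF r(1)] by (auto simp: M\<psi>)
      then show ?thesis
        using \<psi>_in[of w] w eE[OF r(1)] by (auto simp: cell_bdy_def)
    qed
    show "\<psi> (\<phi> z) = z" if "z \<in> cellset M c" for z
    proof
      fix i
      show "\<psi> (\<phi> z) i = z i"
      proof (cases "fst c i < snd c i")
        case True
        then show ?thesis using ei2[OF True] M by (simp add: \<psi>_def \<phi>_def)
      next
        case False
        then have "real M * z i = fst c i"
          using that nsu[OF False] unfolding cs by (metis antisym)
        then show ?thesis using False M by (simp add: \<psi>_def field_simps)
      qed
    qed
    show "\<phi> (\<psi> w) = w" if "w \<in> bx ?j" for w
    proof
      fix r show "\<phi> (\<psi> w) r = w r"
        using that eE[of r] ei[of r] by (simp add: \<phi>_def M\<psi> bx_def)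
    qed
  qed (use bdy_subset in \<open>auto simp: cell_bdy_def\<close>)
qed

text \<open>The usual induction over the cells of a relative complex, here on the number of cells of
  dimension at most \<open>d\<close> that are still missing from \<open>L\<close>.\<close>

lemma lifts_gset:
  assumes M: "0 < M" and l: "\<And>j. j \<le> d \<Longrightarrow> lifts X Y f (bx j) (bdy j)"
    and K: "gset M n d K" and L: "gset M n n L" "L \<subseteq> K"
  shows "lifts X Y f K L"
  using L
proof (induction "card {c \<in> gcells M n. cellset M c \<subseteq> K \<and> cdim c \<le> d \<and> \<not> cellset M c \<subseteq> L}"
    arbitrary: L rule: less_induct)
  case (less P)
  define S where "S P = {c \<in> gcells M n. cellset M c \<subseteq> K \<and> cdim c \<le> d \<and> \<not> cellset M c \<subseteq> P}" for P
  have fin: "finite (S P)" for P using finite_gcells[of M n] by (simp add: S_def)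
  show ?case
  proof (cases "S P = {}")
    case True
    then have "K \<subseteq> P" using K unfolding gset_def S_def by blast
    then have "K = P" using less.prems by blast
    then show ?thesis using lifts_refl by blast
  next
    case False
    \<comment> \<open>In a missing cell of least dimension all proper faces are already present, so
      the part of it that lies in \<open>P\<close> contains its boundary.\<close>
    then obtain c where c: "c \<in> S P" and min: "\<And>c'. c' \<in> S P \<Longrightarrow> cdim c \<le> cdim c'"
      using arg_min_if_finite(1)[OF fin[of P], of cdim] arg_min_least[OF fin[of P], of _ cdim] by blast
    have cc: "c \<in> gcells M n" "cellset M c \<subseteq> K" "cdim c \<le> d" "\<not> cellset M c \<subseteq> P" using c by (auto simp: S_def)
    let ?Q = "cellset M c"
    have face: "cellset M c' \<subseteq> P"
      if "c' \<in> gcells M n" "cellset M c' \<subseteq> ?Q" "cdim c' < cdim c" for c'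
    proof (rule ccontr)
      assume "\<not> ?thesis"
      with that cc have "c' \<in> S P" by (auto simp: S_def)
      with min[OF this] that(3) show False by simp
    qed
    have "?Q \<inter> P = cell_bdy M c"
    proof (intro subset_antisym subsetI)
      fix z assume z: "z \<in> cell_bdy M c"
      then have zQ: "z \<in> ?Q" by (simp add: cell_bdy_def)
      obtain i where i: "fst c i < snd c i" "real M * z i = fst c i \<or> real M * z i = snd c i"
        using z by (auto simp: cell_bdy_def)
      define v where "v = (if real M * z i = fst c i then fst c i else snd c i)"
      define c' where "c' = ((fst c)(i := v), (snd c)(i := v))"
      have v: "fst c i \<le> v" "v \<le> snd c i" "real M * z i = v" using i by (auto simp: v_def)
      have c': "c' \<in> gcells M n"
        using gcellsD[OF cc(1)] v(1,2) unfolding gcells_iff c'_def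
        by (auto intro: order_trans[OF v(2)])
      have "{j. fst c' j < snd c' j} \<subset> {j. fst c j < snd c j}"
        using i(1) by (auto simp: c'_def split: if_splits)
      then have "cdim c' < cdim c"
        unfolding cdim_def by (rule psubset_card_mono[OF finite_free[OF cc(1)]])
      moreover have "cellset M c' \<subseteq> ?Q"
        using v(1,2) by (force simp: cellset_def c'_def split: if_splits)
      moreover have "z \<in> cellset M c'"
        using zQ v(3) by (auto simp: cellset_def c'_def)
      ultimately show "z \<in> ?Q \<inter> P" using face[OF c'] zQ by blast
    next
      fix z assume z: "z \<in> ?Q \<inter> P"
      show "z \<in> cell_bdy M c"
      proof (rule ccontr)
        assume "z \<notin> cell_bdy M c"
        with z have int: "fst c i < real M * z i" "real M * z i < snd c i" if "fst c i < snd c i" for i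
          using that unfolding cell_bdy_def cellset_def by (force simp: less_le)+
        obtain c'' where c'': "c'' \<in> gcells M n" "z \<in> cellset M c''" "cellset M c'' \<subseteq> P"
          using less.prems(1) z unfolding gset_def by blast
        \<comment> \<open>Conversely, if \<open>P\<close> contains an interior point of
          \<open>?Q\<close>, then a cell of \<open>P\<close> around this point has integral corners
          and so contains all of \<open>?Q\<close>.\<close>
        have "fst c'' i \<le> fst c i \<and> snd c i \<le> snd c'' i" for i
        proof -
          have b: "real (fst c'' i) \<le> real M * z i" "real M * z i \<le> real (snd c'' i)"
              "real (fst c i) \<le> real M * z i" "real M * z i \<le> real (snd c i)"
            using c''(2) z by (auto simp: cellset_def)
          have g: "fst c i \<le> snd c i" "snd c i \<le> Suc (fst c i)"
            using gcellsD[OF cc(1), of i] by auto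
          show ?thesis
          proof (cases "fst c i < snd c i")
            case True
            then have "real (fst c'' i) < real (snd c i)" "real (fst c i) < real (snd c'' i)"
              using int[OF True] b by linarith+
            then show ?thesis using g True by simp
          next
            case False
            with g b show ?thesis by simp
          qed
        qed
        then have "?Q \<subseteq> cellset M c''"
          unfolding cellset_def by (fastforce intro: order_trans[OF of_nat_mono] order_trans[OF _ of_nat_mono])
        with c''(3) cc(4) show False by blast
      qed
    qed
    then have "lifts X Y f ?Q (?Q \<inter> P)"
      using lifts_cell[OF M cc(1) l[OF cc(3)]] by simp
    then have "lifts X Y f (P \<union> ?Q) P"
      using closed_gset[OF less.prems(1)] closed_cellset by (intro lifts_Un)
    moreover have "lifts X Y f K (P \<union> ?Q)"
    proof (rule less.hyps)
      have "S (P \<union> ?Q) \<subseteq> S P" by (auto simp: S_def)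
      moreover have "c \<notin> S (P \<union> ?Q)" by (simp add: S_def)
      ultimately have "S (P \<union> ?Q) \<subset> S P" using c by blast
      then show "card {c \<in> gcells M n. cellset M c \<subseteq> K \<and> cdim c \<le> d \<and> \<not> cellset M c \<subseteq> P \<union> ?Q}
          < card {c \<in> gcells M n. cellset M c \<subseteq> K \<and> cdim c \<le> d \<and> \<not> cellset M c \<subseteq> P}"
        using psubset_card_mono[OF fin] by (simp add: S_def)
      show "gset M n n (P \<union> ?Q)"
        using gset_Un[OF less.prems(1) gset_cell[OF cc(1) cdim_le[OF cc(1)]]] .
      show "P \<union> ?Q \<subseteq> K" using cc(2) less.prems(2) by blast
    qed
    ultimately show ?thesis
      using cc(2) less.prems(2) lifts_trans[of X Y f "P \<union> ?Q" P K] by simp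
  qed
qed

section \<open>Fine grids and pushing neighbourhoods into cells\<close>

text \<open>The factor 2 is the sum of the weights \<open>(1/2)^n\<close> in the product
  metric.\<close>

lemma dist_fun_le:
  fixes x y :: "nat \<Rightarrow> real"
  assumes "\<And>i. \<bar>x i - y i\<bar> \<le> e"
  shows "dist x y \<le> 2 * e"
proof -
  have s: "summable (\<lambda>n. (1/2)^n * e)" "suminf (\<lambda>n. (1/2)^n * e) = 2 * e"
    using sums_mult2[OF geometric_sums[of "1/2::real"], of e] by (simp_all add: sums_iff)
  have t: "(1/2)^n * min (dist (x (from_nat n)) (y (from_nat n))) 1 \<le> (1/2)^n * e" for n
    using assms[of "from_nat n"] by (intro mult_left_mono) (auto simp: dist_real_def)
  have "summable (\<lambda>n. (1/2)^n * min (dist (x (from_nat n)) (y (from_nat n))) 1)"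
    by (rule summable_comparison_test[OF _ s(1)]) (use t in auto)
  then have "dist x y \<le> suminf (\<lambda>n. (1/2)^n * e)"
    unfolding dist_fun_def by (intro suminf_le t s(1))
  with s(2) show ?thesis by simp
qed

lemma fine_grid:
  assumes op: "\<And>W. W \<in> \<W> \<Longrightarrow> openin (top_of_set (bx n)) W" and cov: "bx n \<subseteq> \<Union>\<W>"
  obtains M where "0 < M" "\<And>c. c \<in> gcells M n \<Longrightarrow> \<exists>W\<in>\<W>. cellset M c \<subseteq> W"
proof -
  let ?G = "{T. open T \<and> (\<exists>W\<in>\<W>. bx n \<inter> T \<subseteq> W)}"
  have "bx n \<subseteq> \<Union>?G"
  proof
    fix z assume "z \<in> bx n"
    then obtain W where W: "W \<in> \<W>" "z \<in> W" using cov by blast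
    then obtain T where "open T" "W = bx n \<inter> T" using op[OF W(1)] by (auto simp: openin_open)
    with W show "z \<in> \<Union>?G" by blast
  qed
  then obtain e where e: "0 < e" "\<And>z. z \<in> bx n \<Longrightarrow> \<exists>G\<in>?G. ball z e \<subseteq> G"
    using Heine_Borel_lemma[OF compact_bx, of n ?G] by blast
  \<comment> \<open>A cell has sides of length at most \<open>1 / M\<close>, so its points are at
    product distance at most \<open>2 / M\<close> from its lower corner; this must be less than the
    Lebesgue number \<open>e\<close>.\<close>
  obtain M :: nat where M: "2 / e < M" "0 < M"
    using reals_Archimedean2[of "max (2/e) 1"] by (metis max_less_iff_conj of_nat_0_less_iff zero_less_one less_trans)
  show thesis
  proof (rule that[OF M(2)])
    fix c assume c: "c \<in> gcells M n"
    define z where "z = (\<lambda>i. real (fst c i) / real M)"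
    have "z \<in> cellset M c" using c M(2) by (auto simp: z_def cellset_def gcells_iff)
    then have zb: "z \<in> bx n" using cellset_subset_bx[OF M(2) c] by blast
    then obtain G W where G: "ball z e \<subseteq> G" "W \<in> \<W>" "bx n \<inter> G \<subseteq> W" using e(2) by blast
    have "cellset M c \<subseteq> ball z e"
    proof
      fix w assume w: "w \<in> cellset M c"
      have "\<bar>z i - w i\<bar> \<le> 1 / M" for i
      proof -
        have "real (fst c i) \<le> real M * w i" "real M * w i \<le> real (fst c i) + 1"
          using cellsetD[OF w, of i] gcellsD(2)[OF c, of i] by linarith+
        moreover have "real M * z i = real (fst c i)" using M(2) by (simp add: z_def)
        ultimately have "\<bar>real M * z i - real M * w i\<bar> \<le> 1" by linarith
        then have "real M * \<bar>z i - w i\<bar> \<le> 1" by (simp add: abs_mult flip: right_diff_distrib)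
        then show ?thesis using M(2) by (simp add: field_simps)
      qed
      then have "dist z w \<le> 2 * (1 / M)" by (rule dist_fun_le)
      also have "\<dots> < e" using M e(1) by (simp add: field_simps)
      finally show "w \<in> ball z e" by simp
    qed
    with G cellset_subset_bx[OF M(2) c] show "\<exists>W\<in>\<W>. cellset M c \<subseteq> W" by blast
  qed
qed

text \<open>\<open>collapse M\<close> maps each cell of the grid of mesh \<open>1 / M\<close> to itself and the \<open>1 / (4 * M)\<close>-neighbourhood of a cell
  into that cell.\<close>

definition step_fun :: "nat \<Rightarrow> real \<Rightarrow> real" where
  "step_fun M x = (\<Sum>k<M. max 0 (min 1 (2 * (x - real k) - 1/2)))"

definition collapse :: "nat \<Rightarrow> (nat \<Rightarrow> real) \<Rightarrow> nat \<Rightarrow> real" where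
  "collapse M z = (\<lambda>i. step_fun M (real M * z i) / real M)"

lemma step_fun_mono: "x \<le> y \<Longrightarrow> step_fun M x \<le> step_fun M y"
  unfolding step_fun_def by (intro sum_mono) auto

text \<open>The summand with index \<open>k\<close> rises from 0 at \<open>k + 1/4\<close> to 1 at
  \<open>k + 3/4\<close>, so the sum has plateaus of radius \<open>1/4\<close> around the integers
  from 0 to \<open>M\<close>.\<close>

lemma step_fun_near:
  assumes "k \<le> M" "real k - 1/4 \<le> x" "x \<le> real k + 1/4"
  shows "step_fun M x = real k"
proof -
  have "step_fun M x = (\<Sum>j<M. if j < k then 1 else 0)"
    unfolding step_fun_def
  proof (rule sum.cong)
    fix j assume "j \<in> {..<M}"
    show "max 0 (min 1 (2 * (x - real j) - 1/2)) = (if j < k then 1 else 0)"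
    proof (cases "j < k")
      case True
      then have "real j + 1 \<le> real k" by linarith
      then show ?thesis using True assms by auto
    next
      case False
      then have "real k \<le> real j" by simp
      then show ?thesis using False assms by auto
    qed
  qed simp
  also have "\<dots> = real (card {j \<in> {..<M}. j < k})"
    by (simp add: sum.If_cases Int_def)
  also have "{j \<in> {..<M}. j < k} = {..<k}" using assms(1) by auto
  finally show ?thesis by simp
qed

lemma continuous_on_collapse: "continuous_on S (collapse M)"
  unfolding collapse_def
proof (rule continuous_on_coordinatewise_then_product)
  show "continuous_on S (\<lambda>z. step_fun M (real M * z i) / real M)" for i
    unfolding step_fun_def divide_inverse by (intro continuous_intros)
qed

lemma collapse_near:
  assumes M: "0 < M" and c: "c \<in> gcells M n"
    and z: "\<And>i. real (fst c i) - 1/4 \<le> real M * z i" "\<And>i. real M * z i \<le> real (snd c i) + 1/4"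
  shows "collapse M z \<in> cellset M c"
proof -
  have "real (fst c i) \<le> step_fun M (real M * z i)" "step_fun M (real M * z i) \<le> real (snd c i)" for i
  proof -
    note le = gcellsD(3,4)[OF c, of i]
    show "real (fst c i) \<le> step_fun M (real M * z i)"
      using step_fun_mono[OF z(1)[of i], of M] step_fun_near[OF le(2), of "real (fst c i) - 1/4"] by simp
    show "step_fun M (real M * z i) \<le> real (snd c i)"
      using step_fun_mono[OF z(2)[of i], of M] step_fun_near[OF le(1), of "real (snd c i) + 1/4"] by simp
  qed
  then show ?thesis using M by (simp add: cellset_def collapse_def)
qed

lemma collapse_cell:
  assumes "0 < M" "c \<in> gcells M n" "z \<in> cellset M c"
  shows "collapse M z \<in> cellset M c"
proof (rule collapse_near[OF assms(1,2)])
  show "real (fst c i) - 1/4 \<le> real M * z i" "real M * z i \<le> real (snd c i) + 1/4" for i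
    using cellsetD[OF assms(3), of i] by linarith+
qed

lemma collapse_gset:
  assumes "0 < M" "gset M n d K" "z \<in> K"
  shows "collapse M z \<in> K"
  using assms collapse_cell unfolding gset_def by blast

text \<open>Cells are convex and preserved by \<open>collapse M\<close>, so the linear homotopy from
  the identity stays in each of them.\<close>

lemma collapse_homotopy_gset:
  assumes "0 < M" "gset M n d K" "z \<in> K" "t \<in> {0..1}"
  shows "(\<lambda>i. (1 - t) * z i + t * collapse M z i) \<in> K"
proof -
  obtain c where c: "c \<in> gcells M n" "z \<in> cellset M c" "cellset M c \<subseteq> K"
    using assms(2,3) unfolding gset_def by blast
  have cz: "collapse M z \<in> cellset M c" by (rule collapse_cell[OF assms(1) c(1,2)])
  have "real (fst c i) \<le> real M * ((1 - t) * z i + t * collapse M z i)"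
    "real M * ((1 - t) * z i + t * collapse M z i) \<le> real (snd c i)" for i
  proof -
    have e: "real M * ((1 - t) * z i + t * collapse M z i) = (1 - t) * (real M * z i) + t * (real M * collapse M z i)"
      by (simp add: algebra_simps)
    have b: "real (fst c i) \<le> real M * z i" "real M * z i \<le> real (snd c i)"
      "real (fst c i) \<le> real M * collapse M z i" "real M * collapse M z i \<le> real (snd c i)"
      using c(2) cz by (auto simp: cellset_def)
    have "(1 - t) * real (fst c i) + t * real (fst c i) \<le> (1 - t) * (real M * z i) + t * (real M * collapse M z i)"
      using b assms(4) by (intro add_mono mult_left_mono) auto
    then show "real (fst c i) \<le> real M * ((1 - t) * z i + t * collapse M z i)"
      unfolding e by (simp add: algebra_simps)
    have "(1 - t) * (real M * z i) + t * (real M * collapse M z i) \<le> (1 - t) * real (snd c i) + t * real (snd c i)"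
      using b assms(4) by (intro add_mono mult_left_mono) auto
    then show "real M * ((1 - t) * z i + t * collapse M z i) \<le> real (snd c i)"
      unfolding e by (simp add: algebra_simps)
  qed
  then show ?thesis using c(3) by (auto simp: cellset_def)
qed

text \<open>In units of the coarse grid, two points of one fine cell differ by at most
  \<open>1/4\<close> in each coordinate. This is the radius of the plateaus, and the reason for the
  factor 4.\<close>

lemma collapse_neighbour:
  assumes M: "0 < M" and K: "gset M n d K" and c: "c \<in> gcells (4 * M) n"
    and w: "w \<in> cellset (4 * M) c" "w \<in> K" and z: "z \<in> cellset (4 * M) c"
  shows "collapse M z \<in> K"
proof -
  obtain b where b: "b \<in> gcells M n" "w \<in> cellset M b" "cellset M b \<subseteq> K"
    using K w(2) unfolding gset_def by blast
  have "collapse M z \<in> cellset M b"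
  proof (rule collapse_near[OF M b(1)])
    fix i
    have "real (fst c i) \<le> 4 * (real M * w i)" "4 * (real M * w i) \<le> real (snd c i)"
      "real (fst c i) \<le> 4 * (real M * z i)" "4 * (real M * z i) \<le> real (snd c i)"
      "real (fst b i) \<le> real M * w i" "real M * w i \<le> real (snd b i)"
      using w(1) z b(2) by (auto simp: cellset_def mult.assoc)
    moreover have "real (snd c i) \<le> real (fst c i) + 1"
      using gcellsD(2)[OF c, of i] by linarith
    ultimately show "real (fst b i) - 1/4 \<le> real M * z i" "real M * z i \<le> real (snd b i) + 1/4"
      by linarith+
  qed
  with b(3) show ?thesis by blast
qed

section \<open>The geometric realisation\<close>

lemma simplex_space_eq: "simplex_space p = top_of_set (standard_simplex p)"
  by (simp add: simplex_space_def euclidean_product_topology)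

lemma compact_Hausdorff_simplex_space:
  "compact_space (simplex_space p)" "Hausdorff_space (simplex_space p)"
proof -
  show "compact_space (simplex_space p)"
    unfolding simplex_space_def
    using compactin_standard_simplex by (simp add: compact_space_subtopology)
  show "Hausdorff_space (simplex_space p)"
    unfolding simplex_space_eq by (simp add: Hausdorff_space_subtopology)
qed

text \<open>Around a point of a k-open set \<open>W\<close>, choose a closed neighbourhood
  \<open>D\<close> of its second component inside the slice of \<open>W\<close>. By the tube lemma,
  applied after pulling back to a test space, the set of all \<open>x\<close> with
  \<open>{x} \<times> D \<subseteq> W\<close> is k-open, hence open in \<open>X\<close>. The
  realisation is thus built from ordinary products with simplices.\<close>

lemma k_prod_topology_eq:
  fixes X :: "'a topology" and Y :: "'b topology"
  assumes X: "compactly_generated X" and Y: "compact_space Y" "Hausdorff_space Y"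
  shows "k_prod_topology X Y = prod_topology X Y"
proof -
  have "openin (prod_topology X Y) W" if kW: "k_open (prod_topology X Y) W" for W
  proof (subst openin_subopen, intro ballI)
    fix w assume w: "w \<in> W"
    have Wsub: "W \<subseteq> topspace X \<times> topspace Y"
      using kW unfolding k_open_def by simp
    obtain x0 y0 where w0: "w = (x0, y0)" "x0 \<in> topspace X" "y0 \<in> topspace Y"
      using w Wsub by auto
    have "continuous_map Y (prod_topology X Y) (\<lambda>y. (x0, y))"
      using w0 by (intro continuous_map_pairedI) auto
    from k_open_test[OF kW Y this]
    have S: "openin Y {y \<in> topspace Y. (x0, y) \<in> W}" .
    have "neighbourhood_base_of (closedin Y) Y"
      using compact_Hausdorff_imp_regular_space[OF Y] neighbourhood_base_of_closedin by blast
    then obtain N D where ND: "openin Y N" "closedin Y D" "y0 \<in> N" "N \<subseteq> D" "D \<subseteq> {y \<in> topspace Y. (x0, y) \<in> W}"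
      using S w w0 unfolding neighbourhood_base_of by (metis (mono_tags, lifting) mem_Collect_eq)
    have Dc: "compactin Y D" using ND(2) Y(1) closedin_compact_space by blast
    define B where "B = {x \<in> topspace X. {x} \<times> D \<subseteq> W}"
    have "k_open X B"
      unfolding k_open_def
    proof (intro conjI allI impI)
      show "B \<subseteq> topspace X" by (auto simp: B_def)
      fix K :: "(nat \<times> 'a) set set topology" and u
      assume K: "compact_space K \<and> Hausdorff_space K \<and> continuous_map K X u"
      have "continuous_map (prod_topology K Y) X (\<lambda>v. u (fst v))"
        using K continuous_map_compose[OF continuous_map_fst, of K X u Y] by (simp add: o_def)
      then have c: "continuous_map (prod_topology K Y) (prod_topology X Y) (\<lambda>v. (u (fst v), snd v))"
        by (intro continuous_map_pairedI continuous_map_snd)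
      \<comment> \<open>The product of \<open>K\<close> and \<open>Y\<close> is a test space on
        another type than the definition of \<open>k_open\<close> allows, so
        \<open>k_open_test\<close> is called for.\<close>
      have V: "openin (prod_topology K Y) {v \<in> topspace (prod_topology K Y). (u (fst v), snd v) \<in> W}"
        using K Y by (intro k_open_test[OF kW _ _ c])
          (auto simp: compact_space_prod_topology Hausdorff_space_prod_topology)
      show "openin K {z \<in> topspace K. u z \<in> B}"
      proof (subst openin_subopen, intro ballI)
        fix z assume z: "z \<in> {z \<in> topspace K. u z \<in> B}"
        then have "{z} \<times> D \<subseteq> {v \<in> topspace (prod_topology K Y). (u (fst v), snd v) \<in> W}"
          using ND(5) by (auto simp: B_def)
        then obtain U' V' where U': "openin K U'" "z \<in> U'" "D \<subseteq> V'"
          "U' \<times> V' \<subseteq> {v \<in> topspace (prod_topology K Y). (u (fst v), snd v) \<in> W}"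
          using tube_lemma_right[OF V Dc, of z] z by blast
        have "U' \<subseteq> {z \<in> topspace K. u z \<in> B}"
        proof
          fix k assume k: "k \<in> U'"
          then have kK: "k \<in> topspace K" using U'(1) openin_subset by blast
          moreover have "(u k, y) \<in> W" if "y \<in> D" for y
          proof -
            have "(k, y) \<in> U' \<times> V'" using U'(3) that k by auto
            then show ?thesis using U'(4) by auto
          qed
          moreover have "u k \<in> topspace X"
            using K kK continuous_map_image_subset_topspace[of K X u] by auto
          ultimately show "k \<in> {z \<in> topspace K. u z \<in> B}" by (simp add: B_def subset_iff)
        qed
        with U' show "\<exists>T. openin K T \<and> z \<in> T \<and> T \<subseteq> {z \<in> topspace K. u z \<in> B}" by blast
      qed
    qed
    then have "openin X B" using X unfolding compactly_generated_def by blast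
    then have "openin (prod_topology X Y) (B \<times> N)"
      using ND(1) by (simp add: openin_prod_Times_iff)
    moreover have "w \<in> B \<times> N" using w0 ND by (auto simp: B_def)
    moreover have "B \<times> N \<subseteq> W" using ND(4) by (auto simp: B_def)
    ultimately show "\<exists>T. openin (prod_topology X Y) T \<and> w \<in> T \<and> T \<subseteq> W" by blast
  qed
  then show ?thesis
    unfolding k_prod_topology_def topology_eq openin_k_ification using openin_imp_k_open by blast
qed

text \<open>\<open>rem i\<close> deletes the \<open>i\<close>-th coordinate; it is left inverse to the coface \<open>simplical_face i\<close>.\<close>

definition rem :: "nat \<Rightarrow> (nat \<Rightarrow> 'a) \<Rightarrow> nat \<Rightarrow> 'a" where
  "rem i t = (\<lambda>j. if j < i then t j else t (Suc j))"

lemma rem_face: "rem i (simplical_face i t) = t"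
  by (auto simp: rem_def simplical_face_def fun_eq_iff)

lemma face_rem: "t i = 0 \<Longrightarrow> simplical_face i (rem i t) = t"
  by (auto simp: rem_def simplical_face_def fun_eq_iff)

lemma rem_rem: "i < j \<Longrightarrow> rem i (rem j t) = rem (j - 1) (rem i t)"
  by (auto simp: rem_def fun_eq_iff)

lemma continuous_on_rem: "continuous_on S (rem i :: (nat \<Rightarrow> real) \<Rightarrow> _)"
proof (rule continuous_on_coordinatewise_then_product)
  show "continuous_on S (\<lambda>t. rem i t j :: real)" for j
    by (cases "j < i") (auto simp: rem_def intro!: continuous_intros)
qed

lemma face_simplex:
  "i \<le> Suc p \<Longrightarrow> t \<in> standard_simplex p \<Longrightarrow> simplical_face i t \<in> standard_simplex (Suc p)"
  using simplical_face_in_standard_simplex[of "Suc p" i t] by simp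

lemma sum_face:
  fixes g :: "'b::comm_monoid_add \<Rightarrow> real"
  assumes "i \<le> Suc q" "g 0 = 0"
  shows "(\<Sum>j\<le>Suc q. g (simplical_face i t j)) = (\<Sum>j\<le>q. g (t j))"
proof -
  define s where "s j = (if j < i then j else Suc j)" for j
  have "inj_on s {..q}" by (auto simp: inj_on_def s_def split: if_splits)
  moreover have "s ` {..q} = {..Suc q} - {i}"
  proof (intro subset_antisym subsetI)
    fix j assume j: "j \<in> {..Suc q} - {i}"
    show "j \<in> s ` {..q}"
    proof (cases "j < i")
      case True
      then show ?thesis using j assms by (intro image_eqI[of _ _ j]) (auto simp: s_def)
    next
      case False
      then show ?thesis using j by (intro image_eqI[of _ _ "j - 1"]) (auto simp: s_def)
    qed
  qed (use assms in \<open>auto simp: s_def split: if_splits\<close>)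
  ultimately have "(\<Sum>j\<in>{..Suc q} - {i}. g (simplical_face i t j)) = (\<Sum>j\<le>q. g (simplical_face i t (s j)))"
    using sum.reindex[of s "{..q}" "\<lambda>j. g (simplical_face i t j)"] by (simp add: o_def)
  also have "\<dots> = (\<Sum>j\<le>q. g (t j))"
    by (rule sum.cong) (auto simp: s_def simplical_face_def)
  finally show ?thesis
    using assms by (subst sum.remove[of _ i]) (auto simp: simplical_face_def)
qed

lemma rem_simplex:
  assumes "t \<in> standard_simplex (Suc p)" "i \<le> Suc p" "t i = 0"
  shows "rem i t \<in> standard_simplex p"
proof -
  have "(\<Sum>j\<le>p. rem i t j) = (\<Sum>j\<le>Suc p. t j)"
    using sum_face[of i p "\<lambda>x. x" "rem i t"] face_rem[of t i] assms by simp
  then show ?thesis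
    using assms by (auto simp: standard_simplex_def rem_def)
qed

text \<open>\<open>dl d R m q x\<close> applies to the \<open>q\<close>-simplex \<open>x\<close> the face maps with indices in \<open>R \<inter> {..<m}\<close>,
  from the largest index to the smallest.\<close>

primrec dl :: "(nat \<Rightarrow> nat \<Rightarrow> 'a \<Rightarrow> 'a) \<Rightarrow> nat set \<Rightarrow> nat \<Rightarrow> nat \<Rightarrow> 'a \<Rightarrow> 'a" where
  "dl d R 0 q x = x"
| "dl d R (Suc m) q x = (if m \<in> R then dl d R m (q - 1) (d q m x) else dl d R m q x)"

text \<open>The indices in \<open>R\<close> other than \<open>i\<close>, renumbered after vertex
  \<open>i\<close> has been removed.\<close>

definition shift :: "nat \<Rightarrow> nat set \<Rightarrow> nat set" where
  "shift i R = {j. if j < i then j \<in> R else Suc j \<in> R}"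

lemma dl_cong: "R \<inter> {..<m} = R' \<inter> {..<m} \<Longrightarrow> dl d R m q x = dl d R' m q x"
proof (induction m arbitrary: q x)
  case (Suc m)
  have h: "j \<in> R \<longleftrightarrow> j \<in> R'" if "j < Suc m" for j
    using arg_cong[OF Suc.prems, of "\<lambda>S. j \<in> S"] that by simp
  then have "R \<inter> {..<m} = R' \<inter> {..<m}" using less_SucI by blast
  then show ?case using Suc.IH h[of m] by simp
qed simp

lemma card_Int_Suc:
  "card (R \<inter> {..<Suc m}) = (if m \<in> R then Suc (card (R \<inter> {..<m})) else card (R \<inter> {..<m}))"
  by (auto simp: lessThan_Suc)

text \<open>By the simplicial identities the face with index \<open>i\<close> may be taken first.
  The carriers \<open>C\<close> leave room to use this for simplices together with barycentric
  coordinates. The bound on the cardinality ensures that the dimension never drops below 0, where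
  natural subtraction would be wrong.\<close>

lemma dl_shift:
  assumes "\<And>q j x. x \<in> C (Suc q) \<Longrightarrow> j \<le> Suc q \<Longrightarrow> d (Suc q) j x \<in> C q"
    and "\<And>q i j x. i < j \<Longrightarrow> j \<le> Suc (Suc q) \<Longrightarrow> x \<in> C (Suc (Suc q)) \<Longrightarrow>
      d (Suc q) i (d (Suc (Suc q)) j x) = d (Suc q) (j - 1) (d (Suc (Suc q)) i x)"
    and "i \<in> R" "i < m" "m \<le> Suc q" "x \<in> C q" "card (R \<inter> {..<m}) \<le> q"
  shows "dl d R m q x = dl d (shift i R) (m - 1) (q - 1) (d q i x)"
  using assms(4-7)
proof (induction m arbitrary: q x)
  case (Suc m)
  show ?case
  proof (cases "i = m")
    case True
    have "R \<inter> {..<m} = shift m R \<inter> {..<m}" by (auto simp: shift_def)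
    then show ?thesis using True \<open>i \<in> R\<close> dl_cong[of R m "shift m R"] by simp
  next
    case False
    then have im: "i < m" using Suc.prems by simp
    then obtain m' where m': "m = Suc m'" by (cases m) auto
    show ?thesis
    proof (cases "m \<in> R")
      case True
      \<comment> \<open>Two different indices are still to be removed, so \<open>q\<close> is at
        least 2 and the simplicial identity is available.\<close>
      have "{i, m} \<subseteq> R \<inter> {..<Suc m}" using True im \<open>i \<in> R\<close> by auto
      then have "card {i, m} \<le> card (R \<inter> {..<Suc m})" by (intro card_mono) auto
      then have "2 \<le> q" using im Suc.prems by simp
      then obtain q' where q: "q = Suc (Suc q')" using le_Suc_ex[of 2 q] by auto
      have x: "x \<in> C (Suc (Suc q'))" using Suc.prems q by simp
      have "dl d R (Suc m) q x = dl d R m (Suc q') (d q m x)" using True q by simp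
      also have "\<dots> = dl d (shift i R) (m - 1) q' (d (Suc q') i (d q m x))"
      proof -
        have "d q m x \<in> C (Suc q')" using assms(1)[of x "Suc q'" m] x q Suc.prems by simp
        moreover have "card (R \<inter> {..<m}) \<le> Suc q'"
          using Suc.prems(4) True q card_Int_Suc[of R m] by simp
        ultimately show ?thesis
          using Suc.IH[of "Suc q'" "d q m x"] im Suc.prems q by simp
      qed
      also have "d (Suc q') i (d q m x) = d (Suc q') (m - 1) (d q i x)"
        using assms(2)[of i m q' x] im x q Suc.prems by simp
      also have "dl d (shift i R) (m - 1) q' (d (Suc q') (m - 1) (d q i x)) =
          dl d (shift i R) m (Suc q') (d q i x)"
        using True im by (simp add: m' shift_def)
      finally show ?thesis using q by simp
    next
      case False
      then have "dl d R (Suc m) q x = dl d (shift i R) (m - 1) (q - 1) (d q i x)"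
        using Suc.IH[of q x] im Suc.prems card_Int_Suc[of R m] by simp
      also have "\<dots> = dl d (shift i R) m (q - 1) (d q i x)"
        using False im by (simp add: m' shift_def)
      finally show ?thesis by simp
    qed
  qed
qed simp

lemma dl_natural:
  assumes "\<And>q j x. x \<in> C (Suc q) \<Longrightarrow> j \<le> Suc q \<Longrightarrow> d (Suc q) j x \<in> C q"
    and "\<And>q j x. x \<in> C (Suc q) \<Longrightarrow> j \<le> Suc q \<Longrightarrow> g q (d (Suc q) j x) = e (Suc q) j (g (Suc q) x)"
    and "m \<le> Suc q" "x \<in> C q" "card (R \<inter> {..<m}) \<le> q"
  shows "g (q - card (R \<inter> {..<m})) (dl d R m q x) = dl e R m q (g q x)"
  using assms(3-5)
proof (induction m arbitrary: q x)
  case (Suc m)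
  show ?case
  proof (cases "m \<in> R")
    case True
    then have c: "card (R \<inter> {..<Suc m}) = Suc (card (R \<inter> {..<m}))" by (simp add: card_Int_Suc)
    then obtain q' where q: "q = Suc q'" using Suc.prems by (cases q) auto
    then have "d q m x \<in> C q'" using assms(1) Suc.prems by simp
    then show ?thesis using Suc.IH[of q' "d q m x"] Suc.prems True c q assms(2)[of x q' m] by simp
  next
    case False
    then show ?thesis using Suc.IH[of q x] Suc.prems card_Int_Suc[of R m] by simp
  qed
qed simp

lemma continuous_map_dl:
  assumes "\<And>q j. j \<le> Suc q \<Longrightarrow> continuous_map (T (Suc q)) (T q) (d (Suc q) j)"
    and "m \<le> Suc q" "card (R \<inter> {..<m}) \<le> q"
  shows "continuous_map (T q) (T (q - card (R \<inter> {..<m}))) (dl d R m q)"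
  using assms(2,3)
proof (induction m arbitrary: q)
  case (Suc m)
  show ?case
  proof (cases "m \<in> R")
    case True
    then have c: "card (R \<inter> {..<Suc m}) = Suc (card (R \<inter> {..<m}))" by (simp add: card_Int_Suc)
    then obtain q' where q: "q = Suc q'" using Suc.prems by (cases q) auto
    have eq: "dl d R (Suc m) q = dl d R m q' \<circ> d q m" "q - card (R \<inter> {..<Suc m}) = q' - card (R \<inter> {..<m})"
      using True q c by (auto simp: fun_eq_iff)
    have "continuous_map (T q) (T q') (d q m)"
      using assms(1)[of m q'] Suc.prems q by simp
    moreover have "continuous_map (T q') (T (q' - card (R \<inter> {..<m}))) (dl d R m q')"
      using Suc.IH[of q'] Suc.prems c q by simp
    ultimately show ?thesis
      unfolding eq by (rule continuous_map_compose)
  next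
    case False
    moreover have "dl d R (Suc m) q = dl d R m q" using False by (auto simp: fun_eq_iff)
    ultimately show ?thesis using Suc.IH[of q] Suc.prems card_Int_Suc[of R m] by simp
  qed
next
  case 0
  have "dl d R 0 q = id" by (simp add: fun_eq_iff)
  then show ?case by (simp add: id_def)
qed

section \<open>The realisation as a quotient\<close>

locale semisimplicial =
  fixes X :: "nat \<Rightarrow> 'a topology" and d :: "nat \<Rightarrow> nat \<Rightarrow> 'a \<Rightarrow> 'a"
  assumes semisimplicial_space: "semisimplicial_space X d"
begin

abbreviation "R \<equiv> realisation X d"

definition cls :: "nat \<Rightarrow> 'a \<Rightarrow> (nat \<Rightarrow> real) \<Rightarrow> (nat \<times> 'a \<times> (nat \<Rightarrow> real)) set" where
  "cls p x t = realisation_rel X d `` {(p, x, t)}"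

lemma continuous_d: "i \<le> Suc p \<Longrightarrow> continuous_map (X (Suc p)) (X p) (d (Suc p) i)"
  using semisimplicial_space by (simp add: semisimplicial_space_def)

lemma d_in: "x \<in> topspace (X (Suc p)) \<Longrightarrow> i \<le> Suc p \<Longrightarrow> d (Suc p) i x \<in> topspace (X p)"
  using continuous_d continuous_map_image_subset_topspace by fastforce

lemma d_d: "i < j \<Longrightarrow> j \<le> Suc (Suc p) \<Longrightarrow> x \<in> topspace (X (Suc (Suc p))) \<Longrightarrow>
    d (Suc p) i (d (Suc (Suc p)) j x) = d (Suc p) (j - 1) (d (Suc (Suc p)) i x)"
  using semisimplicial_space by (simp add: semisimplicial_space_def)

lemma prerealisation_eq:
  "prerealisation X = sum_topology (\<lambda>p. prod_topology (X p) (simplex_space p)) UNIV"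
  using semisimplicial_space
  by (simp add: prerealisation_def k_prod_topology_eq compact_Hausdorff_simplex_space
      semisimplicial_space_def)

lemma topspace_prerealisation:
  "(p, x, t) \<in> topspace (prerealisation X) \<longleftrightarrow> x \<in> topspace (X p) \<and> t \<in> standard_simplex p"
  by (simp add: prerealisation_eq simplex_space_eq)

lemma openin_prerealisation:
  "openin (prerealisation X) U \<longleftrightarrow> U \<subseteq> topspace (prerealisation X) \<and>
    (\<forall>i. openin (prod_topology (X i) (simplex_space i)) {x. (i, x) \<in> U})"
  unfolding prerealisation_eq openin_sum_topology by (simp add: o_def)

lemma refl_rel: "(w, w) \<in> realisation_rel X d"
  by (simp add: realisation_rel_def)

lemma sym_rel: "(v, w) \<in> realisation_rel X d \<Longrightarrow> (w, v) \<in> realisation_rel X d"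
proof -
  have "sym (realisation_gluing X d \<union> (realisation_gluing X d)\<inverse>)"
    by (auto simp: sym_def)
  then have "sym (realisation_rel X d)"
    unfolding realisation_rel_def by (rule sym_rtrancl)
  then show "(v, w) \<in> realisation_rel X d \<Longrightarrow> (w, v) \<in> realisation_rel X d"
    by (rule symD)
qed

lemma trans_rel: "(u, v) \<in> realisation_rel X d \<Longrightarrow> (v, w) \<in> realisation_rel X d \<Longrightarrow> (u, w) \<in> realisation_rel X d"
  unfolding realisation_rel_def by (rule rtrancl_trans)

lemma rel_class_eq: "(v, w) \<in> realisation_rel X d \<Longrightarrow> realisation_rel X d `` {v} = realisation_rel X d `` {w}"
  using sym_rel trans_rel by blast

lemma rel_invariant:
  assumes inv: "\<And>p i x t. i \<le> Suc p \<Longrightarrow> x \<in> topspace (X (Suc p)) \<Longrightarrow> t \<in> standard_simplex p \<Longrightarrow>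
      F (Suc p, x, simplical_face i t) = F (p, d (Suc p) i x, t)"
    and "(v, w) \<in> realisation_rel X d"
  shows "F v = F w"
  using assms(2) unfolding realisation_rel_def
proof (induction rule: rtrancl_induct)
  case (step y z)
  then show ?case using inv by (auto simp: realisation_gluing_def)
qed simp

lemma cls_face:
  assumes "i \<le> Suc p" "x \<in> topspace (X (Suc p))" "t \<in> standard_simplex p"
  shows "cls (Suc p) x (simplical_face i t) = cls p (d (Suc p) i x) t"
  unfolding cls_def
proof (rule rel_class_eq)
  show "((Suc p, x, simplical_face i t), (p, d (Suc p) i x, t)) \<in> realisation_rel X d"
    unfolding realisation_rel_def using assms
    by (intro r_into_rtrancl UnI1) (auto simp: realisation_gluing_def)
qed

lemma topspace_realisation:
  "c \<in> topspace R \<longleftrightarrow> (\<exists>p x t. c = cls p x t \<and> x \<in> topspace (X p) \<and> t \<in> standard_simplex p)"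
proof
  assume "c \<in> topspace R"
  then obtain w where w: "c = realisation_rel X d `` {w}" "w \<in> topspace (prerealisation X)"
    by (auto simp: realisation_def quotient_def)
  then show "\<exists>p x t. c = cls p x t \<and> x \<in> topspace (X p) \<and> t \<in> standard_simplex p"
    using topspace_prerealisation unfolding cls_def by (metis prod_cases3)
next
  assume "\<exists>p x t. c = cls p x t \<and> x \<in> topspace (X p) \<and> t \<in> standard_simplex p"
  then obtain p x t where "c = cls p x t" "(p, x, t) \<in> topspace (prerealisation X)"
    using topspace_prerealisation by blast
  then show "c \<in> topspace R"
    unfolding realisation_def cls_def topspace_quotient_space by (auto intro: quotientI)
qed

lemma cls_in: "x \<in> topspace (X p) \<Longrightarrow> t \<in> standard_simplex p \<Longrightarrow> cls p x t \<in> topspace R"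
  using topspace_realisation by blast

lemma continuous_map_cls:
  "continuous_map (prod_topology (X p) (simplex_space p)) R (\<lambda>w. cls p (fst w) (snd w))"
proof -
  have "continuous_map (prod_topology (X p) (simplex_space p)) (prerealisation X) (\<lambda>w. (p, w))"
    unfolding prerealisation_eq by (rule continuous_map_component_injection) simp
  moreover have "continuous_map (prerealisation X) R (\<lambda>w. realisation_rel X d `` {w})"
    unfolding realisation_def by (rule quotient_imp_continuous_map[OF quotient_map_quotient_space])
  ultimately have "continuous_map (prod_topology (X p) (simplex_space p)) R
      ((\<lambda>w. realisation_rel X d `` {w}) \<circ> (\<lambda>w. (p, w)))"
    by (rule continuous_map_compose)
  then show ?thesis by (simp add: o_def cls_def)
qed

text \<open>An arbitrary choice; \<open>region\<close> supplies the conditions under which a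
  construction does not depend on it.\<close>

definition rep :: "(nat \<times> 'a \<times> (nat \<Rightarrow> real)) set \<Rightarrow> nat \<times> 'a \<times> (nat \<Rightarrow> real)" where
  "rep c = (SOME w. w \<in> c)"

lemma rep_cls: "((p, x, t), rep (cls p x t)) \<in> realisation_rel X d"
proof -
  have "rep (cls p x t) \<in> cls p x t"
    unfolding rep_def by (rule someI[of _ "(p, x, t)"]) (simp add: cls_def refl_rel)
  then show ?thesis by (simp add: cls_def)
qed

text \<open>Functions on an open part of the realisation, with a parameter in the unit interval, are
  obtained from functions on the simplices that respect the gluing.\<close>

lemma region:
  fixes Z :: "'z topology" and D :: "nat \<times> 'a \<times> (nat \<Rightarrow> real) \<Rightarrow> bool" and F :: "nat \<times> 'a \<times> (nat \<Rightarrow> real) \<Rightarrow> real \<Rightarrow> 'z"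
  assumes D: "\<forall>p. \<forall>i\<le>Suc p. \<forall>x\<in>topspace (X (Suc p)). \<forall>t\<in>standard_simplex p.
      D (Suc p, x, simplical_face i t) = D (p, d (Suc p) i x, t)"
    and op: "\<And>p. openin (prod_topology (X p) (simplex_space p))
        {w \<in> topspace (X p) \<times> standard_simplex p. D (p, w)}"
    and F: "\<forall>p. \<forall>i\<le>Suc p. \<forall>x\<in>topspace (X (Suc p)). \<forall>t\<in>standard_simplex p. \<forall>s\<in>{0..1}.
      D (p, d (Suc p) i x, t) \<longrightarrow> F (Suc p, x, simplical_face i t) s = F (p, d (Suc p) i x, t) s"
    and cont: "\<And>p. continuous_map (prod_topology (subtopology (prod_topology (X p) (simplex_space p))
        {w. D (p, w)}) (top_of_set {0..1::real})) Z (\<lambda>w. F (p, fst w) (snd w))"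
  shows "\<And>p x t. x \<in> topspace (X p) \<Longrightarrow> t \<in> standard_simplex p \<Longrightarrow> D (rep (cls p x t)) = D (p, x, t)"
    and "\<And>p x t s. x \<in> topspace (X p) \<Longrightarrow> t \<in> standard_simplex p \<Longrightarrow> D (p, x, t) \<Longrightarrow> s \<in> {0..1} \<Longrightarrow>
      F (rep (cls p x t)) s = F (p, x, t) s"
    and "openin R {c \<in> topspace R. D (rep c)}"
    and "continuous_map (prod_topology (subtopology R {c. D (rep c)}) (top_of_set {0..1::real})) Z
      (\<lambda>w. F (rep (fst w)) (snd w))"
proof -
  let ?P = "prerealisation X" and ?q = "\<lambda>w. realisation_rel X d `` {w}"
  have Drel: "D v = D w" if "(v, w) \<in> realisation_rel X d" for v w
    by (rule rel_invariant[OF _ that]) (use D in auto)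
  have Frel: "F v s = F w s" if vw: "(v, w) \<in> realisation_rel X d" and "D v" and s: "s \<in> {0..1}" for v w s
  proof -
    \<comment> \<open>\<open>F\<close> respects the gluing only where \<open>D\<close> holds. A
      fixed value elsewhere makes it invariant under the whole relation, so that
      \<open>rel_invariant\<close> applies along chains.\<close>
    have "(if D v then F v s else undefined) = (if D w then F w s else undefined)"
      by (rule rel_invariant[OF _ vw]) (use D F s in auto)
    then show ?thesis using Drel[OF vw] \<open>D v\<close> by simp
  qed
  show 1: "D (rep (cls p x t)) = D (p, x, t)" for p x t
    using Drel[OF rep_cls] by simp
  show 2: "F (rep (cls p x t)) s = F (p, x, t) s" if "D (p, x, t)" "s \<in> {0..1}" for p x t s
    using Frel[OF rep_cls that] by simp
  have q: "quotient_map ?P R ?q"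
    unfolding realisation_def by (rule quotient_map_quotient_space)
  have pre: "{w \<in> topspace ?P. ?q w \<in> {c \<in> topspace R. D (rep c)}} = {w \<in> topspace ?P. D w}"
  proof -
    have "?q w \<in> topspace R" if "w \<in> topspace ?P" for w
      using that q quotient_imp_surjective_map by blast
    moreover have "D (rep (?q w)) = D w" for w
      using 1 by (metis cls_def prod_cases3)
    ultimately show ?thesis by auto
  qed
  have "openin ?P {w \<in> topspace ?P. D w}"
    unfolding prerealisation_eq openin_sum_topology using op by (auto simp: simplex_space_eq)
  then show op': "openin R {c \<in> topspace R. D (rep c)}"
    using q[unfolded quotient_map_def, THEN conjunct2, rule_format, of "{c \<in> topspace R. D (rep c)}"]
    unfolding pre by simp
  let ?U = "{w \<in> topspace ?P. D w}" and ?V = "{c \<in> topspace R. D (rep c)}" and ?I = "top_of_set {0..1::real}"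
  have "quotient_map (subtopology ?P ?U) (subtopology R ?V) ?q"
    by (rule quotient_map_restriction[OF q pre]) (use op' in simp)
  \<comment> \<open>A quotient map times the identity of a locally compact Hausdorff space is again
    a quotient map; this is what lets homotopies descend to the realisation.\<close>
  then have qI: "quotient_map (prod_topology (subtopology ?P ?U) ?I) (prod_topology (subtopology R ?V) ?I)
      (\<lambda>(w, s). (?q w, s))"
  proof (rule quotient_map_prod_left[rotated 2])
    show "locally_compact_space ?I"
      by (intro compact_imp_locally_compact_space) (auto simp: compact_space_subtopology)
    show "Hausdorff_space ?I \<or> regular_space ?I"
      by (simp add: Hausdorff_space_subtopology)
  qed
  have "continuous_map (prod_topology (subtopology ?P ?U) ?I) Z (\<lambda>v. F (fst v) (snd v))"
  \<comment> \<open>The summands of the disjoint union are open, so continuity can be checked on one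
    dimension at a time.\<close>
  proof (rule pasting_lemma[where I=UNIV and T="\<lambda>p. (?U \<inter> {w. fst w = p}) \<times> {0..1}"
        and f="\<lambda>p v. F (fst v) (snd v)"])
    fix p :: nat
    have opP: "openin ?P (?U \<inter> {w. fst w = p})"
    proof -
      have "{x. (i, x) \<in> ?U \<inter> {w. fst w = p}} =
          (if i = p then {w \<in> topspace (X p) \<times> standard_simplex p. D (p, w)} else {})" for i
        by (auto simp: topspace_prerealisation)
      then have "\<forall>i\<in>UNIV. openin (prod_topology (X i) (simplex_space i)) {x. (i, x) \<in> ?U \<inter> {w. fst w = p}}"
        using op by simp
      then show ?thesis
        unfolding openin_prerealisation by auto
    qed
    have "openin (subtopology ?P ?U) (?U \<inter> {w. fst w = p})"
      using openin_subtopology_Int2[OF opP, of ?U] by (simp add: Int_assoc[symmetric])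
    then show "openin (prod_topology (subtopology ?P ?U) ?I) ((?U \<inter> {w. fst w = p}) \<times> {0..1})"
      by (simp add: openin_prod_Times_iff)
    have snd: "continuous_map (subtopology ?P (?U \<inter> {w. fst w = p}))
        (subtopology (prod_topology (X p) (simplex_space p)) {w. D (p, w)}) snd"
    proof -
      have "continuous_map (subtopology ?P (?U \<inter> {w. fst w = p})) (prod_topology (X p) (simplex_space p)) snd"
        unfolding continuous_map
      proof (intro conjI allI impI)
        show "snd ` topspace (subtopology ?P (?U \<inter> {w. fst w = p})) \<subseteq> topspace (prod_topology (X p) (simplex_space p))"
          by (auto simp: topspace_prerealisation simplex_space_eq)
        fix W assume W: "openin (prod_topology (X p) (simplex_space p)) W"
        have "openin ?P ({p} \<times> W)"
        proof -
          have "{x. (i, x) \<in> {p} \<times> W} = (if i = p then W else {})" for i by auto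
          then have "\<forall>i. openin (prod_topology (X i) (simplex_space i)) {x. (i, x) \<in> {p} \<times> W}"
            using W by simp
          moreover have "{p} \<times> W \<subseteq> topspace ?P"
            using openin_subset[OF W] by (auto simp: topspace_prerealisation simplex_space_eq)
          ultimately show ?thesis unfolding openin_prerealisation by blast
        qed
        moreover have "{w \<in> topspace (subtopology ?P (?U \<inter> {w. fst w = p})). snd w \<in> W} =
            (?U \<inter> {w. fst w = p}) \<inter> ({p} \<times> W)"
          by auto
        ultimately show "openin (subtopology ?P (?U \<inter> {w. fst w = p}))
            {w \<in> topspace (subtopology ?P (?U \<inter> {w. fst w = p})). snd w \<in> W}"
          by (auto intro: openin_subtopology_Int2)
      qed
      then show ?thesis by (auto simp: continuous_map_in_subtopology)
    qed
    have "continuous_map (prod_topology (subtopology ?P (?U \<inter> {w. fst w = p})) ?I)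
        (prod_topology (subtopology (prod_topology (X p) (simplex_space p)) {w. D (p, w)}) ?I)
        (\<lambda>v. (snd (fst v), snd v))"
      using continuous_map_compose[OF continuous_map_fst snd]
      by (intro continuous_map_pairedI continuous_map_snd) (simp_all add: o_def)
    from continuous_map_compose[OF this cont[of p]]
    have "continuous_map (prod_topology (subtopology ?P (?U \<inter> {w. fst w = p})) ?I) Z
        (\<lambda>v. F (p, snd (fst v)) (snd v))"
      by (simp add: o_def)
    then have "continuous_map (prod_topology (subtopology ?P (?U \<inter> {w. fst w = p})) ?I) Z
        (\<lambda>v. F (fst v) (snd v))"
      by (rule continuous_map_eq) auto
    moreover have "subtopology (prod_topology (subtopology ?P ?U) ?I) ((?U \<inter> {w. fst w = p}) \<times> {0..1}) =
        prod_topology (subtopology ?P (?U \<inter> {w. fst w = p})) ?I"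
      by (subst subtopology_Times) (simp add: subtopology_subtopology inf.assoc[symmetric])
    ultimately show "continuous_map (subtopology (prod_topology (subtopology ?P ?U) ?I)
        ((?U \<inter> {w. fst w = p}) \<times> {0..1})) Z (\<lambda>v. F (fst v) (snd v))"
      by simp
  qed auto
  then have "continuous_map (prod_topology (subtopology ?P ?U) ?I) Z
      ((\<lambda>w. F (rep (fst w)) (snd w)) \<circ> (\<lambda>(w, s). (?q w, s)))"
  proof (rule continuous_map_eq)
    fix v assume "v \<in> topspace (prod_topology (subtopology ?P ?U) ?I)"
    then have "D (fst v)" "snd v \<in> {0..1}" by auto
    then show "F (fst v) (snd v) = ((\<lambda>w. F (rep (fst w)) (snd w)) \<circ> (\<lambda>(w, s). (?q w, s))) v"
      using 2[of "fst (fst v)" "fst (snd (fst v))" "snd (snd (fst v))" "snd v"]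
      by (simp add: split_def cls_def)
  qed
  then have "continuous_map (prod_topology (subtopology R ?V) ?I) Z (\<lambda>w. F (rep (fst w)) (snd w))"
    by (rule continuous_compose_quotient_map[OF qI])
  moreover have "subtopology R ?V = subtopology R {c. D (rep c)}"
  proof -
    have "?V = topspace R \<inter> {c. D (rep c)}" by auto
    then show ?thesis using subtopology_restrict[of R "{c. D (rep c)}"] by simp
  qed
  ultimately show "continuous_map (prod_topology (subtopology R {c. D (rep c)}) ?I) Z
      (\<lambda>w. F (rep (fst w)) (snd w))"
    by simp
qed

end

section \<open>Truncating and normalising barycentric coordinates\<close>

definition shr :: "nat \<Rightarrow> real \<Rightarrow> (nat \<Rightarrow> real) \<Rightarrow> nat \<Rightarrow> real" where
  "shr q y t = (\<lambda>i. max 0 (t i - y) / (\<Sum>j\<le>q. max 0 (t j - y)))"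

lemma ex_if_card: "card {i. P i} = Suc n \<Longrightarrow> \<exists>i. P i"
proof (rule ccontr)
  assume "card {i. P i} = Suc n" "\<nexists>i. P i"
  then have "{i. P i} = {}" by auto
  with \<open>card {i. P i} = Suc n\<close> show False by (simp only: card.empty)
qed

lemma finite_if_card: "card A = Suc n \<Longrightarrow> finite A"
  by (rule card_ge_0_finite) simp

lemma simplexD:
  assumes "t \<in> standard_simplex q"
  shows "0 \<le> t i" "t i \<le> 1" "q < i \<Longrightarrow> t i = 0" "(\<Sum>j\<le>q. t j) = 1"
  using assms by (auto simp: standard_simplex_def)

lemma shr_sum_pos:
  assumes "t \<in> standard_simplex q" "0 \<le> y" "y < t i"
  shows "0 < (\<Sum>j\<le>q. max 0 (t j - y))"
proof -
  have "i \<le> q" using simplexD(3)[OF assms(1), of i] assms(2,3) by force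
  then have "max 0 (t i - y) \<le> (\<Sum>j\<le>q. max 0 (t j - y))"
    by (intro member_le_sum) auto
  with assms(3) show ?thesis by simp
qed

lemma shr_in:
  assumes "t \<in> standard_simplex q" "0 \<le> y" "y < t i"
  shows "shr q y t \<in> standard_simplex q"
proof -
  let ?S = "\<Sum>j\<le>q. max 0 (t j - y)"
  have S: "0 < ?S" by (rule shr_sum_pos[OF assms])
  have z: "max 0 (t j - y) = 0" if "q < j" for j
    using simplexD(3)[OF assms(1) that] assms(2) by simp
  have "max 0 (t j - y) \<le> ?S" for j
  proof (cases "j \<le> q")
    case True
    then show ?thesis by (intro member_le_sum) auto
  next
    case False
    with z[of j] S show ?thesis by simp
  qed
  then have "shr q y t j \<le> 1" for j using S by (simp add: shr_def)
  moreover have "0 \<le> shr q y t j" for j using S by (simp add: shr_def)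
  moreover have "(\<Sum>j\<le>q. shr q y t j) = 1"
    using S by (simp add: shr_def sum_divide_distrib[symmetric])
  ultimately show ?thesis using z by (simp add: standard_simplex_def shr_def)
qed

lemma shr_0: "t \<in> standard_simplex q \<Longrightarrow> shr q 0 t = t"
  using simplexD[of t q] by (simp add: shr_def fun_eq_iff)

text \<open>The largest coordinate \<open>t k\<close> does not decrease: since
  \<open>t j \<le> t k\<close>, each truncated coordinate is at most
  \<open>t j * ((t k - y) / t k)\<close>, and summing these bounds the denominator by
  \<open>(t k - y) / t k\<close>. The deformation therefore never leaves the open set on which it is
  defined.\<close>

lemma shr_greater:
  assumes t: "t \<in> standard_simplex q" "r < t i" and y: "0 \<le> y" "y \<le> r"
  shows "\<exists>j. r < shr q y t j"
proof -
  have "Max (t ` {..q}) \<in> t ` {..q}" by (intro Max_in) auto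
  then obtain k where k': "k \<in> {..q}" "Max (t ` {..q}) = t k" by blast
  have k: "k \<le> q" "\<And>j. j \<le> q \<Longrightarrow> t j \<le> t k"
    unfolding k'(2)[symmetric] using k'(1) by (auto intro!: Max_ge)
  have "i \<le> q" using simplexD(3)[OF t(1), of i] t(2) y by force
  then have tk: "r < t k" using k(2)[of i] t(2) by simp
  let ?S = "\<Sum>j\<le>q. max 0 (t j - y)"
  have S: "0 < ?S" using shr_sum_pos[OF t(1) y(1), of k] tk y by simp
  have "?S \<le> (\<Sum>j\<le>q. t j * ((t k - y) / t k))"
  proof (rule sum_mono)
    fix j assume "j \<in> {..q}"
    then have j: "t j \<le> t k" "0 \<le> t j" using k simplexD(1)[OF t(1)] by auto
    have "t j - y \<le> t j * ((t k - y) / t k)"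
      using j tk y by (simp add: field_simps mult_left_mono)
    moreover have "0 \<le> t j * ((t k - y) / t k)" using j tk y by simp
    ultimately show "max 0 (t j - y) \<le> t j * ((t k - y) / t k)" by simp
  qed
  also have "\<dots> = (t k - y) / t k"
    by (subst sum_distrib_right[symmetric]) (simp add: simplexD(4)[OF t(1)])
  finally have "t k * ?S \<le> t k - y" using tk y by (simp add: field_simps)
  then have "t k \<le> shr q y t k" using S tk y by (simp add: shr_def le_divide_eq mult.commute)
  with tk show ?thesis by (intro exI[of _ k]) simp
qed

lemma shr_face:
  assumes "i \<le> Suc q" "0 \<le> y"
  shows "shr (Suc q) y (simplical_face i t) = simplical_face i (shr q y t)"
  using sum_face[OF assms(1), of "\<lambda>x. max 0 (x - y)" t] assms(2)
  by (auto simp: shr_def simplical_face_def fun_eq_iff)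

lemma continuous_on_shr:
  assumes "0 \<le> r"
  shows "continuous_on ({t \<in> standard_simplex q. \<exists>i. r < t i} \<times> {0..1})
    (\<lambda>w. shr q (snd w * r) (fst w))"
proof (rule continuous_on_coordinatewise_then_product)
  fix i
  have "(\<Sum>j\<le>q. max 0 (fst w j - snd w * r)) \<noteq> 0"
    if w: "w \<in> {t \<in> standard_simplex q. \<exists>i. r < t i} \<times> {0..1}" for w
  proof -
    obtain k where k: "r < fst w k" "fst w \<in> standard_simplex q" "0 \<le> snd w" "snd w \<le> 1" using w by auto
    have "snd w * r \<le> 1 * r" using k assms by (intro mult_right_mono) auto
    then show ?thesis using shr_sum_pos[OF k(2), of "snd w * r" k] k assms by simp
  qed
  then show "continuous_on ({t \<in> standard_simplex q. \<exists>i. r < t i} \<times> {0..1})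
      (\<lambda>w. shr q (snd w * r) (fst w) i)"
    unfolding shr_def by (intro continuous_intros) auto
qed

text \<open>The coordinate inserted by a coface is 0 and does not exceed \<open>r\<close>, so the
  large coordinates are only renumbered. Conditions on them therefore respect the gluing.\<close>

lemma face_greater_image:
  assumes "(0::real) \<le> r"
  shows "{j. r < simplical_face i t j} = (\<lambda>j. if j < i then j else Suc j) ` {j. r < t j}"
proof (intro subset_antisym subsetI)
  fix j assume j: "j \<in> {j. r < simplical_face i t j}"
  show "j \<in> (\<lambda>j. if j < i then j else Suc j) ` {j. r < t j}"
  proof (cases "j < i")
    case True
    then show ?thesis using j by (intro image_eqI[of _ _ j]) (auto simp: simplical_face_def)
  next
    case False
    then have "j \<noteq> i" using j assms by (auto simp: simplical_face_def)
    then show ?thesis using j False by (intro image_eqI[of _ _ "j - 1"]) (auto simp: simplical_face_def)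
  qed
qed (auto simp: simplical_face_def)

lemma card_face_greater:
  assumes "(0::real) \<le> r"
  shows "card {j. r < simplical_face i t j} = card {j. r < t j}"
  unfolding face_greater_image[OF assms]
  by (rule card_image) (auto simp: inj_on_def split: if_splits)

lemma ex_face_greater:
  assumes "(0::real) \<le> r"
  shows "(\<exists>j. r < simplical_face i t j) \<longleftrightarrow> (\<exists>j. r < t j)"
  using face_greater_image[OF assms, of i t] by blast

lemma greater_subset: "t \<in> standard_simplex q \<Longrightarrow> 0 \<le> r \<Longrightarrow> {j. r < t j} \<subseteq> {..q}"
  using simplexD(3)[of t q] by (force simp: not_le[symmetric])

text \<open>Otherwise \<open>p + 2\<close> coordinates, each strictly larger than
  \<open>1 / (p + 2)\<close>, would have a sum above 1.\<close>

lemma card_greater_le: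
  assumes t: "t \<in> standard_simplex q"
  shows "card {j. 1 / (real p + 2) < t j} \<le> Suc p"
proof -
  let ?E = "{j. 1 / (real p + 2) < t j}"
  have E: "?E \<subseteq> {..q}" using greater_subset[OF t] by simp
  have fin: "finite ?E" using E finite_subset by blast
  have "card ?E * (1 / (real p + 2)) \<le> (\<Sum>j\<in>?E. t j)"
    by (rule sum_bounded_below[of ?E, simplified mult.commute[of "real _"]]) auto
  also have "\<dots> \<le> (\<Sum>j\<le>q. t j)"
    using simplexD(1)[OF t] E by (intro sum_mono2) auto
  finally have "real (card ?E) \<le> real p + 2" using simplexD(4)[OF t] by (simp add: field_simps)
  moreover have "card ?E \<noteq> p + 2"
  proof
    assume c: "card ?E = p + 2"
    then have "?E \<noteq> {}" using ex_if_card[of "\<lambda>j. 1 / (real p + 2) < t j" "Suc p"] by auto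
    then have "(\<Sum>j\<in>?E. 1 / (real p + 2)) < (\<Sum>j\<in>?E. t j)"
      by (intro sum_strict_mono fin) auto
    also have "\<dots> \<le> (\<Sum>j\<le>q. t j)"
      using simplexD(1)[OF t] E by (intro sum_mono2) auto
    finally show False using simplexD(4)[OF t] c by simp
  qed
  ultimately show ?thesis by linarith
qed

text \<open>When coordinate \<open>i\<close> vanishes, this passes to the representative of the same
  point on face \<open>i\<close>. Acting on arbitrary coordinate functions, it satisfies the
  simplicial identities without conditions on them.\<close>

definition dd :: "(nat \<Rightarrow> nat \<Rightarrow> 'a \<Rightarrow> 'a) \<Rightarrow> nat \<Rightarrow> nat \<Rightarrow> 'a \<times> (nat \<Rightarrow> real) \<Rightarrow> 'a \<times> (nat \<Rightarrow> real)" where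
  "dd d q i w = (d q i (fst w), rem i (snd w))"

lemma dd_pair: "dd d q i (x, t) = (d q i x, rem i t)"
  by (simp add: dd_def)

context semisimplicial
begin

lemma openin_snd:
  assumes "open T"
  shows "openin (prod_topology (X p) (simplex_space p)) {w \<in> topspace (X p) \<times> standard_simplex p. snd w \<in> T}"
proof -
  have "continuous_map (prod_topology (X p) (simplex_space p)) euclidean snd"
    using continuous_map_snd[of "X p" "simplex_space p"]
    unfolding simplex_space_eq continuous_map_in_subtopology by simp
  from openin_continuous_map_preimage[OF this, of T] assms show ?thesis
    by (simp add: simplex_space_eq)
qed

text \<open>The open sets of the overview are \<open>hi (1 / (real p + 1))\<close>. A real parameter
  leaves room for slightly larger thresholds.\<close>

definition hi :: "real \<Rightarrow> (nat \<times> 'a \<times> (nat \<Rightarrow> real)) set set" where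
  "hi r = {c \<in> topspace R. \<exists>i. r < snd (snd (rep c)) i}"

lemma open_ex_greater: "open {t :: nat \<Rightarrow> real. \<exists>i. r < t i}"
proof -
  have "{t :: nat \<Rightarrow> real. \<exists>i. r < t i} = (\<Union>i. {t. r < t i})" by auto
  then show ?thesis by (simp only:) (intro open_UN ballI open_Collect_less continuous_intros)
qed

lemma hi_region:
  assumes "0 \<le> r"
  shows "x \<in> topspace (X p) \<Longrightarrow> t \<in> standard_simplex p \<Longrightarrow> cls p x t \<in> hi r \<longleftrightarrow> (\<exists>i. r < t i)"
    and "openin R (hi r)"
proof -
  have op: "openin (prod_topology (X p) (simplex_space p))
      {w \<in> topspace (X p) \<times> standard_simplex p. (\<exists>i. r < snd (snd (p, w)) i)}" for p
    using openin_snd[OF open_ex_greater[of r], of p] by simp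
  have *: "\<forall>p. \<forall>i\<le>Suc p. \<forall>x\<in>topspace (X (Suc p)). \<forall>t\<in>standard_simplex p.
      (\<exists>j. r < snd (snd (Suc p, x, simplical_face i t)) j) = (\<exists>j. r < snd (snd (p, d (Suc p) i x, t)) j)"
    using ex_face_greater[OF assms] by simp
  \<comment> \<open>Only the invariance and the openness provided by \<open>region\<close> matter
    here; the function that it asks for is taken to be 0.\<close>
  have const: "continuous_map (prod_topology (subtopology (prod_topology (X p) (simplex_space p))
      {w. \<exists>i. r < snd (snd (p, w)) i}) (top_of_set {0..1::real})) euclidean (\<lambda>_. 0::real)" for p
    by simp
  note reg = region[of "\<lambda>w. \<exists>i. r < snd (snd w) i" "\<lambda>_ _. 0::real" euclidean, OF * op _ const, simplified]
  show "openin R (hi r)" unfolding hi_def using reg(3) by simp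
  show "cls p x t \<in> hi r \<longleftrightarrow> (\<exists>i. r < t i)" if "x \<in> topspace (X p)" "t \<in> standard_simplex p"
    unfolding hi_def using reg(1)[OF that] cls_in[OF that] by simp
qed

definition theta :: "real \<Rightarrow> (nat \<times> 'a \<times> (nat \<Rightarrow> real)) set \<Rightarrow> real \<Rightarrow> (nat \<times> 'a \<times> (nat \<Rightarrow> real)) set" where
  "theta r c s = (case rep c of (q, x, t) \<Rightarrow> cls q x (shr q (s * r) t))"

text \<open>Truncation commutes with cofaces, so it descends to the realisation. By
  \<open>shr_greater\<close> it maps \<open>hi r\<close> to itself at all times.\<close>

lemma theta_region:
  assumes r: "0 \<le> r"
  shows "x \<in> topspace (X p) \<Longrightarrow> t \<in> standard_simplex p \<Longrightarrow> \<exists>i. r < t i \<Longrightarrow> s \<in> {0..1} \<Longrightarrow>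
      theta r (cls p x t) s = cls p x (shr p (s * r) t)" (is "_ \<Longrightarrow> _ \<Longrightarrow> _ \<Longrightarrow> _ \<Longrightarrow> ?eq x p t s")
    and "continuous_map (prod_topology (subtopology R (hi r)) (top_of_set {0..1})) (subtopology R (hi r))
      (\<lambda>w. theta r (fst w) (snd w))"
proof -
  define D where "D w \<longleftrightarrow> (\<exists>i. r < snd (snd w) i)" for w :: "nat \<times> 'a \<times> (nat \<Rightarrow> real)"
  define F where "F w s = (case w of (q, x, t) \<Rightarrow> cls q x (shr q (s * r) t))" for w s
  have op: "openin (prod_topology (X p) (simplex_space p)) {w \<in> topspace (X p) \<times> standard_simplex p. D (p, w)}" for p
    using openin_snd[OF open_ex_greater[of r], of p] by (simp add: D_def)
  have Dinv: "\<forall>p. \<forall>i\<le>Suc p. \<forall>x\<in>topspace (X (Suc p)). \<forall>t\<in>standard_simplex p.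
      D (Suc p, x, simplical_face i t) = D (p, d (Suc p) i x, t)"
    using ex_face_greater[OF r] by (simp add: D_def)
  have sr: "0 \<le> s * r" "s * r \<le> r" if "s \<in> {0..1}" for s
    using that r by (auto simp: mult_left_le_one_le)
  have shr_s: "shr p (s * r) t \<in> standard_simplex p" if "t \<in> standard_simplex p" "\<exists>i. r < t i" "s \<in> {0..1}" for p t s
    using that sr[OF that(3)] by (auto intro: shr_in le_less_trans)
  have "F (Suc p, x, simplical_face i t) s = F (p, d (Suc p) i x, t) s"
    if "i \<le> Suc p" "x \<in> topspace (X (Suc p))" "t \<in> standard_simplex p" "D (p, d (Suc p) i x, t)" "s \<in> {0..1}"
    for p i x t s
  proof -
    have "F (Suc p, x, simplical_face i t) s = cls (Suc p) x (simplical_face i (shr p (s * r) t))"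
      using shr_face[OF that(1) sr(1)[OF that(5)]] by (simp add: F_def)
    also have "\<dots> = cls p (d (Suc p) i x) (shr p (s * r) t)"
      using that shr_s[OF that(3) _ that(5)] by (intro cls_face) (auto simp: D_def)
    finally show ?thesis by (simp add: F_def)
  qed
  then have Finv: "\<forall>p. \<forall>i\<le>Suc p. \<forall>x\<in>topspace (X (Suc p)). \<forall>t\<in>standard_simplex p. \<forall>s\<in>{0..1}.
      D (p, d (Suc p) i x, t) \<longrightarrow> F (Suc p, x, simplical_face i t) s = F (p, d (Suc p) i x, t) s"
    by blast
  have cont: "continuous_map (prod_topology (subtopology (prod_topology (X p) (simplex_space p)) {w. D (p, w)})
      (top_of_set {0..1::real})) R (\<lambda>w. F (p, fst w) (snd w))" for p
  proof -
    let ?T = "prod_topology (subtopology (prod_topology (X p) (simplex_space p)) {w. D (p, w)}) (top_of_set {0..1::real})"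
    let ?A = "{t \<in> standard_simplex p. \<exists>i. r < t i}"
    have f: "continuous_map ?T (prod_topology (X p) (simplex_space p)) fst"
      by (meson continuous_map_fst continuous_map_into_fulltopology)
    have "continuous_map ?T (X p) (\<lambda>w. fst (fst w))"
      using continuous_map_compose[OF f continuous_map_fst] by (simp add: o_def)
    moreover have "continuous_map ?T (simplex_space p) (\<lambda>w. shr p (snd w * r) (snd (fst w)))"
    proof -
      have "continuous_map ?T (simplex_space p) (\<lambda>w. snd (fst w))"
        using continuous_map_compose[OF f continuous_map_snd] by (simp add: o_def)
      then have "continuous_map ?T (top_of_set ?A) (\<lambda>w. snd (fst w))"
        by (auto simp: simplex_space_eq continuous_map_in_subtopology D_def)
      then have "continuous_map ?T (prod_topology (top_of_set ?A) (top_of_set {0..1})) (\<lambda>w. (snd (fst w), snd w))"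
        by (intro continuous_map_pairedI continuous_map_snd)
      then have 1: "continuous_map ?T (top_of_set (?A \<times> {0..1})) (\<lambda>w. (snd (fst w), snd w))"
        by simp
      have "continuous_map (top_of_set (?A \<times> {0..1})) (simplex_space p) (\<lambda>w. shr p (snd w * r) (fst w))"
      proof -
        have "shr p (snd w * r) (fst w) \<in> standard_simplex p" if "w \<in> ?A \<times> {0..1}" for w
          by (rule shr_s) (use that in auto)
        then show ?thesis
          using continuous_on_shr[OF r, of p] by (simp add: simplex_space_eq continuous_map_in_subtopology)
      qed
      from continuous_map_compose[OF 1 this] show ?thesis by (simp add: o_def)
    qed
    ultimately have "continuous_map ?T (prod_topology (X p) (simplex_space p))
        (\<lambda>w. (fst (fst w), shr p (snd w * r) (snd (fst w))))"
      by (rule continuous_map_pairedI)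
    from continuous_map_compose[OF this continuous_map_cls]
    show ?thesis by (simp add: o_def F_def split_def)
  qed
  note reg = region[of D F R, OF Dinv op Finv cont]
  have hi: "hi r = {c \<in> topspace R. D (rep c)}" by (simp add: hi_def D_def)
  have F_theta: "F (rep c) s = theta r c s" for c s by (simp add: F_def theta_def)
  show eq: "?eq x p t s" if "x \<in> topspace (X p)" "t \<in> standard_simplex p" "\<exists>i. r < t i" "s \<in> {0..1}" for x p t s
    using reg(2)[OF that(1,2) _ that(4)] that(3) F_theta by (simp add: D_def F_def)
  have sub: "subtopology R {c. D (rep c)} = subtopology R (hi r)"
  proof -
    have "hi r = topspace R \<inter> {c. D (rep c)}" by (auto simp: hi)
    then show ?thesis using subtopology_restrict[of R "{c. D (rep c)}"] by simp
  qed
  have "continuous_map (prod_topology (subtopology R (hi r)) (top_of_set {0..1})) R (\<lambda>w. theta r (fst w) (snd w))"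
    using reg(4) unfolding sub F_theta by blast
  moreover have "theta r c s \<in> hi r" if c: "c \<in> hi r" and s: "s \<in> {0..1}" for c s
  proof -
    obtain p x t where p: "c = cls p x t" "x \<in> topspace (X p)" "t \<in> standard_simplex p"
      using c topspace_realisation by (auto simp: hi_def)
    then have "\<exists>i. r < t i" using hi_region(1)[OF r] c by simp
    then show ?thesis
      using eq[OF p(2,3) _ s] p hi_region(1)[OF r p(2) shr_s[OF p(3) _ s]] shr_greater[OF p(3) _ sr[OF s]]
      by auto
  qed
  ultimately show "continuous_map (prod_topology (subtopology R (hi r)) (top_of_set {0..1})) (subtopology R (hi r))
      (\<lambda>w. theta r (fst w) (snd w))"
    by (auto simp: continuous_map_in_subtopology)
qed

lemma theta_0:
  assumes "0 \<le> r" "c \<in> hi r"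
  shows "theta r c 0 = c"
proof -
  obtain p x t where p: "c = cls p x t" "x \<in> topspace (X p)" "t \<in> standard_simplex p"
    using assms topspace_realisation by (auto simp: hi_def)
  then have "\<exists>i. r < t i" using hi_region(1) assms by simp
  then show ?thesis using theta_region(1)[OF assms(1) p(2,3), of 0] p shr_0 by simp
qed

abbreviation carrier where "carrier q \<equiv> topspace (X q) \<times> (UNIV :: (nat \<Rightarrow> real) set)"

lemma dd_in: "w \<in> carrier (Suc q) \<Longrightarrow> j \<le> Suc q \<Longrightarrow> dd d (Suc q) j w \<in> carrier q"
  by (auto simp: dd_def d_in)

lemma dd_dd: "i < j \<Longrightarrow> j \<le> Suc (Suc q) \<Longrightarrow> w \<in> carrier (Suc (Suc q)) \<Longrightarrow>
    dd d (Suc q) i (dd d (Suc (Suc q)) j w) = dd d (Suc q) (j - 1) (dd d (Suc (Suc q)) i w)"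
  by (auto simp: dd_def d_d rem_rem)

lemma continuous_map_dd:
  "j \<le> Suc q \<Longrightarrow> continuous_map (prod_topology (X (Suc q)) euclidean) (prod_topology (X q) euclidean) (dd d (Suc q) j)"
  using continuous_map_compose[OF continuous_map_fst continuous_d, of j q euclidean]
    continuous_map_compose[OF continuous_map_snd, of euclidean euclidean "rem j :: (nat \<Rightarrow> real) \<Rightarrow> _" "X (Suc q)"]
    continuous_on_rem[of UNIV j]
  unfolding dd_def by (intro continuous_map_pairedI) (simp_all add: o_def)

text \<open>Each deleted coordinate is 0, so every single face taken is one application of the
  gluing relation.\<close>

lemma dl_cls:
  assumes "x \<in> topspace (X q)" "t \<in> standard_simplex q" "m \<le> Suc q" "card (S \<inter> {..<m}) \<le> q"
    "\<And>i. i \<in> S \<Longrightarrow> i < m \<Longrightarrow> t i = 0" "q' = q - card (S \<inter> {..<m})" "w = dl (dd d) S m q (x, t)"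
  shows "fst w \<in> topspace (X q') \<and> snd w \<in> standard_simplex q' \<and> cls q' (fst w) (snd w) = cls q x t"
  using assms
proof (induction m arbitrary: q x t)
  case (Suc m)
  show ?case
  proof (cases "m \<in> S")
    case True
    then have c: "card (S \<inter> {..<Suc m}) = Suc (card (S \<inter> {..<m}))" by (simp add: card_Int_Suc)
    then obtain p where q: "q = Suc p" using Suc.prems(4) by (cases q) auto
    have tm: "t m = 0" "m \<le> Suc p" using Suc.prems True q by auto
    have "cls q x t = cls p (d (Suc p) m x) (rem m t)"
      using cls_face[of m p x "rem m t"] rem_simplex[of t p m] face_rem[of t m] Suc.prems tm q by simp
    moreover have "fst w \<in> topspace (X q') \<and> snd w \<in> standard_simplex q' \<and>
        cls q' (fst w) (snd w) = cls p (d (Suc p) m x) (rem m t)"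
    proof (rule Suc.IH)
      show "d (Suc p) m x \<in> topspace (X p)" using d_in Suc.prems tm q by simp
      show "rem m t \<in> standard_simplex p" using rem_simplex[of t p m] Suc.prems tm q by simp
      show "rem m t i = 0" if "i \<in> S" "i < m" for i using Suc.prems(5) that by (simp add: rem_def)
      show "w = dl (dd d) S m p (d (Suc p) m x, rem m t)"
        using Suc.prems(7) True q by (simp add: dd_pair)
    qed (use Suc.prems c q tm in auto)
    ultimately show ?thesis by simp
  next
    case False
    then show ?thesis using Suc.prems Suc.IH[of x q t] card_Int_Suc[of S m] by simp
  qed
qed simp

section \<open>Coordinates on the part that is new in each step\<close>

definition th :: "nat \<Rightarrow> real" where "th p = 1 / (real p + 2)"

text \<open>After truncation at \<open>th p\<close> only the coordinates above \<open>th p\<close>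
  survive. If there are \<open>p + 1\<close> of them, deleting all others presents the truncated
  point in a simplex of dimension \<open>p\<close>.\<close>

definition coord :: "nat \<Rightarrow> nat \<times> 'a \<times> (nat \<Rightarrow> real) \<Rightarrow> 'a \<times> (nat \<Rightarrow> real)" where
  "coord p w = (case w of (q, x, t) \<Rightarrow> dl (dd d) {i. t i \<le> th p} (Suc q) q (x, shr q (th p) t))"

definition stratum :: "nat \<Rightarrow> (nat \<times> 'a \<times> (nat \<Rightarrow> real)) set set" where
  "stratum p = {c \<in> topspace R. card {i. th p < snd (snd (rep c)) i} = Suc p}"

lemma th_pos: "0 < th p" by (simp add: th_def)

lemma card_complement:
  assumes "t \<in> standard_simplex q" "card {i. th p < t i} = Suc p"
  shows "card ({i. t i \<le> th p} \<inter> {..<Suc q}) \<le> q" "p = q - card ({i. t i \<le> th p} \<inter> {..<Suc q})"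
proof -
  have sub: "{i. th p < t i} \<subseteq> {..q}" using greater_subset[OF assms(1)] th_pos[of p] by simp
  have "{i. t i \<le> th p} \<inter> {..<Suc q} = {..q} - {i. th p < t i}" by auto
  moreover have "card ({..q} - {i. th p < t i}) = Suc q - Suc p"
    using card_Diff_subset[OF finite_subset[OF sub] sub] assms(2) by simp
  moreover have "Suc p \<le> Suc q" using card_mono[OF _ sub] assms(2) by simp
  ultimately show "card ({i. t i \<le> th p} \<inter> {..<Suc q}) \<le> q" "p = q - card ({i. t i \<le> th p} \<inter> {..<Suc q})"
    by simp_all
qed

lemma coord_cls:
  assumes x: "x \<in> topspace (X q)" and t: "t \<in> standard_simplex q" and c: "card {i. th p < t i} = Suc p"
  shows "fst (coord p (q, x, t)) \<in> topspace (X p)" "snd (coord p (q, x, t)) \<in> standard_simplex p"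
    "cls p (fst (coord p (q, x, t))) (snd (coord p (q, x, t))) = cls q x (shr q (th p) t)"
proof -
  obtain i where "th p < t i" using ex_if_card[OF c] ..
  then have s: "shr q (th p) t \<in> standard_simplex q" using shr_in[OF t] th_pos[of p] by auto
  have "fst (coord p (q, x, t)) \<in> topspace (X p) \<and> snd (coord p (q, x, t)) \<in> standard_simplex p \<and>
      cls p (fst (coord p (q, x, t))) (snd (coord p (q, x, t))) = cls q x (shr q (th p) t)"
    by (rule dl_cls[OF x s order_refl card_complement(1)[OF t c] _ card_complement(2)[OF t c]])
      (auto simp: shr_def coord_def)
  then show "fst (coord p (q, x, t)) \<in> topspace (X p)" "snd (coord p (q, x, t)) \<in> standard_simplex p"
    "cls p (fst (coord p (q, x, t))) (snd (coord p (q, x, t))) = cls q x (shr q (th p) t)"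
    by auto
qed

text \<open>The coordinate inserted by the coface is 0 and thus among the deleted ones; by
  \<open>dl_shift\<close> it can be deleted first, which undoes the coface.\<close>

lemma coord_face:
  assumes "i \<le> Suc q" "x \<in> topspace (X (Suc q))" "t \<in> standard_simplex q" "card {i. th p < t i} = Suc p"
  shows "coord p (Suc q, x, simplical_face i t) = coord p (q, d (Suc q) i x, t)"
proof -
  let ?t = "simplical_face i t" and ?S = "{j. simplical_face i t j \<le> th p}"
  have t': "?t \<in> standard_simplex (Suc q)" "card {j. th p < ?t j} = Suc p"
    using face_simplex[OF assms(1,3)] card_face_greater[of "th p" i t] th_pos[of p] assms(4) by auto
  have iS: "i \<in> ?S" using th_pos[of p] by (auto simp: simplical_face_def)
  have sh: "shift i ?S = {j. t j \<le> th p}"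
    by (auto simp: shift_def simplical_face_def)
  have "coord p (Suc q, x, ?t) = dl (dd d) ?S (Suc (Suc q)) (Suc q) (x, shr (Suc q) (th p) ?t)"
    by (simp add: coord_def)
  also have "\<dots> = dl (dd d) (shift i ?S) (Suc (Suc q) - 1) (Suc q - 1) (dd d (Suc q) i (x, shr (Suc q) (th p) ?t))"
    by (rule dl_shift[where C=carrier and d="dd d" and R="?S" and i=i, OF dd_in dd_dd iS])
      (use assms card_complement(1)[OF t'] in auto)
  also have "dd d (Suc q) i (x, shr (Suc q) (th p) ?t) = (d (Suc q) i x, shr q (th p) t)"
    using shr_face[OF assms(1), of "th p" t] th_pos[of p] by (simp add: dd_pair rem_face)
  finally show ?thesis by (simp add: coord_def sh del: dl.simps)
qed

lemma open_all_greater: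
  fixes E :: "nat set"
  assumes "finite E"
  shows "open {t :: nat \<Rightarrow> real. \<forall>i\<in>E. r < t i}"
proof -
  have "{t :: nat \<Rightarrow> real. \<forall>i\<in>E. r < t i} = (\<Inter>i\<in>E. {t. r < t i})" by auto
  then show ?thesis using assms
    by (simp only:) (intro open_INT ballI open_Collect_less continuous_intros)
qed

text \<open>Having at least \<open>Suc p\<close> coordinates above the threshold is an open
  condition, and by \<open>card_greater_le\<close> there are never more.\<close>

lemma open_card_greater:
  "openin (prod_topology (X q) (simplex_space q))
    {w \<in> topspace (X q) \<times> standard_simplex q. card {i. th p < snd w i} = Suc p}"
proof -
  let ?T = "\<Union>E\<in>{E :: nat set. finite E \<and> card E = Suc p}. {t. \<forall>i\<in>E. th p < t i}"
  have "open ?T" by (intro open_UN ballI open_all_greater) auto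
  from openin_snd[OF this, of q]
  have op: "openin (prod_topology (X q) (simplex_space q)) {w \<in> topspace (X q) \<times> standard_simplex q. snd w \<in> ?T}" .
  have Tiff: "t \<in> ?T \<longleftrightarrow> card {i. th p < t i} = Suc p" if t: "t \<in> standard_simplex q" for t
  proof
    have fin: "finite {i. th p < t i}"
      by (rule finite_subset[OF greater_subset[OF t]]) (use th_pos[of p] in auto)
    assume "t \<in> ?T"
    then obtain E where "card E = Suc p" "E \<subseteq> {i. th p < t i}" by auto
    then have "Suc p \<le> card {i. th p < t i}" using card_mono[OF fin] by metis
    then show "card {i. th p < t i} = Suc p" using card_greater_le[OF t, of p] by (simp add: th_def)
  next
    assume c: "card {i. th p < t i} = Suc p"
    then have "finite {i. th p < t i}" by (rule finite_if_card)
    with c show "t \<in> ?T" by (intro UN_I[of "{i. th p < t i}"]) simp_all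
  qed
  have "{w \<in> topspace (X q) \<times> standard_simplex q. snd w \<in> ?T} =
      {w \<in> topspace (X q) \<times> standard_simplex q. card {i. th p < snd w i} = Suc p}"
    by (rule Collect_cong, rule conj_cong[OF refl], rule Tiff) (simp only: mem_Times_iff)
  with op show ?thesis by (simp only:)
qed

text \<open>The set of surviving indices is locally constant, again because \<open>Suc p\<close> is
  the largest possible number. On each piece of the resulting open cover the same faces are
  taken.\<close>

lemma continuous_map_coord:
  "continuous_map (subtopology (prod_topology (X q) (simplex_space q)) {w. card {i. th p < snd w i} = Suc p})
    (prod_topology (X p) (simplex_space p)) (\<lambda>w. coord p (q, w))"
proof -
  let ?A = "subtopology (prod_topology (X q) (simplex_space q)) {w. card {i. th p < snd w i} = Suc p}"
  have tA: "w \<in> topspace ?A \<longleftrightarrow> fst w \<in> topspace (X q) \<and> snd w \<in> standard_simplex q \<and> card {i. th p < snd w i} = Suc p" for w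
    by (auto simp: simplex_space_eq mem_Times_iff)
  have fin: "finite {i. th p < snd w i}" if "w \<in> topspace ?A" for w
    using that finite_if_card unfolding tA by blast
  have "continuous_map ?A (prod_topology (X p) euclidean) (\<lambda>w. coord p (q, w))"
  proof (rule pasting_lemma[where I="{E. E \<subseteq> {..q} \<and> card E = Suc p}"
        and T="\<lambda>E. topspace ?A \<inter> {w. \<forall>i\<in>E. th p < snd w i}"
        and f="\<lambda>E w. dl (dd d) (UNIV - E) (Suc q) q (fst w, shr q (th p) (snd w))"])
    fix E assume E: "E \<in> {E. E \<subseteq> {..q} \<and> card E = Suc p}"
    then have fE: "finite E" using finite_subset by auto
    show "openin ?A (topspace ?A \<inter> {w. \<forall>i\<in>E. th p < snd w i})"
    proof -
      have "open {t :: nat \<Rightarrow> real. \<forall>i\<in>E. th p < t i}" by (rule open_all_greater[OF fE])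
      from openin_snd[OF this, of q]
      have "openin ?A ({w. card {i. th p < snd w i} = Suc p} \<inter>
          {w \<in> topspace (X q) \<times> standard_simplex q. snd w \<in> {t. \<forall>i\<in>E. th p < t i}})"
        by (rule openin_subtopology_Int2)
      moreover have "{w. card {i. th p < snd w i} = Suc p} \<inter>
          {w \<in> topspace (X q) \<times> standard_simplex q. snd w \<in> {t. \<forall>i\<in>E. th p < t i}} =
          topspace ?A \<inter> {w. \<forall>i\<in>E. th p < snd w i}"
        by (auto simp: simplex_space_eq)
      ultimately show ?thesis by simp
    qed
    have cE: "card ((UNIV - E) \<inter> {..<Suc q}) \<le> q" "q - card ((UNIV - E) \<inter> {..<Suc q}) = p"
    proof -
      have "(UNIV - E) \<inter> {..<Suc q} = {..q} - E" by auto
      moreover have "card ({..q} - E) = Suc q - Suc p"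
        using card_Diff_subset[OF fE, of "{..q}"] E by simp
      moreover have "Suc p \<le> Suc q" using card_mono[of "{..q}" E] E by simp
      ultimately show "card ((UNIV - E) \<inter> {..<Suc q}) \<le> q" "q - card ((UNIV - E) \<inter> {..<Suc q}) = p" by simp_all
    qed
    let ?B = "subtopology ?A (topspace ?A \<inter> {w. \<forall>i\<in>E. th p < snd w i})"
    have B: "continuous_map ?B (X q) fst" "continuous_map ?B (simplex_space q) snd"
      by (intro continuous_map_from_subtopology continuous_map_fst continuous_map_snd)+
    have "continuous_map ?B (top_of_set {t \<in> standard_simplex q. \<exists>i. th p < t i}) snd"
    proof -
      have "\<exists>i. th p < snd w i" if "w \<in> topspace ?B" for w
      proof -
        have "card {i. th p < snd w i} = Suc p" using that tA by auto
        then show ?thesis by (rule ex_if_card)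
      qed
      then show ?thesis
        using B(2) unfolding simplex_space_eq continuous_map_in_subtopology by auto
    qed
    moreover have "continuous_on {t \<in> standard_simplex q. \<exists>i. th p < t i} (\<lambda>t. shr q (th p) t)"
    proof -
      have "continuous_on {t \<in> standard_simplex q. \<exists>i. th p < t i} (\<lambda>t. shr q (snd (t, 1::real) * th p) (fst (t, 1::real)))"
      proof (rule continuous_on_compose2[OF continuous_on_shr])
        show "continuous_on {t \<in> standard_simplex q. \<exists>i. th p < t i} (\<lambda>t. (t, 1::real))"
          by (intro continuous_intros)
      qed (use th_pos[of p] in auto)
      then show ?thesis by simp
    qed
    ultimately have "continuous_map ?B euclidean (\<lambda>w. shr q (th p) (snd w))"
      using continuous_map_compose[of ?B _ snd euclidean "shr q (th p)"] by (simp add: o_def)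
    with B(1) have c1: "continuous_map ?B (prod_topology (X q) euclidean) (\<lambda>w. (fst w, shr q (th p) (snd w)))"
      by (rule continuous_map_pairedI)
    have c2: "continuous_map (prod_topology (X q) euclidean) (prod_topology (X p) euclidean)
        (dl (dd d) (UNIV - E) (Suc q) q)"
      using continuous_map_dl[where T="\<lambda>q. prod_topology (X q) euclidean" and d="dd d", OF continuous_map_dd order_refl cE(1)]
      by (simp only: cE(2))
    show "continuous_map ?B (prod_topology (X p) euclidean)
        (\<lambda>w. dl (dd d) (UNIV - E) (Suc q) q (fst w, shr q (th p) (snd w)))"
      using continuous_map_compose[OF c1 c2] by (simp only: o_def)
  next
    have eq: "E = {i. th p < snd w i}"
      if E: "E \<subseteq> {..q} \<and> card E = Suc p" and w: "w \<in> topspace ?A" "\<forall>i\<in>E. th p < snd w i" for E w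
    proof (rule card_seteq[OF fin[OF w(1)]])
      show "E \<subseteq> {i. th p < snd w i}" using w(2) by blast
      have "card {i. th p < snd w i} = Suc p" using w(1) unfolding tA by (elim conjE)
      then show "card {i. th p < snd w i} \<le> card E" using E by simp
    qed
    fix E E' w
    assume E: "E \<in> {E. E \<subseteq> {..q} \<and> card E = Suc p}" "E' \<in> {E. E \<subseteq> {..q} \<and> card E = Suc p}"
      and w: "w \<in> topspace ?A \<inter> (topspace ?A \<inter> {w. \<forall>i\<in>E. th p < snd w i}) \<inter> (topspace ?A \<inter> {w. \<forall>i\<in>E'. th p < snd w i})"
    have "E = {i. th p < snd w i}" "E' = {i. th p < snd w i}"
      by (rule eq; use E w in blast)+
    then show "dl (dd d) (UNIV - E) (Suc q) q (fst w, shr q (th p) (snd w)) =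
        dl (dd d) (UNIV - E') (Suc q) q (fst w, shr q (th p) (snd w))"
      by (simp only:)
  next
    fix w assume w: "w \<in> topspace ?A"
    let ?E = "{i. th p < snd w i}"
    have "?E \<subseteq> {..q}" using w greater_subset[of "snd w" q "th p"] th_pos[of p] unfolding tA by simp
    moreover have "UNIV - ?E = {i. snd w i \<le> th p}" by auto
    ultimately show "\<exists>E. E \<in> {E. E \<subseteq> {..q} \<and> card E = Suc p} \<and>
        w \<in> topspace ?A \<inter> {w. \<forall>i\<in>E. th p < snd w i} \<and>
        coord p (q, w) = dl (dd d) (UNIV - E) (Suc q) q (fst w, shr q (th p) (snd w))"
      using w w[unfolded tA] by (intro exI[of _ ?E]) (simp add: coord_def split_def del: dl.simps)
  qed
  note c = this
  have "continuous_map ?A (X p) (\<lambda>w. fst (coord p (q, w)))"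
    using continuous_map_compose[OF c continuous_map_fst] by (simp add: o_def)
  moreover have "continuous_map ?A euclidean (\<lambda>w. snd (coord p (q, w)))"
    using continuous_map_compose[OF c continuous_map_snd] by (simp add: o_def)
  moreover have "snd (coord p (q, w)) \<in> standard_simplex p" if "w \<in> topspace ?A" for w
    using that coord_cls(2)[of "fst w" q "snd w" p] unfolding tA by simp
  ultimately have "continuous_map ?A (prod_topology (X p) (simplex_space p)) (\<lambda>w. (fst (coord p (q, w)), snd (coord p (q, w))))"
    by (intro continuous_map_pairedI) (auto simp: simplex_space_eq continuous_map_in_subtopology)
  then show ?thesis by simp
qed

text \<open>For \<open>c\<close> in \<open>stratum p\<close>, the simplex and, in
  \<open>sig\<close>, the barycentric coordinates of the endpoint of the deformation
  \<open>theta\<close>; see \<open>theta_1_stratum\<close>.\<close>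

definition kap :: "nat \<Rightarrow> (nat \<times> 'a \<times> (nat \<Rightarrow> real)) set \<Rightarrow> 'a" where
  "kap p c = fst (coord p (rep c))"

definition sig :: "nat \<Rightarrow> (nat \<times> 'a \<times> (nat \<Rightarrow> real)) set \<Rightarrow> nat \<Rightarrow> real" where
  "sig p c = snd (coord p (rep c))"

lemma stratum_region:
  shows "x \<in> topspace (X q) \<Longrightarrow> t \<in> standard_simplex q \<Longrightarrow> cls q x t \<in> stratum p \<longleftrightarrow> card {i. th p < t i} = Suc p"
    (is "_ \<Longrightarrow> _ \<Longrightarrow> ?iff x q t")
    and "openin R (stratum p)"
    and "x \<in> topspace (X q) \<Longrightarrow> t \<in> standard_simplex q \<Longrightarrow> card {i. th p < t i} = Suc p \<Longrightarrow>
      (kap p (cls q x t), sig p (cls q x t)) = coord p (q, x, t)" (is "_ \<Longrightarrow> _ \<Longrightarrow> _ \<Longrightarrow> ?eq x q t")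
    and "continuous_map (subtopology R (stratum p)) (X p) (kap p)"
    and "continuous_map (subtopology R (stratum p)) (simplex_space p) (sig p)"
proof -
  define D where "D w \<longleftrightarrow> card {i. th p < snd (snd w) i} = Suc p" for w :: "nat \<times> 'a \<times> (nat \<Rightarrow> real)"
  have op: "openin (prod_topology (X q) (simplex_space q)) {w \<in> topspace (X q) \<times> standard_simplex q. D (q, w)}" for q
    using open_card_greater[of q p] by (simp add: D_def)
  have Dinv: "\<forall>q. \<forall>i\<le>Suc q. \<forall>x\<in>topspace (X (Suc q)). \<forall>t\<in>standard_simplex q.
      D (Suc q, x, simplical_face i t) = D (q, d (Suc q) i x, t)"
    using card_face_greater[OF less_imp_le[OF th_pos]] by (simp add: D_def)
  have Finv: "\<forall>q. \<forall>i\<le>Suc q. \<forall>x\<in>topspace (X (Suc q)). \<forall>t\<in>standard_simplex q. \<forall>s\<in>{0..1::real}.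
      D (q, d (Suc q) i x, t) \<longrightarrow> coord p (Suc q, x, simplical_face i t) = coord p (q, d (Suc q) i x, t)"
    using coord_face by (simp add: D_def)
  have cont: "continuous_map (prod_topology (subtopology (prod_topology (X q) (simplex_space q)) {w. D (q, w)})
      (top_of_set {0..1::real})) (prod_topology (X p) (simplex_space p)) (\<lambda>w. coord p (q, fst w))" for q
    using continuous_map_compose[OF continuous_map_fst continuous_map_coord[of q p]]
    by (simp add: o_def D_def)
  note reg = region[of D "\<lambda>w _. coord p w" "prod_topology (X p) (simplex_space p)", OF Dinv op Finv cont]
  have st: "stratum p = {c \<in> topspace R. D (rep c)}" by (simp add: stratum_def D_def)
  show "?iff x q t" if "x \<in> topspace (X q)" "t \<in> standard_simplex q" for x q t
    using reg(1)[OF that] cls_in[OF that] by (simp add: st D_def)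
  show "openin R (stratum p)" unfolding st by (rule reg(3))
  show "?eq x q t" if "x \<in> topspace (X q)" "t \<in> standard_simplex q" "card {i. th p < t i} = Suc p" for x q t
    using reg(2)[OF that(1,2), of 0] that(3) by (simp add: D_def kap_def sig_def)
  have sub: "subtopology R {c. D (rep c)} = subtopology R (stratum p)"
  proof -
    have "stratum p = topspace R \<inter> {c. D (rep c)}" by (auto simp: st)
    then show ?thesis using subtopology_restrict[of R "{c. D (rep c)}"] by simp
  qed
  have "continuous_map (prod_topology (subtopology R (stratum p)) (top_of_set {0..1::real}))
      (prod_topology (X p) (simplex_space p)) (\<lambda>w. coord p (rep (fst w)))"
    using reg(4) unfolding sub .
  moreover have "continuous_map (subtopology R (stratum p))
      (prod_topology (subtopology R (stratum p)) (top_of_set {0..1::real})) (\<lambda>c. (c, 0))"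
    by (intro continuous_map_pairedI) auto
  ultimately have c: "continuous_map (subtopology R (stratum p)) (prod_topology (X p) (simplex_space p)) (\<lambda>c. coord p (rep c))"
    using continuous_map_compose[of "subtopology R (stratum p)" _ "\<lambda>c. (c, 0)" "prod_topology (X p) (simplex_space p)"
        "\<lambda>w. coord p (rep (fst w))"] by (simp add: o_def)
  show "continuous_map (subtopology R (stratum p)) (X p) (kap p)"
    using continuous_map_compose[OF c continuous_map_fst] by (simp add: o_def kap_def[abs_def])
  show "continuous_map (subtopology R (stratum p)) (simplex_space p) (sig p)"
    using continuous_map_compose[OF c continuous_map_snd] by (simp add: o_def sig_def[abs_def])
qed

lemma theta_1_stratum:
  assumes "c \<in> stratum p"
  shows "kap p c \<in> topspace (X p)" "sig p c \<in> standard_simplex p" "theta (th p) c 1 = cls p (kap p c) (sig p c)"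
proof -
  have "c \<in> topspace R" using assms by (simp add: stratum_def)
  then obtain q x t where q: "c = cls q x t" "x \<in> topspace (X q)" "t \<in> standard_simplex q"
    using topspace_realisation by blast
  then have cd: "card {i. th p < t i} = Suc p" using stratum_region(1) assms by simp
  then have "\<exists>i. th p < t i" by (rule ex_if_card)
  moreover have "kap p c = fst (coord p (q, x, t))" "sig p c = snd (coord p (q, x, t))"
    using stratum_region(3)[OF q(2,3) cd] q(1) by (metis fst_conv snd_conv)+
  ultimately show "kap p c \<in> topspace (X p)" "sig p c \<in> standard_simplex p" "theta (th p) c 1 = cls p (kap p c) (sig p c)"
    using coord_cls[OF q(2,3) cd] theta_region(1)[OF _ q(2,3), of "th p" 1] th_pos[of p] q(1) by simp_all
qed

text \<open>If all truncated coordinates are at most \<open>r\<close> and sum to 1, then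
  \<open>p * r < 1\<close> forces more than \<open>p\<close> of them to be nonzero. As
  \<open>r\<close> may exceed \<open>1 / (p + 1)\<close>, points outside the stratum end well inside
  the previous open set.\<close>

lemma in_stratum:
  assumes c: "c \<in> hi (th p)" and n: "theta (th p) c 1 \<notin> hi r" and r: "0 \<le> r" "real p * r < 1"
  shows "c \<in> stratum p"
proof -
  have "c \<in> topspace R" using c by (simp add: hi_def)
  then obtain q x t where q: "c = cls q x t" "x \<in> topspace (X q)" "t \<in> standard_simplex q"
    using topspace_realisation by blast
  let ?s = "shr q (th p) t" and ?E = "{i. th p < t i}"
  have ex: "\<exists>i. th p < t i" using c hi_region(1)[OF _ q(2,3), of "th p"] th_pos[of p] q(1) by simp
  then have s: "?s \<in> standard_simplex q" using shr_in[OF q(3)] th_pos[of p] by auto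
  have "theta (th p) c 1 = cls q x ?s" using theta_region(1)[OF _ q(2,3) ex, of 1] th_pos[of p] q(1) by simp
  then have le: "?s i \<le> r" for i using n hi_region(1)[OF r(1) q(2) s] by (simp add: not_less)
  have E: "?E \<subseteq> {..q}" using greater_subset[OF q(3)] th_pos[of p] by simp
  have "1 = (\<Sum>j\<le>q. ?s j)" using simplexD(4)[OF s] by simp
  also have "\<dots> = (\<Sum>j\<in>?E. ?s j)"
    using E by (intro sum.mono_neutral_right) (auto simp: shr_def)
  also have "\<dots> \<le> real (card ?E) * r" using sum_bounded_above[of ?E ?s r] le by simp
  finally have "1 \<le> real (card ?E) * r" .
  then have "\<not> real (card ?E) \<le> real p" using r mult_right_mono[of "real (card ?E)" "real p" r] by linarith
  moreover have "card ?E \<le> Suc p" using card_greater_le[OF q(3), of p] by (simp add: th_def)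
  ultimately have "card ?E = Suc p" by simp
  then show ?thesis using stratum_region(1)[OF q(2,3)] q(1) by simp
qed

end

lemma solvable_cong:
  assumes "solvable X Y f n a b" "\<And>z. z \<in> bx n \<Longrightarrow> a z = a' z" "\<And>z. z \<in> bdy n \<Longrightarrow> b z = b' z"
  shows "solvable X Y f n a' b'"
proof -
  obtain c G where c: "continuous_map (top_of_set (bx n)) X c"
     "continuous_map (top_of_set (bx n \<times> {0..1::real})) Y G"
     "\<forall>z\<in>bx n. G (z, 0) = a z \<and> G (z, 1) = f (c z)"
     "\<forall>z\<in>bdy n. c z = b z \<and> (\<forall>t\<in>{0..1}. G (z, t) = a z)"
    using assms(1) by (rule solvableE)
  show ?thesis
    by (rule solvableI[OF c(1,2)]) (use c(3,4) assms(2,3) bdyD in auto)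
qed

context semisimplicial
begin

lemma simplex_max:
  assumes "t \<in> standard_simplex p" "r < 1 / (real p + 1)"
  shows "\<exists>i. r < t i"
proof (rule ccontr)
  assume "\<not> ?thesis"
  then have "t i \<le> r" for i by (simp add: not_less)
  then have "(\<Sum>i\<le>p. t i) \<le> (real p + 1) * r"
    using sum_bounded_above[of "{..p}" t r] by (simp add: add.commute)
  moreover have "(real p + 1) * r < 1" using assms(2) by (simp add: field_simps)
  ultimately show False using simplexD(4)[OF assms(1)] by simp
qed

lemma cmap_cls:
  assumes x: "continuous_map (top_of_set K) (X p) x" and t: "continuous_on K t"
    and tK: "\<And>z. z \<in> K \<Longrightarrow> t z \<in> standard_simplex p" and r: "0 \<le> r" "r < 1 / (real p + 1)"
  shows "continuous_map (top_of_set K) (subtopology R (hi r)) (\<lambda>z. cls p (x z) (t z))"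
proof -
  have "continuous_map (top_of_set K) (simplex_space p) t"
    using t tK by (auto simp: simplex_space_eq continuous_map_in_subtopology)
  with x have "continuous_map (top_of_set K) (prod_topology (X p) (simplex_space p)) (\<lambda>z. (x z, t z))"
    by (rule continuous_map_pairedI)
  from continuous_map_compose[OF this continuous_map_cls]
  have "continuous_map (top_of_set K) R (\<lambda>z. cls p (x z) (t z))" by (simp add: o_def)
  moreover have "cls p (x z) (t z) \<in> hi r" if "z \<in> K" for z
    using hi_region(1)[OF r(1) cmap_in_topspace[OF x that] tK[OF that]] simplex_max[OF tK[OF that] r(2)] by simp
  ultimately show ?thesis by (auto simp: continuous_map_in_subtopology)
qed

lemma hi_mono: "r \<le> r' \<Longrightarrow> hi r' \<subseteq> hi r"
  unfolding hi_def using le_less_trans by blast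

lemma hi_cases:
  assumes "c \<in> hi r"
  obtains q x t where "c = cls q x t" "x \<in> topspace (X q)" "t \<in> standard_simplex q"
proof -
  have "c \<in> topspace R" using assms by (simp add: hi_def)
  then show thesis unfolding topspace_realisation using that by (elim exE conjE)
qed

end

lemma Image_image: "r `` (g ` C) = (\<Union>w\<in>C. r `` {g w})"
  by (auto simp: Image_def)

section \<open>The map induced on realisations\<close>

locale semisimplicial_morphism =
  X: semisimplicial X d + Y: semisimplicial Y e
  for X :: "nat \<Rightarrow> 'a topology" and d and Y :: "nat \<Rightarrow> 'b topology" and e +
  fixes f :: "nat \<Rightarrow> 'a \<Rightarrow> 'b"
  assumes semisimplicial_map: "semisimplicial_map X d Y e f"
begin

abbreviation "F \<equiv> realisation_map Y e f"

lemma continuous_f: "continuous_map (X p) (Y p) (f p)"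
  using semisimplicial_map by (simp add: semisimplicial_map_def)

lemma f_in: "x \<in> topspace (X p) \<Longrightarrow> f p x \<in> topspace (Y p)"
  using continuous_map_image_subset_topspace[OF continuous_f] by blast

lemma f_d: "i \<le> Suc p \<Longrightarrow> x \<in> topspace (X (Suc p)) \<Longrightarrow> f p (d (Suc p) i x) = e (Suc p) i (f (Suc p) x)"
  using semisimplicial_map by (simp add: semisimplicial_map_def)

lemma F_cls:
  assumes "x \<in> topspace (X p)" "t \<in> standard_simplex p"
  shows "F (X.cls p x t) = Y.cls p (f p x) t"
proof -
  let ?g = "\<lambda>(p, x, t). (p, f p x, t)"
  let ?C = "X.cls p x t"
  have eq: "realisation_rel Y e `` {?g w} = realisation_rel Y e `` {?g (p, x, t)}" if "w \<in> ?C" for w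
  proof (rule X.rel_invariant[of "\<lambda>w. realisation_rel Y e `` {?g w}", symmetric])
    show "((p, x, t), w) \<in> realisation_rel X d" using that by (simp add: X.cls_def)
    fix q i x t assume "i \<le> Suc q" "x \<in> topspace (X (Suc q))" "t \<in> standard_simplex q"
    then show "realisation_rel Y e `` {?g (Suc q, x, simplical_face i t)} = realisation_rel Y e `` {?g (q, d (Suc q) i x, t)}"
      using Y.cls_face[of i q "f (Suc q) x" t] f_in f_d by (simp add: Y.cls_def)
  qed
  have "(p, x, t) \<in> ?C"
    by (simp add: X.cls_def X.refl_rel)
  have "realisation_rel Y e `` (?g ` ?C) = (\<Union>w\<in>?C. realisation_rel Y e `` {?g w})"
    by (rule Image_image)
  also have "\<dots> = (\<Union>w\<in>?C. realisation_rel Y e `` {?g (p, x, t)})"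
    by (rule SUP_cong[OF refl eq])
  also have "\<dots> = realisation_rel Y e `` {?g (p, x, t)}"
    using \<open>(p, x, t) \<in> ?C\<close> by (intro SUP_const) blast
  finally have "realisation_rel Y e `` (?g ` ?C) = realisation_rel Y e `` {?g (p, x, t)}" .
  then show ?thesis
    by (simp add: realisation_map_def Y.cls_def)
qed

lemma continuous_F: "continuous_map X.R Y.R F"
proof -
  define G where "G w s = (case w of (p, x, t) \<Rightarrow> Y.cls p (f p x) t)" for w :: "nat \<times> 'a \<times> (nat \<Rightarrow> real)" and s :: real
  have op: "openin (prod_topology (X p) (simplex_space p)) {w \<in> topspace (X p) \<times> standard_simplex p. True}" for p
    using openin_topspace[of "prod_topology (X p) (simplex_space p)"] by (simp add: simplex_space_eq)
  have G: "\<forall>p. \<forall>i\<le>Suc p. \<forall>x\<in>topspace (X (Suc p)). \<forall>t\<in>standard_simplex p. \<forall>s\<in>{0..1}.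
      True \<longrightarrow> G (Suc p, x, simplical_face i t) s = G (p, d (Suc p) i x, t) s"
    using Y.cls_face f_in f_d by (simp add: G_def)
  have cont: "continuous_map (prod_topology (subtopology (prod_topology (X p) (simplex_space p))
      {w. True}) (top_of_set {0..1::real})) Y.R (\<lambda>w. G (p, fst w) (snd w))" for p
  proof -
    let ?T = "prod_topology (prod_topology (X p) (simplex_space p)) (top_of_set {0..1::real})"
    have f1: "continuous_map ?T (prod_topology (X p) (simplex_space p)) fst" by (rule continuous_map_fst)
    have "continuous_map ?T (X p) (\<lambda>w. fst (fst w))"
      using continuous_map_compose[OF f1 continuous_map_fst] by (simp add: o_def)
    from continuous_map_compose[OF this continuous_f]
    have "continuous_map ?T (Y p) (\<lambda>w. f p (fst (fst w)))" by (simp add: o_def)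
    moreover have "continuous_map ?T (simplex_space p) (\<lambda>w. snd (fst w))"
      using continuous_map_compose[OF f1 continuous_map_snd] by (simp add: o_def)
    ultimately have "continuous_map ?T (prod_topology (Y p) (simplex_space p)) (\<lambda>w. (f p (fst (fst w)), snd (fst w)))"
      by (rule continuous_map_pairedI)
    from continuous_map_compose[OF this Y.continuous_map_cls]
    show ?thesis by (simp add: o_def G_def split_def)
  qed
  have D: "\<forall>p. \<forall>i\<le>Suc p. \<forall>x\<in>topspace (X (Suc p)). \<forall>t\<in>standard_simplex p. True = True" by simp
  note reg = X.region[of "\<lambda>_. True" G Y.R, OF D op G cont]
  have "continuous_map (prod_topology X.R (top_of_set {0..1::real})) Y.R (\<lambda>w. G (X.rep (fst w)) (snd w))"
    using reg(4) by simp
  moreover have "continuous_map X.R (prod_topology X.R (top_of_set {0..1::real})) (\<lambda>c. (c, 0))"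
    by (intro continuous_map_pairedI) auto
  ultimately have "continuous_map X.R Y.R (\<lambda>c. G (X.rep c) 0)"
    using continuous_map_compose[of X.R _ "\<lambda>c. (c, 0)" Y.R "\<lambda>w. G (X.rep (fst w)) (snd w)"] by (simp add: o_def)
  moreover have "G (X.rep c) 0 = F c" if "c \<in> topspace X.R" for c
  proof -
    obtain q x t where q: "c = X.cls q x t" "x \<in> topspace (X q)" "t \<in> standard_simplex q"
      using \<open>c \<in> topspace X.R\<close> X.topspace_realisation by blast
    then show ?thesis using reg(2)[OF q(2,3), of 0] F_cls[OF q(2,3)] by (simp add: G_def)
  qed
  ultimately show ?thesis by (rule continuous_map_eq)
qed

lemma F_hi:
  assumes "0 \<le> r" "c \<in> topspace X.R"
  shows "F c \<in> Y.hi r \<longleftrightarrow> c \<in> X.hi r"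
proof -
  obtain q x t where q: "c = X.cls q x t" "x \<in> topspace (X q)" "t \<in> standard_simplex q"
    using assms(2) X.topspace_realisation by blast
  then show ?thesis
    using X.hi_region(1)[OF assms(1) q(2,3)] Y.hi_region(1)[OF assms(1) f_in[OF q(2)] q(3)] F_cls[OF q(2,3)]
    by simp
qed

lemma F_theta:
  assumes r: "0 \<le> r" and c: "c \<in> X.hi r" and s: "s \<in> {0..1}"
  shows "F (X.theta r c s) = Y.theta r (F c) s"
proof -
  obtain q x t where q: "c = X.cls q x t" "x \<in> topspace (X q)" "t \<in> standard_simplex q"
    using c by (rule X.hi_cases)
  then have ex: "\<exists>i. r < t i" using X.hi_region(1)[OF r q(2,3)] c by simp
  have "0 \<le> s * r" "s * r \<le> r" using s r by (auto simp: mult_left_le_one_le)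
  then have "shr q (s * r) t \<in> standard_simplex q"
    using ex shr_in[OF q(3), of "s * r"] by (auto intro: le_less_trans)
  then show ?thesis
    using X.theta_region(1)[OF r q(2,3) ex s] Y.theta_region(1)[OF r f_in[OF q(2)] q(3) ex s] q
      F_cls[OF q(2)] by simp
qed

text \<open>Which faces \<open>coord p\<close> takes depends only on barycentric coordinates, which
  \<open>F\<close> preserves, and \<open>f\<close> commutes with the faces.\<close>

lemma F_stratum:
  assumes "c \<in> topspace X.R"
  shows "F c \<in> Y.stratum p \<longleftrightarrow> c \<in> X.stratum p"
    and "c \<in> X.stratum p \<Longrightarrow> Y.kap p (F c) = f p (X.kap p c)"
    and "c \<in> X.stratum p \<Longrightarrow> Y.sig p (F c) = X.sig p c"
proof -
  obtain q x t where q: "c = X.cls q x t" "x \<in> topspace (X q)" "t \<in> standard_simplex q"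
    using assms X.topspace_realisation by blast
  show iff: "F c \<in> Y.stratum p \<longleftrightarrow> c \<in> X.stratum p"
    using X.stratum_region(1)[OF q(2,3)] Y.stratum_region(1)[OF f_in[OF q(2)] q(3)] F_cls[OF q(2,3)] q(1) by simp
  have "(Y.kap p (F c), Y.sig p (F c)) = (f p (X.kap p c), X.sig p c)" if cs: "c \<in> X.stratum p"
  proof -
    have cd: "card {i. X.th p < t i} = Suc p" using cs X.stratum_region(1)[OF q(2,3)] q(1) by simp
    let ?S = "{i. t i \<le> X.th p}" and ?w = "(x, shr q (X.th p) t)"
    let ?g = "\<lambda>q w. (f q (fst w), snd w)"
    have n: "?g (q - card (?S \<inter> {..<Suc q})) (dl (dd d) ?S (Suc q) q ?w) = dl (dd e) ?S (Suc q) q (?g q ?w)"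
      by (rule dl_natural[where C=X.carrier and d="dd d" and e="dd e" and g="?g" and R="?S"])
        (use X.card_complement(1)[OF q(3) cd] q(2) X.d_in f_d in \<open>auto simp: dd_def simp del: dl.simps\<close>)
    have "q - card (?S \<inter> {..<Suc q}) = p" by (rule X.card_complement(2)[OF q(3) cd, symmetric])
    with n have "?g p (dl (dd d) ?S (Suc q) q ?w) = dl (dd e) ?S (Suc q) q (?g q ?w)" by (simp only:)
    then have "Y.coord p (q, f q x, t) = ?g p (X.coord p (q, x, t))"
      unfolding X.coord_def Y.coord_def prod.case fst_conv snd_conv by (rule sym)
    moreover have "(Y.kap p (F c), Y.sig p (F c)) = Y.coord p (q, f q x, t)"
      unfolding q(1) F_cls[OF q(2,3)]
      by (rule Y.stratum_region(3)[OF f_in[OF q(2)] q(3)]) (rule cd)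
    moreover have "X.kap p c = fst (X.coord p (q, x, t))" "X.sig p c = snd (X.coord p (q, x, t))"
      unfolding q(1) X.stratum_region(3)[OF q(2,3) cd, symmetric] by (simp_all only: fst_conv snd_conv)
    ultimately show ?thesis by (simp only:)
  qed
  then show "c \<in> X.stratum p \<Longrightarrow> Y.kap p (F c) = f p (X.kap p c)"
    "c \<in> X.stratum p \<Longrightarrow> Y.sig p (F c) = X.sig p c"
    by auto
qed

end

section \<open>Making a map transverse to the barycentres of the top stratum\<close>

lemma (in semisimplicial_morphism) continuous_F_hi:
  "0 \<le> r \<Longrightarrow> continuous_map (subtopology X.R (X.hi r)) (subtopology Y.R (Y.hi r)) F"
  using continuous_map_from_subtopology[OF continuous_F] F_hi
  by (auto simp: continuous_map_in_subtopology)

text \<open>Soft thresholding: for \<open>r \<ge> 0\<close> it moves \<open>x\<close> by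
  \<open>r\<close> towards 0 and vanishes on the interval from \<open>- r\<close> to
  \<open>r\<close>.\<close>

definition soft :: "real \<Rightarrow> real \<Rightarrow> real" where
  "soft r x = max 0 (x - r) - max 0 (- x - r)"

lemma soft_abs: "0 \<le> r \<Longrightarrow> \<bar>soft r x\<bar> \<le> \<bar>x\<bar>"
  by (auto simp: soft_def)

text \<open>The distance to \<open>S\<close>, but \<open>1\<close> for the empty set, where \<^const>\<open>infdist\<close> is \<open>0\<close>.\<close>

definition setd :: "(nat \<Rightarrow> real) \<Rightarrow> (nat \<Rightarrow> real) set \<Rightarrow> real" where
  "setd z S = (if S = {} then 1 else infdist z S)"

lemma setd_0: "z \<in> S \<Longrightarrow> setd z S = 0"
  by (auto simp: setd_def)

lemma setd_pos: "closed S \<Longrightarrow> z \<notin> S \<Longrightarrow> 0 < setd z S"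
  using infdist_pos_not_in_closed[of S z] by (auto simp: setd_def)

lemma continuous_on_setd: "continuous_on T (\<lambda>z. setd z S)"
  unfolding setd_def by (cases "S = {}") (auto intro!: continuous_intros)

text \<open>The lifting problem after the deformation \<open>theta\<close>. On \<open>U\<close>, the
  preimage of the stratum, \<open>a1\<close> is given by a simplex \<open>y\<close> and coordinates
  \<open>s\<close>, and \<open>b1\<close> likewise by \<open>x\<close> and \<open>s\<close>.
  \<open>inU\<close> says that elsewhere \<open>a1\<close> is safely in the previous open set,
  \<open>L1\<close> is the induction hypothesis for that set, and \<open>L2\<close> is the
  connectivity of \<open>f p\<close>.\<close>

locale stage = semisimplicial_morphism X d Y e f
  for X :: "nat \<Rightarrow> 'a topology" and d and Y :: "nat \<Rightarrow> 'b topology" and e and f +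
  fixes p n :: nat and a1 :: "(nat \<Rightarrow> real) \<Rightarrow> (nat \<times> 'b \<times> (nat \<Rightarrow> real)) set"
    and b1 :: "(nat \<Rightarrow> real) \<Rightarrow> (nat \<times> 'a \<times> (nat \<Rightarrow> real)) set"
    and U :: "(nat \<Rightarrow> real) set" and y :: "(nat \<Rightarrow> real) \<Rightarrow> 'b" and s :: "(nat \<Rightarrow> real) \<Rightarrow> nat \<Rightarrow> real"
    and x :: "(nat \<Rightarrow> real) \<Rightarrow> 'a"
  assumes a1: "continuous_map (top_of_set (bx n)) (subtopology Y.R (Y.hi (1 / (real p + 2)))) a1"
    and b1: "continuous_map (top_of_set (bdy n)) (subtopology X.R (X.hi (1 / (real p + 2)))) b1"
    and fb1: "z \<in> bdy n \<Longrightarrow> F (b1 z) = a1 z"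
    and U_open: "openin (top_of_set (bx n)) U"
    and y: "continuous_map (top_of_set U) (Y p) y"
    and s: "continuous_on U s" and s_in: "z \<in> U \<Longrightarrow> s z \<in> standard_simplex p"
    and x: "continuous_map (top_of_set (U \<inter> bdy n)) (X p) x"
    and fx: "z \<in> U \<Longrightarrow> z \<in> bdy n \<Longrightarrow> f p (x z) = y z"
    and a1U: "z \<in> U \<Longrightarrow> a1 z = Y.cls p (y z) (s z)"
    and b1U: "z \<in> U \<Longrightarrow> z \<in> bdy n \<Longrightarrow> b1 z = X.cls p (x z) (s z)"
    and inU: "z \<in> bx n \<Longrightarrow> a1 z \<notin> Y.hi r \<Longrightarrow> 0 \<le> r \<Longrightarrow> real p * r < 1 \<Longrightarrow> z \<in> U"
    and L1: "j \<le> n \<Longrightarrow> lifts (subtopology X.R (X.hi (1 / (real p + 1))))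
      (subtopology Y.R (Y.hi (1 / (real p + 1)))) F (bx j) (bdy j)"
    and L2: "j + p \<le> n \<Longrightarrow> lifts (X p) (Y p) (f p) (bx j) (bdy j)"
begin

abbreviation "VX \<equiv> subtopology X.R (X.hi (1 / (real p + 2)))"
abbreviation "VY \<equiv> subtopology Y.R (Y.hi (1 / (real p + 2)))"

text \<open>The barycentre has coordinates \<open>1 / P\<close>. The thresholds
  \<open>c1 < c2\<close> lie just above, with \<open>p * c1 < 1\<close> as needed for
  \<open>inU\<close>. Near the barycentre offsets are at most \<open>2 * P * ep\<close>;
  \<open>ep\<close> and \<open>ka\<close> are chosen so that the \<open>p\<close> old offsets and
  the \<open>p\<close> perturbations each sum to at most \<open>1 / (2 * P)\<close>, which keeps the
  perturbed point in the simplex. \<open>de\<close>, the tolerance for signs, is so small that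
  \<open>p\<close> tolerances stay well below the offset \<open>ep\<close> that marks points away
  from the barycentre.\<close>

definition P :: real where "P = real p + 1"
definition ep :: real where "ep = 1 / (4 * P ^ 3)"
definition c1 :: real where "c1 = 1 / P + ep"
definition c2 :: real where "c2 = 1 / P + 2 * ep"
definition de :: real where "de = ep / (3 * P ^ 2)"
definition ka :: real where "ka = 1 / (2 * P ^ 2)"

lemma P: "1 \<le> P" "0 < P" "real p = P - 1" "real p \<le> P"
  by (auto simp: P_def)

lemma pos: "0 < ep" "0 < de" "0 < ka" "0 < c1"
  using P by (auto simp: ep_def de_def ka_def c1_def add_pos_pos)

lemma p_P: "real p / P = 1 - 1 / P"
  using P(2) by (simp add: P_def field_simps)

lemma de_ep: "3 * P * de = ep / P"
  using P by (simp add: de_def power2_eq_square)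

lemma ep_P: "2 * P ^ 2 * ep = 1 / (2 * P)" "P * ka = 1 / (2 * P)"
  using P by (simp_all add: ep_def ka_def power3_eq_cube power2_eq_square)

lemma p_c1: "real p * c1 < 1"
proof -
  have "P * ep \<le> P ^ 2 * ep" using P pos by (intro mult_right_mono) (auto simp: power2_eq_square)
  also have "\<dots> = 1 / (4 * P)" using ep_P(1) by simp
  also have "\<dots> < 1 / P" using P by (simp add: field_simps)
  finally have "P * ep < 1 / P" .
  moreover have "real p * c1 = real p / P + (P * ep - ep)"
    by (simp add: c1_def P_def algebra_simps)
  ultimately show ?thesis using pos p_P by linarith
qed

text \<open>The offset from the barycentre. Only indices below \<open>p\<close> are used, since the
  last coordinate is determined by the sum.\<close>

definition sd :: "nat \<Rightarrow> (nat \<Rightarrow> real) \<Rightarrow> real" where "sd j z = s z j - 1 / P"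

definition Winf where "Winf = {z \<in> bx n. a1 z \<in> Y.hi c1}"

text \<open>Each offset has a colour \<open>\<zeta> j\<close>. The two conditions overlap where the
  offset is smaller than \<open>de\<close> in absolute value, so that open sets of both colours can
  cover.\<close>

definition Wz :: "(nat \<Rightarrow> bool) \<Rightarrow> (nat \<Rightarrow> real) set" where
  "Wz \<zeta> = {z \<in> U. (\<forall>i\<le>p. s z i < c2) \<and> (\<forall>j<p. if \<zeta> j then sd j z < de else - de < sd j z)}"

lemma grid_exists:
  "\<exists>M>0. \<forall>c\<in>gcells M n. cellset M c \<subseteq> Winf \<or> (\<exists>\<zeta>. cellset M c \<subseteq> Wz \<zeta>)"
proof -
  have "openin (top_of_set (bx n)) Winf"
  proof -
    have "openin VY (Y.hi c1 \<inter> topspace VY)"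
    proof -
      have "openin Y.R (Y.hi c1)" using Y.hi_region(2)[of c1] pos by simp
      then have "openin VY (Y.hi c1 \<inter> Y.hi (1 / (real p + 2)))" by (rule openin_subtopology_Int)
      then have "openin VY (Y.hi c1 \<inter> Y.hi (1 / (real p + 2)) \<inter> topspace VY)" by blast
      then show ?thesis by (simp add: Int_ac)
    qed
    from openin_continuous_map_preimage[OF a1 this]
    have "openin (top_of_set (bx n)) {z \<in> bx n. a1 z \<in> Y.hi c1 \<inter> topspace VY}" by simp
    moreover have "{z \<in> bx n. a1 z \<in> Y.hi c1 \<inter> topspace VY} = Winf"
      using cmap_in_topspace[OF a1] by (auto simp: Winf_def)
    ultimately show ?thesis by simp
  qed
  moreover have "openin (top_of_set (bx n)) (Wz \<zeta>)" for \<zeta>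
  proof -
    let ?T = "(\<Inter>i\<in>{..p}. {t :: nat \<Rightarrow> real. t i < c2}) \<inter>
      (\<Inter>j\<in>{..<p}. {t. if \<zeta> j then t j - 1 / P < de else - de < t j - 1 / P})"
    have "open {t :: nat \<Rightarrow> real. if \<zeta> j then t j - 1 / P < de else - de < t j - 1 / P}" for j
      by (cases "\<zeta> j") (auto intro!: open_Collect_less continuous_intros)
    then have "open ?T"
      by (intro open_Int open_INT ballI open_Collect_less continuous_intros) auto
    then have "openin (top_of_set U) (U \<inter> s -` ?T)"
      by (rule continuous_openin_preimage_gen[OF s])
    moreover have "U \<inter> s -` ?T = Wz \<zeta>" by (auto simp: Wz_def sd_def)
    ultimately have "openin (top_of_set U) (Wz \<zeta>)" by simp
    then show ?thesis using U_open openin_trans by blast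
  qed
  ultimately have op: "openin (top_of_set (bx n)) W" if "W \<in> insert Winf (range Wz)" for W
    using that by auto
  have cov: "bx n \<subseteq> \<Union>(insert Winf (range Wz))"
  proof
    fix z assume z: "z \<in> bx n"
    show "z \<in> \<Union>(insert Winf (range Wz))"
    proof (cases "a1 z \<in> Y.hi c1")
      case True
      then show ?thesis using z by (simp add: Winf_def)
    next
      case False
      then have zU: "z \<in> U" using inU[OF z _ _ p_c1] pos by simp
      then have "\<not> (\<exists>i. c1 < s z i)"
        using False a1U[OF zU] Y.hi_region(1)[OF _ cmap_in_topspace[OF y zU] s_in[OF zU], of c1] pos by simp
      \<comment> \<open>The gap between \<open>c1\<close> and \<open>c2\<close> turns the weak
        inequality into an open condition. As colouring one takes \<open>sd j z < de\<close>; if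
        this fails, the offset is at least \<open>de\<close> and in particular above
        \<open>- de\<close>.\<close>
      then have "s z i < c2" for i using pos by (auto simp: c1_def c2_def not_less intro: le_less_trans)
      then have "z \<in> Wz (\<lambda>j. sd j z < de)" using zU pos by (auto simp: Wz_def)
      then show ?thesis by blast
    qed
  qed
  obtain M where "0 < M" "\<And>c. c \<in> gcells M n \<Longrightarrow> \<exists>W\<in>insert Winf (range Wz). cellset M c \<subseteq> W"
    using fine_grid[OF op cov] by blast
  then show ?thesis by blast
qed

\<comment> \<open>The combinatorial locus near the barycentres\<close>
end

locale stage_grid = stage +
  fixes M :: nat
  assumes M: "0 < M" and grid: "c \<in> gcells M n \<Longrightarrow> cellset M c \<subseteq> Winf \<or> (\<exists>\<zeta>. cellset M c \<subseteq> Wz \<zeta>)"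
begin

definition neg :: "nat \<Rightarrow> gcell \<Rightarrow> bool" where
  "neg j c \<longleftrightarrow> (\<forall>z\<in>cellset M c. sd j z < de)"

text \<open>Intersecting cells on which \<open>sd j\<close> is nearly negative with cells on which it is nearly positive
  lowers the dimension by one for each \<open>j < p\<close> and leaves only points whose image is close to a barycentre.\<close>

primrec Sg :: "nat \<Rightarrow> gcell set" where
  "Sg 0 = {c \<in> gcells M n. \<not> cellset M c \<subseteq> Winf}"
| "Sg (Suc j) = {cmeet c c' |c c'. c \<in> Sg j \<and> neg j c \<and> c' \<in> Sg j \<and> \<not> neg j c' \<and>
     cellset M c \<inter> cellset M c' \<noteq> {}}"

definition ucells :: "gcell set \<Rightarrow> (nat \<Rightarrow> real) set" where "ucells S = (\<Union>c\<in>S. cellset M c)"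

definition D :: "nat \<Rightarrow> (nat \<Rightarrow> real) set" where "D j = ucells (Sg j)"
definition A :: "(nat \<Rightarrow> real) set" where "A = ucells {c \<in> gcells M n. cellset M c \<subseteq> Winf}"

lemma Sg_SucE:
  assumes "c \<in> Sg (Suc j)"
  obtains u v where "c = cmeet u v" "u \<in> Sg j" "neg j u" "v \<in> Sg j" "\<not> neg j v"
    "cellset M u \<inter> cellset M v \<noteq> {}"
proof -
  have "\<exists>u v. c = cmeet u v \<and> u \<in> Sg j \<and> neg j u \<and> v \<in> Sg j \<and> \<not> neg j v \<and>
      cellset M u \<inter> cellset M v \<noteq> {}"
    using assms by (simp only: Sg.simps mem_Collect_eq)
  then show thesis using that by blast
qed

text \<open>The two cells of each pair have different colours and are therefore distinct, so
  \<open>cdim_meet_less\<close> lowers the dimension bound by one at each stage.\<close>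

lemma Sg_props:
  "c \<in> Sg j \<Longrightarrow> c \<in> gcells M n \<and> cdim c + j \<le> n \<and> (\<exists>c0\<in>Sg 0. cellset M c \<subseteq> cellset M c0)"
proof (induction j arbitrary: c)
  case 0
  then have "c \<in> gcells M n" by simp
  then have "cdim c + 0 \<le> n" using cdim_le[of c M n] by simp
  with \<open>c \<in> gcells M n\<close> 0 show ?case by blast
next
  case (Suc j)
  obtain u v where c: "c = cmeet u v" "u \<in> Sg j" "neg j u" "v \<in> Sg j" "\<not> neg j v"
    "cellset M u \<inter> cellset M v \<noteq> {}" by (rule Sg_SucE[OF Suc.prems])
  then obtain z where z: "z \<in> cellset M u" "z \<in> cellset M v" by blast
  note 1 = Suc.IH[OF c(2)] and 2 = Suc.IH[OF c(4)]
  have uv: "u \<noteq> v" using c by auto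
  have g: "u \<in> gcells M n" "v \<in> gcells M n" and d: "cdim u \<le> n - j" "cdim v \<le> n - j" "j \<le> n"
    using 1 2 by linarith+
  have "cdim (cmeet u v) < n - j"
    by (rule cdim_meet_less[OF g z uv d(1,2)])
  then have "cdim c + Suc j \<le> n" using c(1) by simp
  moreover have "c \<in> gcells M n" using cmeet_in[OF g z] c(1) by simp
  moreover have "cellset M c \<subseteq> cellset M u" using cellset_meet[of M u v] c(1) by blast
  moreover obtain c0 where c0: "c0 \<in> Sg 0" "cellset M u \<subseteq> cellset M c0" using 1 by blast
  ultimately show ?case using subset_trans[OF _ c0(2)] c0(1) by (intro conjI bexI[OF _ c0(1)]) simp_all
qed

lemma D_gset: "gset M n (n - j) (D j)"
  unfolding D_def ucells_def
proof (rule gset_Union)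
  fix c assume "c \<in> Sg j"
  from Sg_props[OF this] show "c \<in> gcells M n \<and> cdim c \<le> n - j" by linarith
qed

lemma closed_Un_Sg: "S \<subseteq> Sg j \<Longrightarrow> closed (ucells S)"
  unfolding ucells_def
proof (rule closed_UN)
  assume "S \<subseteq> Sg j"
  then have "S \<subseteq> gcells M n" using Sg_props by blast
  then show "finite S" using finite_gcells finite_subset by blast
qed (use closed_cellset in auto)

lemma D_Suc: "D (Suc j) \<subseteq> D j"
proof
  fix z assume "z \<in> D (Suc j)"
  then obtain c where c: "c \<in> Sg (Suc j)" "z \<in> cellset M c" unfolding D_def ucells_def by blast
  obtain u v where uv: "c = cmeet u v" "u \<in> Sg j" by (rule Sg_SucE[OF c(1)])
  then have "z \<in> cellset M u" using c(2) cellset_meet[of M u v] by blast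
  with uv(2) show "z \<in> D j" unfolding D_def ucells_def by blast
qed

lemma D_antimono: "i \<le> j \<Longrightarrow> D j \<subseteq> D i"
  by (rule lift_Suc_antimono_le[of D]) (use D_Suc in auto)

lemma A_gset: "gset M n n A"
  unfolding A_def ucells_def
proof (rule gset_Union)
  fix c assume "c \<in> {c \<in> gcells M n. cellset M c \<subseteq> Winf}"
  then show "c \<in> gcells M n \<and> cdim c \<le> n" using cdim_le[of c M n] by simp
qed

lemma D0_gset: "gset M n n (D 0)"
  using D_gset[of 0] by simp

lemma A_D: "A \<union> D 0 = bx n"
proof
  show "A \<union> D 0 \<subseteq> bx n" using gset_subset_bx[OF M] A_gset D0_gset by blast
  show "bx n \<subseteq> A \<union> D 0"
  proof
    fix z assume "z \<in> bx n"
    note cc = carrier_cell[OF this, of M]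
    show "z \<in> A \<union> D 0"
    proof (cases "cellset M (carrier_cell M z) \<subseteq> Winf")
      case True
      with cc have "z \<in> A" unfolding A_def ucells_def by blast
      then show ?thesis ..
    next
      case False
      with cc have "carrier_cell M z \<in> Sg 0" by simp
      with cc have "z \<in> D 0" unfolding D_def ucells_def by blast
      then show ?thesis ..
    qed
  qed
qed

lemma cell_Wz:
  assumes "c \<in> Sg j"
  obtains \<zeta> where "cellset M c \<subseteq> Wz \<zeta>"
proof -
  obtain c0 where "c0 \<in> Sg 0" "cellset M c \<subseteq> cellset M c0" using Sg_props[OF assms] by blast
  moreover from this(1) have "\<exists>\<zeta>. cellset M c0 \<subseteq> Wz \<zeta>" using grid[of c0] by auto
  ultimately show thesis using that by blast
qed

lemma D0_props:
  assumes "z \<in> D 0"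
  shows "z \<in> U" "i \<le> p \<Longrightarrow> s z i < c2"
proof -
  obtain c where c: "c \<in> Sg 0" "z \<in> cellset M c" using assms unfolding D_def ucells_def by blast
  obtain \<zeta> where "cellset M c \<subseteq> Wz \<zeta>" using cell_Wz[OF c(1)] .
  with c(2) have "z \<in> Wz \<zeta>" by blast
  then show "z \<in> U" "i \<le> p \<Longrightarrow> s z i < c2" by (auto simp: Wz_def)
qed

text \<open>The cell lies in some \<open>Wz \<zeta>\<close>; if \<open>\<zeta> j\<close> held, it
  would be \<open>neg\<close>.\<close>

lemma not_neg:
  assumes "c \<in> Sg i" "\<not> neg j c" "j < p" "z \<in> cellset M c"
  shows "- de < sd j z"
proof -
  obtain \<zeta> where \<zeta>: "cellset M c \<subseteq> Wz \<zeta>" using cell_Wz[OF assms(1)] .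
  have "\<not> \<zeta> j"
  proof
    assume "\<zeta> j"
    then have "neg j c" using \<zeta> assms(3) unfolding neg_def Wz_def by force
    with assms(2) show False ..
  qed
  then show ?thesis using \<zeta> assms(3,4) unfolding Wz_def by force
qed

text \<open>A distance from the barycentre. It is at least \<open>3 * P * de\<close> on
  \<open>A \<inter> D 0\<close> and at most \<open>P * de\<close> on \<open>D p\<close>, which
  leaves room for the cutoffs \<open>thr\<close> and \<open>wt\<close> between the two.\<close>

definition Nn :: "(nat \<Rightarrow> real) \<Rightarrow> real" where "Nn z = (\<Sum>j<p. \<bar>sd j z\<bar>)"

lemma sd_sum: "z \<in> U \<Longrightarrow> (\<Sum>j<p. sd j z) = 1 / P - s z p"
proof -
  assume "z \<in> U"
  then have "(\<Sum>j\<le>p. s z j) = 1" using s_in simplexD(4) by blast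
  moreover have "(\<Sum>j\<le>p. s z j) = (\<Sum>j<p. s z j) + s z p"
    by (simp add: lessThan_Suc_atMost[symmetric])
  moreover have "(\<Sum>j<p. sd j z) = (\<Sum>j<p. s z j) - real p / P"
    by (simp add: sd_def sum_subtractf)
  ultimately show ?thesis by (simp add: p_P)
qed

lemma sd_le_Nn: "j < p \<Longrightarrow> \<bar>sd j z\<bar> \<le> Nn z"
  unfolding Nn_def by (rule member_le_sum) auto

text \<open>Some coordinate exceeds \<open>1 / P\<close> by more than \<open>ep\<close>. If it is
  the last one, the other offsets sum to less than \<open>- ep\<close>.\<close>

lemma AD_Nn:
  assumes "z \<in> A" "z \<in> D 0"
  shows "3 * P * de \<le> Nn z"
proof -
  have zU: "z \<in> U" using D0_props assms(2) by blast
  have "a1 z \<in> Y.hi c1" using assms(1) by (auto simp: A_def ucells_def Winf_def)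
  then obtain i where i: "c1 < s z i"
    using a1U[OF zU] Y.hi_region(1)[OF _ cmap_in_topspace[OF y zU] s_in[OF zU], of c1] pos by auto
  have ep: "ep / P \<le> ep" using P pos by (simp add: divide_le_eq)
  have ip: "i \<le> p"
  proof (rule ccontr)
    assume "\<not> i \<le> p"
    then have "s z i = 0" using simplexD(3)[OF s_in[OF zU]] by simp
    with i pos show False by simp
  qed
  show ?thesis
  proof (cases "i = p")
    case False
    then have "ep \<le> \<bar>sd i z\<bar>" using i by (simp add: sd_def c1_def)
    also have "\<dots> \<le> Nn z" using sd_le_Nn ip False by simp
    finally show ?thesis using ep de_ep by simp
  next
    case True
    have "ep < - (\<Sum>j<p. sd j z)" using sd_sum[OF zU] i True by (simp add: c1_def)
    also have "\<dots> \<le> Nn z" unfolding Nn_def using sum_abs[of "\<lambda>j. sd j z" "{..<p}"] by linarith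
    finally show ?thesis using ep de_ep by simp
  qed
qed

text \<open>A point of \<open>D (Suc j)\<close> lies in cells of both colours for \<open>j\<close>,
  which bounds the offset from both sides.\<close>

lemma Dp_sd:
  assumes "z \<in> D p" "j < p"
  shows "\<bar>sd j z\<bar> < de"
proof -
  have "z \<in> D (Suc j)" using assms D_antimono[of "Suc j" p] by auto
  then obtain c0 where c0: "c0 \<in> Sg (Suc j)" "z \<in> cellset M c0" unfolding D_def ucells_def by blast
  obtain c c' where c: "c0 = cmeet c c'" "c \<in> Sg j" "neg j c" "c' \<in> Sg j" "\<not> neg j c'"
    by (rule Sg_SucE[OF c0(1)])
  then have z: "z \<in> cellset M c" "z \<in> cellset M c'" using c0(2) cellset_meet[of M c c'] by auto
  then have "sd j z < de" using c(3) by (auto simp: neg_def)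
  moreover have "- de < sd j z" using not_neg[OF c(4,5) assms(2) z(2)] .
  ultimately show ?thesis by simp
qed

lemma Dp_Nn: "z \<in> D p \<Longrightarrow> Nn z \<le> P * de"
proof -
  assume z: "z \<in> D p"
  have "Nn z \<le> real p * de"
    unfolding Nn_def using sum_bounded_above[of "{..<p}" "\<lambda>j. \<bar>sd j z\<bar>" de] Dp_sd[OF z] by fastforce
  also have "\<dots> \<le> P * de" using P pos by (intro mult_right_mono) auto
  finally show ?thesis .
qed

lemma A_Dp: "A \<inter> D p = {}"
proof -
  have "False" if "z \<in> A" "z \<in> D p" for z
  proof -
    have "3 * P * de \<le> P * de" using AD_Nn[OF that(1)] Dp_Nn[OF that(2)] D_antimono[of 0 p] that(2) by fastforce
    moreover have "0 < P * de" using P pos by simp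
    ultimately show False by simp
  qed
  then show ?thesis by blast
qed

abbreviation c :: "(nat \<Rightarrow> real) \<Rightarrow> nat \<Rightarrow> real" where "c \<equiv> collapse M"

lemma c_in: "z \<in> D j \<Longrightarrow> c z \<in> D j" "z \<in> A \<Longrightarrow> c z \<in> A" "z \<in> bx n \<Longrightarrow> c z \<in> bx n"
  "z \<in> bdy n \<Longrightarrow> c z \<in> bdy n"
  using collapse_gset[OF M D_gset] collapse_gset[OF M A_gset] collapse_gset[OF M gset_bx[OF M]]
    collapse_gset[OF M gset_bdy[OF M]] by auto

text \<open>\<open>s2\<close> is \<open>s \<circ> c\<close> perturbed by functions \<open>phi j\<close> that vanish only where both kinds of cells meet.  Off \<open>D p\<close>
  it avoids the barycentre, and it equals \<open>s \<circ> c\<close> on \<open>A\<close>, where \<open>thr\<close> and \<open>wt\<close> are \<open>0\<close>.\<close>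

definition phi :: "nat \<Rightarrow> (nat \<Rightarrow> real) \<Rightarrow> real" where
  "phi j z = max (- ka) (min ka (setd z (ucells {c \<in> Sg j. neg j c}) - setd z (ucells {c \<in> Sg j. \<not> neg j c})))"

definition thr :: "(nat \<Rightarrow> real) \<Rightarrow> real" where "thr z = de * max 0 (min 1 (3 - Nn z / (P * de)))"
definition wt :: "(nat \<Rightarrow> real) \<Rightarrow> real" where "wt z = max 0 (1 - Nn z / (2 * (P * de)))"

definition w :: "nat \<Rightarrow> (nat \<Rightarrow> real) \<Rightarrow> real" where
  "w j z = soft (thr (c z)) (sd j (c z)) + wt (c z) * phi j z"

definition s2 :: "(nat \<Rightarrow> real) \<Rightarrow> nat \<Rightarrow> real" where
  "s2 z = (\<lambda>i. if i < p then 1 / P + w i z else if i = p then 1 / P - (\<Sum>j<p. w j z) else 0)"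

lemma Pde: "0 < P * de" using P pos by simp

lemma Nn_nonneg: "0 \<le> Nn z" by (simp add: Nn_def sum_nonneg)

lemma thr: "0 \<le> thr z" "thr z \<le> de" using pos by (auto simp: thr_def mult_left_le)

lemma wt: "0 \<le> wt z" "wt z \<le> 1"
  using Pde Nn_nonneg[of z] by (auto simp: wt_def)

lemma phi: "\<bar>phi j z\<bar> \<le> ka" using pos by (auto simp: phi_def)

text \<open>The upper bound is that of \<open>c2\<close>. For the lower one, the other
  \<open>p\<close> coordinates are below \<open>c2\<close> and the sum is 1, so no coordinate can be
  much below \<open>1 / P\<close>.\<close>

lemma sd_bound:
  assumes z: "z \<in> D 0" and j: "j < p"
  shows "\<bar>sd j z\<bar> \<le> 2 * P * ep"
proof -
  have zU: "z \<in> U" using D0_props z by blast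
  have "(\<Sum>i\<in>{..p} - {j}. s z i) \<le> real (card ({..p} - {j})) * c2"
    using sum_bounded_above[of "{..p} - {j}" "s z" c2] D0_props(2)[OF z] by (auto intro: less_imp_le)
  also have "card ({..p} - {j}) = p" using j by simp
  finally have "1 - s z j \<le> real p * c2"
    using simplexD(4)[OF s_in[OF zU]] sum.remove[of "{..p}" j "s z"] j by simp
  moreover have "real p * c2 = real p / P + 2 * P * ep - 2 * ep"
    by (simp add: c2_def P_def algebra_simps)
  ultimately have "- (2 * P * ep) \<le> sd j z" using pos by (simp add: sd_def p_P)
  moreover have "2 * ep \<le> 2 * P * ep" using P pos by simp
  then have "sd j z \<le> 2 * P * ep" using D0_props(2)[OF z, of j] j by (simp add: sd_def c2_def)
  ultimately show ?thesis by simp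
qed

text \<open>This uses the calibration of \<open>ep\<close> and \<open>ka\<close>. The total
  \<open>1 / P\<close> also bounds the change of the last coordinate, so all coordinates of
  \<open>s2\<close> stay nonnegative.\<close>

lemma w_sum: "z \<in> D 0 \<Longrightarrow> (\<Sum>j<p. \<bar>w j z\<bar>) \<le> 1 / P"
proof -
  assume z: "z \<in> D 0"
  have "\<bar>w j z\<bar> \<le> 2 * P * ep + ka" if "j < p" for j
  proof -
    have "\<bar>soft (thr (c z)) (sd j (c z))\<bar> \<le> 2 * P * ep"
      using soft_abs[OF thr(1)] sd_bound[OF c_in(1)[OF z] that] order_trans by blast
    moreover have "\<bar>wt (c z) * phi j z\<bar> \<le> 1 * ka"
      unfolding abs_mult using wt[of "c z"] phi[of j z] by (intro mult_mono) auto
    ultimately show ?thesis unfolding w_def by linarith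
  qed
  then have "(\<Sum>j<p. \<bar>w j z\<bar>) \<le> real p * (2 * P * ep + ka)"
    using sum_bounded_above[of "{..<p}" "\<lambda>j. \<bar>w j z\<bar>" "2 * P * ep + ka"] by simp
  also have "\<dots> \<le> P * (2 * P * ep + ka)"
    using P pos by (intro mult_right_mono) auto
  also have "\<dots> = 2 * P ^ 2 * ep + P * ka" by (simp add: power2_eq_square algebra_simps)
  also have "\<dots> = 1 / P" unfolding ep_P using P by (simp add: field_simps)
  finally show ?thesis .
qed

lemma s2_sum: "(\<Sum>i\<le>p. s2 z i) = 1"
proof -
  have "(\<Sum>i\<le>p. s2 z i) = (\<Sum>i<p. 1 / P + w i z) + (1 / P - (\<Sum>j<p. w j z))"
    by (simp add: lessThan_Suc_atMost[symmetric] s2_def)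
  also have "\<dots> = real p / P + 1 / P" by (simp add: sum.distrib)
  also have "\<dots> = 1" by (simp add: p_P)
  finally show ?thesis .
qed

lemma s2_in:
  assumes z: "z \<in> D 0"
  shows "s2 z \<in> standard_simplex p"
proof -
  have "\<bar>w i z\<bar> \<le> 1 / P" if "i < p" for i
    using member_le_sum[of i "{..<p}" "\<lambda>j. \<bar>w j z\<bar>"] w_sum[OF z] that by auto
  moreover have "\<bar>\<Sum>j<p. w j z\<bar> \<le> 1 / P"
    using sum_abs[of "\<lambda>j. w j z" "{..<p}"] w_sum[OF z] by linarith
  ultimately have nn: "0 \<le> s2 z i" for i
    using P by (auto simp: s2_def abs_le_iff) (smt (verit))+
  moreover have "s2 z i \<le> 1" for i
  proof (cases "i \<le> p")
    case True
    then show ?thesis using member_le_sum[of i "{..p}" "s2 z"] nn s2_sum[of z] by simp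
  qed (simp add: s2_def)
  ultimately show ?thesis
    using s2_sum by (auto simp: standard_simplex_def s2_def)
qed

lemma continuous_on_s2: "continuous_on (D 0) s2"
proof -
  have cc: "continuous_on (D 0) c" by (rule continuous_on_collapse)
  have cs: "continuous_on (D 0) (\<lambda>z. sd j (c z))" for j
  proof -
    have "continuous_on (D 0) (\<lambda>z. s (c z))"
      using D0_props c_in(1) by (intro continuous_on_compose2[OF s cc]) auto
    from continuous_on_coord[OF this] show ?thesis
      unfolding sd_def by (intro continuous_intros)
  qed
  have cN: "continuous_on (D 0) (\<lambda>z. Nn (c z))"
    unfolding Nn_def by (intro continuous_intros cs)
  have cw: "continuous_on (D 0) (w j)" for j
    unfolding w_def soft_def thr_def wt_def phi_def
    using Pde by (intro continuous_intros cs cN continuous_on_setd) auto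
  show ?thesis
  proof (rule continuous_on_coordinatewise_then_product)
    fix i
    show "continuous_on (D 0) (\<lambda>z. s2 z i)"
      unfolding s2_def by (cases "i < p"; cases "i = p") (auto intro!: continuous_intros cw)
  qed
qed

lemma s2_AD:
  assumes "z \<in> A" "z \<in> D 0"
  shows "s2 z = s (c z)"
proof -
  have cz: "c z \<in> A" "c z \<in> D 0" using c_in assms by auto
  then have N: "3 * (P * de) \<le> Nn (c z)" using AD_Nn by (simp add: mult.assoc)
  then have "3 \<le> Nn (c z) / (P * de)" using Pde by (simp add: le_divide_eq)
  then have "thr (c z) = 0" by (simp add: thr_def)
  moreover have "1 \<le> Nn (c z) / (2 * (P * de))" using N Pde by (simp add: le_divide_eq)
  then have "wt (c z) = 0" by (simp add: wt_def)
  ultimately have w: "w j z = sd j (c z)" for j by (simp add: w_def soft_def)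
  have zU: "c z \<in> U" using D0_props cz by blast
  show ?thesis
    using sd_sum[OF zU] simplexD(3)[OF s_in[OF zU]]
    by (auto simp: fun_eq_iff s2_def w sd_def)
qed

text \<open>Away from the barycentre some offset is too large to be killed by \<open>soft\<close>,
  and \<open>wt\<close> has switched the perturbation off. Close to it, take \<open>j\<close> with
  \<open>z\<close> in \<open>D j\<close> but not in \<open>D (Suc j)\<close>: only cells of one
  colour in \<open>Sg j\<close> contain \<open>z\<close>, so \<open>phi j z\<close> is nonzero with
  the sign of that colour. As \<open>collapse M\<close> keeps the cell, the offset has this sign up
  to \<open>de\<close>, and \<open>soft\<close> removes the error. Hence the two terms of
  \<open>w j z\<close> cannot cancel.\<close>

lemma w_nonzero:
  assumes z: "z \<in> D 0" "z \<notin> D p"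
  shows "\<exists>j<p. w j z \<noteq> 0"
proof (cases "2 * (P * de) \<le> Nn (c z)")
  case True
  have "\<exists>j<p. 2 * de \<le> \<bar>sd j (c z)\<bar>"
  proof (rule ccontr)
    assume "\<not> ?thesis"
    then have "Nn (c z) \<le> real p * (2 * de)"
      unfolding Nn_def using sum_bounded_above[of "{..<p}" "\<lambda>j. \<bar>sd j (c z)\<bar>" "2 * de"] by force
    moreover have "real p * (2 * de) < P * (2 * de)" using P pos by (intro mult_strict_right_mono) auto
    ultimately show False using True by simp
  qed
  then obtain j where j: "j < p" "2 * de \<le> \<bar>sd j (c z)\<bar>" by blast
  have "1 \<le> Nn (c z) / (2 * (P * de))" using True Pde by (simp add: le_divide_eq)
  then have "wt (c z) = 0" by (simp add: wt_def)
  moreover have "soft (thr (c z)) (sd j (c z)) \<noteq> 0"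
    using j(2) thr[of "c z"] pos by (auto simp: soft_def abs_if max_def split: if_splits)
  ultimately show ?thesis using j(1) by (auto simp: w_def)
next
  case False
  then have "Nn (c z) / (P * de) \<le> 2" using Pde by (simp add: divide_le_eq)
  then have thr: "thr (c z) = de" by (simp add: thr_def)
  have "Nn (c z) / (2 * (P * de)) < 1" using False Pde by (simp add: divide_less_eq)
  then have wt: "0 < wt (c z)" by (simp add: wt_def)
  have "\<exists>j<p. z \<in> D j \<and> z \<notin> D (Suc j)"
  proof (rule ccontr)
    assume "\<not> ?thesis"
    then have "z \<in> D k" if "k \<le> p" for k
      using that by (induction k) (use z in auto)
    with z(2) show False by blast
  qed
  then obtain j where j: "j < p" "z \<in> D j" "z \<notin> D (Suc j)" by blast
  then obtain c' where c': "c' \<in> Sg j" "z \<in> cellset M c'" unfolding D_def ucells_def by blast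
  have cz: "c z \<in> cellset M c'" using collapse_cell[OF M _ c'(2)] Sg_props[OF c'(1)] by blast
  let ?N = "ucells {c \<in> Sg j. neg j c}" and ?Q = "ucells {c \<in> Sg j. \<not> neg j c}"
  have cl: "closed ?N" "closed ?Q" by (rule closed_Un_Sg[of _ j]; auto)+
  have disj: "\<not> (z \<in> ?N \<and> z \<in> ?Q)"
  proof
    assume "z \<in> ?N \<and> z \<in> ?Q"
    then obtain u v where uv: "u \<in> Sg j" "neg j u" "z \<in> cellset M u" "v \<in> Sg j" "\<not> neg j v" "z \<in> cellset M v"
      unfolding ucells_def by blast
    then have "cmeet u v \<in> Sg (Suc j)" unfolding Sg.simps by blast
    moreover have "z \<in> cellset M (cmeet u v)" using uv cellset_meet[of M u v] by blast
    ultimately have "z \<in> D (Suc j)" unfolding D_def ucells_def by blast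
    with j(3) show False ..
  qed
  have "w j z \<noteq> 0"
  proof (cases "neg j c'")
    case True
    then have "z \<in> ?N" using c' unfolding ucells_def by blast
    then have "setd z ?N = 0" "0 < setd z ?Q" using disj setd_0 setd_pos[OF cl(2)] by auto
    then have "phi j z < 0" using pos by (auto simp: phi_def)
    then have "wt (c z) * phi j z < 0" using wt by (simp add: mult_pos_neg)
    moreover have "sd j (c z) < de" using True cz by (auto simp: neg_def)
    then have "soft (thr (c z)) (sd j (c z)) \<le> 0" by (auto simp: soft_def thr)
    ultimately show ?thesis by (simp add: w_def)
  next
    case False
    then have "z \<in> ?Q" using c' unfolding ucells_def by blast
    then have "setd z ?Q = 0" "0 < setd z ?N" using disj setd_0 setd_pos[OF cl(1)] by auto
    then have "0 < phi j z" using pos by (auto simp: phi_def)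
    then have "0 < wt (c z) * phi j z" using wt by simp
    moreover have "- de < sd j (c z)" using not_neg[OF c'(1) False j(1) cz] .
    then have "0 \<le> soft (thr (c z)) (sd j (c z))" by (auto simp: soft_def thr)
    ultimately show ?thesis by (simp add: w_def)
  qed
  with j(1) show ?thesis by blast
qed

text \<open>A point of the simplex with no coordinate above \<open>1 / P\<close> is the barycentre,
  but some \<open>w j z\<close> is nonzero.\<close>

lemma s2_off_core:
  assumes z: "z \<in> D 0" "z \<notin> D p"
  shows "\<exists>i. 1 / P < s2 z i"
proof (rule ccontr)
  assume "\<not> ?thesis"
  then have le: "s2 z i \<le> 1 / P" for i by (simp add: not_less)
  obtain j where j: "j < p" "w j z \<noteq> 0" using w_nonzero[OF z] by blast
  have "s2 z j < 1 / P" using le[of j] j by (auto simp: s2_def)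
  moreover have "(\<Sum>i\<in>{..p} - {j}. s2 z i) \<le> (\<Sum>i\<in>{..p} - {j}. 1 / P)"
    using le by (rule sum_mono)
  moreover have "(\<Sum>i\<le>p. s2 z i) = s2 z j + (\<Sum>i\<in>{..p} - {j}. s2 z i)"
    "(\<Sum>i\<le>p. 1 / P) = 1 / P + (\<Sum>i\<in>{..p} - {j}. 1 / P)"
    by (rule sum.remove; use j(1) in simp)+
  moreover have "(\<Sum>i\<le>p. 1 / P) = 1" using P(2) p_P by (simp add: add_divide_distrib)
  ultimately show False using s2_sum[of z] by linarith
qed

end

section \<open>The inductive step\<close>

lemma (in semisimplicial) cmap_hi:
  assumes "continuous_map (top_of_set K) (subtopology R (hi r)) g" "\<And>z. z \<in> K \<Longrightarrow> g z \<in> hi r'"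
  shows "continuous_map (top_of_set K) (subtopology R (hi r')) g"
  using continuous_map_into_fulltopology[OF assms(1)] assms(2)
  by (intro continuous_map_into_subtopology) auto

context stage_grid
begin

text \<open>\<open>D p\<close> has dimension at most \<open>n - p\<close>, so \<open>L2\<close>
  lifts \<open>y\<close> there up to a homotopy relative to the boundary of the cube. The homotopy
  is then extended to \<open>D 0\<close>, stationary on \<open>A\<close>, so that it can be
  continued by the unchanged \<open>a1\<close>.\<close>

lemma core_lift:
  obtains x' H where "continuous_map (top_of_set (D p)) (X p) x'"
    "continuous_map (top_of_set (D 0 \<times> {0..1::real})) (Y p) H"
    "\<forall>z\<in>D p. H (z, 1) = f p (x' z)" "\<forall>z\<in>D 0. H (z, 0) = y z"
    "\<forall>z\<in>D p \<inter> bdy n. x' z = x z"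
    "\<forall>z\<in>D 0 \<inter> (A \<union> bdy n). \<forall>t\<in>{0..1}. H (z, t) = y z"
proof -
  have D0U: "D 0 \<subseteq> U" and Dp0: "D p \<subseteq> D 0" using D0_props D_antimono[of 0 p] by blast+
  have yD0: "continuous_map (top_of_set (D 0)) (Y p) y" by (rule cmap_subset[OF y D0U])
  have gB: "gset M n n (bdy n)" by (rule gset_bdy[OF M])
  have lp: "lifts (X p) (Y p) (f p) (D p) (D p \<inter> bdy n)"
  proof (cases "p \<le> n")
    case True
    have "gset M n n (bdy n \<inter> D p)" using gset_Int[OF gB D_gset[of p]] .
    then have "gset M n n (D p \<inter> bdy n)" by (simp add: Int_commute)
    moreover have "lifts (X p) (Y p) (f p) (bx j) (bdy j)" if "j \<le> n - p" for j
      using L2[of j] that True by linarith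
    ultimately show ?thesis using lifts_gset[OF M _ D_gset[of p]] by blast
  next
    \<comment> \<open>For \<open>p > n\<close> the hypothesis \<open>L2\<close> is void, but the
      dimension bound then leaves no cell in \<open>Sg p\<close>.\<close>
    case False
    have "Sg p = {}"
    proof (rule ccontr)
      assume "Sg p \<noteq> {}"
      then obtain c where "c \<in> Sg p" by blast
      from Sg_props[OF this] False show False by linarith
    qed
    then have "D p = {}" by (simp add: D_def ucells_def)
    then show ?thesis using lifts_refl by (metis Int_empty_left)
  qed
  have "continuous_map (top_of_set (D p)) (Y p) y" by (rule cmap_subset[OF yD0 Dp0])
  moreover have "continuous_map (top_of_set (D p \<inter> bdy n)) (X p) x"
    by (rule cmap_subset[OF x]) (use D0U Dp0 in blast)
  moreover have "continuous_map (top_of_set ((D p \<inter> bdy n) \<times> {0..1::real})) (Y p) (\<lambda>w. y (fst w))"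
    by (rule cmap_compose[OF y]) (use D0U Dp0 in \<open>auto intro!: continuous_intros\<close>)
  moreover have "\<forall>z\<in>D p \<inter> bdy n. y (fst (z, 0::real)) = y z \<and> y (fst (z, 1::real)) = f p (x z)"
    using fx D0U Dp0 by auto
  ultimately obtain x' h1 where x': "continuous_map (top_of_set (D p)) (X p) x'"
    and h1: "continuous_map (top_of_set (D p \<times> {0..1::real})) (Y p) h1"
    and h1a: "\<forall>z\<in>D p. h1 (z, 0) = y z \<and> h1 (z, 1) = f p (x' z)"
    and h1b: "\<forall>z\<in>D p \<inter> bdy n. x' z = x z \<and> (\<forall>t\<in>{0..1}. h1 (z, t) = y (fst (z, t)))"
    by (rule liftsE[OF lp])
  let ?E = "D 0 \<inter> (A \<union> bdy n)"
  let ?L = "D p \<union> ?E"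
  have gE: "gset M n n ?E" by (rule gset_Int[OF D0_gset gset_Un[OF A_gset gB]])
  have gL: "gset M n n ?L" by (rule gset_Un[OF gset_top[OF D_gset[of p]] gE])
  have cl: "closed (D p)" "closed ?E" using closed_gset[OF D_gset[of p]] closed_gset[OF gE] .
  have hep: "lifts (Y p) (Y p) (\<lambda>x. x) (D 0) ?L"
    by (rule lifts_gset[OF M hep_bx D0_gset gL]) (use Dp0 in blast)
  have hcl: "closed (D p \<times> {0..1::real})" "closed (?E \<times> {0..1::real})"
    using cl by (auto intro: closed_Times)
  \<comment> \<open>Since \<open>A\<close> and \<open>D p\<close> are disjoint, \<open>D p\<close>
    meets \<open>?E\<close> only in the boundary of the cube, where \<open>h1\<close> is
    stationary.\<close>
  have agree: "h1 (z, t) = y z" if "z \<in> D p" "z \<in> ?E" "t \<in> {0..1}" for z t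
  proof -
    have "z \<in> D p \<inter> bdy n" using that A_Dp by blast
    with h1b that(3) have "h1 (z, t) = y (fst (z, t))" by blast
    then show ?thesis by simp
  qed
  have hc: "continuous_map (top_of_set (?L \<times> {0..1::real})) (Y p)
      (\<lambda>w. if w \<in> D p \<times> {0..1} then h1 w else y (fst w))"
    unfolding Sigma_Un_distrib1
  proof (rule cmap_closed_Un_if[OF hcl h1])
    show "continuous_map (top_of_set (?E \<times> {0..1::real})) (Y p) (\<lambda>w. y (fst w))"
      by (rule cmap_compose[OF yD0 continuous_on_fst[OF continuous_on_id]]) (simp only: mem_Times_iff Int_iff)
    fix w :: "(nat \<Rightarrow> real) \<times> real"
    assume w: "w \<in> D p \<times> {0..1}" "w \<in> ?E \<times> {0..1}"
    have "h1 (fst w, snd w) = y (fst w)"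
      by (rule agree) (use w in \<open>auto simp only: mem_Times_iff\<close>)
    then show "h1 w = y (fst w)" by simp
  qed
  define h where "h = (\<lambda>w. if w \<in> D p \<times> {0..1} then h1 w else y (fst w))"
  have hc': "continuous_map (top_of_set (?L \<times> {0..1::real})) (Y p) h" unfolding h_def by (rule hc)
  have hb: "continuous_map (top_of_set ?L) (Y p) (\<lambda>z. h (z, 1))"
  proof (rule cmap_compose[OF hc', where \<phi> = "\<lambda>z. (z, 1)"])
    show "continuous_on ?L (\<lambda>z. (z, 1::real))" by (intro continuous_intros)
  qed simp
  have h0: "h (z, 0) = y z" for z
  proof (cases "z \<in> D p")
    case True
    then have "h1 (z, 0) = y z" using h1a by blast
    with True show ?thesis by (simp add: h_def)
  qed (simp add: h_def)
  then have h01: "\<forall>z\<in>?L. h (z, 0) = y z \<and> h (z, 1) = h (z, 1)" by blast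
  obtain y' H where H: "continuous_map (top_of_set (D 0 \<times> {0..1::real})) (Y p) H"
    "\<forall>z\<in>D 0. H (z, 0) = y z \<and> H (z, 1) = y' z"
    "\<forall>z\<in>?L. y' z = h (z, 1) \<and> (\<forall>t\<in>{0..1}. H (z, t) = h (z, t))"
    by (rule liftsE[OF hep yD0 hb hc' h01])
  show thesis
  proof (rule that[OF x' H(1)])
    show "\<forall>z\<in>D p. H (z, 1) = f p (x' z)"
    proof
      fix z assume z: "z \<in> D p"
      then have "H (z, 1) = h (z, 1)" using H(3) by simp
      also have "h (z, 1) = h1 (z, 1)" using z by (simp add: h_def)
      finally have "H (z, 1) = h1 (z, 1)" .
      then show "H (z, 1) = f p (x' z)" using h1a z by simp
    qed
    show "\<forall>z\<in>D 0. H (z, 0) = y z" using H(2) by blast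
    show "\<forall>z\<in>D p \<inter> bdy n. x' z = x z" using h1b by blast
    show "\<forall>z\<in>?E. \<forall>t\<in>{0..1}. H (z, t) = y z"
    proof (intro ballI)
      fix z t assume z: "z \<in> ?E" "t \<in> {0..1::real}"
      then have "H (z, t) = h (z, t)" using H(3) by blast
      then show "H (z, t) = y z" using agree[OF _ z] by (cases "z \<in> D p") (use z(2) in \<open>simp_all add: h_def\<close>)
    qed
  qed
qed

text \<open>The cube is covered by two closed sets: \<open>D 0\<close>, where simplex and
  coordinates are defined, and \<open>A\<close>, where nothing is changed.\<close>

lemma cmap_paste:
  assumes S: "closed S" "S \<subseteq> bx n"
    and g: "continuous_map (top_of_set ((D 0 \<inter> S) \<times> {0..1::real})) T g"
    and g': "continuous_map (top_of_set ((A \<inter> S) \<times> {0..1::real})) T g'"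
    and eq: "\<And>z t. z \<in> A \<Longrightarrow> z \<in> D 0 \<Longrightarrow> z \<in> S \<Longrightarrow> t \<in> {0..1} \<Longrightarrow> g (z, t) = g' (z, t)"
  shows "continuous_map (top_of_set (S \<times> {0..1::real})) T (\<lambda>w. if fst w \<in> D 0 then g w else g' w)"
proof -
  let ?K1 = "(D 0 \<inter> S) \<times> {0..1::real}" and ?K2 = "(A \<inter> S) \<times> {0..1::real}"
  have cl: "closed ?K1" "closed ?K2"
    using closed_gset[OF D0_gset] closed_gset[OF A_gset] S(1) by (auto intro!: closed_Times)
  have un: "?K1 \<union> ?K2 = S \<times> {0..1}" using A_D S(2) by blast
  have e: "g w = g' w" if "w \<in> ?K1" "w \<in> ?K2" for w
    using eq[of "fst w" "snd w"] that by (cases w) auto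
  have "continuous_map (top_of_set (S \<times> {0..1::real})) T (\<lambda>w. if w \<in> ?K1 then g w else g' w)"
    using cmap_closed_Un_if[OF cl g g' e] unfolding un by simp
  then show ?thesis by (rule cmap_cong) auto
qed

lemma mix_in: "z \<in> D 0 \<Longrightarrow> t \<in> {0..1} \<Longrightarrow> (\<lambda>i. (1 - t) * s (c z) i + t * s2 z i) \<in> standard_simplex p"
  using convex_standard_simplex[OF s_in[OF D0_props(1)[OF c_in(1)]] s2_in] by auto

lemma continuous_on_mix:
  "continuous_on (D 0 \<times> {0..1::real}) (\<lambda>w i. (1 - snd w) * s (c (fst w)) i + snd w * s2 (fst w) i)"
proof (rule continuous_on_coordinatewise_then_product)
  fix i
  have "continuous_on (D 0 \<times> {0..1::real}) (\<lambda>w. c (fst w))"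
    by (rule continuous_on_compose2[OF continuous_on_collapse[of UNIV M]]) (auto intro!: continuous_intros)
  then have "continuous_on (D 0 \<times> {0..1::real}) (\<lambda>w. s (c (fst w)))"
    by (rule continuous_on_compose2[OF s]) (use D0_props(1) c_in(1) in auto)
  moreover have "continuous_on (D 0 \<times> {0..1::real}) (\<lambda>w. s2 (fst w))"
    by (rule continuous_on_compose2[OF continuous_on_s2]) (auto intro!: continuous_intros)
  ultimately show "continuous_on (D 0 \<times> {0..1::real}) (\<lambda>w. (1 - snd w) * s (c (fst w)) i + snd w * s2 (fst w) i)"
    by (intro continuous_intros continuous_on_coord)
qed

text \<open>A lift is known over \<open>D p\<close> only, but the part of the cube left to the
  induction hypothesis must be closed and avoid \<open>D p\<close>. \<open>N\<close> consists of the
  fine cells that touch \<open>D p\<close>; by \<open>collapse_neighbour\<close> they are mapped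
  into it, so lifts composed with \<open>c\<close> are defined on all of \<open>N\<close>.\<close>

lemma near_core:
  obtains N Q where "gset (4 * M) n n N" "gset (4 * M) n n Q" "N \<union> Q = bx n" "Q \<inter> D p = {}"
    "\<forall>z\<in>N. c z \<in> D p" "N \<subseteq> D 0"
proof -
  let ?CN = "{c \<in> gcells (4 * M) n. cellset (4 * M) c \<inter> D p \<noteq> {}}"
  let ?CQ = "{c \<in> gcells (4 * M) n. cellset (4 * M) c \<inter> D p = {}}"
  have M4: "0 < 4 * M" using M by simp
  have gN: "gset (4 * M) n n (\<Union>c\<in>?CN. cellset (4 * M) c)"
    by (rule gset_Union) (use cdim_le in blast)
  have gQ: "gset (4 * M) n n (\<Union>c\<in>?CQ. cellset (4 * M) c)"
    by (rule gset_Union) (use cdim_le in blast)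
  have cov: "bx n \<subseteq> (\<Union>c\<in>?CN. cellset (4 * M) c) \<union> (\<Union>c\<in>?CQ. cellset (4 * M) c)"
  proof
    fix z assume "z \<in> bx n"
    from carrier_cell[OF this, of "4 * M"]
    show "z \<in> (\<Union>c\<in>?CN. cellset (4 * M) c) \<union> (\<Union>c\<in>?CQ. cellset (4 * M) c)" by blast
  qed
  have sub: "(\<Union>c\<in>?CN. cellset (4 * M) c) \<subseteq> bx n" "(\<Union>c\<in>?CQ. cellset (4 * M) c) \<subseteq> bx n"
    using gset_subset_bx[OF M4 gN] gset_subset_bx[OF M4 gQ] .
  have cp: "c z \<in> D p" if z: "z \<in> (\<Union>c\<in>?CN. cellset (4 * M) c)" for z
  proof -
    from z obtain b where b: "b \<in> ?CN" "z \<in> cellset (4 * M) b" by (rule UN_E)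
    then obtain w where "b \<in> gcells (4 * M) n" "w \<in> cellset (4 * M) b" "w \<in> D p" by blast
    then show ?thesis using collapse_neighbour[OF M D_gset] b(2) by blast
  qed
  show thesis
  proof (rule that[OF gN gQ])
    show "\<forall>z\<in>\<Union>c\<in>?CN. cellset (4 * M) c. c z \<in> D p" using cp by blast
    show "(\<Union>c\<in>?CN. cellset (4 * M) c) \<union> (\<Union>c\<in>?CQ. cellset (4 * M) c) = bx n"
      using cov sub by (intro equalityI Un_least)
    show "(\<Union>c\<in>?CQ. cellset (4 * M) c) \<inter> D p = {}" by blast
    show "(\<Union>c\<in>?CN. cellset (4 * M) c) \<subseteq> D 0"
    proof
      fix z assume z: "z \<in> (\<Union>c\<in>?CN. cellset (4 * M) c)"
      then have "c z \<in> D p" "z \<in> A \<union> D 0" using cp sub(1) A_D by blast+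
      then show "z \<in> D 0" using c_in(2)[of z] A_Dp by blast
    qed
  qed
qed

lemma solvable_collapse:
  assumes "solvable VX VY F n (\<lambda>z. a1 (c z)) (\<lambda>z. b1 (c z))"
  shows "solvable VX VY F n a1 b1"
proof -
  let ?m = "\<lambda>w :: (nat \<Rightarrow> real) \<times> real. \<lambda>i. (1 - snd w) * fst w i + snd w * c (fst w) i"
  have cm: "continuous_on S ?m" for S
  proof (rule continuous_on_coordinatewise_then_product)
    fix i
    have "continuous_on S (\<lambda>w. c (fst w))"
      by (rule continuous_on_compose2[OF continuous_on_collapse[of UNIV M]]) (auto intro!: continuous_intros)
    then show "continuous_on S (\<lambda>w. ?m w i)"
      by (intro continuous_intros continuous_on_coord)
  qed
  have m_bx: "?m w \<in> bx n" if "w \<in> bx n \<times> {0..1}" for w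
    using collapse_homotopy_gset[OF M gset_bx[OF M, of n], where z = "fst w" and t = "snd w"] that
    by (simp add: mem_Times_iff)
  have m_bdy: "?m w \<in> bdy n" if "w \<in> bdy n \<times> {0..1}" for w
    using collapse_homotopy_gset[OF M gset_bdy[OF M, of n], where z = "fst w" and t = "snd w"] that
    by (simp add: mem_Times_iff)
  have "solvable VX VY F n (\<lambda>z. a1 (?m (z, 0))) (\<lambda>z. b1 (?m (z, 0)))"
  proof (rule solvable_homotopy[where a = "\<lambda>w. a1 (?m w)" and b = "\<lambda>w. b1 (?m w)"])
    show "continuous_map VX VY F" by (rule continuous_F_hi) simp
    show "continuous_map (top_of_set (bx n \<times> {0..1::real})) VY (\<lambda>w. a1 (?m w))"
      by (rule cmap_compose[OF a1 cm m_bx])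
    show "continuous_map (top_of_set (bdy n \<times> {0..1::real})) VX (\<lambda>w. b1 (?m w))"
      by (rule cmap_compose[OF b1 cm m_bdy])
    show "F (b1 (?m (z, t))) = a1 (?m (z, t))" if "z \<in> bdy n" "t \<in> {0..1}" for z t
      using m_bdy[of "(z, t)"] that by (intro fb1) auto
    show "solvable VX VY F n (\<lambda>z. a1 (?m (z, 1))) (\<lambda>z. b1 (?m (z, 1)))"
      using assms by simp
  qed
  then show ?thesis by simp
qed

text \<open>The problem is deformed until on \<open>N\<close> it is solved by the lift over
  \<open>D p\<close> and on \<open>Q\<close> it takes values in the previous open set, where
  \<open>L1\<close> applies. The solution on \<open>Q\<close> is taken relative to \<open>N\<close>
  and the boundary, so the two fit together.\<close>

lemma solvable_stage: "solvable VX VY F n a1 b1"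
proof (rule solvable_collapse)
  obtain x' H where x': "continuous_map (top_of_set (D p)) (X p) x'"
    and H: "continuous_map (top_of_set (D 0 \<times> {0..1::real})) (Y p) H"
    and H1: "\<forall>z\<in>D p. H (z, 1) = f p (x' z)" and H0: "\<forall>z\<in>D 0. H (z, 0) = y z"
    and x'x: "\<forall>z\<in>D p \<inter> bdy n. x' z = x z"
    and Hy: "\<forall>z\<in>D 0 \<inter> (A \<union> bdy n). \<forall>t\<in>{0..1}. H (z, t) = y z"
    by (rule core_lift)
  define mix where "mix = (\<lambda>w :: (nat \<Rightarrow> real) \<times> real. \<lambda>i. (1 - snd w) * s (c (fst w)) i + snd w * s2 (fst w) i)"
  have mix0: "mix (z, 0) = s (c z)" and mix1: "mix (z, 1) = s2 z" for z by (simp_all add: mix_def)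
  have mixA: "mix (z, t) = s (c z)" if "z \<in> A" "z \<in> D 0" for z t
    using s2_AD[OF that] by (simp add: mix_def fun_eq_iff algebra_simps)
  have mix_in': "mix w \<in> standard_simplex p" if "fst w \<in> D 0" "snd w \<in> {0..1}" for w
    unfolding mix_def by (rule mix_in[OF that])
  have cmix: "continuous_on (D 0 \<times> {0..1::real}) mix" unfolding mix_def by (rule continuous_on_mix)
  have r: "0 \<le> 1 / (real p + 2)" "1 / (real p + 2) < 1 / (real p + 1)" by (simp_all add: frac_less2)
  have cc: "continuous_on S (\<lambda>w. c (fst w))" for S :: "((nat \<Rightarrow> real) \<times> real) set"
    by (rule continuous_on_compose2[OF continuous_on_collapse[of UNIV M]]) (auto intro!: continuous_intros)
  have xc: "x (c z) \<in> topspace (X p)" "f p (x (c z)) = y (c z)" "H (c z, t) = y (c z)"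
    "a1 (c z) = Y.cls p (y (c z)) (s (c z))" "b1 (c z) = X.cls p (x (c z)) (s (c z))"
    if "z \<in> D 0" "z \<in> bdy n" "t \<in> {0..1}" for z t
  proof -
    have cz: "c z \<in> U" "c z \<in> bdy n" "c z \<in> D 0" using D0_props(1) c_in that by blast+
    show "x (c z) \<in> topspace (X p)" by (rule cmap_in_topspace[OF x]) (use cz in blast)
    show "f p (x (c z)) = y (c z)" "a1 (c z) = Y.cls p (y (c z)) (s (c z))"
      "b1 (c z) = X.cls p (x (c z)) (s (c z))" using fx a1U b1U cz by simp_all
    show "H (c z, t) = y (c z)" using Hy cz that(3) by blast
  qed
  \<comment> \<open>On \<open>D 0\<close> the simplex moves along \<open>H\<close> and the
    coordinates along a segment from \<open>s\<close> to \<open>s2\<close>. Both are stationary on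
    the overlap with \<open>A\<close>.\<close>
  define aa where "aa = (\<lambda>w. if fst w \<in> D 0 then Y.cls p (H (c (fst w), snd w)) (mix w) else a1 (c (fst w)))"
  \<comment> \<open>On the boundary of the cube \<open>H\<close> is stationary, so only the
    coordinates move and \<open>x\<close> still lifts the simplex.\<close>
  define bb where "bb = (\<lambda>w. if fst w \<in> D 0 then X.cls p (x (c (fst w))) (mix w) else b1 (c (fst w)))"
  have aa: "continuous_map (top_of_set (bx n \<times> {0..1::real})) VY aa"
    unfolding aa_def
  proof (rule cmap_paste[OF closed_bx subset_refl])
    show "continuous_map (top_of_set ((D 0 \<inter> bx n) \<times> {0..1::real})) VY
      (\<lambda>w. Y.cls p (H (c (fst w), snd w)) (mix w))"
    proof (rule Y.cmap_cls[OF _ _ _ r])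
      show "continuous_map (top_of_set ((D 0 \<inter> bx n) \<times> {0..1::real})) (Y p) (\<lambda>w. H (c (fst w), snd w))"
      proof (rule cmap_compose[OF H, where \<phi> = "\<lambda>w. (c (fst w), snd w)"])
        show "continuous_on ((D 0 \<inter> bx n) \<times> {0..1::real}) (\<lambda>w. (c (fst w), snd w))"
          by (intro continuous_on_Pair cc continuous_on_snd continuous_on_id)
        show "(c (fst w), snd w) \<in> D 0 \<times> {0..1}" if "w \<in> (D 0 \<inter> bx n) \<times> {0..1}" for w
          using that c_in(1)[of "fst w" 0] by (simp add: mem_Times_iff)
      qed
      show "continuous_on ((D 0 \<inter> bx n) \<times> {0..1::real}) mix"
        by (rule continuous_on_subset[OF cmix]) blast
      show "mix w \<in> standard_simplex p" if "w \<in> (D 0 \<inter> bx n) \<times> {0..1}" for w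
        by (rule mix_in') (use that in \<open>simp_all add: mem_Times_iff\<close>)
    qed
    show "continuous_map (top_of_set ((A \<inter> bx n) \<times> {0..1::real})) VY (\<lambda>w. a1 (c (fst w)))"
    proof (rule cmap_compose[OF a1 cc])
      show "c (fst w) \<in> bx n" if "w \<in> (A \<inter> bx n) \<times> {0..1::real}" for w
        by (rule c_in(3)) (use that in \<open>simp add: mem_Times_iff\<close>)
    qed
    fix z and t :: real
    assume z: "z \<in> A" "z \<in> D 0" "t \<in> {0..1}"
    then have cz: "c z \<in> A" "c z \<in> D 0" "c z \<in> U" using c_in D0_props(1) by blast+
    then have "H (c z, t) = y (c z)" using Hy z(3) by blast
    then show "Y.cls p (H (c (fst (z, t)), snd (z, t))) (mix (z, t)) = a1 (c (fst (z, t)))"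
      using a1U[OF cz(3)] mixA[OF z(1,2)] by simp
  qed
  have bb: "continuous_map (top_of_set (bdy n \<times> {0..1::real})) VX bb"
    unfolding bb_def
  proof (rule cmap_paste[OF closed_bdy bdy_subset])
    show "continuous_map (top_of_set ((D 0 \<inter> bdy n) \<times> {0..1::real})) VX (\<lambda>w. X.cls p (x (c (fst w))) (mix w))"
    proof (rule X.cmap_cls[OF _ _ _ r])
      show "continuous_map (top_of_set ((D 0 \<inter> bdy n) \<times> {0..1::real})) (X p) (\<lambda>w. x (c (fst w)))"
      proof (rule cmap_compose[OF x cc])
        show "c (fst w) \<in> U \<inter> bdy n" if "w \<in> (D 0 \<inter> bdy n) \<times> {0..1::real}" for w
          using that D0_props(1)[OF c_in(1), of "fst w"] c_in(4)[of "fst w"] by (simp add: mem_Times_iff)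
      qed
      show "continuous_on ((D 0 \<inter> bdy n) \<times> {0..1::real}) mix"
        by (rule continuous_on_subset[OF cmix]) blast
      show "mix w \<in> standard_simplex p" if "w \<in> (D 0 \<inter> bdy n) \<times> {0..1}" for w
        by (rule mix_in') (use that in \<open>simp_all add: mem_Times_iff\<close>)
    qed
    show "continuous_map (top_of_set ((A \<inter> bdy n) \<times> {0..1::real})) VX (\<lambda>w. b1 (c (fst w)))"
    proof (rule cmap_compose[OF b1 cc])
      show "c (fst w) \<in> bdy n" if "w \<in> (A \<inter> bdy n) \<times> {0..1::real}" for w
        by (rule c_in(4)) (use that in \<open>simp add: mem_Times_iff\<close>)
    qed
    show "X.cls p (x (c (fst (z, t)))) (mix (z, t)) = b1 (c (fst (z, t)))"
      if "z \<in> A" "z \<in> D 0" "z \<in> bdy n" "t \<in> {0..1}" for z and t :: real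
      using xc(5)[OF that(2,3,4)] mixA[OF that(1,2)] by simp
  qed
  have Fbb: "F (bb (z, t)) = aa (z, t)" if z: "z \<in> bdy n" "t \<in> {0..1}" for z t
  proof (cases "z \<in> D 0")
    case True
    then show ?thesis using F_cls[OF xc(1)[OF True z] mix_in', of "(z, t)"] xc(2,3)[OF True z] z(2)
      by (simp add: aa_def bb_def)
  next
    case False
    then show ?thesis using fb1[OF c_in(4)[OF z(1)]] by (simp add: aa_def bb_def)
  qed
  have "solvable VX VY F n (\<lambda>z. aa (z, 1)) (\<lambda>z. bb (z, 1))"
  proof -
    define a4 where "a4 = (\<lambda>z. aa (z, 1))"
    define b4 where "b4 = (\<lambda>z. bb (z, 1))"
    define bN where "bN z = X.cls p (x' (c z)) (s2 z)" for z
    obtain N Q where N: "gset (4 * M) n n N" and Q: "gset (4 * M) n n Q" and NQ: "N \<union> Q = bx n"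
      and QD: "Q \<inter> D p = {}" and cN': "\<forall>z\<in>N. c z \<in> D p" and ND: "N \<subseteq> D 0"
      by (rule near_core)
    have cN: "c z \<in> D p" if "z \<in> N" for z using cN' that by blast
    note clN = closed_gset[OF N] and clQ = closed_gset[OF Q]
    have M4: "0 < 4 * M" using M by simp
    have a4D: "a4 z = Y.cls p (H (c z, 1)) (s2 z)" if "z \<in> D 0" for z
      using that by (simp add: a4_def aa_def mix1)
    have ca4: "continuous_map (top_of_set (bx n)) VY a4"
      unfolding a4_def
      by (rule cmap_compose[OF aa, where \<phi> = "\<lambda>z. (z, 1)"]) (auto intro!: continuous_intros)
    have cb4: "continuous_map (top_of_set (bdy n)) VX b4"
      unfolding b4_def
      by (rule cmap_compose[OF bb, where \<phi> = "\<lambda>z. (z, 1)"]) (auto intro!: continuous_intros)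
    have Fb4: "F (b4 z) = a4 z" if "z \<in> bdy n" for z
      using Fbb[OF that, of 1] by (simp add: a4_def b4_def)
    have cbN: "continuous_map (top_of_set N) VX bN"
      unfolding bN_def
    proof (rule X.cmap_cls[OF _ _ _ r])
      show "continuous_map (top_of_set N) (X p) (\<lambda>z. x' (c z))"
        by (rule cmap_compose[OF x' continuous_on_collapse cN])
      show "continuous_on N s2" by (rule continuous_on_subset[OF continuous_on_s2 ND])
      show "s2 z \<in> standard_simplex p" if "z \<in> N" for z using s2_in ND that by blast
    qed
    have FbN: "F (bN z) = a4 z" if "z \<in> N" for z
    proof -
      have z: "z \<in> D 0" "c z \<in> D p" using ND cN that by blast+
      have "F (bN z) = Y.cls p (f p (x' (c z))) (s2 z)"
        unfolding bN_def by (rule F_cls[OF cmap_in_topspace[OF x' z(2)] s2_in[OF z(1)]])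
      then show ?thesis using a4D[OF z(1)] H1 z(2) by simp
    qed
    have bNb4: "bN z = b4 z" if "z \<in> N" "z \<in> bdy n" for z
    proof -
      have z: "z \<in> D 0" "c z \<in> D p \<inter> bdy n" using ND cN c_in(4) that by blast+
      then have "x' (c z) = x (c z)" using x'x by blast
      with z(1) show ?thesis by (simp add: bN_def b4_def bb_def mix1)
    qed
    define b0 where "b0 = (\<lambda>z. if z \<in> N then bN z else b4 z)"
    have cb0: "continuous_map (top_of_set (N \<union> bdy n)) VX b0"
      unfolding b0_def by (rule cmap_closed_Un_if[OF clN closed_bdy cbN cb4 bNb4])
    have Fb0: "F (b0 z) = a4 z" if "z \<in> N \<union> bdy n" for z
      using that FbN Fb4 by (auto simp: b0_def)
    \<comment> \<open>On \<open>D 0\<close> this is where the perturbation pays off: away from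
      \<open>D p\<close> the point has a coordinate above \<open>1 / P\<close>. On \<open>A\<close>
      nothing was moved, and \<open>c1\<close> exceeds \<open>1 / P\<close> from the start.\<close>
    have a4Q: "a4 z \<in> Y.hi (1 / (real p + 1))" if z: "z \<in> Q" for z
    proof (cases "z \<in> D 0")
      case True
      then have cz: "c z \<in> D 0" using c_in(1) by blast
      have "(c z, 1) \<in> D 0 \<times> {0..1::real}" using cz by simp
      from cmap_in_topspace[OF H this] have "H (c z, 1) \<in> topspace (Y p)" .
      moreover have "\<exists>i. 1 / (real p + 1) < s2 z i"
        using s2_off_core[OF True] z QD unfolding P_def by blast
      ultimately show ?thesis
        unfolding a4D[OF True] using Y.hi_region(1)[OF _ _ s2_in[OF True], of "1 / (real p + 1)"] by simp
    next
      case False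
      then have "z \<in> A" using z NQ A_D by blast
      then have "c z \<in> A" by (rule c_in(2))
      then have "a1 (c z) \<in> Y.hi c1" by (auto simp: A_def ucells_def Winf_def)
      moreover have "1 / (real p + 1) \<le> c1" using pos by (simp add: c1_def P_def)
      ultimately show ?thesis using Y.hi_mono False by (auto simp: a4_def aa_def)
    qed
    let ?L = "Q \<inter> (N \<union> bdy n)"
    have QB: "Q \<subseteq> bx n" using NQ by blast
    have caQ: "continuous_map (top_of_set Q) (subtopology Y.R (Y.hi (1 / (real p + 1)))) a4"
      by (rule Y.cmap_hi[OF cmap_subset[OF ca4 QB] a4Q])
    have cbL: "continuous_map (top_of_set ?L) (subtopology X.R (X.hi (1 / (real p + 1)))) b0"
    proof (rule X.cmap_hi)
      show c: "continuous_map (top_of_set ?L) VX b0" by (rule cmap_subset[OF cb0]) blast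
      fix z assume z: "z \<in> ?L"
      have "b0 z \<in> topspace X.R" using cmap_in_topspace[OF c z] by simp
      moreover have "F (b0 z) \<in> Y.hi (1 / (real p + 1))" using Fb0[of z] a4Q[of z] z by simp
      ultimately show "b0 z \<in> X.hi (1 / (real p + 1))" using F_hi[of "1 / (real p + 1)" "b0 z"] by simp
    qed
    have chL: "continuous_map (top_of_set (?L \<times> {0..1::real})) (subtopology Y.R (Y.hi (1 / (real p + 1)))) (\<lambda>w. a4 (fst w))"
      by (rule cmap_compose[OF caQ continuous_on_fst[OF continuous_on_id]]) (simp add: mem_Times_iff)
    have "gset (4 * M) n n ?L" by (rule gset_Int[OF Q gset_Un[OF N gset_bdy[OF M4]]])
    then have lQ: "lifts (subtopology X.R (X.hi (1 / (real p + 1)))) (subtopology Y.R (Y.hi (1 / (real p + 1)))) F Q ?L"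
      by (intro lifts_gset[OF M4 _ Q] L1) auto
    have "\<forall>z\<in>?L. a4 (fst (z, 0::real)) = a4 z \<and> a4 (fst (z, 1::real)) = F (b0 z)"
      using Fb0 by simp
    then obtain b' h' where b': "continuous_map (top_of_set Q) (subtopology X.R (X.hi (1 / (real p + 1)))) b'"
      and h': "continuous_map (top_of_set (Q \<times> {0..1::real})) (subtopology Y.R (Y.hi (1 / (real p + 1)))) h'"
      and h'1: "\<forall>z\<in>Q. h' (z, 0) = a4 z \<and> h' (z, 1) = F (b' z)"
      and h'2: "\<forall>z\<in>?L. b' z = b0 z \<and> (\<forall>t\<in>{0..1}. h' (z, t) = a4 (fst (z, t)))"
      by (rule liftsE[OF lQ caQ cbL chL])
    have rr: "1 / (real p + 2) \<le> 1 / (real p + 1)" using r by simp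
    have b'V: "continuous_map (top_of_set Q) VX b'"
      by (rule X.cmap_hi[OF b']) (use cmap_in_topspace[OF b'] X.hi_mono[OF rr] in auto)
    have h'V: "continuous_map (top_of_set (Q \<times> {0..1::real})) VY h'"
      by (rule Y.cmap_hi[OF h']) (use cmap_in_topspace[OF h'] Y.hi_mono[OF rr] in auto)
    have h'c: "h' (z, t) = a4 z" if "z \<in> ?L" "t \<in> {0..1}" for z t
    proof -
      from h'2 that have "h' (z, t) = a4 (fst (z, t))" by blast
      then show ?thesis by simp
    qed
    have "solvable VX VY F n a4 b4"
    proof (rule solvableI)
      have "continuous_map (top_of_set (N \<union> Q)) VX (\<lambda>z. if z \<in> N then bN z else b' z)"
      proof (rule cmap_closed_Un_if[OF clN clQ cbN b'V])
        fix z assume z: "z \<in> N" "z \<in> Q"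
        then have "b' z = b0 z" using h'2 by blast
        then show "bN z = b' z" using z(1) by (simp add: b0_def)
      qed
      then show "continuous_map (top_of_set (bx n)) VX (\<lambda>z. if z \<in> N then bN z else b' z)"
        unfolding NQ .
      have "continuous_map (top_of_set (N \<times> {0..1::real} \<union> Q \<times> {0..1})) VY
          (\<lambda>w. if w \<in> N \<times> {0..1} then a4 (fst w) else h' w)"
      proof (rule cmap_closed_Un_if[OF _ _ _ h'V])
        show "closed (N \<times> {0..1::real})" "closed (Q \<times> {0..1::real})"
          using clN clQ by (auto intro: closed_Times)
        show "continuous_map (top_of_set (N \<times> {0..1::real})) VY (\<lambda>w. a4 (fst w))"
        proof (rule cmap_compose[OF ca4 continuous_on_fst[OF continuous_on_id]])
          show "fst w \<in> bx n" if "w \<in> N \<times> {0..1::real}" for w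
            using that NQ by (auto simp: mem_Times_iff)
        qed
        show "a4 (fst w) = h' w" if "w \<in> N \<times> {0..1}" "w \<in> Q \<times> {0..1}" for w
          using h'c[of "fst w" "snd w"] that by (simp add: mem_Times_iff)
      qed
      then show "continuous_map (top_of_set (bx n \<times> {0..1::real})) VY
          (\<lambda>w. if w \<in> N \<times> {0..1} then a4 (fst w) else h' w)"
        unfolding Sigma_Un_distrib1[symmetric] NQ .
      fix z assume zn: "z \<in> bx n"
      then have zQ: "z \<in> Q" if "z \<notin> N" using that NQ by blast
      show "(if (z, 0) \<in> N \<times> {0..1::real} then a4 (fst (z, 0::real)) else h' (z, 0)) = a4 z"
        using h'1 zQ by auto
      show "(if (z, 1) \<in> N \<times> {0..1::real} then a4 (fst (z, 1::real)) else h' (z, 1)) =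
          F (if z \<in> N then bN z else b' z)"
        using h'1 zQ FbN by auto
    next
      fix z assume z: "z \<in> bdy n"
      then have zQ: "z \<in> ?L" if "z \<notin> N" using that NQ bdy_subset[of n] by blast
      show "(if z \<in> N then bN z else b' z) = b4 z"
      proof (cases "z \<in> N")
        case False
        then have "b' z = b0 z" using h'2 zQ by blast
        with False show ?thesis by (simp add: b0_def)
      qed (simp add: bNb4 z)
      show "(if (z, t) \<in> N \<times> {0..1::real} then a4 (fst (z, t)) else h' (z, t)) = a4 z"
        if "t \<in> {0..1}" for t
        using h'c[OF zQ that] that by auto
    qed
    then show ?thesis unfolding a4_def b4_def .
  qed
  then have sol: "solvable VX VY F n (\<lambda>z. aa (z, 0)) (\<lambda>z. bb (z, 0))"
    using solvable_homotopy[OF continuous_F_hi[OF r(1)] aa bb] Fbb by blast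
  show "solvable VX VY F n (\<lambda>z. a1 (c z)) (\<lambda>z. b1 (c z))"
  proof (rule solvable_cong[OF sol])
    show "aa (z, 0) = a1 (c z)" if "z \<in> bx n" for z
    proof (cases "z \<in> D 0")
      case True
      then have "c z \<in> D 0" "c z \<in> U" using c_in(1) D0_props(1) by blast+
      then show ?thesis using True H0 a1U[of "c z"] by (simp add: aa_def mix0)
    qed (simp add: aa_def)
    show "bb (z, 0) = b1 (c z)" if "z \<in> bdy n" for z
      using xc(5)[of z 0] that by (simp add: bb_def mix0)
  qed
qed

end

context semisimplicial_morphism
begin

text \<open>\<open>theta\<close> deforms \<open>a\<close> and \<open>b\<close> compatibly within the
  open sets, so \<open>solvable_homotopy\<close> reduces the problem to its endpoint, where the
  preimage of the stratum and the maps \<open>kap\<close> and \<open>sig\<close> provide the data of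
  \<open>stage\<close>.\<close>

lemma solves_hi_step:
  assumes L1: "\<And>j. j \<le> n \<Longrightarrow> lifts (subtopology X.R (X.hi (1 / (real p + 1))))
      (subtopology Y.R (Y.hi (1 / (real p + 1)))) F (bx j) (bdy j)"
    and L2: "\<And>j. j + p \<le> n \<Longrightarrow> lifts (X p) (Y p) (f p) (bx j) (bdy j)"
  shows "solves (subtopology X.R (X.hi (X.th p))) (subtopology Y.R (Y.hi (X.th p))) F n"
  unfolding solves_def
proof (intro allI impI)
  let ?r = "X.th p"
  let ?VX = "subtopology X.R (X.hi ?r)" and ?VY = "subtopology Y.R (Y.hi ?r)"
  fix a b
  assume a: "continuous_map (top_of_set (bx n)) ?VY a"
    and b: "continuous_map (top_of_set (bdy n)) ?VX b" and Fb': "\<forall>z\<in>bdy n. F (b z) = a z"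
  have r0: "0 \<le> ?r" using X.th_pos[of p] by simp
  have r: "?r = 1 / (real p + 2)" by (rule X.th_def)
  have a_hi: "a z \<in> Y.hi ?r" if "z \<in> bx n" for z using cmap_in_topspace[OF a that] by simp
  have b_hi: "b z \<in> X.hi ?r" "b z \<in> topspace X.R" if "z \<in> bdy n" for z
    using cmap_in_topspace[OF b that] by simp_all
  have Fb: "F (b z) = a z" if "z \<in> bdy n" for z using Fb' that by blast
  define aa where "aa = (\<lambda>w. Y.theta ?r (a (fst w)) (snd w))"
  define bb where "bb = (\<lambda>w. X.theta ?r (b (fst w)) (snd w))"
  have aa: "continuous_map (top_of_set (bx n \<times> {0..1::real})) ?VY aa"
  proof -
    have "continuous_map (top_of_set (bx n \<times> {0..1::real})) ?VY (\<lambda>w. a (fst w))"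
      by (rule cmap_compose[OF a continuous_on_fst[OF continuous_on_id]]) (simp add: mem_Times_iff)
    moreover have "continuous_map (top_of_set (bx n \<times> {0..1::real})) (top_of_set {0..1::real}) snd"
      by (auto simp: continuous_map_in_subtopology intro!: continuous_intros)
    ultimately have "continuous_map (top_of_set (bx n \<times> {0..1::real})) (prod_topology ?VY (top_of_set {0..1::real}))
        (\<lambda>w. (a (fst w), snd w))" by (rule continuous_map_pairedI)
    from continuous_map_compose[OF this Y.theta_region(2)[OF r0]]
    show ?thesis by (simp add: aa_def o_def)
  qed
  have bb: "continuous_map (top_of_set (bdy n \<times> {0..1::real})) ?VX bb"
  proof -
    have "continuous_map (top_of_set (bdy n \<times> {0..1::real})) ?VX (\<lambda>w. b (fst w))"
      by (rule cmap_compose[OF b continuous_on_fst[OF continuous_on_id]]) (simp add: mem_Times_iff)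
    moreover have "continuous_map (top_of_set (bdy n \<times> {0..1::real})) (top_of_set {0..1::real}) snd"
      by (auto simp: continuous_map_in_subtopology intro!: continuous_intros)
    ultimately have "continuous_map (top_of_set (bdy n \<times> {0..1::real})) (prod_topology ?VX (top_of_set {0..1::real}))
        (\<lambda>w. (b (fst w), snd w))" by (rule continuous_map_pairedI)
    from continuous_map_compose[OF this X.theta_region(2)[OF r0]]
    show ?thesis by (simp add: bb_def o_def)
  qed
  have Fbb: "F (bb (z, t)) = aa (z, t)" if z: "z \<in> bdy n" "t \<in> {0..1}" for z t
    using F_theta[OF r0 b_hi(1)[OF z(1)] z(2)] Fb[OF z(1)] by (simp add: aa_def bb_def)
  define a1 where "a1 = (\<lambda>z. aa (z, 1))"
  define b1 where "b1 = (\<lambda>z. bb (z, 1))"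
  define U where "U = {z \<in> bx n. a z \<in> Y.stratum p}"
  define y where "y = (\<lambda>z. Y.kap p (a z))"
  define s where "s = (\<lambda>z. Y.sig p (a z))"
  define x where "x = (\<lambda>z. X.kap p (b z))"
  have aU: "a z \<in> Y.stratum p" "z \<in> bx n" if "z \<in> U" for z using that by (auto simp: U_def)
  have bU: "b z \<in> X.stratum p" if "z \<in> U" "z \<in> bdy n" for z
    using F_stratum(1)[OF b_hi(2)[OF that(2)]] Fb[OF that(2)] aU(1)[OF that(1)] by simp
  have caU: "continuous_map (top_of_set U) (subtopology Y.R (Y.stratum p)) a"
    using continuous_map_into_fulltopology[OF cmap_subset[OF a, of U]] aU
    by (intro continuous_map_into_subtopology) auto
  have cbU: "continuous_map (top_of_set (U \<inter> bdy n)) (subtopology X.R (X.stratum p)) b"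
    using continuous_map_into_fulltopology[OF cmap_subset[OF b, of "U \<inter> bdy n"]] bU
    by (intro continuous_map_into_subtopology) auto
  have "stage X d Y e f p n a1 b1 U y s x"
  proof (unfold_locales, unfold r[symmetric])
    show "continuous_map (top_of_set (bx n)) ?VY a1"
      unfolding a1_def
      by (rule cmap_compose[OF aa, where \<phi> = "\<lambda>z. (z, 1)"]) (auto intro!: continuous_intros)
    show "continuous_map (top_of_set (bdy n)) ?VX b1"
      unfolding b1_def
      by (rule cmap_compose[OF bb, where \<phi> = "\<lambda>z. (z, 1)"]) (auto intro!: continuous_intros)
    show "F (b1 z) = a1 z" if "z \<in> bdy n" for z using Fbb[OF that, of 1] by (simp add: a1_def b1_def)
    show "openin (top_of_set (bx n)) U"
    proof -
      have "openin ?VY (Y.stratum p \<inter> Y.hi ?r)"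
        by (rule openin_subtopology_Int[OF Y.stratum_region(2)])
      from openin_continuous_map_preimage[OF a this]
      have "openin (top_of_set (bx n)) {z \<in> bx n. a z \<in> Y.stratum p \<inter> Y.hi ?r}" by simp
      moreover have "{z \<in> bx n. a z \<in> Y.stratum p \<inter> Y.hi ?r} = U" using a_hi by (auto simp: U_def)
      ultimately show ?thesis by simp
    qed
    show "continuous_map (top_of_set U) (Y p) y"
      using continuous_map_compose[OF caU Y.stratum_region(4)] by (simp add: y_def o_def)
    show "continuous_on U s"
      using continuous_map_compose[OF caU Y.stratum_region(5)]
      by (simp add: s_def o_def simplex_space_eq continuous_map_in_subtopology)
    show "s z \<in> standard_simplex p" if "z \<in> U" for z
      using Y.theta_1_stratum(2)[OF aU(1)[OF that]] by (simp add: s_def)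
    show "continuous_map (top_of_set (U \<inter> bdy n)) (X p) x"
      using continuous_map_compose[OF cbU X.stratum_region(4)] by (simp add: x_def o_def)
    show "f p (x z) = y z" if "z \<in> U" "z \<in> bdy n" for z
      using F_stratum(2)[OF b_hi(2)[OF that(2)] bU[OF that]] Fb[OF that(2)] by (simp add: x_def y_def)
    show "a1 z = Y.cls p (y z) (s z)" if "z \<in> U" for z
      using Y.theta_1_stratum(3)[OF aU(1)[OF that]] by (simp add: a1_def aa_def y_def s_def)
    show "b1 z = X.cls p (x z) (s z)" if "z \<in> U" "z \<in> bdy n" for z
      using X.theta_1_stratum(3)[OF bU[OF that]] F_stratum(3)[OF b_hi(2)[OF that(2)] bU[OF that]] Fb[OF that(2)]
      by (simp add: b1_def bb_def x_def s_def)
    show "z \<in> U" if "z \<in> bx n" "a1 z \<notin> Y.hi r" "0 \<le> r" "real p * r < 1" for z r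
      using Y.in_stratum[OF a_hi[OF that(1)] _ that(3,4)] that(1,2) by (simp add: U_def a1_def aa_def)
  qed (use L1 L2 in simp_all)
  then interpret st: stage X d Y e f p n a1 b1 U y s x .
  obtain M where M: "0 < M" "\<forall>c\<in>gcells M n. cellset M c \<subseteq> st.Winf \<or> (\<exists>\<zeta>. cellset M c \<subseteq> st.Wz \<zeta>)"
    using st.grid_exists by blast
  interpret sg: stage_grid X d Y e f p n a1 b1 U y s x M
    using M by unfold_locales blast+
  have "solvable ?VX ?VY F n (\<lambda>z. aa (z, 1)) (\<lambda>z. bb (z, 1))"
    using sg.solvable_stage unfolding a1_def b1_def r .
  then have "solvable ?VX ?VY F n (\<lambda>z. aa (z, 0)) (\<lambda>z. bb (z, 0))"
    using solvable_homotopy[OF continuous_F_hi[OF r0] aa bb] Fbb by blast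
  then show "solvable ?VX ?VY F n a b"
    by (rule solvable_cong) (simp_all add: aa_def bb_def Y.theta_0[OF r0 a_hi] X.theta_0[OF r0 b_hi(1)])
qed

lemma lifts_hi:
  assumes "\<And>p j. j + p \<le> N \<Longrightarrow> lifts (X p) (Y p) (f p) (bx j) (bdy j)" and "n \<le> N"
  shows "lifts (subtopology X.R (X.hi (1 / (real p + 1)))) (subtopology Y.R (Y.hi (1 / (real p + 1)))) F (bx n) (bdy n)"
  using assms(2)
proof (induction p arbitrary: n)
  case 0
  have "Y.hi 1 = {}"
  proof (rule ccontr)
    assume "Y.hi 1 \<noteq> {}"
    then obtain c where c: "c \<in> Y.hi 1" by blast
    then obtain q x t where q: "c = Y.cls q x t" "x \<in> topspace (Y q)" "t \<in> standard_simplex q"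
      by (rule Y.hi_cases)
    then obtain i where "1 < t i" using c Y.hi_region(1)[of 1 x q t] by auto
    with simplexD(2)[OF q(3), of i] show False by simp
  qed
  \<comment> \<open>The cube has a point, so it admits no map into the empty space and the lifting
    problem is vacuous.\<close>
  moreover have "(\<lambda>i. 0) \<in> bx n" by (simp add: bx_def)
  ultimately have "\<not> continuous_map (top_of_set (bx n)) (subtopology Y.R (Y.hi (1 / (real 0 + 1)))) a" for a
    using cmap_in_topspace[of "bx n" "subtopology Y.R (Y.hi (1 / (real 0 + 1)))" a "\<lambda>i. 0"] by auto
  then show ?case unfolding lifts_def by blast
next
  case (Suc p)
  have "solves (subtopology X.R (X.hi (X.th p))) (subtopology Y.R (Y.hi (X.th p))) F n"
  proof (rule solves_hi_step)
    show "lifts (subtopology X.R (X.hi (1 / (real p + 1)))) (subtopology Y.R (Y.hi (1 / (real p + 1)))) F (bx j) (bdy j)"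
      if "j \<le> n" for j using Suc.IH[of j] that Suc.prems by simp
    show "lifts (X p) (Y p) (f p) (bx j) (bdy j)" if "j + p \<le> n" for j
      using assms(1)[of j p] that Suc.prems by simp
  qed
  moreover have "X.th p = 1 / (real (Suc p) + 1)" by (simp add: X.th_def)
  ultimately show ?case using solves_imp_lifts by simp
qed

lemma solves_realisation:
  assumes "\<And>p j. j + p \<le> n \<Longrightarrow> lifts (X p) (Y p) (f p) (bx j) (bdy j)"
  shows "solves X.R Y.R F n"
  unfolding solves_def
proof (intro allI impI)
  fix a b
  assume a: "continuous_map (top_of_set (bx n)) Y.R a" and b: "continuous_map (top_of_set (bdy n)) X.R b"
    and Fb: "\<forall>z\<in>bdy n. F (b z) = a z"
  define V where "V = (\<lambda>q::nat. Y.hi (1 / (real q + 2)))"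
  have V_mono: "V q \<subseteq> V m" if "q \<le> m" for q m
    unfolding V_def by (rule Y.hi_mono) (use that in \<open>simp add: frac_le\<close>)
  have "compactin (top_of_set (bx n)) (bx n)"
    using compact_bx[of n] by (simp add: compactin_subtopology compactin_euclidean_iff)
  then have comp: "compactin Y.R (a ` bx n)" using a by (rule image_compactin)
  have op: "openin Y.R W" if "W \<in> range V" for W
    using that Y.hi_region(2) by (auto simp: V_def)
  have cov: "a ` bx n \<subseteq> \<Union>(range V)"
  proof
    fix v assume "v \<in> a ` bx n"
    then have "v \<in> topspace Y.R" using cmap_in_topspace[OF a] by blast
    then obtain q x t where q: "v = Y.cls q x t" "x \<in> topspace (Y q)" "t \<in> standard_simplex q"
      using Y.topspace_realisation by blast
    \<comment> \<open>Some coordinate of a point in a simplex of dimension \<open>q\<close> is at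
      least \<open>1 / (q + 1)\<close>, hence strictly above the next threshold.\<close>
    have "1 / (real q + 2) < 1 / (real q + 1)" by (simp add: frac_less2)
    then obtain i where "1 / (real q + 2) < t i" using Y.simplex_max[OF q(3)] by blast
    then have "v \<in> V q" using Y.hi_region(1)[OF _ q(2,3), of "1 / (real q + 2)"] q(1) by (auto simp: V_def)
    then show "v \<in> \<Union>(range V)" by blast
  qed
  have "\<exists>\<F>. finite \<F> \<and> \<F> \<subseteq> range V \<and> a ` bx n \<subseteq> \<Union>\<F>"
    by (rule compactinD[OF comp op cov])
  then obtain \<F> where \<F>: "finite \<F> \<and> \<F> \<subseteq> range V \<and> a ` bx n \<subseteq> \<Union>\<F>" ..
  then have "\<exists>C. C \<subseteq> UNIV \<and> finite C \<and> \<F> = V ` C" by (intro finite_subset_image) simp_all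
  then obtain C where C: "C \<subseteq> UNIV \<and> finite C \<and> \<F> = V ` C" ..
  obtain m where m: "\<And>q. q \<in> C \<Longrightarrow> q \<le> m" using C finite_nat_set_iff_bounded_le[of C] by blast
  have aV: "a z \<in> V m" if "z \<in> bx n" for z
  proof -
    have "a z \<in> \<Union>(V ` C)" using \<F> C that by blast
    then show ?thesis using V_mono[OF m] by blast
  qed
  have V: "V m = Y.hi (1 / (real (Suc m) + 1))" by (simp add: V_def add.commute)
  let ?r = "1 / (real (Suc m) + 1)"
  let ?VX = "subtopology X.R (X.hi ?r)" and ?VY = "subtopology Y.R (Y.hi ?r)"
  have aY: "continuous_map (top_of_set (bx n)) ?VY a"
    using aV V by (intro continuous_map_into_subtopology[OF a]) auto
  have bX: "continuous_map (top_of_set (bdy n)) ?VX b"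
  proof (rule continuous_map_into_subtopology[OF b])
    \<comment> \<open>\<open>F\<close> keeps barycentric coordinates, so the boundary values lie in
      the corresponding open set of the source.\<close>
    have "b z \<in> X.hi ?r" if z: "z \<in> bdy n" for z
      using F_hi[OF _ cmap_in_topspace[OF b z], of ?r] Fb aV[of z] V z by auto
    then show "b \<in> topspace (top_of_set (bdy n)) \<rightarrow> X.hi ?r" by auto
  qed
  have "lifts ?VX ?VY F (bx n) (bdy n)" by (rule lifts_hi[OF assms order_refl])
  then have "solvable ?VX ?VY F n a b"
    using solvesD[OF lifts_imp_solves aY bX] Fb by blast
  then obtain b' G where G: "continuous_map (top_of_set (bx n)) ?VX b'"
     "continuous_map (top_of_set (bx n \<times> {0..1::real})) ?VY G"
     "\<forall>z\<in>bx n. G (z, 0) = a z \<and> G (z, 1) = F (b' z)"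
     "\<forall>z\<in>bdy n. b' z = b z \<and> (\<forall>t\<in>{0..1}. G (z, t) = a z)"
    by (rule solvableE)
  show "solvable X.R Y.R F n a b"
    using continuous_map_into_fulltopology[OF G(1)] continuous_map_into_fulltopology[OF G(2)] G(3,4)
    by (intro solvableI[of n X.R b' Y.R G]) simp_all
qed

end

theorem lemma2p4:
  fixes X :: "nat \<Rightarrow> 'a topology" and d :: "nat \<Rightarrow> nat \<Rightarrow> 'a \<Rightarrow> 'a"
    and Y :: "nat \<Rightarrow> 'b topology" and e :: "nat \<Rightarrow> nat \<Rightarrow> 'b \<Rightarrow> 'b"
    and f :: "nat \<Rightarrow> 'a \<Rightarrow> 'b" and k :: int
  assumes "semisimplicial_space X d" and "semisimplicial_space Y e"
    and "semisimplicial_map X d Y e f"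
    and "\<And>p. k_connected_map (k - int p) (X p) (Y p) (f p)"
  shows "k_connected_map k (realisation X d) (realisation Y e) (realisation_map Y e f)"
proof -
  interpret semisimplicial_morphism X d Y e f
    using assms(1-3) by unfold_locales
  show ?thesis
  proof (rule k_connected_map_if_solves[OF continuous_F])
    fix n assume "int n \<le> k"
    \<comment> \<open>From \<open>j + p \<le> n\<close> and \<open>n \<le> k\<close>, the dimension
      \<open>j\<close> is at most \<open>k - p\<close>, so the connectivity of \<open>f p\<close>
      covers it.\<close>
    then have "lifts (X p) (Y p) (f p) (bx j) (bdy j)" if "j + p \<le> n" for j p
      using k_connected_map_imp_solves[OF assms(4)[of p], of j] that by (intro solves_imp_lifts) simp
    then show "solves X.R Y.R F n" by (rule solves_realisation)
  qed
qed

end
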